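(* Let $\mathrm S$ be a dependent type theory admitting all the rules of two-dimensional type theory $\mathrm{ML}_2$, and let $\mathfrak C_{\mathrm S}$ be its $2$-category of contexts. For every context $\Gamma$ and type $\Gamma\vdash A\ \mathsf{type}$ in $\mathrm S$, the context $\Gamma.A.A.\mathrm{Id}_A$, together with the projections $\pi_1\pi_{\mathrm{Id}_A},\ \pi_2\pi_{\mathrm{Id}_A}\colon\Gamma.A.A.\mathrm{Id}_A\to\Gamma.A$, can be made into an arrow object for $\Gamma.A$ in the slice $2$-category $\mathfrak C_{\mathrm S}/\Gamma$.
   Context: **Type theory.** $\mathrm S$ has judgement forms $A\ \mathsf{type}$, $a:A$, $A=B\ \mathsf{type}$, $a=b:A$ (definitional equality), relative to contexts $\Gamma=(x_1:A_1,\dots,x_n:A_n)$ with $A_i$ a type in context $(x_1:A_1,\dots,x_{i-1}:A_{i-1})$; equality rules (definitional equality is a congruence) and structural rules (weakening, contraction, exchange, substitution). All rules are relative to an arbitrary ambient context, and all operations are stable under substitution in it. Rules of $\mathrm{ML}_2$: - $\Sigma$: from $A$ and $x:A\vdash B(x)$ form $\Sigma(A,B)$; from $a:A$, $b:B(a)$ get $\langle a,b\rangle:\Sigma(A,B)$; from $z:\Sigma(A,B)\vdash C(z)\ \mathsf{type}$ and $x:A,y:B(x)\vdash d(x,y):C(\langle x,y\rangle)$ get $z:\Sigma(A,B)\vdash \mathrm E_d(z):C(z)$ with $\mathrm E_d(\langle x,y\rangle)=d(x,y)$. - Unit: $\mathbf 1\ \mathsf{type}$; $\star:\mathbf 1$;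 from $z:\mathbf 1\vdash C(z)\ \mathsf{type}$ and $d:C(\star)$ get $z:\mathbf 1\vdash\mathrm U_d(z):C(z)$ with $\mathrm U_d(\star)=d$. - Identity: from $a,b:A$ form $\mathrm{Id}_A(a,b)$; $\mathrm r(a):\mathrm{Id}_A(a,a)$; from $x,y:A,p:\mathrm{Id}_A(x,y)\vdash C(x,y,p)\ \mathsf{type}$ and $x:A\vdash d(x):C(x,x,\mathrm r(x))$ get $x,y:A,p:\mathrm{Id}_A(x,y)\vdash\mathrm J_d(x,y,p):C(x,y,p)$ with $\mathrm J_d(x,x,\mathrm r(x))=d(x)$. - $\Pi$: form $\Pi(A,B)$; from $x:A\vdash f(x):B(x)$ get $\lambda f:\Pi(A,B)$; from $m:\Pi(A,B)$ get $y:A\vdash m\cdot y:B(y)$; $(\lambda f)\cdot y=f(y)$. - Discrete identity types: if $p,q:\mathrm{Id}_A(a,b)$ and $\alpha:\mathrm{Id}(p,q)$ then $p=q$ and $\alpha=\mathrm r(p)$. - Function extensionality: from $m,n:\Pi(A,B)$ and $x:A\vdash p(x):\mathrm{Id}(m\cdot x,n\cdot x)$ get $\mathsf{ext}(m,n,p):\mathrm{Id}(m,n)$; $\mathsf{ext}(m,m,[x]\mathrm r(m\cdot x))=\mathrm r(m)$; $\mathsf{ext}(m,n,p)\ast x=p(x)$, where $p\ast a:=\mathrm J_{[x]\mathrm r(x\cdot a)}(m,n,p)$. By $\Pi$-abstracting over a telescope $\Delta$ one derives extended identity elimination/computation, in which $C$ and the conclusion live in context $x,y:A,p:\mathrm{Id}_A(x,y),\Delta$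 and $d$ in context $x:A,\Delta[x,x,\mathrm r(x)/x,y,p]$. Vector notation is used: an element $a:\Gamma$ of a context is a list of terms. **Identity contexts.** The identity rules extend to contexts by induction on length. For a single type, elimination into a context $\Theta=(u:\Lambda,v:D(u))$ is componentwise: from $d=(d_1,d_2)$ form $\mathrm J_{d_1}$, then $\mathrm J_{d_2}$ into $D(x,y,p,\mathrm J_{d_1}(x,y,p))$. $\mathrm{Id}_{()}=()$, with $\mathrm J_d=d$. For $\Phi=(x:\Lambda,y:D(x))$: transport $p^*(z):\Upsilon(x)$ for $p:\mathrm{Id}_\Lambda(x,x')$, $z:\Upsilon(x')$ is defined by $\mathrm{Id}_\Lambda$-elimination from $\mathrm r(x)^*(z)=z$; $\mathrm{Id}_\Phi((x,y),(x',y')):=(p:\mathrm{Id}_\Lambda(x,x'),\,q:\mathrm{Id}_{D(x)}(y,p^*y'))$; $\mathrm r(x,y):=(\mathrm r(x),\mathrm r(y))$; elimination for $\mathrm{Id}_\Phi$: first apply elimination for $\mathrm{Id}_{D(x)}$ to $d$, giving $d'(x,y,y',q)$, then $\mathrm{Id}_\Lambda$-elimination with post-context $(y,y',q)$ to $d'$. **The 2-category $\mathfrak C_{\mathrm S}$.** (Modulo $\alpha$-conversion and definitional equality.) Objects: contexts. 1-cells $\Gamma\to\Delta$: judgements $x:\Gamma\vdash f(x):\Delta$, composed by substitution. 2-cells $f\Rightarrow g$: judgements $x:\Gamma\vdash\alpha(x):\mathrm{Id}_\Delta(fx,gx)$. Here $q\circ p$ is defined by elimination on $q$ with $\mathrm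 r(y)\circ p=p$, and $h^\bullet(p):\mathrm{Id}_\Delta(hx,hy)$ by elimination on $p$ with $h^\bullet(\mathrm r(x))=\mathrm r(hx)$; vertical composition is $\beta(x)\circ\alpha(x)$, identities are $\mathrm r(fx)$, whiskerings are $(\alpha k)(x)=\alpha(kx)$, $(h\alpha)(x)=h^\bullet(\alpha(x))$. It is locally groupoidal. For a type $A$ in context $\Gamma$: $\Gamma.A=(x:\Gamma,y:A(x))$ with projection $\pi_A\colon\Gamma.A\to\Gamma$; $\Gamma.A.A=(x:\Gamma,y:A(x),z:A(x))$ with $\pi_1,\pi_2\colon\Gamma.A.A\to\Gamma.A$ the projections onto the first and second copy of $A$; $\Gamma.A.A.\mathrm{Id}_A=(x:\Gamma,y:A(x),z:A(x),p:\mathrm{Id}_{A(x)}(y,z))$ with $\pi_{\mathrm{Id}_A}$ its projection to $\Gamma.A.A$. These are regarded as objects of $\mathfrak C_{\mathrm S}/\Gamma$ via the projections to $\Gamma$. The slice $\mathfrak C_{\mathrm S}/\Gamma$ has strictly commuting triangles as 1-cells and, as 2-cells, those whose composite with the structure map to $\Gamma$ is an identity. **Arrow objects.** An arrow object for $X$ in a 2-category $\mathbf K$ is an object $Y$ with a 2-cell $\kappa\colon s\Rightarrow t\colon Y\to X$ such that composition with $\kappa$ gives isomorphisms of categories $\mathbf K(A,Y)\cong\mathbf K(A,X)^{\mathbf 2}$, 2-natural in $A$. "$Y$ together with $s,t$ can be made into an arrow object" means that there is such a $\kappa\colon s\Rightarrow t$. *)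

theory Defs
  imports Main
begin

section \<open>Expressions\<close>

text \<open>
  Raw expressions are built from de Bruijn indices, abstraction (binding one variable) and
  applications of symbols to lists of expressions, so that \<open>\<alpha>\<close>-equivalence is equality.
  Besides the symbols of two-dimensional type theory there may be arbitrary further ones
  (\<open>Other s\<close>).  Symbols are fully annotated: they are applied to all the data occurring in the
  premises of their rule, e.g. \<open>jT A C d a b p\<close> is \<open>J\<^sub>d(a,b,p)\<close>.
\<close>

datatype 's sym =
    SigmaSym | PairSym | SplitSym | UnitSym | StarSym | UnitrecSym | IdSym | ReflSym | JSym
  | PiSym | LamSym | AppSym | ExtSym
  | Other 's

datatype 's expr = Var nat | Bind "'s expr" | Op "'s sym" "'s expr list"

fun rename :: "(nat \<Rightarrow> nat) \<Rightarrow> 's expr \<Rightarrow> 's expr" where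
  "rename \<rho> (Var i) = Var (\<rho> i)"
| "rename \<rho> (Bind e) = Bind (rename (\<lambda>i. case i of 0 \<Rightarrow> 0 | Suc j \<Rightarrow> Suc (\<rho> j)) e)"
| "rename \<rho> (Op f es) = Op f (map (rename \<rho>) es)"

definition up :: "(nat \<Rightarrow> 's expr) \<Rightarrow> nat \<Rightarrow> 's expr" where
  "up \<sigma> i = (case i of 0 \<Rightarrow> Var 0 | Suc j \<Rightarrow> rename Suc (\<sigma> j))"

fun subst :: "(nat \<Rightarrow> 's expr) \<Rightarrow> 's expr \<Rightarrow> 's expr" where
  "subst \<sigma> (Var i) = \<sigma> i"
| "subst \<sigma> (Bind e) = Bind (subst (up \<sigma>) e)"
| "subst \<sigma> (Op f es) = Op f (map (subst \<sigma>) es)"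

fun scoped :: "nat \<Rightarrow> 's expr \<Rightarrow> bool" where
  "scoped n (Var i) \<longleftrightarrow> i < n"
| "scoped n (Bind e) \<longleftrightarrow> scoped (Suc n) e"
| "scoped n (Op f es) \<longleftrightarrow> (\<forall>e\<in>set es. scoped n e)"

text \<open>
  Contexts, telescopes (relative to a context) and lists of terms have the newest entry first:
  \<open>x\<^sub>1 : A\<^sub>1, \<dots>, x\<^sub>n : A\<^sub>n\<close> is \<open>[A\<^sub>n, \<dots>, A\<^sub>1]\<close>, and an extension of \<open>\<Gamma>\<close> by a telescope \<open>T\<close> is
  \<open>T @ \<Gamma>\<close>.

  \<open>sb k [a\<^sub>n, \<dots>, a\<^sub>1]\<close> replaces the newest \<open>n\<close> variables by the given terms; the terms live in an
  extension by \<open>k\<close> variables of the context of the remaining variables.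
\<close>

definition sb :: "nat \<Rightarrow> 's expr list \<Rightarrow> nat \<Rightarrow> 's expr" where
  "sb k as i = (if i < length as then as ! i else Var (i - length as + k))"

abbreviation inst :: "'s expr list \<Rightarrow> 's expr \<Rightarrow> 's expr" where
  "inst as \<equiv> subst (sb 0 as)"

abbreviation insts :: "'s expr list \<Rightarrow> 's expr list \<Rightarrow> 's expr list" where
  "insts as \<equiv> map (inst as)"

abbreviation wk :: "nat \<Rightarrow> 's expr \<Rightarrow> 's expr" where
  "wk k \<equiv> subst (sb k [])"

abbreviation ups :: "nat \<Rightarrow> (nat \<Rightarrow> 's expr) \<Rightarrow> nat \<Rightarrow> 's expr" where
  "ups n \<equiv> up ^^ n"

primrec tsubst :: "(nat \<Rightarrow> 's expr) \<Rightarrow> 's expr list \<Rightarrow> 's expr list" where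
  "tsubst \<sigma> [] = []"
| "tsubst \<sigma> (A # T) = subst (ups (length T) \<sigma>) A # tsubst \<sigma> T"

definition vars :: "nat \<Rightarrow> nat \<Rightarrow> 's expr list" where
  "vars k n = map Var [k..<k + n]"

abbreviation sigmaT :: "'s expr \<Rightarrow> 's expr \<Rightarrow> 's expr" where
  "sigmaT A B \<equiv> Op SigmaSym [A, Bind B]"

abbreviation pairT :: "'s expr \<Rightarrow> 's expr \<Rightarrow> 's expr \<Rightarrow> 's expr \<Rightarrow> 's expr" where
  "pairT A B a b \<equiv> Op PairSym [A, Bind B, a, b]"

abbreviation splitT ::
  "'s expr \<Rightarrow> 's expr \<Rightarrow> 's expr \<Rightarrow> 's expr \<Rightarrow> 's expr \<Rightarrow> 's expr" where
  "splitT A B C d c \<equiv> Op SplitSym [A, Bind B, Bind C, Bind (Bind d), c]"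

abbreviation unitT :: "'s expr" where
  "unitT \<equiv> Op UnitSym []"

abbreviation starT :: "'s expr" where
  "starT \<equiv> Op StarSym []"

abbreviation unitrecT :: "'s expr \<Rightarrow> 's expr \<Rightarrow> 's expr \<Rightarrow> 's expr" where
  "unitrecT C d c \<equiv> Op UnitrecSym [Bind C, d, c]"

abbreviation idT :: "'s expr \<Rightarrow> 's expr \<Rightarrow> 's expr \<Rightarrow> 's expr" where
  "idT A a b \<equiv> Op IdSym [A, a, b]"

abbreviation reflT :: "'s expr \<Rightarrow> 's expr \<Rightarrow> 's expr" where
  "reflT A a \<equiv> Op ReflSym [A, a]"

abbreviation jT ::
  "'s expr \<Rightarrow> 's expr \<Rightarrow> 's expr \<Rightarrow> 's expr \<Rightarrow> 's expr \<Rightarrow> 's expr \<Rightarrow> 's expr" where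
  "jT A C d a b p \<equiv> Op JSym [A, Bind (Bind (Bind C)), Bind d, a, b, p]"

abbreviation piT :: "'s expr \<Rightarrow> 's expr \<Rightarrow> 's expr" where
  "piT A B \<equiv> Op PiSym [A, Bind B]"

abbreviation lamT :: "'s expr \<Rightarrow> 's expr \<Rightarrow> 's expr \<Rightarrow> 's expr" where
  "lamT A B f \<equiv> Op LamSym [A, Bind B, Bind f]"

abbreviation appT :: "'s expr \<Rightarrow> 's expr \<Rightarrow> 's expr \<Rightarrow> 's expr \<Rightarrow> 's expr" where
  "appT A B m a \<equiv> Op AppSym [A, Bind B, m, a]"

abbreviation extT ::
  "'s expr \<Rightarrow> 's expr \<Rightarrow> 's expr \<Rightarrow> 's expr \<Rightarrow> 's expr \<Rightarrow> 's expr" where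
  "extT A B m n p \<equiv> Op ExtSym [A, Bind B, m, n, Bind p]"

text \<open>
  \<open>app_wk k A B m a\<close> is \<open>m \<cdot> a\<close> where \<open>A\<close> and \<open>B\<close> are weakened by \<open>k\<close> variables, but \<open>m\<close> and \<open>a\<close>
  are not; \<open>app_var A B m\<close> is \<open>m \<cdot> x\<close> in context \<open>x : A\<close>, and \<open>happly A B m n p a\<close> is \<open>p \<ast> a\<close>.
\<close>

definition app_wk :: "nat \<Rightarrow> 's expr \<Rightarrow> 's expr \<Rightarrow> 's expr \<Rightarrow> 's expr \<Rightarrow> 's expr" where
  "app_wk k A B m a = appT (wk k A) (subst (up (sb k [])) B) m a"

definition app_var :: "'s expr \<Rightarrow> 's expr \<Rightarrow> 's expr \<Rightarrow> 's expr" where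
  "app_var A B m = app_wk 1 A B (wk 1 m) (Var 0)"

definition happly ::
  "'s expr \<Rightarrow> 's expr \<Rightarrow> 's expr \<Rightarrow> 's expr \<Rightarrow> 's expr \<Rightarrow> 's expr \<Rightarrow> 's expr" where
  "happly A B m n p a =
     jT (piT A B)
       (idT (wk 3 (inst [a] B)) (app_wk 3 A B (Var 2) (wk 3 a)) (app_wk 3 A B (Var 1) (wk 3 a)))
       (reflT (wk 1 (inst [a] B)) (app_wk 1 A B (Var 0) (wk 1 a)))
       m n p"


section \<open>Judgements and the rules\<close>

text \<open>\<open>Ty A\<close>, \<open>Tm a A\<close>, \<open>TyEq A B\<close> and \<open>TmEq a b A\<close> are \<open>A type\<close>, \<open>a : A\<close>, \<open>A = B type\<close> and
  \<open>a = b : A\<close>.  A type theory is given by the set of its derivable judgements in context.\<close>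

datatype 's judgement =
    Ty "'s expr"
  | Tm "'s expr" "'s expr"
  | TyEq "'s expr" "'s expr"
  | TmEq "'s expr" "'s expr" "'s expr"

primrec jsubst :: "(nat \<Rightarrow> 's expr) \<Rightarrow> 's judgement \<Rightarrow> 's judgement" where
  "jsubst \<sigma> (Ty A) = Ty (subst \<sigma> A)"
| "jsubst \<sigma> (Tm a A) = Tm (subst \<sigma> a) (subst \<sigma> A)"
| "jsubst \<sigma> (TyEq A B) = TyEq (subst \<sigma> A) (subst \<sigma> B)"
| "jsubst \<sigma> (TmEq a b A) = TmEq (subst \<sigma> a) (subst \<sigma> b) (subst \<sigma> A)"

primrec jscoped :: "nat \<Rightarrow> 's judgement \<Rightarrow> bool" where
  "jscoped n (Ty A) \<longleftrightarrow> scoped n A"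
| "jscoped n (Tm a A) \<longleftrightarrow> scoped n a \<and> scoped n A"
| "jscoped n (TyEq A B) \<longleftrightarrow> scoped n A \<and> scoped n B"
| "jscoped n (TmEq a b A) \<longleftrightarrow> scoped n a \<and> scoped n b \<and> scoped n A"

type_synonym 's tt = "('s expr list \<times> 's judgement) set"

inductive is_ctx :: "'s tt \<Rightarrow> 's expr list \<Rightarrow> bool" for S where
  "is_ctx S []"
| "is_ctx S \<Gamma> \<Longrightarrow> (\<Gamma>, Ty A) \<in> S \<Longrightarrow> is_ctx S (A # \<Gamma>)"

inductive ctx_eq :: "'s tt \<Rightarrow> 's expr list \<Rightarrow> 's expr list \<Rightarrow> bool" for S where
  "ctx_eq S [] []"
| "ctx_eq S \<Gamma> \<Delta> \<Longrightarrow> (\<Gamma>, TyEq A B) \<in> S \<Longrightarrow> ctx_eq S (A # \<Gamma>) (B # \<Delta>)"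

text \<open>
  \<open>elems S \<Gamma> as T\<close>: in context \<open>\<Gamma>\<close>, the list \<open>as\<close> is an element of the telescope \<open>T\<close> over \<open>\<Gamma>\<close>.
  A closed context is also a telescope over any \<open>\<Gamma>\<close>: its expressions refer to its own variables
  only, so that weakening does not change it.
\<close>

inductive elems :: "'s tt \<Rightarrow> 's expr list \<Rightarrow> 's expr list \<Rightarrow> 's expr list \<Rightarrow> bool" for S \<Gamma> where
  "elems S \<Gamma> [] []"
| "elems S \<Gamma> as T \<Longrightarrow> (\<Gamma>, Tm a (inst as A)) \<in> S \<Longrightarrow> elems S \<Gamma> (a # as) (A # T)"

inductive elems_eq ::
  "'s tt \<Rightarrow> 's expr list \<Rightarrow> 's expr list \<Rightarrow> 's expr list \<Rightarrow> 's expr list \<Rightarrow> bool" for S \<Gamma> where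
  "elems_eq S \<Gamma> [] [] []"
| "elems_eq S \<Gamma> as bs T \<Longrightarrow> (\<Gamma>, TmEq a b (inst as A)) \<in> S \<Longrightarrow>
     elems_eq S \<Gamma> (a # as) (b # bs) (A # T)"

text \<open>
  In the structural rules, \<open>substitution\<close> for arbitrary simultaneous substitutions, together with
  \<open>variable\<close>, comprises weakening, contraction and exchange.  The rules \<open>scope\<close> and \<open>presup_*\<close> say
  what it means to be a judgement in context: the expressions in it are over the variables of a
  well-formed context, and terms are terms of a type.
\<close>

locale type_theory =
  fixes S :: "'s tt"
  assumes scope: "(\<Gamma>, j) \<in> S \<Longrightarrow> jscoped (length \<Gamma>) j"
    and presup_ctx: "(\<Gamma>, j) \<in> S \<Longrightarrow> is_ctx S \<Gamma>"
    and presup_Tm: "(\<Gamma>, Tm a A) \<in> S \<Longrightarrow> (\<Gamma>, Ty A) \<in> S"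
    and presup_TyEq: "(\<Gamma>, TyEq A B) \<in> S \<Longrightarrow> (\<Gamma>, Ty A) \<in> S \<and> (\<Gamma>, Ty B) \<in> S"
    and presup_TmEq: "(\<Gamma>, TmEq a b A) \<in> S \<Longrightarrow> (\<Gamma>, Tm a A) \<in> S \<and> (\<Gamma>, Tm b A) \<in> S"
    and variable: "is_ctx S \<Gamma> \<Longrightarrow> i < length \<Gamma> \<Longrightarrow> (\<Gamma>, Tm (Var i) (wk (Suc i) (\<Gamma> ! i))) \<in> S"
    and substitution:
      "(\<Gamma>, j) \<in> S \<Longrightarrow> is_ctx S \<Delta> \<Longrightarrow> elems S \<Delta> as \<Gamma> \<Longrightarrow> (\<Delta>, jsubst (sb 0 as) j) \<in> S"
    and TyEq_refl: "(\<Gamma>, Ty A) \<in> S \<Longrightarrow> (\<Gamma>, TyEq A A) \<in> S"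
    and TyEq_sym: "(\<Gamma>, TyEq A B) \<in> S \<Longrightarrow> (\<Gamma>, TyEq B A) \<in> S"
    and TyEq_trans:
      "(\<Gamma>, TyEq A B) \<in> S \<Longrightarrow> (\<Gamma>, TyEq B C) \<in> S \<Longrightarrow> (\<Gamma>, TyEq A C) \<in> S"
    and TmEq_refl: "(\<Gamma>, Tm a A) \<in> S \<Longrightarrow> (\<Gamma>, TmEq a a A) \<in> S"
    and TmEq_sym: "(\<Gamma>, TmEq a b A) \<in> S \<Longrightarrow> (\<Gamma>, TmEq b a A) \<in> S"
    and TmEq_trans:
      "(\<Gamma>, TmEq a b A) \<in> S \<Longrightarrow> (\<Gamma>, TmEq b c A) \<in> S \<Longrightarrow> (\<Gamma>, TmEq a c A) \<in> S"
    and Tm_conv: "(\<Gamma>, Tm a A) \<in> S \<Longrightarrow> (\<Gamma>, TyEq A B) \<in> S \<Longrightarrow> (\<Gamma>, Tm a B) \<in> S"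
    and TmEq_conv: "(\<Gamma>, TmEq a b A) \<in> S \<Longrightarrow> (\<Gamma>, TyEq A B) \<in> S \<Longrightarrow> (\<Gamma>, TmEq a b B) \<in> S"
    and Ty_subst_cong:
      "(\<Gamma>, Ty A) \<in> S \<Longrightarrow> is_ctx S \<Delta> \<Longrightarrow> elems_eq S \<Delta> as bs \<Gamma> \<Longrightarrow>
       (\<Delta>, TyEq (inst as A) (inst bs A)) \<in> S"
    and Tm_subst_cong:
      "(\<Gamma>, Tm a A) \<in> S \<Longrightarrow> is_ctx S \<Delta> \<Longrightarrow> elems_eq S \<Delta> as bs \<Gamma> \<Longrightarrow>
       (\<Delta>, TmEq (inst as a) (inst bs a) (inst as A)) \<in> S"

locale ml2_theory = type_theory S for S :: "'s tt" +
  assumes sigma_form: "(\<Gamma>, Ty A) \<in> S \<Longrightarrow> (A # \<Gamma>, Ty B) \<in> S \<Longrightarrow> (\<Gamma>, Ty (sigmaT A B)) \<in> S"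
    and sigma_intro:
      "(\<Gamma>, Ty A) \<in> S \<Longrightarrow> (A # \<Gamma>, Ty B) \<in> S \<Longrightarrow>
       (\<Gamma>, Tm a A) \<in> S \<Longrightarrow> (\<Gamma>, Tm b (inst [a] B)) \<in> S \<Longrightarrow>
       (\<Gamma>, Tm (pairT A B a b) (sigmaT A B)) \<in> S"
    and sigma_elim:
      "(\<Gamma>, Ty A) \<in> S \<Longrightarrow> (A # \<Gamma>, Ty B) \<in> S \<Longrightarrow>
       (sigmaT A B # \<Gamma>, Ty C) \<in> S \<Longrightarrow>
       (B # A # \<Gamma>,
         Tm d (subst (sb 2 [pairT (wk 2 A) (subst (up (sb 2 [])) B) (Var 1) (Var 0)]) C)) \<in> S \<Longrightarrow>
       (\<Gamma>, Tm c (sigmaT A B)) \<in> S \<Longrightarrow>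
       (\<Gamma>, Tm (splitT A B C d c) (inst [c] C)) \<in> S"
    and sigma_comp:
      "(\<Gamma>, Ty A) \<in> S \<Longrightarrow> (A # \<Gamma>, Ty B) \<in> S \<Longrightarrow>
       (sigmaT A B # \<Gamma>, Ty C) \<in> S \<Longrightarrow>
       (B # A # \<Gamma>,
         Tm d (subst (sb 2 [pairT (wk 2 A) (subst (up (sb 2 [])) B) (Var 1) (Var 0)]) C)) \<in> S \<Longrightarrow>
       (\<Gamma>, Tm a A) \<in> S \<Longrightarrow> (\<Gamma>, Tm b (inst [a] B)) \<in> S \<Longrightarrow>
       (\<Gamma>, TmEq (splitT A B C d (pairT A B a b)) (inst [b, a] d) (inst [pairT A B a b] C)) \<in> S"
    and sigma_cong:
      "(\<Gamma>, TyEq A A') \<in> S \<Longrightarrow> (A # \<Gamma>, TyEq B B') \<in> S \<Longrightarrow>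
       (\<Gamma>, TyEq (sigmaT A B) (sigmaT A' B')) \<in> S"
    and pair_cong:
      "(\<Gamma>, TyEq A A') \<in> S \<Longrightarrow> (A # \<Gamma>, TyEq B B') \<in> S \<Longrightarrow>
       (\<Gamma>, TmEq a a' A) \<in> S \<Longrightarrow> (\<Gamma>, TmEq b b' (inst [a] B)) \<in> S \<Longrightarrow>
       (\<Gamma>, TmEq (pairT A B a b) (pairT A' B' a' b') (sigmaT A B)) \<in> S"
    and split_cong:
      "(\<Gamma>, TyEq A A') \<in> S \<Longrightarrow> (A # \<Gamma>, TyEq B B') \<in> S \<Longrightarrow>
       (sigmaT A B # \<Gamma>, TyEq C C') \<in> S \<Longrightarrow>
       (B # A # \<Gamma>,
         TmEq d d' (subst (sb 2 [pairT (wk 2 A) (subst (up (sb 2 [])) B) (Var 1) (Var 0)]) C)) \<in> S \<Longrightarrow>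
       (\<Gamma>, TmEq c c' (sigmaT A B)) \<in> S \<Longrightarrow>
       (\<Gamma>, TmEq (splitT A B C d c) (splitT A' B' C' d' c') (inst [c] C)) \<in> S"
    and unit_form: "is_ctx S \<Gamma> \<Longrightarrow> (\<Gamma>, Ty unitT) \<in> S"
    and unit_intro: "is_ctx S \<Gamma> \<Longrightarrow> (\<Gamma>, Tm starT unitT) \<in> S"
    and unit_elim:
      "(unitT # \<Gamma>, Ty C) \<in> S \<Longrightarrow> (\<Gamma>, Tm d (inst [starT] C)) \<in> S \<Longrightarrow> (\<Gamma>, Tm c unitT) \<in> S \<Longrightarrow>
       (\<Gamma>, Tm (unitrecT C d c) (inst [c] C)) \<in> S"
    and unit_comp:
      "(unitT # \<Gamma>, Ty C) \<in> S \<Longrightarrow> (\<Gamma>, Tm d (inst [starT] C)) \<in> S \<Longrightarrow>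
       (\<Gamma>, TmEq (unitrecT C d starT) d (inst [starT] C)) \<in> S"
    and unitrec_cong:
      "(unitT # \<Gamma>, TyEq C C') \<in> S \<Longrightarrow> (\<Gamma>, TmEq d d' (inst [starT] C)) \<in> S \<Longrightarrow>
       (\<Gamma>, TmEq c c' unitT) \<in> S \<Longrightarrow>
       (\<Gamma>, TmEq (unitrecT C d c) (unitrecT C' d' c') (inst [c] C)) \<in> S"
    and id_form:
      "(\<Gamma>, Tm a A) \<in> S \<Longrightarrow> (\<Gamma>, Tm b A) \<in> S \<Longrightarrow> (\<Gamma>, Ty (idT A a b)) \<in> S"
    and id_intro: "(\<Gamma>, Tm a A) \<in> S \<Longrightarrow> (\<Gamma>, Tm (reflT A a) (idT A a a)) \<in> S"
    and id_elim:
      "(\<Gamma>, Ty A) \<in> S \<Longrightarrow>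
       (idT (wk 2 A) (Var 1) (Var 0) # wk 1 A # A # \<Gamma>, Ty C) \<in> S \<Longrightarrow>
       (A # \<Gamma>, Tm d (subst (sb 1 [reflT (wk 1 A) (Var 0), Var 0, Var 0]) C)) \<in> S \<Longrightarrow>
       (\<Gamma>, Tm a A) \<in> S \<Longrightarrow> (\<Gamma>, Tm b A) \<in> S \<Longrightarrow> (\<Gamma>, Tm p (idT A a b)) \<in> S \<Longrightarrow>
       (\<Gamma>, Tm (jT A C d a b p) (inst [p, b, a] C)) \<in> S"
    and id_comp:
      "(\<Gamma>, Ty A) \<in> S \<Longrightarrow>
       (idT (wk 2 A) (Var 1) (Var 0) # wk 1 A # A # \<Gamma>, Ty C) \<in> S \<Longrightarrow>
       (A # \<Gamma>, Tm d (subst (sb 1 [reflT (wk 1 A) (Var 0), Var 0, Var 0]) C)) \<in> S \<Longrightarrow>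
       (\<Gamma>, Tm a A) \<in> S \<Longrightarrow>
       (\<Gamma>, TmEq (jT A C d a a (reflT A a)) (inst [a] d) (inst [reflT A a, a, a] C)) \<in> S"
    and id_cong:
      "(\<Gamma>, TyEq A A') \<in> S \<Longrightarrow> (\<Gamma>, TmEq a a' A) \<in> S \<Longrightarrow> (\<Gamma>, TmEq b b' A) \<in> S \<Longrightarrow>
       (\<Gamma>, TyEq (idT A a b) (idT A' a' b')) \<in> S"
    and refl_cong:
      "(\<Gamma>, TyEq A A') \<in> S \<Longrightarrow> (\<Gamma>, TmEq a a' A) \<in> S \<Longrightarrow>
       (\<Gamma>, TmEq (reflT A a) (reflT A' a') (idT A a a)) \<in> S"
    and j_cong:
      "(\<Gamma>, TyEq A A') \<in> S \<Longrightarrow>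
       (idT (wk 2 A) (Var 1) (Var 0) # wk 1 A # A # \<Gamma>, TyEq C C') \<in> S \<Longrightarrow>
       (A # \<Gamma>, TmEq d d' (subst (sb 1 [reflT (wk 1 A) (Var 0), Var 0, Var 0]) C)) \<in> S \<Longrightarrow>
       (\<Gamma>, TmEq a a' A) \<in> S \<Longrightarrow> (\<Gamma>, TmEq b b' A) \<in> S \<Longrightarrow> (\<Gamma>, TmEq p p' (idT A a b)) \<in> S \<Longrightarrow>
       (\<Gamma>, TmEq (jT A C d a b p) (jT A' C' d' a' b' p') (inst [p, b, a] C)) \<in> S"
    and pi_form: "(\<Gamma>, Ty A) \<in> S \<Longrightarrow> (A # \<Gamma>, Ty B) \<in> S \<Longrightarrow> (\<Gamma>, Ty (piT A B)) \<in> S"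
    and pi_intro:
      "(\<Gamma>, Ty A) \<in> S \<Longrightarrow> (A # \<Gamma>, Tm f B) \<in> S \<Longrightarrow> (\<Gamma>, Tm (lamT A B f) (piT A B)) \<in> S"
    and pi_elim:
      "(\<Gamma>, Ty A) \<in> S \<Longrightarrow> (A # \<Gamma>, Ty B) \<in> S \<Longrightarrow>
       (\<Gamma>, Tm m (piT A B)) \<in> S \<Longrightarrow> (\<Gamma>, Tm a A) \<in> S \<Longrightarrow>
       (\<Gamma>, Tm (appT A B m a) (inst [a] B)) \<in> S"
    and pi_comp:
      "(\<Gamma>, Ty A) \<in> S \<Longrightarrow> (A # \<Gamma>, Tm f B) \<in> S \<Longrightarrow> (\<Gamma>, Tm a A) \<in> S \<Longrightarrow>
       (\<Gamma>, TmEq (appT A B (lamT A B f) a) (inst [a] f) (inst [a] B)) \<in> S"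
    and pi_cong:
      "(\<Gamma>, TyEq A A') \<in> S \<Longrightarrow> (A # \<Gamma>, TyEq B B') \<in> S \<Longrightarrow>
       (\<Gamma>, TyEq (piT A B) (piT A' B')) \<in> S"
    and lam_cong:
      "(\<Gamma>, TyEq A A') \<in> S \<Longrightarrow> (A # \<Gamma>, TyEq B B') \<in> S \<Longrightarrow> (A # \<Gamma>, TmEq f f' B) \<in> S \<Longrightarrow>
       (\<Gamma>, TmEq (lamT A B f) (lamT A' B' f') (piT A B)) \<in> S"
    and app_cong:
      "(\<Gamma>, TyEq A A') \<in> S \<Longrightarrow> (A # \<Gamma>, TyEq B B') \<in> S \<Longrightarrow>
       (\<Gamma>, TmEq m m' (piT A B)) \<in> S \<Longrightarrow> (\<Gamma>, TmEq a a' A) \<in> S \<Longrightarrow>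
       (\<Gamma>, TmEq (appT A B m a) (appT A' B' m' a') (inst [a] B)) \<in> S"
    and discrete_eq:
      "(\<Gamma>, Tm p (idT A a b)) \<in> S \<Longrightarrow> (\<Gamma>, Tm q (idT A a b)) \<in> S \<Longrightarrow>
       (\<Gamma>, Tm \<alpha> (idT (idT A a b) p q)) \<in> S \<Longrightarrow>
       (\<Gamma>, TmEq p q (idT A a b)) \<in> S"
    and discrete_refl:
      "(\<Gamma>, Tm p (idT A a b)) \<in> S \<Longrightarrow> (\<Gamma>, Tm q (idT A a b)) \<in> S \<Longrightarrow>
       (\<Gamma>, Tm \<alpha> (idT (idT A a b) p q)) \<in> S \<Longrightarrow>
       (\<Gamma>, TmEq \<alpha> (reflT (idT A a b) p) (idT (idT A a b) p q)) \<in> S"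
    and ext_intro:
      "(\<Gamma>, Ty A) \<in> S \<Longrightarrow> (A # \<Gamma>, Ty B) \<in> S \<Longrightarrow>
       (\<Gamma>, Tm m (piT A B)) \<in> S \<Longrightarrow> (\<Gamma>, Tm n (piT A B)) \<in> S \<Longrightarrow>
       (A # \<Gamma>, Tm p (idT B (app_var A B m) (app_var A B n))) \<in> S \<Longrightarrow>
       (\<Gamma>, Tm (extT A B m n p) (idT (piT A B) m n)) \<in> S"
    and ext_refl:
      "(\<Gamma>, Ty A) \<in> S \<Longrightarrow> (A # \<Gamma>, Ty B) \<in> S \<Longrightarrow> (\<Gamma>, Tm m (piT A B)) \<in> S \<Longrightarrow>
       (\<Gamma>, TmEq (extT A B m m (reflT B (app_var A B m))) (reflT (piT A B) m)
              (idT (piT A B) m m)) \<in> S"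
    and ext_app:
      "(\<Gamma>, Ty A) \<in> S \<Longrightarrow> (A # \<Gamma>, Ty B) \<in> S \<Longrightarrow>
       (\<Gamma>, Tm m (piT A B)) \<in> S \<Longrightarrow> (\<Gamma>, Tm n (piT A B)) \<in> S \<Longrightarrow>
       (A # \<Gamma>, Tm p (idT B (app_var A B m) (app_var A B n))) \<in> S \<Longrightarrow> (\<Gamma>, Tm a A) \<in> S \<Longrightarrow>
       (\<Gamma>, TmEq (happly A B m n (extT A B m n p) a) (inst [a] p)
              (idT (inst [a] B) (appT A B m a) (appT A B n a))) \<in> S"
    and ext_cong:
      "(\<Gamma>, TyEq A A') \<in> S \<Longrightarrow> (A # \<Gamma>, TyEq B B') \<in> S \<Longrightarrow>
       (\<Gamma>, TmEq m m' (piT A B)) \<in> S \<Longrightarrow> (\<Gamma>, TmEq n n' (piT A B)) \<in> S \<Longrightarrow>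
       (A # \<Gamma>, TmEq p p' (idT B (app_var A B m) (app_var A B n))) \<in> S \<Longrightarrow>
       (\<Gamma>, TmEq (extT A B m n p) (extT A' B' m' n' p') (idT (piT A B) m n)) \<in> S"


section \<open>Identity contexts\<close>

primrec pi_tel :: "'s expr list \<Rightarrow> 's expr \<Rightarrow> 's expr" where
  "pi_tel [] C = C"
| "pi_tel (A # T) C = pi_tel T (piT A C)"

primrec lam_tel :: "'s expr list \<Rightarrow> 's expr \<Rightarrow> 's expr \<Rightarrow> 's expr" where
  "lam_tel [] C e = e"
| "lam_tel (A # T) C e = lam_tel T (piT A C) (lamT A C e)"

text \<open>For \<open>m : \<Pi>(T, C)\<close> in context \<open>\<Gamma>\<close>, \<open>app_tel T C m : C\<close> is the application of \<open>m\<close> to the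
  variables of \<open>T\<close>, in context \<open>T @ \<Gamma>\<close>.\<close>

primrec app_tel :: "'s expr list \<Rightarrow> 's expr \<Rightarrow> 's expr \<Rightarrow> 's expr" where
  "app_tel [] C m = m"
| "app_tel (A # T) C m = app_var A C (app_tel T (piT A C) m)"

text \<open>
  Extended identity elimination.  For \<open>A\<close> in context \<open>\<Gamma>\<close>, a post-context \<open>\<Delta>\<close> over
  \<open>\<Gamma>, x : A, y : A, p : Id(x, y)\<close>, a type \<open>C\<close> over \<open>\<Delta>\<close> and
  \<open>d : C[x, x, r(x)]\<close> in context \<open>\<Gamma>, x : A, \<Delta>[x, x, r(x)]\<close>, the term \<open>J_post A \<Delta> C d : C\<close> lives in
  context \<open>\<Gamma>, x, y, p, \<Delta>\<close>.  \<open>J_tel\<close> is its componentwise extension to telescopes \<open>\<Theta>\<close> in place of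
  \<open>C\<close>.
\<close>

definition J_post :: "'s expr \<Rightarrow> 's expr list \<Rightarrow> 's expr \<Rightarrow> 's expr \<Rightarrow> 's expr" where
  "J_post A \<Delta> C d =
     (let \<rho> = sb 1 [reflT (wk 1 A) (Var 0), Var 0, Var 0]
      in app_tel \<Delta> C
           (jT (wk 3 A)
              (subst (ups 3 (sb 3 [])) (pi_tel \<Delta> C))
              (subst (up (sb 3 [])) (lam_tel (tsubst \<rho> \<Delta>) (subst (ups (length \<Delta>) \<rho>) C) d))
              (Var 2) (Var 1) (Var 0)))"

fun J_tel :: "'s expr \<Rightarrow> 's expr list \<Rightarrow> 's expr list \<Rightarrow> 's expr list \<Rightarrow> 's expr list" where
  "J_tel A \<Delta> [] d = []"
| "J_tel A \<Delta> (C # \<Theta>) d =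
     (let e = J_tel A \<Delta> \<Theta> (tl d) in J_post A \<Delta> (inst e C) (hd d) # e)"

type_synonym 's eliminator = "'s expr list \<Rightarrow> 's expr list \<Rightarrow> 's expr list \<Rightarrow> 's expr list"

text \<open>
  Let \<open>J\<close> be identity elimination for a closed context \<open>\<Lambda>\<close> of length \<open>n\<close> and \<open>D\<close> a type in context
  \<open>\<Lambda>\<close>.  \<open>transport J n D\<close> is \<open>p\<^sup>*(z) : D(x)\<close> in context \<open>x : \<Lambda>, x' : \<Lambda>, p : Id(x, x'), z : D(x')\<close>, and
  \<open>id_over J n D x x' p y y'\<close> is \<open>Id(y, p\<^sup>*(y'))\<close>, a type of identities between \<open>y : D(x)\<close> and
  \<open>y' : D(x')\<close>.
\<close>

definition transport :: "'s eliminator \<Rightarrow> nat \<Rightarrow> 's expr \<Rightarrow> 's expr" where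
  "transport J n D = hd (J [inst (vars n n) D] [inst (vars (2*n + 1) n) D] [Var 0])"

definition id_over ::
  "'s eliminator \<Rightarrow> nat \<Rightarrow> 's expr \<Rightarrow> 's expr list \<Rightarrow> 's expr list \<Rightarrow> 's expr list \<Rightarrow>
   's expr \<Rightarrow> 's expr \<Rightarrow> 's expr" where
  "id_over J n D x x' p y y' = idT (inst x D) y (inst (y' # p @ x' @ x) (transport J n D))"

text \<open>\<open>r(x) : Id(x, x)\<close> in context \<open>x : \<Lambda>\<close>\<close>

primrec refl_ctx :: "'s expr list \<Rightarrow> 's expr list" where
  "refl_ctx [] = []"
| "refl_ctx (D # \<Lambda>) = reflT (wk 1 D) (Var 0) # map (wk 1) (refl_ctx \<Lambda>)"

text \<open>
  \<open>J_ctx \<Lambda> \<Delta> \<Theta> d : \<Theta>\<close> in context \<open>x : \<Lambda>, x' : \<Lambda>, p : Id(x, x'), \<Delta>\<close>, for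
  \<open>d : \<Theta>[x, x, r(x)]\<close> in context \<open>x : \<Lambda>, \<Delta>[x, x, r(x)]\<close>.  As a list the former context is
  \<open>\<Delta> @ id_ctx \<Lambda> @ \<Lambda> @ \<Lambda>\<close>, with \<open>id_ctx\<close> defined below.  For \<open>\<Phi> = (x : \<Lambda>, y : D(x))\<close>, the
  variables are those of \<open>x, y, x', y', p, q, \<Delta>\<close>.  The first step is in context \<open>x, y, y', q\<close>; the
  substitution \<open>\<rho>1\<close> sends \<open>(x, y, x', y', p, q)\<close> to \<open>(x, y, x, y', r(x), q)\<close>.  The second step is
  in context \<open>x, x', p, y, y', q, \<Delta>2\<close>, with \<open>\<rho>2\<close> and \<open>\<rho>3\<close> permuting the variables between this
  order and that of \<open>\<Phi>\<close>.
\<close>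

fun J_ctx :: "'s expr list \<Rightarrow> 's eliminator" where
  "J_ctx [] \<Delta> \<Theta> d = d"
| "J_ctx (D # \<Lambda>) \<Delta> \<Theta> d =
     (let n = length \<Lambda>;
          m = length \<Delta>;
          \<rho>1 = sb 0 (Var 0 # insts (vars 3 n) (refl_ctx \<Lambda>) @ Var 1 # vars 3 n @ Var 2 # vars 3 n);
          d' = J_tel D (tsubst \<rho>1 \<Delta>) (tsubst (ups m \<rho>1) \<Theta>) d;
          \<rho>2 = sb 0 (Var 0 # vars 3 n @ Var 1 # vars (n + 3) n @ Var 2 # vars (2*n + 3) n);
          \<Delta>2 = tsubst \<rho>2 \<Delta> @
               [id_over (J_ctx \<Lambda>) n D
                  (vars (2*n + 2) n) (vars (n + 2) n) (vars 2 n) (Var 1) (Var 0),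
                inst (vars (n + 1) n) D,
                inst (vars (2*n) n) D];
          e = J_ctx \<Lambda> \<Delta>2 (tsubst (ups m \<rho>2) \<Theta>) d';
          \<rho>3 = vars 0 m @ Var m # Var (m + n + 1) # Var (m + 2*n + 2) #
               vars (m + 1) n @ vars (m + n + 2) n @ vars (m + 2*n + 3) n
      in insts \<rho>3 e)"

text \<open>\<open>Id(x, x')\<close> in context \<open>x : \<Lambda>, x' : \<Lambda>\<close>, i.e. over \<open>\<Lambda> @ \<Lambda>\<close>\<close>

primrec id_ctx :: "'s expr list \<Rightarrow> 's expr list" where
  "id_ctx [] = []"
| "id_ctx (D # \<Lambda>) =
     (let n = length \<Lambda>
      in id_over (J_ctx \<Lambda>) n D
           (vars (2*n + 2) n) (vars (n + 1) n) (vars 0 n) (Var (2*n + 1)) (Var n)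
         # tsubst (sb 0 (vars 1 n @ vars (n + 2) n)) (id_ctx \<Lambda>))"

definition id_tel :: "'s expr list \<Rightarrow> 's expr list \<Rightarrow> 's expr list \<Rightarrow> 's expr list" where
  "id_tel \<Lambda> a b = tsubst (sb 0 (b @ a)) (id_ctx \<Lambda>)"

definition refl_at :: "'s expr list \<Rightarrow> 's expr list \<Rightarrow> 's expr list" where
  "refl_at \<Lambda> a = insts a (refl_ctx \<Lambda>)"

text \<open>\<open>q \<circ> p : Id(x, z)\<close> for \<open>p : Id(x, y)\<close> and \<open>q : Id(y, z)\<close>: elimination on \<open>q\<close>, with post-context
  \<open>x : \<Lambda>, p : Id(x, y)\<close>, from \<open>r(y) \<circ> p = p\<close>\<close>

definition id_comp ::
  "'s expr list \<Rightarrow> 's expr list \<Rightarrow> 's expr list \<Rightarrow> 's expr list \<Rightarrow> 's expr list \<Rightarrow> 's expr list \<Rightarrow>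
   's expr list" where
  "id_comp \<Lambda> x y z q p =
     (let n = length \<Lambda>
      in insts (p @ x @ q @ z @ y)
           (J_ctx \<Lambda> (id_tel \<Lambda> (vars 0 n) (vars (3*n) n) @ \<Lambda>)
              (id_tel \<Lambda> (vars n n) (vars (3*n) n)) (vars 0 n)))"

text \<open>\<open>h\<^sup>\<bullet>(p) : Id(hx, hy)\<close> for \<open>h : \<Lambda> \<rightarrow> \<Delta>\<close> and \<open>p : Id(x, y)\<close>\<close>

definition id_map ::
  "'s expr list \<Rightarrow> 's expr list \<Rightarrow> 's expr list \<Rightarrow> 's expr list \<Rightarrow> 's expr list \<Rightarrow> 's expr list \<Rightarrow>
   's expr list" where
  "id_map \<Lambda> \<Delta> h x y p =
     (let n = length \<Lambda>
      in insts (p @ y @ x)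
           (J_ctx \<Lambda> []
              (id_tel \<Delta> (insts (vars (2*n) n) h) (insts (vars n n) h)) (refl_at \<Delta> h)))"


section \<open>Categories, 2-categories and arrow objects\<close>

text \<open>In \<open>cmp\<close>, \<open>comp1\<close> and \<open>vcomp\<close> the arguments come in the order of composition \<open>g \<circ> f\<close>, preceded
  by the objects or 1-cells involved from source to target.\<close>

record ('o, 'm) cat =
  obj :: "'o set"
  mor :: "'o \<Rightarrow> 'o \<Rightarrow> 'm set"
  idn :: "'o \<Rightarrow> 'm"
  cmp :: "'o \<Rightarrow> 'o \<Rightarrow> 'o \<Rightarrow> 'm \<Rightarrow> 'm \<Rightarrow> 'm"

definition is_functor ::
  "('o, 'm) cat \<Rightarrow> ('p, 'n) cat \<Rightarrow> ('o \<Rightarrow> 'p) \<Rightarrow> ('o \<Rightarrow> 'o \<Rightarrow> 'm \<Rightarrow> 'n) \<Rightarrow> bool" where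
  "is_functor C D F F' \<longleftrightarrow>
     (\<forall>a\<in>obj C. F a \<in> obj D) \<and>
     (\<forall>a\<in>obj C. \<forall>b\<in>obj C. \<forall>f\<in>mor C a b. F' a b f \<in> mor D (F a) (F b)) \<and>
     (\<forall>a\<in>obj C. F' a a (idn C a) = idn D (F a)) \<and>
     (\<forall>a\<in>obj C. \<forall>b\<in>obj C. \<forall>c\<in>obj C. \<forall>f\<in>mor C a b. \<forall>g\<in>mor C b c.
        F' a c (cmp C a b c g f) = cmp D (F a) (F b) (F c) (F' b c g) (F' a b f))"

definition is_cat_iso ::
  "('o, 'm) cat \<Rightarrow> ('p, 'n) cat \<Rightarrow> ('o \<Rightarrow> 'p) \<Rightarrow> ('o \<Rightarrow> 'o \<Rightarrow> 'm \<Rightarrow> 'n) \<Rightarrow> bool" where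
  "is_cat_iso C D F F' \<longleftrightarrow> is_functor C D F F' \<and>
     (\<exists>G G'. is_functor D C G G' \<and>
        (\<forall>a\<in>obj C. G (F a) = a) \<and>
        (\<forall>a\<in>obj C. \<forall>b\<in>obj C. \<forall>f\<in>mor C a b. G' (F a) (F b) (F' a b f) = f) \<and>
        (\<forall>a\<in>obj D. F (G a) = a) \<and>
        (\<forall>a\<in>obj D. \<forall>b\<in>obj D. \<forall>f\<in>mor D a b. F' (G a) (G b) (G' a b f) = f))"

text \<open>The category \<open>C\<^sup>2\<close>: objects are arrows (with their source and target), morphisms commutative
  squares\<close>

definition arrow_cat :: "('o, 'm) cat \<Rightarrow> ('o \<times> 'o \<times> 'm, 'm \<times> 'm) cat" where
  "arrow_cat C =
    \<lparr>obj = {(a, b, f). a \<in> obj C \<and> b \<in> obj C \<and> f \<in> mor C a b},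
     mor = (\<lambda>(a, b, f) (a', b', f').
       {(u, v). u \<in> mor C a a' \<and> v \<in> mor C b b' \<and> cmp C a a' b' f' u = cmp C a b b' v f}),
     idn = (\<lambda>(a, b, f). (idn C a, idn C b)),
     cmp = (\<lambda>(a, b, f) (a', b', f') (a'', b'', f'') (u', v') (u, v).
       (cmp C a a' a'' u' u, cmp C b b' b'' v' v))\<rparr>"

text \<open>\<open>whisk_r A B C f g \<alpha> k\<close> is \<open>\<alpha>k\<close> for \<open>k : A \<rightarrow> B\<close> and \<open>\<alpha> : f \<Rightarrow> g : B \<rightarrow> C\<close>;
  \<open>whisk_l A B C f g h \<alpha>\<close> is \<open>h\<alpha>\<close> for \<open>\<alpha> : f \<Rightarrow> g : A \<rightarrow> B\<close> and \<open>h : B \<rightarrow> C\<close>.\<close>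

record ('o, 'a, 'b) two_cat =
  ob :: "'o set"
  hom :: "'o \<Rightarrow> 'o \<Rightarrow> 'a set"
  cell :: "'o \<Rightarrow> 'o \<Rightarrow> 'a \<Rightarrow> 'a \<Rightarrow> 'b set"
  id1 :: "'o \<Rightarrow> 'a"
  comp1 :: "'o \<Rightarrow> 'o \<Rightarrow> 'o \<Rightarrow> 'a \<Rightarrow> 'a \<Rightarrow> 'a"
  id2 :: "'o \<Rightarrow> 'o \<Rightarrow> 'a \<Rightarrow> 'b"
  vcomp :: "'o \<Rightarrow> 'o \<Rightarrow> 'a \<Rightarrow> 'a \<Rightarrow> 'a \<Rightarrow> 'b \<Rightarrow> 'b \<Rightarrow> 'b"
  whisk_r :: "'o \<Rightarrow> 'o \<Rightarrow> 'o \<Rightarrow> 'a \<Rightarrow> 'a \<Rightarrow> 'b \<Rightarrow> 'a \<Rightarrow> 'b"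
  whisk_l :: "'o \<Rightarrow> 'o \<Rightarrow> 'o \<Rightarrow> 'a \<Rightarrow> 'a \<Rightarrow> 'a \<Rightarrow> 'b \<Rightarrow> 'b"

definition hom_cat :: "('o, 'a, 'b) two_cat \<Rightarrow> 'o \<Rightarrow> 'o \<Rightarrow> ('a, 'b) cat" where
  "hom_cat K A B =
    \<lparr>obj = hom K A B, mor = cell K A B, idn = id2 K A B, cmp = vcomp K A B\<rparr>"

definition slice :: "('o, 'a, 'b) two_cat \<Rightarrow> 'o \<Rightarrow> ('o \<times> 'a, 'a, 'b) two_cat" where
  "slice K B =
    \<lparr>ob = {(E, p). E \<in> ob K \<and> p \<in> hom K E B},
     hom = (\<lambda>(E, p) (E', p'). {f \<in> hom K E E'. comp1 K E E' B p' f = p}),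
     cell = (\<lambda>(E, p) (E', p') f g.
       {\<alpha> \<in> cell K E E' f g. whisk_l K E E' B f g p' \<alpha> = id2 K E B p}),
     id1 = (\<lambda>(E, p). id1 K E),
     comp1 = (\<lambda>(E, p) (E', p') (E'', p''). comp1 K E E' E''),
     id2 = (\<lambda>(E, p) (E', p'). id2 K E E'),
     vcomp = (\<lambda>(E, p) (E', p'). vcomp K E E'),
     whisk_r = (\<lambda>(E, p) (E', p') (E'', p''). whisk_r K E E' E''),
     whisk_l = (\<lambda>(E, p) (E', p') (E'', p''). whisk_l K E E' E'')\<rparr>"

text \<open>Composition with \<open>\<kappa> : s \<Rightarrow> t : Y \<rightarrow> X\<close>, from \<open>K(A, Y)\<close> to \<open>K(A, X)\<^sup>2\<close>\<close>

definition with_cell_obj ::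
  "('o, 'a, 'b) two_cat \<Rightarrow> 'o \<Rightarrow> 'o \<Rightarrow> 'a \<Rightarrow> 'a \<Rightarrow> 'b \<Rightarrow> 'o \<Rightarrow> 'a \<Rightarrow> 'a \<times> 'a \<times> 'b" where
  "with_cell_obj K X Y s t \<kappa> A h =
     (comp1 K A Y X s h, comp1 K A Y X t h, whisk_r K A Y X s t \<kappa> h)"

definition with_cell_mor ::
  "('o, 'a, 'b) two_cat \<Rightarrow> 'o \<Rightarrow> 'o \<Rightarrow> 'a \<Rightarrow> 'a \<Rightarrow> 'o \<Rightarrow> 'a \<Rightarrow> 'a \<Rightarrow> 'b \<Rightarrow> 'b \<times> 'b" where
  "with_cell_mor K X Y s t A h h' \<theta> =
     (whisk_l K A Y X h h' s \<theta>, whisk_l K A Y X h h' t \<theta>)"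

text \<open>2-naturality in \<open>A\<close>: compatibility with the functors \<open>K(k, Y)\<close> and \<open>K(k, X)\<^sup>2\<close> given by
  precomposition with \<open>k : A' \<rightarrow> A\<close>, on objects and on morphisms, and with the transformations
  \<open>K(\<tau>, Y)\<close> and \<open>K(\<tau>, X)\<^sup>2\<close> given by \<open>\<tau> : k \<Rightarrow> k'\<close>\<close>

definition with_cell_2natural ::
  "('o, 'a, 'b) two_cat \<Rightarrow> 'o \<Rightarrow> 'o \<Rightarrow> 'a \<Rightarrow> 'a \<Rightarrow> 'b \<Rightarrow> bool" where
  "with_cell_2natural K X Y s t \<kappa> \<longleftrightarrow>
     (\<forall>A\<in>ob K. \<forall>A'\<in>ob K. \<forall>k\<in>hom K A' A.
        (\<forall>h\<in>hom K A Y.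
           with_cell_obj K X Y s t \<kappa> A' (comp1 K A' A Y h k) =
             (case with_cell_obj K X Y s t \<kappa> A h of
                (u, v, \<gamma>) \<Rightarrow> (comp1 K A' A X u k, comp1 K A' A X v k, whisk_r K A' A X u v \<gamma> k))) \<and>
        (\<forall>h\<in>hom K A Y. \<forall>h'\<in>hom K A Y. \<forall>\<theta>\<in>cell K A Y h h'.
           with_cell_mor K X Y s t A' (comp1 K A' A Y h k) (comp1 K A' A Y h' k)
               (whisk_r K A' A Y h h' \<theta> k) =
             (case with_cell_mor K X Y s t A h h' \<theta> of
                (\<phi>, \<psi>) \<Rightarrow>
                  (whisk_r K A' A X (comp1 K A Y X s h) (comp1 K A Y X s h') \<phi> k,
                   whisk_r K A' A X (comp1 K A Y X t h) (comp1 K A Y X t h') \<psi> k))) \<and>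
        (\<forall>k'\<in>hom K A' A. \<forall>\<tau>\<in>cell K A' A k k'. \<forall>h\<in>hom K A Y.
           with_cell_mor K X Y s t A' (comp1 K A' A Y h k) (comp1 K A' A Y h k')
               (whisk_l K A' A Y k k' h \<tau>) =
             (case with_cell_obj K X Y s t \<kappa> A h of
                (u, v, \<gamma>) \<Rightarrow> (whisk_l K A' A X k k' u \<tau>, whisk_l K A' A X k k' v \<tau>))))"

definition arrow_object ::
  "('o, 'a, 'b) two_cat \<Rightarrow> 'o \<Rightarrow> 'o \<Rightarrow> 'a \<Rightarrow> 'a \<Rightarrow> 'b \<Rightarrow> bool" where
  "arrow_object K X Y s t \<kappa> \<longleftrightarrow>
     X \<in> ob K \<and> Y \<in> ob K \<and> s \<in> hom K Y X \<and> t \<in> hom K Y X \<and> \<kappa> \<in> cell K Y X s t \<and>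
     (\<forall>A\<in>ob K.
        is_cat_iso (hom_cat K A Y) (arrow_cat (hom_cat K A X))
          (with_cell_obj K X Y s t \<kappa> A) (with_cell_mor K X Y s t A)) \<and>
     with_cell_2natural K X Y s t \<kappa>"


section \<open>The 2-category of contexts\<close>

text \<open>Objects and cells are equivalence classes modulo definitional equality.  An operation on
  classes is the union, over all representatives of its arguments, of the class of the result.\<close>

type_synonym 's cls = "'s expr list set"

definition ctx_class :: "'s tt \<Rightarrow> 's expr list \<Rightarrow> 's cls" where
  "ctx_class S \<Gamma> = {\<Delta>. ctx_eq S \<Gamma> \<Delta>}"

definition elems_class :: "'s tt \<Rightarrow> 's expr list \<Rightarrow> 's expr list \<Rightarrow> 's expr list \<Rightarrow> 's cls" where
  "elems_class S \<Gamma> T a = {b. elems_eq S \<Gamma> a b T}"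

definition ctx_two_cat :: "'s tt \<Rightarrow> ('s cls, 's cls, 's cls) two_cat" where
  "ctx_two_cat S =
    \<lparr>ob = {ctx_class S \<Gamma> |\<Gamma>. is_ctx S \<Gamma>},
     hom = (\<lambda>G D. {elems_class S \<Gamma> \<Delta> f |\<Gamma> \<Delta> f. \<Gamma> \<in> G \<and> \<Delta> \<in> D \<and> elems S \<Gamma> f \<Delta>}),
     cell = (\<lambda>G D F F'.
       {elems_class S \<Gamma> (id_tel \<Delta> f f') a |\<Gamma> \<Delta> f f' a.
          \<Gamma> \<in> G \<and> \<Delta> \<in> D \<and> f \<in> F \<and> f' \<in> F' \<and> elems S \<Gamma> a (id_tel \<Delta> f f')}),
     id1 = (\<lambda>G. \<Union>\<Gamma>\<in>G. elems_class S \<Gamma> \<Gamma> (vars 0 (length \<Gamma>))),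
     comp1 = (\<lambda>G D E H F. \<Union>\<Gamma>\<in>G. \<Union>\<Theta>\<in>E. \<Union>f\<in>F. \<Union>h\<in>H. elems_class S \<Gamma> \<Theta> (insts f h)),
     id2 = (\<lambda>G D F. \<Union>\<Gamma>\<in>G. \<Union>\<Delta>\<in>D. \<Union>f\<in>F. elems_class S \<Gamma> (id_tel \<Delta> f f) (refl_at \<Delta> f)),
     vcomp = (\<lambda>G D F1 F2 F3 b a.
       \<Union>\<Gamma>\<in>G. \<Union>\<Delta>\<in>D. \<Union>f1\<in>F1. \<Union>f2\<in>F2. \<Union>f3\<in>F3. \<Union>\<beta>\<in>b. \<Union>\<alpha>\<in>a.
         elems_class S \<Gamma> (id_tel \<Delta> f1 f3) (id_comp \<Delta> f1 f2 f3 \<beta> \<alpha>)),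
     whisk_r = (\<lambda>G D E F F' a K.
       \<Union>\<Gamma>\<in>G. \<Union>\<Theta>\<in>E. \<Union>f\<in>F. \<Union>f'\<in>F'. \<Union>\<alpha>\<in>a. \<Union>k\<in>K.
         elems_class S \<Gamma> (id_tel \<Theta> (insts k f) (insts k f')) (insts k \<alpha>)),
     whisk_l = (\<lambda>G D E F F' H a.
       \<Union>\<Gamma>\<in>G. \<Union>\<Delta>\<in>D. \<Union>\<Theta>\<in>E. \<Union>f\<in>F. \<Union>f'\<in>F'. \<Union>h\<in>H. \<Union>\<alpha>\<in>a.
         elems_class S \<Gamma> (id_tel \<Theta> (insts f h) (insts f' h)) (id_map \<Delta> \<Theta> h f f' \<alpha>))\<rparr>"


section \<open>The contexts \<open>\<Gamma>.A\<close>, \<open>\<Gamma>.A.A\<close> and \<open>\<Gamma>.A.A.Id\<^sub>A\<close>\<close>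

definition ext1 :: "'s expr list \<Rightarrow> 's expr \<Rightarrow> 's expr list" where
  "ext1 \<Gamma> A = A # \<Gamma>"

definition ext2 :: "'s expr list \<Rightarrow> 's expr \<Rightarrow> 's expr list" where
  "ext2 \<Gamma> A = wk 1 A # A # \<Gamma>"

definition extId :: "'s expr list \<Rightarrow> 's expr \<Rightarrow> 's expr list" where
  "extId \<Gamma> A = idT (wk 2 A) (Var 1) (Var 0) # wk 1 A # A # \<Gamma>"

text \<open>The projection of \<open>T @ \<Gamma>\<close> to \<open>\<Gamma>\<close>, where \<open>k\<close> is the length of \<open>T\<close>\<close>

definition proj :: "'s tt \<Rightarrow> nat \<Rightarrow> 's expr list \<Rightarrow> 's cls" where
  "proj S k \<Phi> = elems_class S \<Phi> (drop k \<Phi>) (vars k (length \<Phi> - k))"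

definition proj1 :: "'s tt \<Rightarrow> 's expr list \<Rightarrow> 's expr \<Rightarrow> 's cls" where
  "proj1 S \<Gamma> A = elems_class S (ext2 \<Gamma> A) (ext1 \<Gamma> A) (Var 1 # vars 2 (length \<Gamma>))"

definition proj2 :: "'s tt \<Rightarrow> 's expr list \<Rightarrow> 's expr \<Rightarrow> 's cls" where
  "proj2 S \<Gamma> A = elems_class S (ext2 \<Gamma> A) (ext1 \<Gamma> A) (Var 0 # vars 2 (length \<Gamma>))"

definition over :: "'s tt \<Rightarrow> nat \<Rightarrow> 's expr list \<Rightarrow> 's cls \<times> 's cls" where
  "over S k \<Phi> = (ctx_class S \<Phi>, proj S k \<Phi>)"

end

theory Submission
  imports Defs
begin

text \<open>
  Eliminating identities amounts to a left lifting property of reflexivity substitutions against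
  context projections. As identity types are discrete, lifting an identity between two elements of an
  identity type makes them definitionally equal. Hence families of identities that are natural in the
  context agree as soon as they agree at reflexivities, which gives the groupoid laws, functoriality
  and naturality.

  Transport along reflexivities is trivial, so a 2-cell into \<open>\<Gamma>.A\<close> over an identity of \<open>\<Gamma>\<close> is the same as
  an element of a fibrewise identity type. This yields \<open>\<kappa>\<close> and the bijection on objects. For morphisms,
  elimination constructs a filler: from identities \<open>(p, u)\<close> and \<open>(p, v)\<close> in \<open>\<Gamma>.A\<close> and an element \<open>w'\<close> of \<open>Id\<^sub>A\<close> at
  their ends, an element of \<open>Id\<^sub>A\<close> at their starts together with an identity \<open>\<theta>\<close> to \<open>w'\<close> lying over \<open>(p, u)\<close> and
  \<open>(p, v)\<close>. Existence of \<open>\<theta>\<close> is fullness, and faithfulness follows because every identity in \<open>\<Gamma>.A.A.Id\<^sub>A\<close> is the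
  filler of its own projections.
\<close>

text \<open>The obstacle is strictness. An arrow object asks for isomorphisms of hom-categories, so
  every equation must hold definitionally, whereas elimination by itself only produces inhabitants.
  Discreteness bridges the gap, but only for elements of identity types; equations between elements
  of arbitrary contexts have to come from the congruence and computation rules. A second obstacle is
  the shape of identities in \<open>extId \<Gamma> A\<close>: spelled out, they contain transports
  in the weakened \<open>A\<close> and in \<open>Id\<close> itself, over ever longer contexts. These
  transports are never computed. Such identities are handled only through their elimination rule,
  their images under the two maps to \<open>\<Gamma>.A\<close>, and one element \<theta> obtained by
  elimination. Finally, terms are raw and cells are classes, so each operation on identities comes
  with three facts: congruence, which makes it well defined on classes; computation at reflexivity;
  and literal commutation with substitution, by which a statement about the generic identity, made
  of variables, can be specialised to any context.\<close>

section \<open>Substitution calculus\<close>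

lemma sb_simps [simp]:
  "i < length as \<Longrightarrow> sb k as i = as ! i"
  "\<not> i < length as \<Longrightarrow> sb k as i = Var (i - length as + k)"
  by (simp_all add: sb_def)

lemma sb_0_Nil [simp]: "sb 0 [] = Var"
  by (simp add: fun_eq_iff)

lemma up_simps [simp]: "up \<sigma> 0 = Var 0" "up \<sigma> (Suc i) = rename Suc (\<sigma> i)"
  by (simp_all add: up_def)

lemma rename_conv_subst: "rename \<rho> e = subst (\<lambda>i. Var (\<rho> i)) e"
proof (induction e arbitrary: \<rho>)
  case (Bind e)
  have eq: "up (\<lambda>i. Var (\<rho> i)) = (\<lambda>i. Var (case i of 0 \<Rightarrow> 0 | Suc j \<Rightarrow> Suc (\<rho> j)))"
    by (auto simp: up_def fun_eq_iff split: nat.split)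
  show ?case unfolding rename.simps subst.simps Bind.IH eq ..
qed auto

lemma subst_cong: "(\<And>i. \<sigma> i = \<tau> i) \<Longrightarrow> subst \<sigma> e = subst \<tau> e"
  by (metis ext)

lemma up_Var [simp]: "up Var = Var"
  by (auto simp: up_def fun_eq_iff split: nat.split)

lemma subst_Var [simp]: "subst Var e = e"
  by (induction e) (auto simp: map_idI)

lemma rename_subst: "rename \<rho> (subst \<tau> e) = subst (\<lambda>i. rename \<rho> (\<tau> i)) e"
proof (induction e arbitrary: \<rho> \<tau>)
  case (Bind e)
  have "(\<lambda>i. rename (case_nat 0 (\<lambda>j. Suc (\<rho> j))) (up \<tau> i)) = up (\<lambda>i. rename \<rho> (\<tau> i))"
  proof
    fix i
    show "rename (case_nat 0 (\<lambda>j. Suc (\<rho> j))) (up \<tau> i) = up (\<lambda>i. rename \<rho> (\<tau> i)) i"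
    proof (cases i)
      case (Suc j)
      have "rename (\<lambda>i. case i of 0 \<Rightarrow> 0 | Suc j \<Rightarrow> Suc (\<rho> j)) (rename Suc t) = rename Suc (rename \<rho> t)"
        for t :: "'a expr"
      proof -
        have "rename r (rename s t) = rename (\<lambda>i. r (s i)) t" for r s and t :: "'a expr"
        proof (induction t arbitrary: r s)
          case (Bind t)
          have "(\<lambda>i. case_nat 0 (\<lambda>j. Suc (r j)) (case_nat 0 (\<lambda>j. Suc (s j)) i)) =
              case_nat 0 (\<lambda>j. Suc (r (s j)))"
            by (auto simp: fun_eq_iff split: nat.split)
          then show ?case by (simp add: Bind)
        qed auto
        then show ?thesis by simp
      qed
      then show ?thesis by (simp add: Suc)
    qed simp
  qed
  then show ?case by (simp add: Bind)
qed auto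

lemma subst_rename: "subst \<sigma> (rename \<rho> e) = subst (\<lambda>i. \<sigma> (\<rho> i)) e"
proof (induction e arbitrary: \<rho> \<sigma>)
  case (Bind e)
  have "(\<lambda>i. up \<sigma> (case_nat 0 (\<lambda>j. Suc (\<rho> j)) i)) = up (\<lambda>i. \<sigma> (\<rho> i))"
    by (auto simp: up_def fun_eq_iff split: nat.split)
  then show ?case by (simp add: Bind)
qed auto

lemma subst_up_up: "subst (up \<sigma>) (up \<tau> i) = up (\<lambda>i. subst \<sigma> (\<tau> i)) i"
  by (cases i) (simp_all add: subst_rename rename_subst)

lemma subst_subst [simp]: "subst \<sigma> (subst \<tau> e) = subst (\<lambda>i. subst \<sigma> (\<tau> i)) e"
  by (induction e arbitrary: \<sigma> \<tau>) (auto simp: subst_up_up)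

lemma up_eq: "up \<sigma> = (\<lambda>i. case i of 0 \<Rightarrow> Var 0 | Suc j \<Rightarrow> wk 1 (\<sigma> j))"
  by (auto simp: up_def fun_eq_iff rename_conv_subst split: nat.split intro!: subst_cong)

lemma ups_eq: "ups n \<sigma> i = (if i < n then Var i else wk n (\<sigma> (i - n)))"
proof (induction n arbitrary: i)
  case 0
  show ?case by (simp add: sb_def)
next
  case (Suc n)
  show ?case
    by (cases i) (auto simp: rename_conv_subst Suc intro!: subst_cong)
qed

lemma ups_Var [simp]: "ups n Var = Var"
  by (induction n) auto

lemma ups_add: "ups (m + n) \<sigma> = ups m (ups n \<sigma>)"
  by (simp add: funpow_add)

lemma subst_ups_ups: "subst (ups n \<sigma>) (ups n \<tau> i) = ups n (\<lambda>i. subst \<sigma> (\<tau> i)) i"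
  by (simp add: ups_eq)

text \<open>Substitutions built from different lists usually agree only on the variables that can
  occur. Equations between substitution instances are therefore reduced to this one, with scoping
  read off from typing.\<close>

lemma subst_scoped_cong:
  "scoped n e \<Longrightarrow> (\<And>i. i < n \<Longrightarrow> \<sigma> i = \<tau> i) \<Longrightarrow> subst \<sigma> e = subst \<tau> e"
proof (induction e arbitrary: n \<sigma> \<tau>)
  case (Bind e)
  have "subst (up \<sigma>) e = subst (up \<tau>) e"
    by (rule Bind.IH[of "Suc n"]) (use Bind.prems in \<open>auto simp: up_def split: nat.split\<close>)
  then show ?case by simp
next
  case (Op f es)
  have "map (subst \<sigma>) es = map (subst \<tau>) es"
    by (rule map_cong[OF refl], rule Op.IH) (use Op.prems in auto)
  then show ?case by simp
qed simp

lemma jsubst_scoped_cong: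
  "jscoped n j \<Longrightarrow> (\<And>i. i < n \<Longrightarrow> \<sigma> i = \<tau> i) \<Longrightarrow> jsubst \<sigma> j = jsubst \<tau> j"
  by (cases j) (auto intro: subst_scoped_cong)

lemma jsubst_Var [simp]: "jsubst Var j = j"
  by (cases j) auto

lemma tsubst_length [simp]: "length (tsubst \<sigma> T) = length T"
  by (induction T) auto

lemma tsubst_append: "tsubst \<sigma> (T @ U) = tsubst (ups (length U) \<sigma>) T @ tsubst \<sigma> U"
  by (induction T) (simp_all add: funpow_add)

lemma tsubst_Var [simp]: "tsubst Var T = T"
  by (induction T) auto

lemma tsubst_tsubst [simp]: "tsubst \<sigma> (tsubst \<tau> T) = tsubst (\<lambda>i. subst \<sigma> (\<tau> i)) T"
  by (induction T) (auto simp: subst_ups_ups)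

primrec tscoped :: "nat \<Rightarrow> 's expr list \<Rightarrow> bool" where
  "tscoped n [] \<longleftrightarrow> True"
| "tscoped n (A # T) \<longleftrightarrow> scoped (length T + n) A \<and> tscoped n T"

lemma tscoped_append [simp]: "tscoped n (T @ U) \<longleftrightarrow> tscoped (length U + n) T \<and> tscoped n U"
  by (induction T) (auto simp: add.assoc)

lemma ups_cong: "(\<And>i. i < n \<Longrightarrow> \<sigma> i = \<tau> i) \<Longrightarrow> i < m + n \<Longrightarrow> ups m \<sigma> i = ups m \<tau> i"
  by (auto simp: ups_eq)

lemma tsubst_scoped_cong:
  "tscoped n T \<Longrightarrow> (\<And>i. i < n \<Longrightarrow> \<sigma> i = \<tau> i) \<Longrightarrow> tsubst \<sigma> T = tsubst \<tau> T"
proof (induction T)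
  case (Cons A T)
  have "subst (ups (length T) \<sigma>) A = subst (ups (length T) \<tau>) A"
    by (rule subst_scoped_cong[of "length T + n"]) (use Cons.prems in \<open>auto intro: ups_cong\<close>)
  with Cons show ?case by simp
qed simp

lemma vars_length [simp]: "length (vars k n) = n"
  by (simp add: vars_def)

lemma vars_nth [simp]: "i < n \<Longrightarrow> vars k n ! i = Var (k + i)"
  by (simp add: vars_def)

lemma vars_0 [simp]: "vars k 0 = []"
  by (simp add: vars_def)

lemma vars_Suc: "vars k (Suc n) = Var k # vars (Suc k) n"
  by (simp add: vars_def upt_rec[of k])

lemma vars_add: "vars k (m + n) = vars k m @ vars (k + m) n"
  unfolding vars_def map_append[symmetric]
  by (metis add.assoc le_add1 upt_add_eq_append)

lemma drop_vars [simp]: "drop i (vars k n) = vars (k + i) (n - i)"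
  by (rule nth_equalityI) auto

lemma insts_vars: "k + n \<le> length as \<Longrightarrow> insts as (vars k n) = take n (drop k as)"
  by (rule nth_equalityI) auto

lemma insts_vars_all [simp]: "insts as (vars 0 (length as)) = as"
  by (simp add: insts_vars)

text \<open>Scoping matters here: a variable beyond \<open>as\<close> would be renumbered by
  \<open>inst as\<close> and then captured by \<open>inst bs\<close>, while the right-hand side
  leaves it a variable.\<close>

lemma inst_inst: "scoped (length as) e \<Longrightarrow> inst bs (inst as e) = inst (insts bs as) e"
  by (auto intro: subst_scoped_cong)

lemma insts_insts:
  "\<forall>e\<in>set es. scoped (length as) e \<Longrightarrow> insts bs (insts as es) = insts (insts bs as) es"
  by (simp add: inst_inst del: subst_subst)

lemma tsubst_inst_inst:
  "tscoped (length as) T \<Longrightarrow> tsubst (sb 0 bs) (tsubst (sb 0 as) T) = tsubst (sb 0 (insts bs as)) T"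
  by (auto intro: tsubst_scoped_cong)

lemma inst_wk: "k \<le> length as \<Longrightarrow> inst as (wk k e) = inst (drop k as) e"
  by (auto intro!: subst_cong simp: sb_def add.commute)

lemma insts_wk: "k \<le> length as \<Longrightarrow> insts as (map (wk k) es) = insts (drop k as) es"
  by (simp add: inst_wk del: subst_subst)

lemma subst_inst: "subst \<sigma> (inst as e) = inst (map (subst \<sigma>) as) (subst (ups (length as) \<sigma>) e)"
  by (auto intro!: subst_cong simp: ups_eq sb_def)

lemma inst_vars: "scoped n e \<Longrightarrow> inst (vars k n) e = wk k e"
  by (rule subst_scoped_cong[of n]) auto

lemma inst_vars_0: "scoped n e \<Longrightarrow> inst (vars 0 n) e = e"
  by (simp add: inst_vars del: subst_subst)

lemma inst_append: "inst (as @ bs) e = inst as (subst (ups (length as) (sb 0 bs)) e)"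
  by (auto intro!: subst_cong simp: ups_eq sb_def nth_append)

lemma subst_ups_comp:
  assumes "map (subst \<sigma>) l = l'" "scoped (m + length l) e"
  shows "subst (ups m \<sigma>) (subst (ups m (sb 0 l)) e) = subst (ups m (sb 0 l')) e"
  unfolding subst_subst subst_ups_ups
  by (rule subst_scoped_cong[OF assms(2)], rule ups_cong[of "length l"]) (use assms(1) in auto)

lemma tsubst_ups_comp:
  assumes "map (subst \<sigma>) l = l'" "tscoped (m + length l) T"
  shows "tsubst (ups m \<sigma>) (tsubst (ups m (sb 0 l)) T) = tsubst (ups m (sb 0 l')) T"
  unfolding tsubst_tsubst subst_ups_ups
  by (rule tsubst_scoped_cong[OF assms(2)], rule ups_cong[of "length l"]) (use assms(1) in auto)

lemma map_subst_vars: "map (subst \<sigma>) (vars k n) = map \<sigma> [k..<k + n]"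
  by (simp add: vars_def)

lemma insts_vars_eq: "\<forall>e\<in>set es. scoped n e \<Longrightarrow> insts (vars k n) es = map (wk k) es"
  by (auto simp: inst_vars simp del: subst_subst)

text \<open>The list form of \<open>ups m (sb 0 l)\<close>. The last step of \<open>J_ctx\<close>
  instantiates a list of this shape, while typing of lifted substitutions is available for
  \<open>ups\<close>; \<open>sb_lift\<close> mediates.\<close>

definition lift :: "nat \<Rightarrow> 's expr list \<Rightarrow> 's expr list" where
  "lift m l = vars 0 m @ map (wk m) l"

lemma lift_length [simp]: "length (lift m l) = m + length l"
  by (simp add: lift_def)

lemma sb_lift: "i < m + length l \<Longrightarrow> sb 0 (lift m l) i = ups m (sb 0 l) i"
  by (auto simp: lift_def ups_eq nth_append)

lemma subst_inst_scoped:
  "scoped (length as) e \<Longrightarrow> subst \<sigma> (inst as e) = inst (map (subst \<sigma>) as) e"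
  by (auto intro: subst_scoped_cong)

declare subst_subst [simp del] tsubst_tsubst [simp del]

section \<open>Contexts and substitutions\<close>

lemma elems_eq_length:
  assumes "elems_eq S \<Gamma> as bs T"
  shows "length as = length T" "length bs = length T"
  using assms by (induction) auto

lemma elems_eq_Nil [simp]: "elems_eq S \<Gamma> as bs [] \<longleftrightarrow> as = [] \<and> bs = []"
  by (auto elim: elems_eq.cases intro: elems_eq.intros)

lemma elems_eq_Cons [simp]:
  "elems_eq S \<Gamma> (a # as) (b # bs) (A # T) \<longleftrightarrow>
     elems_eq S \<Gamma> as bs T \<and> (\<Gamma>, TmEq a b (inst as A)) \<in> S"
  by (auto elim: elems_eq.cases intro: elems_eq.intros)

lemma elems_eq_ConsE:
  assumes "elems_eq S \<Gamma> as bs (A # T)"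
  obtains a as' b bs' where "as = a # as'" "bs = b # bs'"
    "elems_eq S \<Gamma> as' bs' T" "(\<Gamma>, TmEq a b (inst as' A)) \<in> S"
  using assms by (auto elim: elems_eq.cases)

lemma elems_eq_append:
  assumes "length as2 = length T2" "length bs2 = length T2"
  shows "elems_eq S \<Gamma> (as2 @ as1) (bs2 @ bs1) (T2 @ T1) \<longleftrightarrow>
    elems_eq S \<Gamma> as1 bs1 T1 \<and> elems_eq S \<Gamma> as2 bs2 (tsubst (sb 0 as1) T2)"
  using assms
proof (induction T2 arbitrary: as2 bs2)
  case (Cons A T2)
  obtain a as' b bs' where eq: "as2 = a # as'" "bs2 = b # bs'"
    using Cons.prems by (metis length_Suc_conv)
  then have len: "length as' = length T2" "length bs' = length T2"
    using Cons.prems by auto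
  show ?case
    unfolding eq append_Cons elems_eq_Cons tsubst.simps Cons.IH[OF len] inst_append len by blast
qed simp

lemma elems_eq_iff_nth:
  "elems_eq S \<Gamma> as bs T \<longleftrightarrow> length as = length T \<and> length bs = length T \<and>
     (\<forall>i<length T. (\<Gamma>, TmEq (as ! i) (bs ! i) (inst (drop (Suc i) as) (T ! i))) \<in> S)"
proof (induction T arbitrary: as bs)
  case (Cons A T)
  show ?case
  proof (cases "\<exists>a as' b bs'. as = a # as' \<and> bs = b # bs'")
    case True
    then obtain a as' b bs' where eq: "as = a # as'" "bs = b # bs'" by blast
    show ?thesis
      unfolding eq elems_eq_Cons Cons.IH by (auto simp: nth_Cons split: nat.splits)
  next
    case False
    then show ?thesis
      by (auto elim: elems_eq.cases simp: length_Suc_conv)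
  qed
qed auto

lemma ctx_eq_length: "ctx_eq S \<Gamma> \<Delta> \<Longrightarrow> length \<Delta> = length \<Gamma>"
  by (induction rule: ctx_eq.induct) auto

lemma ctx_eq_Nil [simp]: "ctx_eq S [] \<Delta> \<longleftrightarrow> \<Delta> = []"
  by (auto elim: ctx_eq.cases intro: ctx_eq.intros)

lemma ctx_eq_Cons [simp]:
  "ctx_eq S (A # \<Gamma>) (B # \<Delta>) \<longleftrightarrow> ctx_eq S \<Gamma> \<Delta> \<and> (\<Gamma>, TyEq A B) \<in> S"
  by (auto elim: ctx_eq.cases intro: ctx_eq.intros)

lemma ctx_eq_append:
  "length T = length U \<Longrightarrow> ctx_eq S (T @ \<Gamma>) (U @ \<Delta>) \<Longrightarrow> ctx_eq S \<Gamma> \<Delta>"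
  by (induction T U rule: list_induct2) auto

text \<open>All type equations in \<open>ctx_eq\<close> are stated over the left-hand context, so
  the tail on the right can be exchanged freely.\<close>

lemma ctx_eq_change_right:
  "length T = length U \<Longrightarrow> ctx_eq S (T @ \<Gamma>) (U @ \<Delta>) \<Longrightarrow> ctx_eq S \<Gamma> \<Delta>' \<Longrightarrow>
     ctx_eq S (T @ \<Gamma>) (U @ \<Delta>')"
  by (induction T U rule: list_induct2) auto

lemma is_ctx_Nil [simp]: "is_ctx S []"
  by (rule is_ctx.intros)

lemma is_ctx_Cons [simp]: "is_ctx S (A # \<Gamma>) \<longleftrightarrow> is_ctx S \<Gamma> \<and> (\<Gamma>, Ty A) \<in> S"
  by (auto elim: is_ctx.cases intro: is_ctx.intros)

lemma is_ctx_appendD: "is_ctx S (T @ \<Gamma>) \<Longrightarrow> is_ctx S \<Gamma>"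
  by (induction T) auto

lemma is_ctx_nth: "is_ctx S \<Gamma> \<Longrightarrow> i < length \<Gamma> \<Longrightarrow> (drop (Suc i) \<Gamma>, Ty (\<Gamma> ! i)) \<in> S"
  by (induction \<Gamma> arbitrary: i) (auto simp: nth_Cons split: nat.splits)

context type_theory
begin

abbreviation tyeq where "tyeq \<Gamma> A B \<equiv> (\<Gamma>, TyEq A B) \<in> S"
abbreviation tmeq where "tmeq \<Gamma> a b A \<equiv> (\<Gamma>, TmEq a b A) \<in> S"
abbreviation eleq where "eleq \<equiv> elems_eq S"
abbreviation cteq where "cteq \<equiv> ctx_eq S"
abbreviation ctx where "ctx \<equiv> is_ctx S"
text \<open>Typing is treated as reflexive equality, so that each rule is needed for equalities only.\<close>

abbreviation (input) isel where "isel \<Gamma> a T \<equiv> elems_eq S \<Gamma> a a T"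
abbreviation (input) istm where "istm \<Gamma> a A \<equiv> (\<Gamma>, TmEq a a A) \<in> S"
abbreviation (input) isty where "isty \<Gamma> A \<equiv> (\<Gamma>, TyEq A A) \<in> S"

lemma ty_iff: "(\<Gamma>, Ty A) \<in> S \<longleftrightarrow> isty \<Gamma> A"
  using TyEq_refl presup_TyEq by blast

lemma tm_iff: "(\<Gamma>, Tm a A) \<in> S \<longleftrightarrow> istm \<Gamma> a A"
  using TmEq_refl presup_TmEq by blast

lemma tyeqD: "tyeq \<Gamma> A B \<Longrightarrow> isty \<Gamma> A" "tyeq \<Gamma> A B \<Longrightarrow> isty \<Gamma> B"
  using ty_iff presup_TyEq by auto

lemma tmeqD: "tmeq \<Gamma> a b A \<Longrightarrow> istm \<Gamma> a A" "tmeq \<Gamma> a b A \<Longrightarrow> istm \<Gamma> b A"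
  using tm_iff presup_TmEq by auto

lemma tmeq_ty: "tmeq \<Gamma> a b A \<Longrightarrow> isty \<Gamma> A"
  using presup_TmEq presup_Tm ty_iff by blast

lemma is_ctx_tscoped: "ctx \<Gamma> \<Longrightarrow> tscoped 0 \<Gamma>"
proof (induction \<Gamma>)
  case (Cons A \<Gamma>)
  then show ?case using scope[of \<Gamma> "Ty A"] by auto
qed simp

lemma is_ctx_tscoped_append: "ctx (T @ \<Gamma>) \<Longrightarrow> tscoped (length \<Gamma>) T"
  using is_ctx_tscoped[of "T @ \<Gamma>"] by simp

lemma elems_iff: "elems S \<Gamma> as T \<longleftrightarrow> isel \<Gamma> as T"
proof
  show "elems S \<Gamma> as T \<Longrightarrow> isel \<Gamma> as T"
    by (induction rule: elems.induct) (auto simp: tm_iff)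
  have "eleq \<Gamma> as bs T \<Longrightarrow> elems S \<Gamma> as T" for bs
  proof (induction as bs T rule: elems_eq.induct)
    case (2 as bs T a b A)
    from tmeqD(1)[OF 2(2)] have "(\<Gamma>, Tm a (inst as A)) \<in> S" by (simp add: tm_iff)
    with 2(3) show ?case by (rule elems.intros)
  qed (rule elems.intros)
  then show "isel \<Gamma> as T \<Longrightarrow> elems S \<Gamma> as T" .
qed

lemma elems_eq_scoped:
  assumes "eleq \<Gamma> as bs T"
  shows "\<forall>e\<in>set as. scoped (length \<Gamma>) e" "\<forall>e\<in>set bs. scoped (length \<Gamma>) e"
  using assms by induction (auto dest: scope)

text \<open>Equality of two context morphisms, given as functions on variables rather than as lists,
  so that they can be lifted by \<open>up\<close> and \<open>ups\<close>. Values at variables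
  outside \<open>\<Delta>\<close> are unconstrained.\<close>

definition esub where
  "esub \<Gamma> \<sigma> \<tau> \<Delta> \<longleftrightarrow> ctx \<Gamma> \<and> ctx \<Delta> \<and>
     (\<forall>i<length \<Delta>. tmeq \<Gamma> (\<sigma> i) (\<tau> i) (subst \<sigma> (wk (Suc i) (\<Delta> ! i))))"

lemma esub_iff:
  assumes "ctx \<Gamma>" "ctx \<Delta>"
  shows "esub \<Gamma> \<sigma> \<tau> \<Delta> \<longleftrightarrow> eleq \<Gamma> (map \<sigma> [0..<length \<Delta>]) (map \<tau> [0..<length \<Delta>]) \<Delta>"
proof -
  have "inst (drop (Suc i) (map \<sigma> [0..<length \<Delta>])) (\<Delta> ! i) = subst \<sigma> (wk (Suc i) (\<Delta> ! i))"
    if "i < length \<Delta>" for i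
    unfolding subst_subst
  proof (rule subst_scoped_cong)
    show "scoped (length \<Delta> - Suc i) (\<Delta> ! i)"
      using is_ctx_nth[OF assms(2) that] by (auto dest: scope)
  qed (use that in \<open>auto simp: add.commute\<close>)
  then show ?thesis
    unfolding esub_def elems_eq_iff_nth using assms by simp
qed

lemma jsubst_map:
  "(\<Delta>, j) \<in> S \<Longrightarrow> jsubst (sb 0 (map \<sigma> [0..<length \<Delta>])) j = jsubst \<sigma> j"
  by (rule jsubst_scoped_cong[OF scope]) auto

lemma esub_inst:
  assumes "ctx \<Gamma>" "ctx \<Delta>" "length as = length \<Delta>" "length bs = length \<Delta>"
  shows "esub \<Gamma> (sb 0 as) (sb 0 bs) \<Delta> \<longleftrightarrow> eleq \<Gamma> as bs \<Delta>"
proof -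
  have "map (sb 0 as) [0..<length \<Delta>] = as" "map (sb 0 bs) [0..<length \<Delta>] = bs"
    using assms by (auto intro!: nth_equalityI)
  then show ?thesis
    using esub_iff[OF assms(1,2), of "sb 0 as" "sb 0 bs"] by simp
qed

lemma esub_instI: "ctx \<Gamma> \<Longrightarrow> ctx \<Delta> \<Longrightarrow> eleq \<Gamma> as bs \<Delta> \<Longrightarrow> esub \<Gamma> (sb 0 as) (sb 0 bs) \<Delta>"
  using esub_inst elems_eq_length by blast

lemma elems_eq_left:
  "eleq \<Gamma> as bs T \<Longrightarrow> isel \<Gamma> as T"
  by (induction as bs T rule: elems_eq.induct) (auto dest: tmeqD)

lemma esub_ctx: "esub \<Gamma> \<sigma> \<tau> \<Delta> \<Longrightarrow> ctx \<Gamma>" "esub \<Gamma> \<sigma> \<tau> \<Delta> \<Longrightarrow> ctx \<Delta>"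
  by (auto simp: esub_def)

lemma esub_left: "esub \<Gamma> \<sigma> \<tau> \<Delta> \<Longrightarrow> esub \<Gamma> \<sigma> \<sigma> \<Delta>"
  unfolding esub_def by (auto dest: tmeqD)

lemma esub_jsubst: "(\<Delta>, j) \<in> S \<Longrightarrow> esub \<Gamma> \<sigma> \<tau> \<Delta> \<Longrightarrow> (\<Gamma>, jsubst \<sigma> j) \<in> S"
  using substitution[of \<Delta> j \<Gamma> "map \<sigma> [0..<length \<Delta>]"] esub_left[of \<Gamma> \<sigma> \<tau> \<Delta>] jsubst_map[of \<Delta> j \<sigma>]
    esub_iff[of \<Gamma> \<Delta> \<sigma> \<sigma>] elems_iff esub_ctx by metis

lemma esub_tyeq:
  assumes "tyeq \<Delta> A B" "esub \<Gamma> \<sigma> \<tau> \<Delta>"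
  shows "tyeq \<Gamma> (subst \<sigma> A) (subst \<tau> B)"
proof -
  have B: "(\<Delta>, Ty B) \<in> S" using assms(1) presup_TyEq by blast
  have "tyeq \<Gamma> (subst \<sigma> B) (subst \<tau> B)"
    using Ty_subst_cong[OF B, of \<Gamma> "map \<sigma> [0..<length \<Delta>]" "map \<tau> [0..<length \<Delta>]"]
      jsubst_map[OF B, of \<sigma>] jsubst_map[OF B, of \<tau>] esub_iff[of \<Gamma> \<Delta> \<sigma> \<tau>] assms(2)
      esub_ctx[OF assms(2)] by simp
  moreover have "tyeq \<Gamma> (subst \<sigma> A) (subst \<sigma> B)"
    using esub_jsubst[OF assms] by simp
  ultimately show ?thesis using TyEq_trans by blast
qed

lemma esub_tmeq:
  assumes "tmeq \<Delta> a b A" "esub \<Gamma> \<sigma> \<tau> \<Delta>"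
  shows "tmeq \<Gamma> (subst \<sigma> a) (subst \<tau> b) (subst \<sigma> A)"
proof -
  have B: "(\<Delta>, Tm b A) \<in> S" using assms(1) presup_TmEq by blast
  have "tmeq \<Gamma> (subst \<sigma> b) (subst \<tau> b) (subst \<sigma> A)"
    using Tm_subst_cong[OF B, of \<Gamma> "map \<sigma> [0..<length \<Delta>]" "map \<tau> [0..<length \<Delta>]"]
      jsubst_map[OF B, of \<sigma>] jsubst_map[OF B, of \<tau>] esub_iff[of \<Gamma> \<Delta> \<sigma> \<tau>] assms(2)
      esub_ctx[OF assms(2)] by simp
  moreover have "tmeq \<Gamma> (subst \<sigma> a) (subst \<sigma> b) (subst \<sigma> A)"
    using esub_jsubst[OF assms] by simp
  ultimately show ?thesis using TmEq_trans by blast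
qed

lemma inst_tyeq:
  "tyeq \<Delta> A B \<Longrightarrow> ctx \<Gamma> \<Longrightarrow> eleq \<Gamma> as bs \<Delta> \<Longrightarrow> tyeq \<Gamma> (inst as A) (inst bs B)"
  using esub_tyeq esub_instI presup_ctx by metis

lemma inst_tmeq:
  "tmeq \<Delta> a b A \<Longrightarrow> ctx \<Gamma> \<Longrightarrow> eleq \<Gamma> as bs \<Delta> \<Longrightarrow>
     tmeq \<Gamma> (inst as a) (inst bs b) (inst as A)"
  using esub_tmeq esub_instI presup_ctx by metis

lemma esub_wk: "ctx (T @ \<Gamma>) \<Longrightarrow> k = length T \<Longrightarrow> esub (T @ \<Gamma>) (sb k []) (sb k []) \<Gamma>"
  unfolding esub_def
proof (intro conjI allI impI)
  fix i assume *: "ctx (T @ \<Gamma>)" "k = length T" "i < length \<Gamma>"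
  then have "istm (T @ \<Gamma>) (Var (k + i)) (wk (Suc (k + i)) ((T @ \<Gamma>) ! (k + i)))"
    using variable[of "T @ \<Gamma>" "k + i"] by (auto simp: tm_iff)
  moreover have "wk (Suc (k + i)) ((T @ \<Gamma>) ! (k + i)) = wk k (wk (Suc i) (\<Gamma> ! i))"
    using * by (auto simp: subst_subst nth_append intro!: subst_cong)
  ultimately show "istm (T @ \<Gamma>) (sb k [] i) (wk k (wk (Suc i) (\<Gamma> ! i)))"
    by (simp add: add.commute)
qed (auto dest: is_ctx_appendD)

lemma esub_up:
  assumes "esub \<Gamma> \<sigma> \<tau> \<Delta>" "isty \<Delta> A" "B = subst \<sigma> A"
  shows "esub (B # \<Gamma>) (up \<sigma>) (up \<tau>) (A # \<Delta>)"
proof -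
  have B: "(\<Gamma>, Ty B) \<in> S" using esub_jsubst[of \<Delta> "Ty A"] assms by (simp add: ty_iff)
  then have ctx: "ctx (B # \<Gamma>)" using assms(1) esub_ctx by auto
  have w: "esub (B # \<Gamma>) (sb 1 []) (sb 1 []) \<Gamma>"
    using esub_wk[of "[B]" \<Gamma> 1] ctx by simp
  have "tmeq (B # \<Gamma>) (up \<sigma> i) (up \<tau> i) (subst (up \<sigma>) (wk (Suc i) ((A # \<Delta>) ! i)))"
    if i: "i < Suc (length \<Delta>)" for i
  proof (cases i)
    case 0
    have "istm (B # \<Gamma>) (Var 0) (wk 1 B)"
      using variable[of "B # \<Gamma>" 0] ctx by (simp add: tm_iff)
    moreover have "subst (up \<sigma>) (wk 1 A) = wk 1 B"
      unfolding assms(3) subst_subst by (rule subst_cong) (auto simp: up_eq)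
    ultimately show ?thesis using 0 by simp
  next
    case (Suc j)
    have "tmeq (B # \<Gamma>) (wk 1 (\<sigma> j)) (wk 1 (\<tau> j)) (wk 1 (subst \<sigma> (wk (Suc j) (\<Delta> ! j))))"
      using esub_tmeq[OF _ w] assms(1) i Suc by (auto simp: esub_def)
    moreover have "wk 1 (subst \<sigma> (wk (Suc j) (\<Delta> ! j))) = subst (up \<sigma>) (wk (Suc i) (\<Delta> ! j))"
      unfolding Suc subst_subst by (rule subst_cong) (auto simp: up_eq subst_subst)
    ultimately show ?thesis using Suc by (simp add: up_eq)
  qed
  then show ?thesis
    unfolding esub_def using ctx assms(1,2) by (auto simp: esub_def ty_iff)
qed

lemma esub_ups:
  assumes "esub \<Gamma> \<sigma> \<tau> \<Delta>" "ctx (T @ \<Delta>)"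
  shows "esub (tsubst \<sigma> T @ \<Gamma>) (ups (length T) \<sigma>) (ups (length T) \<tau>) (T @ \<Delta>)"
  using assms(2)
proof (induction T)
  case (Cons A T)
  then show ?case using esub_up[of "tsubst \<sigma> T @ \<Gamma>" "ups (length T) \<sigma>" _ "T @ \<Delta>" A]
    by (auto simp: ty_iff)
qed (use assms(1) in simp)

lemma is_ctx_tsubst: "esub \<Gamma> \<sigma> \<tau> \<Delta> \<Longrightarrow> ctx (T @ \<Delta>) \<Longrightarrow> ctx (tsubst \<sigma> T @ \<Gamma>)"
  using esub_ups esub_ctx by blast

lemma esub_comp:
  assumes "esub \<Gamma> \<sigma> \<sigma>' \<Delta>" "esub \<Theta> \<tau> \<tau>' \<Gamma>"
  shows "esub \<Theta> (\<lambda>i. subst \<tau> (\<sigma> i)) (\<lambda>i. subst \<tau>' (\<sigma>' i)) \<Delta>"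
proof -
  have "tmeq \<Theta> (subst \<tau> (\<sigma> i)) (subst \<tau>' (\<sigma>' i))
      (subst \<tau> (subst \<sigma> (wk (Suc i) (\<Delta> ! i))))" if "i < length \<Delta>" for i
    using esub_tmeq[OF _ assms(2)] assms(1) that unfolding esub_def by blast
  then show ?thesis
    using assms unfolding esub_def by (simp only: subst_subst[of \<tau>]) auto
qed

lemma is_ctx_cteq_refl: "ctx \<Gamma> \<Longrightarrow> cteq \<Gamma> \<Gamma>"
  by (induction rule: is_ctx.induct) (auto simp: ty_iff)

text \<open>Context conversion is derived from substitution: the variables of
  \<open>\<Delta>\<close> form a morphism to \<open>\<Gamma>\<close>, where each new variable is
  converted along the equation of its types.\<close>

lemma cteq_ident: "cteq \<Gamma> \<Delta> \<Longrightarrow> ctx \<Gamma> \<and> esub \<Delta> Var Var \<Gamma>"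
proof (induction rule: ctx_eq.induct)
  case 1
  show ?case by (simp add: esub_def)
next
  case (2 \<Gamma> \<Delta> A B)
  then have "esub \<Delta> Var Var \<Gamma>" by blast
  then have AB: "tyeq \<Delta> A B" using esub_tyeq[OF 2(2)] by fastforce
  then have ctx: "ctx (B # \<Delta>)" using 2 by (auto simp: esub_def ty_iff dest: tyeqD)
  have w: "esub (B # \<Delta>) (sb 1 []) (sb 1 []) \<Delta>"
    using esub_wk[of "[B]" \<Delta> 1] ctx by simp
  have "istm (B # \<Delta>) (Var i) (wk (Suc i) ((A # \<Gamma>) ! i))" if i: "i < Suc (length \<Gamma>)" for i
  proof (cases i)
    case 0
    have "istm (B # \<Delta>) (Var 0) (wk 1 B)"
      using variable[of "B # \<Delta>" 0] ctx by (simp add: tm_iff)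
    moreover have "tyeq (B # \<Delta>) (wk 1 B) (wk 1 A)"
      using TyEq_sym[OF esub_tyeq[OF AB w]] .
    ultimately show ?thesis using 0 TmEq_conv by auto
  next
    case (Suc j)
    then have "istm \<Delta> (Var j) (wk (Suc j) (\<Gamma> ! j))"
      using 2 i by (auto simp: esub_def)
    moreover have "wk 1 (wk (Suc j) (\<Gamma> ! j)) = wk (Suc i) (\<Gamma> ! j)"
      unfolding subst_subst by (rule subst_cong) (simp add: Suc)
    ultimately show ?thesis
      using esub_tmeq[OF _ w, of "Var j" "Var j" "wk (Suc j) (\<Gamma> ! j)"] by (simp add: Suc)
  qed
  then show ?case
    using ctx 2 by (auto simp: esub_def ty_iff dest: tyeqD)
qed

lemma cteq_ctx: "cteq \<Gamma> \<Delta> \<Longrightarrow> ctx \<Gamma>" "cteq \<Gamma> \<Delta> \<Longrightarrow> ctx \<Delta>"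
  using cteq_ident esub_ctx by blast+

lemma cteq_conv: "(\<Gamma>, j) \<in> S \<Longrightarrow> cteq \<Gamma> \<Delta> \<Longrightarrow> (\<Delta>, j) \<in> S"
  using cteq_ident esub_jsubst by fastforce

lemma cteq_sym: "cteq \<Gamma> \<Delta> \<Longrightarrow> cteq \<Delta> \<Gamma>"
proof (induction rule: ctx_eq.induct)
  case (2 \<Gamma> \<Delta> A B)
  from cteq_conv[OF TyEq_sym[OF 2(2)] 2(1)] 2(3) show ?case by simp
qed simp

lemma cteq_tsubst:
  assumes "esub \<Gamma> \<sigma> \<tau> \<Delta>" "cteq (T @ \<Delta>) (U @ \<Delta>')" "length U = length T"
  shows "cteq (tsubst \<sigma> T @ \<Gamma>) (tsubst \<tau> U @ \<Gamma>)"
  using assms(3,2)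
proof (induction U T rule: list_induct2)
  case Nil
  then show ?case using is_ctx_cteq_refl esub_ctx assms by simp
next
  case (Cons B U A T)
  then have "ctx (T @ \<Delta>)" "tyeq (T @ \<Delta>) A B" by (auto dest: cteq_ctx)
  from esub_tyeq[OF this(2) esub_ups[OF assms(1) this(1)]] Cons show ?case
    by simp
qed

lemma elems_eq_cteq: "eleq \<Gamma> as bs T \<Longrightarrow> cteq \<Gamma> \<Delta> \<Longrightarrow> eleq \<Delta> as bs T"
  by (induction as bs T rule: elems_eq.induct) (auto intro: cteq_conv)

lemma esub_cteq: "esub \<Gamma> \<sigma> \<tau> \<Delta> \<Longrightarrow> cteq \<Gamma> \<Gamma>' \<Longrightarrow> esub \<Gamma>' \<sigma> \<tau> \<Delta>"
  unfolding esub_def by (auto intro: cteq_conv dest: cteq_ctx)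

lemma tsubst_vars_0: "ctx (T @ \<Gamma>) \<Longrightarrow> tsubst (sb 0 (vars 0 (length \<Gamma>))) T = T"
  using tsubst_scoped_cong[OF is_ctx_tscoped_append, of T \<Gamma> "sb 0 (vars 0 (length \<Gamma>))" Var] by simp

lemma elems_eq_vars:
  assumes "ctx (T @ \<Gamma>)" "k = length T" "n = length \<Gamma>"
  shows "isel (T @ \<Gamma>) (vars k n) \<Gamma>"
proof -
  have "map (sb k []) [0..<length \<Gamma>] = vars k n"
    using assms by (auto intro!: nth_equalityI)
  then show ?thesis
    using esub_iff[of "T @ \<Gamma>" \<Gamma> "sb k []" "sb k []"] esub_wk[OF assms(1,2)] assms(1) is_ctx_appendD
    by metis
qed

lemma elems_eq_vars_0: "ctx \<Gamma> \<Longrightarrow> n = length \<Gamma> \<Longrightarrow> isel \<Gamma> (vars 0 n) \<Gamma>"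
  using elems_eq_vars[of "[]" \<Gamma>] by simp

text \<open>Appending the variables of \<open>\<Gamma>\<close> turns elements of a telescope into
  elements of a closed context. Symmetry and transitivity are proved for closed contexts and
  transferred along this equivalence.\<close>

lemma elems_eq_tel_iff:
  assumes "ctx (T @ \<Gamma>)" "length as = length T" "length bs = length T"
  shows "eleq \<Gamma> as bs T \<longleftrightarrow>
    eleq \<Gamma> (as @ vars 0 (length \<Gamma>)) (bs @ vars 0 (length \<Gamma>)) (T @ \<Gamma>)"
  using elems_eq_append[OF assms(2,3)] tsubst_vars_0[OF assms(1)] elems_eq_vars_0[of \<Gamma>]
    is_ctx_appendD[OF assms(1)] by auto

lemma elems_eq_comp:
  assumes "eleq \<Delta> as bs T" "esub \<Gamma> \<sigma> \<tau> \<Delta>"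
  shows "eleq \<Gamma> (map (subst \<sigma>) as) (map (subst \<tau>) bs) (tsubst \<sigma> T)"
  using assms(1)
proof (induction as bs T rule: elems_eq.induct)
  case (2 as bs T a b A)
  have "inst (map (subst \<sigma>) as) (subst (ups (length T) \<sigma>) A) = subst \<sigma> (inst as A)"
    unfolding subst_inst elems_eq_length[OF 2(1)] ..
  with 2 esub_tmeq[OF 2(2) assms(2)] show ?case by simp
qed simp

text \<open>Each entry is typed over the left list. After swapping, its type has to be converted
  along the equation between the two instances of \<open>A\<close>, which is why the context must be
  well formed.\<close>

lemma elems_eq_sym_closed: "eleq \<Gamma> as bs \<Delta> \<Longrightarrow> ctx \<Gamma> \<Longrightarrow> ctx \<Delta> \<Longrightarrow> eleq \<Gamma> bs as \<Delta>"
proof (induction as bs \<Delta> rule: elems_eq.induct)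
  case (2 as bs T a b A)
  then have "ctx T" "isty T A" by (simp_all add: ty_iff)
  from TmEq_conv[OF TmEq_sym[OF 2(2)] inst_tyeq[OF this(2) 2(4) 2(1)]] 2 \<open>ctx T\<close> show ?case
    by simp
qed simp

lemma elems_eq_trans_closed:
  "eleq \<Gamma> as bs \<Delta> \<Longrightarrow> eleq \<Gamma> bs cs \<Delta> \<Longrightarrow> ctx \<Gamma> \<Longrightarrow> ctx \<Delta> \<Longrightarrow> eleq \<Gamma> as cs \<Delta>"
proof (induction as bs \<Delta> arbitrary: cs rule: elems_eq.induct)
  case (2 as bs T a b A)
  from 2(4) obtain c cs' where cs: "cs = c # cs'" "eleq \<Gamma> bs cs' T" "tmeq \<Gamma> b c (inst bs A)"
    by (auto elim: elems_eq_ConsE)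
  from 2 have T: "ctx T" "isty T A" by (simp_all add: ty_iff)
  from inst_tyeq[OF T(2) 2(5) elems_eq_sym_closed[OF 2(1,5) T(1)]]
  have "tyeq \<Gamma> (inst bs A) (inst as A)" .
  from TmEq_trans[OF 2(2) TmEq_conv[OF cs(3) this]] 2(3)[OF cs(2) 2(5) T(1)] show ?case
    by (simp add: cs)
qed simp

lemma elems_eq_sym:
  assumes "eleq \<Gamma> as bs T" "ctx (T @ \<Gamma>)"
  shows "eleq \<Gamma> bs as T"
proof -
  note iff = elems_eq_tel_iff[OF assms(2)] and len = elems_eq_length[OF assms(1)]
  show ?thesis
    using elems_eq_sym_closed[OF _ is_ctx_appendD[OF assms(2)] assms(2)] assms(1)
    unfolding iff[OF len] iff[OF len(2,1)] .
qed

lemma elems_eq_trans: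
  assumes "eleq \<Gamma> as bs T" "eleq \<Gamma> bs cs T" "ctx (T @ \<Gamma>)"
  shows "eleq \<Gamma> as cs T"
proof -
  note iff = elems_eq_tel_iff[OF assms(3)]
    and len = elems_eq_length[OF assms(1)] elems_eq_length[OF assms(2)]
  show ?thesis
    using elems_eq_trans_closed[OF _ _ is_ctx_appendD[OF assms(3)] assms(3)] assms(1,2)
    unfolding iff[OF len(1,2)] iff[OF len(3,4)] iff[OF len(1,4)] .
qed

lemma elems_eq_right:
  assumes "eleq \<Gamma> as bs T" "ctx (T @ \<Gamma>)"
  shows "isel \<Gamma> bs T"
  using elems_eq_sym elems_eq_left assms by blast

lemma elems_eq_conv:
  assumes "eleq \<Gamma> as bs T" "cteq (T @ \<Gamma>) (U @ \<Gamma>')" "length U = length T"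
  shows "eleq \<Gamma> as bs U"
  using assms(3,1,2)
proof (induction U T arbitrary: as bs rule: list_induct2)
  case (Cons B U A T)
  from Cons(3) obtain a as' b bs' where eq: "as = a # as'" "bs = b # bs'"
      "eleq \<Gamma> as' bs' T" "tmeq \<Gamma> a b (inst as' A)"
    by (auto elim: elems_eq_ConsE)
  have ctx: "ctx (T @ \<Gamma>)" and AB: "tyeq (T @ \<Gamma>) A B" using Cons(4) by (auto dest: cteq_ctx)
  have \<Gamma>: "ctx \<Gamma>" using ctx is_ctx_appendD by blast
  have as': "isel \<Gamma> (as' @ vars 0 (length \<Gamma>)) (T @ \<Gamma>)"
    using elems_eq_tel_iff[OF ctx] elems_eq_left[OF eq(3)] elems_eq_length[OF eq(3)] by auto
  have "inst (as' @ vars 0 (length \<Gamma>)) C = inst as' C" if "(T @ \<Gamma>, Ty C) \<in> S" for C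
  proof (rule subst_scoped_cong)
    show "scoped (length T + length \<Gamma>) C" using scope[OF that] by simp
    fix i assume "i < length T + length \<Gamma>"
    then show "sb 0 (as' @ vars 0 (length \<Gamma>)) i = sb 0 as' i"
      using elems_eq_length[OF eq(3)] by (cases "i < length T") (auto simp: nth_append sb_def)
  qed
  then have "tyeq \<Gamma> (inst as' A) (inst as' B)"
    using inst_tyeq[OF AB \<Gamma> as'] presup_TyEq[OF AB] by simp
  then show ?case using eq Cons TmEq_conv by auto
qed simp

lemma elems_eq_conv':
  "eleq \<Gamma> as bs T \<Longrightarrow> cteq (T @ \<Gamma>) (U @ \<Gamma>) \<Longrightarrow> eleq \<Gamma> as bs U"
  using elems_eq_conv ctx_eq_length by (metis add_right_cancel length_append)

text \<open>\<open>sb\<close> sends variables beyond its list to the remaining variables in order,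
  which is exactly what the appended \<open>vars 0 n\<close> do.\<close>

lemma inst_tel_scoped:
  "scoped (length as + n) e \<Longrightarrow> inst (as @ vars 0 n) e = inst as e"
  by (rule subst_scoped_cong) (auto simp: nth_append sb_def)

lemma inst_tel_tyeq:
  assumes "tyeq (T @ \<Gamma>) A B" "eleq \<Gamma> as bs T"
  shows "tyeq \<Gamma> (inst as A) (inst bs B)"
proof -
  have ctx: "ctx (T @ \<Gamma>)" using assms presup_ctx by blast
  note len = elems_eq_length[OF assms(2)]
  have "eleq \<Gamma> (as @ vars 0 (length \<Gamma>)) (bs @ vars 0 (length \<Gamma>)) (T @ \<Gamma>)"
    using assms(2) elems_eq_tel_iff[OF ctx len] by simp
  from inst_tyeq[OF assms(1) is_ctx_appendD[OF ctx] this] show ?thesis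
    using scope[OF assms(1)] by (simp add: inst_tel_scoped len)
qed

lemma tsubst_closed: "ctx \<Lambda> \<Longrightarrow> tsubst \<sigma> \<Lambda> = \<Lambda>"
  using tsubst_scoped_cong[OF is_ctx_tscoped, of \<Lambda> \<sigma> Var] by simp

lemma cteq_append_closed:
  assumes "cteq \<Lambda> \<Lambda>'" "cteq \<Omega> \<Omega>'"
  shows "cteq (\<Lambda> @ \<Omega>) (\<Lambda>' @ \<Omega>')"
proof -
  have "esub \<Omega> Var Var []" using assms(2) cteq_ctx by (auto simp: esub_def)
  from cteq_tsubst[OF this, of \<Lambda> \<Lambda>' "[]"] have "cteq (\<Lambda> @ \<Omega>) (\<Lambda>' @ \<Omega>)"
    using assms(1) ctx_eq_length[OF assms(1)] by simp
  then show ?thesis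
    using ctx_eq_change_right[OF ctx_eq_length[OF assms(1), symmetric] _ assms(2)] by blast
qed

lemma is_ctx_append_closed: "ctx \<Lambda> \<Longrightarrow> ctx \<Omega> \<Longrightarrow> ctx (\<Lambda> @ \<Omega>)"
  using cteq_append_closed is_ctx_cteq_refl cteq_ctx by blast

end

section \<open>Identity elimination with post-contexts\<close>

lemma subst_pi_tel:
  "subst \<sigma> (pi_tel T C) = pi_tel (tsubst \<sigma> T) (subst (ups (length T) \<sigma>) C)"
  by (induction T arbitrary: C) auto

lemma subst_up_app_var:
  "subst (up \<sigma>) (app_var A B m) = app_var (subst \<sigma> A) (subst (up \<sigma>) B) (subst \<sigma> m)"
proof -
  have "subst (up \<sigma>) (wk 1 e) = wk 1 (subst \<sigma> e)" for e
    unfolding subst_subst by (rule subst_cong) (simp add: up_eq)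
  moreover have "subst (up (up \<sigma>)) (subst (up (sb 1 [])) B) = subst (up (sb 1 [])) (subst (up \<sigma>) B)"
    unfolding subst_subst by (rule subst_cong) (auto simp: up_eq subst_subst split: nat.split)
  ultimately show ?thesis
    by (simp add: app_var_def app_wk_def)
qed

lemma subst_app_tel:
  "subst (ups (length T) \<sigma>) (app_tel T C m) =
     app_tel (tsubst \<sigma> T) (subst (ups (length T) \<sigma>) C) (subst \<sigma> m)"
  by (induction T arbitrary: C) (simp_all add: subst_up_app_var)

text \<open>The morphism \<open>(x, x, r(x))\<close> from \<open>\<Gamma>.A\<close> to
  \<open>\<Gamma>.A.A.Id\<close>, in the form in which \<open>id_elim\<close> and
  \<open>J_post\<close> use it.\<close>

definition refl_sub :: "'s expr \<Rightarrow> nat \<Rightarrow> 's expr" where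
  "refl_sub A = sb 1 [reflT (wk 1 A) (Var 0), Var 0, Var 0]"

context type_theory
begin

lemma esub_sb:
  assumes "ctx (U @ \<Gamma>)" "k = length U" "ctx (T @ \<Gamma>)" "eleq (U @ \<Gamma>) as bs (tsubst (sb k []) T)"
  shows "esub (U @ \<Gamma>) (sb k as) (sb k bs) (T @ \<Gamma>)"
proof -
  have len: "length as = length T" "length bs = length T"
    using elems_eq_length[OF assms(4)] by auto
  have "map (sb k cs) [0..<length (T @ \<Gamma>)] = cs @ vars k (length \<Gamma>)"
    if "length cs = length T" for cs :: "'s expr list"
    using that by (auto intro!: nth_equalityI simp: nth_append sb_def)
  moreover have "tsubst (sb 0 (vars k (length \<Gamma>))) T = tsubst (sb k []) T"
    by (rule tsubst_scoped_cong[OF is_ctx_tscoped_append[OF assms(3)]]) auto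
  ultimately show ?thesis
    using esub_iff[OF assms(1,3)] elems_eq_append[OF len] len elems_eq_vars[OF assms(1,2)] assms(4)
    by simp
qed

end

context ml2_theory
begin

lemma pi_tel_cong:
  "cteq (T @ \<Gamma>) (T' @ \<Gamma>) \<Longrightarrow> length T' = length T \<Longrightarrow> tyeq (T @ \<Gamma>) C C' \<Longrightarrow>
     tyeq \<Gamma> (pi_tel T C) (pi_tel T' C')"
proof (induction T arbitrary: T' C C')
  case (Cons A T)
  then obtain A' U where "T' = A' # U" by (metis length_Suc_conv)
  with Cons pi_cong[of "T @ \<Gamma>" A A' C C'] show ?case by simp
qed simp

lemma lam_tel_cong:
  "cteq (T @ \<Gamma>) (T' @ \<Gamma>) \<Longrightarrow> length T' = length T \<Longrightarrow> tyeq (T @ \<Gamma>) C C' \<Longrightarrow>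
     tmeq (T @ \<Gamma>) e e' C \<Longrightarrow> tmeq \<Gamma> (lam_tel T C e) (lam_tel T' C' e') (pi_tel T C)"
proof (induction T arbitrary: T' C C' e e')
  case (Cons A T)
  then obtain A' U where "T' = A' # U" by (metis length_Suc_conv)
  with Cons pi_cong[of "T @ \<Gamma>" A A' C C'] lam_cong[of "T @ \<Gamma>" A A' C C' e e'] show ?case by simp
qed simp

lemma app_var_cong:
  assumes "tyeq \<Gamma> A A'" "tyeq (A # \<Gamma>) C C'" "tmeq \<Gamma> m m' (piT A C)"
  shows "tmeq (A # \<Gamma>) (app_var A C m) (app_var A' C' m') C"
proof -
  have ctx: "ctx (A # \<Gamma>)" using assms(2) presup_ctx by blast
  have w: "esub (A # \<Gamma>) (sb 1 []) (sb 1 []) \<Gamma>"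
    using esub_wk[of "[A]" \<Gamma> 1] ctx by simp
  have "tmeq (A # \<Gamma>) (appT (wk 1 A) (subst (up (sb 1 [])) C) (wk 1 m) (Var 0))
      (appT (wk 1 A') (subst (up (sb 1 [])) C') (wk 1 m') (Var 0))
      (inst [Var 0] (subst (up (sb 1 [])) C))"
  proof (rule app_cong)
    show "tyeq (A # \<Gamma>) (wk 1 A) (wk 1 A')" by (rule esub_tyeq[OF assms(1) w])
    show "tyeq (wk 1 A # A # \<Gamma>) (subst (up (sb 1 [])) C) (subst (up (sb 1 [])) C')"
      by (rule esub_tyeq[OF assms(2) esub_up[OF w _ refl]]) (use assms(1) tyeqD in blast)
    show "tmeq (A # \<Gamma>) (wk 1 m) (wk 1 m') (piT (wk 1 A) (subst (up (sb 1 [])) C))"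
      using esub_tmeq[OF assms(3) w] by simp
    show "istm (A # \<Gamma>) (Var 0) (wk 1 A)"
      using variable[of "A # \<Gamma>" 0] ctx by (simp add: tm_iff)
  qed
  moreover have "inst [Var 0] (subst (up (sb 1 [])) C) = C"
    unfolding subst_subst
    by (rule trans[OF subst_cong subst_Var]) (auto simp: up_eq split: nat.split)
  ultimately show ?thesis by (simp add: app_var_def app_wk_def)
qed

lemma app_tel_cong:
  "cteq (T @ \<Gamma>) (T' @ \<Gamma>) \<Longrightarrow> length T' = length T \<Longrightarrow> tyeq (T @ \<Gamma>) C C' \<Longrightarrow>
     tmeq \<Gamma> m m' (pi_tel T C) \<Longrightarrow> tmeq (T @ \<Gamma>) (app_tel T C m) (app_tel T' C' m') C"
proof (induction T arbitrary: T' C C')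
  case (Cons A T)
  then obtain A' U where "T' = A' # U" by (metis length_Suc_conv)
  with Cons pi_cong[of "T @ \<Gamma>" A A' C C'] app_var_cong[of "T @ \<Gamma>" A A' C C'] show ?case by simp
qed simp

lemma app_var_beta:
  assumes "istm (A # \<Gamma>) e C"
  shows "tmeq (A # \<Gamma>) (app_var A C (lamT A C e)) e C"
proof -
  have ctx: "ctx (A # \<Gamma>)" using assms presup_ctx by blast
  have w: "esub (A # \<Gamma>) (sb 1 []) (sb 1 []) \<Gamma>"
    using esub_wk[of "[A]" \<Gamma> 1] ctx by simp
  have A: "isty (A # \<Gamma>) (wk 1 A)"
    using esub_tyeq[OF _ w] ctx by (simp add: ty_iff)
  have *: "inst [Var 0] (subst (up (sb 1 [])) t) = t" for t :: "'s expr"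
    unfolding subst_subst
    by (rule trans[OF subst_cong subst_Var]) (auto simp: up_eq split: nat.split)
  have "tmeq (A # \<Gamma>)
      (appT (wk 1 A) (subst (up (sb 1 [])) C)
        (lamT (wk 1 A) (subst (up (sb 1 [])) C) (subst (up (sb 1 [])) e)) (Var 0))
      (inst [Var 0] (subst (up (sb 1 [])) e)) (inst [Var 0] (subst (up (sb 1 [])) C))"
  proof (rule pi_comp)
    show "(A # \<Gamma>, Ty (wk 1 A)) \<in> S" using A by (simp add: ty_iff)
    show "(wk 1 A # A # \<Gamma>, Tm (subst (up (sb 1 [])) e) (subst (up (sb 1 [])) C)) \<in> S"
      unfolding tm_iff by (rule esub_tmeq[OF assms esub_up[OF w _ refl]]) (use ctx ty_iff in auto)
    show "(A # \<Gamma>, Tm (Var 0) (wk 1 A)) \<in> S"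
      using variable[of "A # \<Gamma>" 0] ctx by simp
  qed
  then show ?thesis unfolding app_var_def app_wk_def subst.simps list.map * .
qed

lemma app_tel_beta:
  "istm (T @ \<Gamma>) e C \<Longrightarrow> tmeq (T @ \<Gamma>) (app_tel T C (lam_tel T C e)) e C"
proof (induction T arbitrary: C e)
  case (Cons A T)
  then have ctx: "ctx (A # T @ \<Gamma>)" and C: "isty (A # T @ \<Gamma>) C" and A: "isty (T @ \<Gamma>) A"
    using presup_ctx tmeq_ty by (fastforce simp: ty_iff)+
  have "istm (T @ \<Gamma>) (lamT A C e) (piT A C)"
    using lam_cong[OF A C] Cons.prems by simp
  from TmEq_trans[OF app_var_cong[OF A C Cons.IH[OF this]] app_var_beta] Cons.prems
  show ?case by simp
qed simp

lemma extId_cong: "tyeq \<Gamma> A A' \<Longrightarrow> cteq (extId \<Gamma> A) (extId \<Gamma> A')"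
proof -
  assume A: "tyeq \<Gamma> A A'"
  then have ctx: "ctx (A # \<Gamma>)" using presup_ctx presup_TyEq by fastforce
  have w: "esub (A # \<Gamma>) (sb 1 []) (sb 1 []) \<Gamma>"
    using esub_wk[of "[A]" \<Gamma> 1] ctx by simp
  have A1: "tyeq (A # \<Gamma>) (wk 1 A) (wk 1 A')" by (rule esub_tyeq[OF A w])
  then have ctx2: "ctx (wk 1 A # A # \<Gamma>)" using ctx presup_TyEq by fastforce
  have w2: "esub (wk 1 A # A # \<Gamma>) (sb 2 []) (sb 2 []) \<Gamma>"
    using esub_wk[of "[wk 1 A, A]" \<Gamma> 2] ctx2 by simp
  have A2: "tyeq (wk 1 A # A # \<Gamma>) (wk 2 A) (wk 2 A')" by (rule esub_tyeq[OF A w2])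
  have "wk (Suc 0) (wk 1 A) = wk 2 A"
    unfolding subst_subst by (rule subst_cong) simp
  then have "istm (wk 1 A # A # \<Gamma>) (Var 0) (wk 2 A)"
    "istm (wk 1 A # A # \<Gamma>) (Var 1) (wk 2 A)"
    using variable[OF ctx2, of 0] variable[OF ctx2, of 1] by (simp_all add: tm_iff numeral_2_eq_2)
  from id_cong[OF A2 this(2,1)] show "cteq (extId \<Gamma> A) (extId \<Gamma> A')"
    using A A1 ctx is_ctx_cteq_refl unfolding extId_def by simp
qed

lemma is_ctx_extId: "isty \<Gamma> A \<Longrightarrow> ctx (extId \<Gamma> A)"
  using extId_cong cteq_ctx by blast

lemma esub_refl_sub:
  assumes "tyeq \<Gamma> A A'"
  shows "esub (A # \<Gamma>) (refl_sub A) (refl_sub A') (extId \<Gamma> A)"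
proof -
  have AA: "isty \<Gamma> A" using assms tyeqD by blast
  then have ctx: "ctx (A # \<Gamma>)" using presup_ctx by (auto simp: ty_iff)
  have w: "esub (A # \<Gamma>) (sb 1 []) (sb 1 []) \<Gamma>"
    using esub_wk[of "[A]" \<Gamma> 1] ctx by simp
  have 0: "istm (A # \<Gamma>) (Var 0) (wk 1 A)"
    using variable[of "A # \<Gamma>" 0] ctx by (simp add: tm_iff)
  have r: "tmeq (A # \<Gamma>) (reflT (wk 1 A) (Var 0)) (reflT (wk 1 A') (Var 0)) (idT (wk 1 A) (Var 0) (Var 0))"
    using refl_cong[OF esub_tyeq[OF assms w] 0] .
  have e1: "inst [Var 0] (subst (ups (Suc 0) (sb 1 [])) (wk 1 A)) = wk 1 A"
    unfolding subst_subst by (rule subst_cong) (auto simp: ups_eq sb_def)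
  have e2: "inst [Var 0, Var 0] (subst (ups 2 (sb 1 [])) (wk 2 A)) = wk 1 A"
    unfolding subst_subst by (rule subst_cong) (auto simp: ups_eq sb_def)
  have "esub ([A] @ \<Gamma>) (refl_sub A) (refl_sub A') ([idT (wk 2 A) (Var 1) (Var 0), wk 1 A, A] @ \<Gamma>)"
    unfolding refl_sub_def
    by (rule esub_sb)
      (use ctx is_ctx_extId[OF AA, unfolded extId_def] 0 r e1 e2 in \<open>simp_all add: numeral_2_eq_2\<close>)
  then show ?thesis unfolding extId_def by simp
qed

text \<open>The post-context is moved into the motive: the identity is eliminated into the iterated
  product \<open>pi_tel \<Delta> C\<close>, with the abstraction of \<open>d\<close> as method, and
  the result is applied to the variables of \<open>\<Delta>\<close>. Congruence holds stage by
  stage; computation is that of \<open>J\<close> followed by beta.\<close>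

lemma J_post_main:
  fixes \<Delta> :: "'s expr list"
  assumes A: "tyeq \<Gamma> A A'"
    and \<Delta>: "cteq (\<Delta> @ extId \<Gamma> A) (\<Delta>' @ extId \<Gamma> A)"
    and C: "tyeq (\<Delta> @ extId \<Gamma> A) C C'"
    and d: "tmeq (tsubst (refl_sub A) \<Delta> @ A # \<Gamma>) d d' (subst (ups (length \<Delta>) (refl_sub A)) C)"
  shows J_post_cong: "tmeq (\<Delta> @ extId \<Gamma> A) (J_post A \<Delta> C d) (J_post A' \<Delta>' C' d') C"
    and J_post_comp: "tmeq (tsubst (refl_sub A) \<Delta> @ A # \<Gamma>)
      (subst (ups (length \<Delta>) (refl_sub A)) (J_post A \<Delta> C d)) d
      (subst (ups (length \<Delta>) (refl_sub A)) C)"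
proof -
  let ?\<rho> = "refl_sub A" and ?\<rho>' = "refl_sub A'" and ?m = "length \<Delta>"
  let ?\<Psi> = "extId \<Gamma> A" and ?P = "pi_tel \<Delta> C" and ?P' = "pi_tel \<Delta>' C'"
  define L where "L = lam_tel (tsubst ?\<rho> \<Delta>) (subst (ups ?m ?\<rho>) C) d"
  define L' where "L' = lam_tel (tsubst ?\<rho>' \<Delta>') (subst (ups ?m ?\<rho>') C') d'"
  have len: "length \<Delta>' = ?m" using ctx_eq_length[OF \<Delta>] by simp
  have AA: "isty \<Gamma> A" using A tyeqD by blast
  have ctx\<Psi>: "ctx ?\<Psi>" by (rule is_ctx_extId[OF AA])
  have ctx\<Delta>: "ctx (\<Delta> @ ?\<Psi>)" using \<Delta> cteq_ctx by blast
  have ctx: "ctx (A # \<Gamma>)" using ctx\<Psi> unfolding extId_def by simp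
  note \<rho> = esub_refl_sub[OF A]
  have P: "tyeq ?\<Psi> ?P ?P'" using pi_tel_cong[OF \<Delta> len C] .
  have \<Delta>\<rho>: "cteq (tsubst ?\<rho> \<Delta> @ A # \<Gamma>) (tsubst ?\<rho>' \<Delta>' @ A # \<Gamma>)"
    using cteq_tsubst[OF \<rho> \<Delta>] len by simp
  have C\<rho>: "tyeq (tsubst ?\<rho> \<Delta> @ A # \<Gamma>) (subst (ups ?m ?\<rho>) C) (subst (ups ?m ?\<rho>') C')"
    using esub_tyeq[OF C esub_ups[OF \<rho> ctx\<Delta>]] .
  have L: "tmeq (A # \<Gamma>) L L' (subst ?\<rho> ?P)"
    unfolding subst_pi_tel L_def L'_def
    using lam_tel_cong[OF \<Delta>\<rho> _ C\<rho> d] len by simp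
  \<comment> \<open>\<open>J\<close> is applied inside \<open>extId \<Gamma> A\<close> to the three
    newest variables themselves, so the premises of its rule are needed weakened by these three
    variables.\<close>
  have w: "esub ?\<Psi> (sb 3 []) (sb 3 []) \<Gamma>"
    using esub_wk[of "[idT (wk 2 A) (Var 1) (Var 0), wk 1 A, A]" \<Gamma> 3] ctx\<Psi> unfolding extId_def by simp
  have w1: "esub (wk 3 A # ?\<Psi>) (up (sb 3 [])) (up (sb 3 [])) (A # \<Gamma>)"
    using esub_up[OF w AA refl] .
  have t: "wk 1 (wk 3 A) = subst (up (sb 3 [])) (wk 1 A)"
      "wk 2 (wk 3 A) = subst (ups 2 (sb 3 [])) (wk 2 A)"
    unfolding subst_subst by (auto intro!: subst_cong simp: ups_eq up_eq)
  have w3: "esub (extId ?\<Psi> (wk 3 A)) (ups 3 (sb 3 [])) (ups 3 (sb 3 [])) ?\<Psi>"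
    using esub_ups[OF w, of "[idT (wk 2 A) (Var 1) (Var 0), wk 1 A, A]"] ctx\<Psi>
    unfolding extId_def t by (simp add: numeral_2_eq_2 numeral_3_eq_3)
  have A3: "tyeq ?\<Psi> (wk 3 A) (wk 3 A')" by (rule esub_tyeq[OF A w])
  let ?C3 = "subst (ups 3 (sb 3 [])) ?P" and ?C3' = "subst (ups 3 (sb 3 [])) ?P'"
  let ?L3 = "subst (up (sb 3 [])) L" and ?L3' = "subst (up (sb 3 [])) L'"
  have C3: "tyeq (extId ?\<Psi> (wk 3 A)) ?C3 ?C3'" by (rule esub_tyeq[OF P w3])
  \<comment> \<open>The type that the rule prescribes for the weakened method is the weakened type
    of \<open>L\<close>.\<close>
  have e: "subst (refl_sub (wk 3 A)) ?C3 = subst (up (sb 3 [])) (subst ?\<rho> ?P)"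
  proof -
    have "subst (refl_sub (wk 3 A)) (ups 3 (sb 3 []) i) = subst (up (sb 3 [])) (refl_sub A i)" for i
    proof (cases "i < 3")
      case True
      then have "i = 0 \<or> i = 1 \<or> i = 2" by auto
      then show ?thesis
        unfolding refl_sub_def by (auto simp: ups_eq t[symmetric] up_eq simp del: subst_subst)
         (auto simp: subst_subst intro!: subst_cong)
    qed (auto simp: refl_sub_def ups_eq up_eq sb_def split: nat.split)
    then show ?thesis unfolding subst_subst by (rule subst_cong)
  qed
  have L3: "tmeq (wk 3 A # ?\<Psi>) ?L3 ?L3' (subst (refl_sub (wk 3 A)) ?C3)"
    unfolding e by (rule esub_tmeq[OF L w1])
  have v: "istm ?\<Psi> (Var 2) (wk 3 A)" "istm ?\<Psi> (Var 1) (wk 3 A)"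
    "istm ?\<Psi> (Var 0) (idT (wk 3 A) (Var 2) (Var 1))"
  proof -
    have "wk (Suc (Suc 0)) (wk 1 A) = wk 3 A" "wk (Suc 0) (wk 2 A) = wk 3 A"
      unfolding subst_subst by (auto intro!: subst_cong)
    then show "istm ?\<Psi> (Var 2) (wk 3 A)" "istm ?\<Psi> (Var 1) (wk 3 A)"
        "istm ?\<Psi> (Var 0) (idT (wk 3 A) (Var 2) (Var 1))"
      using variable[OF ctx\<Psi>, of 2] variable[OF ctx\<Psi>, of 1] variable[OF ctx\<Psi>, of 0]
      unfolding extId_def by (simp_all add: tm_iff numeral_2_eq_2 numeral_3_eq_3)
  qed
  define j where "j = jT (wk 3 A) ?C3 ?L3 (Var 2) (Var 1) (Var 0)"
  define j' where "j' = jT (wk 3 A') ?C3' ?L3' (Var 2) (Var 1) (Var 0)"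
  have "tmeq ?\<Psi> j j' (inst [Var 0, Var 1, Var 2] ?C3)"
    unfolding j_def j'_def
    by (rule j_cong[OF A3 C3[unfolded extId_def[of ?\<Psi>]] L3[unfolded refl_sub_def] v])
  moreover have "inst [Var 0, Var 1, Var 2] ?C3 = ?P"
  proof -
    have "inst [Var 0, Var 1, Var 2] (ups 3 (sb 3 []) i) = Var i" for i
    proof (cases "i < 3")
      case True
      then have "i = 0 \<or> i = 1 \<or> i = 2" by auto
      then show ?thesis by (auto simp: ups_eq)
    qed (auto simp: ups_eq sb_def)
    then show ?thesis unfolding subst_subst by (rule trans[OF subst_cong subst_Var])
  qed
  ultimately have j: "tmeq ?\<Psi> j j' ?P" by simp
  have J: "J_post A \<Delta> C d = app_tel \<Delta> C j" "J_post A' \<Delta>' C' d' = app_tel \<Delta>' C' j'"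
    unfolding J_post_def Let_def j_def j'_def L_def L'_def refl_sub_def len by simp_all
  show "tmeq (\<Delta> @ ?\<Psi>) (J_post A \<Delta> C d) (J_post A' \<Delta>' C' d') C"
    unfolding J using app_tel_cong[OF \<Delta> len C j] .
  \<comment> \<open>Restriction along reflexivity removes the three weakening variables again and
    makes the eliminated identity \<open>r(x)\<close>, so that \<open>id_comp\<close> applies over
    \<open>\<Gamma>.A\<close>.\<close>
  have "subst ?\<rho> j = jT (wk 1 A) (subst (ups 3 ?\<rho>) ?C3) (subst (up ?\<rho>) ?L3) (Var 0) (Var 0) (reflT (wk 1 A)
      (Var 0))"
  proof -
    have "subst ?\<rho> (wk 3 A) = wk 1 A"
      unfolding subst_subst refl_sub_def by (rule subst_cong) (auto simp: sb_def)
    then show ?thesis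
      unfolding j_def by (simp add: refl_sub_def numeral_3_eq_3)
  qed
  moreover have "inst [Var 0] (subst (up ?\<rho>) ?L3) = L"
    unfolding subst_subst refl_sub_def
    by (rule trans[OF subst_cong subst_Var]) (auto simp: up_eq sb_def split: nat.split)
  moreover have "inst [reflT (wk 1 A) (Var 0), Var 0, Var 0] (subst (ups 3 ?\<rho>) ?C3) = subst ?\<rho> ?P"
  proof -
    have "inst [reflT (wk 1 A) (Var 0), Var 0, Var 0] (subst (ups 3 ?\<rho>) (ups 3 (sb 3 []) i)) = ?\<rho> i" for i
    proof (cases "i < 3")
      case True
      then have "i = 0 \<or> i = 1 \<or> i = 2" by auto
      then show ?thesis by (auto simp: ups_eq refl_sub_def)
    qed (auto simp: ups_eq sb_def refl_sub_def)
    then show ?thesis unfolding subst_subst by (rule subst_cong)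
  qed
  moreover have "tmeq (A # \<Gamma>) (jT (wk 1 A) (subst (ups 3 ?\<rho>) ?C3) (subst (up ?\<rho>) ?L3) (Var 0) (Var 0) (reflT
      (wk 1 A) (Var 0)))
     (inst [Var 0] (subst (up ?\<rho>) ?L3)) (inst [reflT (wk 1 A) (Var 0), Var 0, Var 0] (subst (ups 3 ?\<rho>) ?C3))"
  proof (rule id_comp)
    have w: "esub (A # \<Gamma>) (sb 1 []) (sb 1 []) \<Gamma>"
      using esub_wk[of "[A]" \<Gamma> 1] ctx by simp
    have w1: "esub (wk 1 A # A # \<Gamma>) (up (sb 1 [])) (up (sb 1 [])) (A # \<Gamma>)"
      using esub_up[OF w AA refl] .
    show "(A # \<Gamma>, Ty (wk 1 A)) \<in> S" using esub_tyeq[OF AA w] by (simp add: ty_iff)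
    have t': "wk 1 (wk 1 A) = subst (up (sb 1 [])) (wk 1 A)"
        "wk 2 (wk 1 A) = subst (ups 2 (sb 1 [])) (wk 2 A)"
      unfolding subst_subst by (auto intro!: subst_cong simp: ups_eq up_eq)
    have w3: "esub (extId (A # \<Gamma>) (wk 1 A)) (ups 3 (sb 1 [])) (ups 3 (sb 1 [])) ?\<Psi>"
      using esub_ups[OF w, of "[idT (wk 2 A) (Var 1) (Var 0), wk 1 A, A]"] ctx\<Psi>
      unfolding extId_def t' by (simp add: numeral_2_eq_2 numeral_3_eq_3)
    have c: "subst (ups 3 ?\<rho>) ?C3 = subst (ups 3 (sb 1 [])) ?P"
      unfolding subst_subst
    proof (rule subst_cong)
      fix i
      show "subst (ups 3 ?\<rho>) (ups 3 (sb 3 []) i) = ups 3 (sb 1 []) i"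
        by (cases "i < 3") (auto simp: ups_eq sb_def refl_sub_def)
    qed
    have l: "subst (up ?\<rho>) ?L3 = subst (up (sb 1 [])) L"
      unfolding subst_subst
      by (rule subst_cong) (auto simp: up_eq sb_def refl_sub_def split: nat.split)
    have "isty ?\<Psi> ?P" using P tyeqD by blast
    from esub_tyeq[OF this w3]
    show "(idT (wk 2 (wk 1 A)) (Var 1) (Var 0) # wk 1 (wk 1 A) # wk 1 A # A # \<Gamma>,
        Ty (subst (ups 3 ?\<rho>) ?C3)) \<in> S"
      unfolding ty_iff c extId_def .
    have e: "subst (sb 1 [reflT (wk 1 (wk 1 A)) (Var 0), Var 0, Var 0]) (subst (ups 3 ?\<rho>) ?C3) =
        subst (up (sb 1 [])) (subst ?\<rho> ?P)"
    proof -
      have "subst (sb 1 [reflT (wk 1 (wk 1 A)) (Var 0), Var 0, Var 0]) (ups 3 (sb 1 []) i) =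
          subst (up (sb 1 [])) (?\<rho> i)" for i
      proof (cases "i < 3")
        case True
        then have "i = 0 \<or> i = 1 \<or> i = 2" by auto
        then show ?thesis
          unfolding refl_sub_def by (auto simp: ups_eq t' up_eq simp del: subst_subst)
           (auto simp: subst_subst intro!: subst_cong)
      qed (auto simp: refl_sub_def ups_eq up_eq sb_def split: nat.split)
      then show ?thesis
        unfolding c subst_subst[of _ "ups 3 (sb 1 [])"] subst_subst[of _ ?\<rho>] by (rule subst_cong)
    qed
    have "istm (A # \<Gamma>) L (subst ?\<rho> ?P)" using L tmeqD by blast
    from esub_tmeq[OF this w1]
    show "(wk 1 A # A # \<Gamma>, Tm (subst (up ?\<rho>) ?L3)
        (subst (sb 1 [reflT (wk 1 (wk 1 A)) (Var 0), Var 0, Var 0]) (subst (ups 3 ?\<rho>) ?C3))) \<in> S"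
      unfolding tm_iff e l .
    show "(A # \<Gamma>, Tm (Var 0) (wk 1 A)) \<in> S"
      using variable[of "A # \<Gamma>" 0] ctx by simp
  qed
  ultimately have "tmeq (A # \<Gamma>) (subst ?\<rho> j) L (subst ?\<rho> ?P)" by simp
  \<comment> \<open>It remains to apply the abstraction \<open>L\<close> of \<open>d\<close> to the
    variables over which it was formed.\<close>
  then have "tmeq (tsubst ?\<rho> \<Delta> @ A # \<Gamma>)
      (app_tel (tsubst ?\<rho> \<Delta>) (subst (ups ?m ?\<rho>) C) (subst ?\<rho> j))
      (app_tel (tsubst ?\<rho> \<Delta>) (subst (ups ?m ?\<rho>) C) L) (subst (ups ?m ?\<rho>) C)"
    unfolding subst_pi_tel
    by (intro app_tel_cong is_ctx_cteq_refl)
      (use \<Delta>\<rho> cteq_ctx C\<rho> tyeqD in \<open>blast | simp\<close>)+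
  moreover have "tmeq (tsubst ?\<rho> \<Delta> @ A # \<Gamma>) (app_tel (tsubst ?\<rho> \<Delta>) (subst (ups ?m ?\<rho>) C) L) d
      (subst (ups ?m ?\<rho>) C)"
    unfolding L_def by (rule app_tel_beta) (use d tmeqD in blast)
  ultimately show "tmeq (tsubst ?\<rho> \<Delta> @ A # \<Gamma>) (subst (ups ?m ?\<rho>) (J_post A \<Delta> C d)) d
      (subst (ups ?m ?\<rho>) C)"
    unfolding J subst_app_tel using TmEq_trans by blast
qed

text \<open>Induction on the target telescope. The type of each new component mentions the
  components already eliminated, so the computation rule for those is needed to type the method of
  the next one.\<close>

lemma J_tel_main:
  assumes A: "tyeq \<Gamma> A A'"
    and "cteq (\<Theta> @ \<Delta> @ extId \<Gamma> A) (\<Theta>' @ \<Delta>' @ extId \<Gamma> A)"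
    and \<Delta>: "length \<Delta>' = length \<Delta>"
    and "eleq (tsubst (refl_sub A) \<Delta> @ A # \<Gamma>) d d' (tsubst (ups (length \<Delta>) (refl_sub A)) \<Theta>)"
  shows "eleq (\<Delta> @ extId \<Gamma> A) (J_tel A \<Delta> \<Theta> d) (J_tel A' \<Delta>' \<Theta>' d') \<Theta> \<and>
    eleq (tsubst (refl_sub A) \<Delta> @ A # \<Gamma>)
      (map (subst (ups (length \<Delta>) (refl_sub A))) (J_tel A \<Delta> \<Theta> d)) d
      (tsubst (ups (length \<Delta>) (refl_sub A)) \<Theta>)"
proof -
  have "length \<Theta>' = length \<Theta>" using ctx_eq_length[OF assms(2)] \<Delta> by simp
  then show ?thesis
    using assms(2,4)
  proof (induction \<Theta>' \<Theta> arbitrary: d d' rule: list_induct2)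
    case (Cons C' \<Theta>' C \<Theta>)
    let ?\<rho> = "refl_sub A" and ?m = "length \<Delta>"
    from Cons(4) obtain d0 ds d0' ds' where d: "d = d0 # ds" "d' = d0' # ds'"
      "eleq (tsubst ?\<rho> \<Delta> @ A # \<Gamma>) ds ds' (tsubst (ups ?m ?\<rho>) \<Theta>)"
      "tmeq (tsubst ?\<rho> \<Delta> @ A # \<Gamma>) d0 d0' (inst ds (subst (ups (length \<Theta>) (ups ?m ?\<rho>)) C))"
      by (auto elim: elems_eq_ConsE)
    from Cons(3) have \<Theta>: "cteq (\<Theta> @ \<Delta> @ extId \<Gamma> A) (\<Theta>' @ \<Delta>' @ extId \<Gamma> A)"
      and C: "tyeq (\<Theta> @ \<Delta> @ extId \<Gamma> A) C C'" by auto
    define e where "e = J_tel A \<Delta> \<Theta> ds"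
    define e' where "e' = J_tel A' \<Delta>' \<Theta>' ds'"
    have IH: "eleq (\<Delta> @ extId \<Gamma> A) e e' \<Theta>"
      "eleq (tsubst ?\<rho> \<Delta> @ A # \<Gamma>) (map (subst (ups ?m ?\<rho>)) e) ds (tsubst (ups ?m ?\<rho>) \<Theta>)"
      using Cons.IH[OF \<Theta> d(3)] unfolding e_def e'_def by auto
    have ctx\<Theta>: "ctx (\<Theta> @ \<Delta> @ extId \<Gamma> A)" using \<Theta> cteq_ctx by blast
    have ctx\<Delta>: "ctx (\<Delta> @ extId \<Gamma> A)" using ctx\<Theta> is_ctx_appendD by blast
    have \<Delta>eq: "cteq (\<Delta> @ extId \<Gamma> A) (\<Delta>' @ extId \<Gamma> A)"
      using ctx_eq_append[OF Cons(1)[symmetric] \<Theta>] .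
    have AA: "isty \<Gamma> A" using A tyeqD by blast
    note \<rho>m = esub_ups[OF esub_refl_sub[OF AA] ctx\<Delta>]
    have Ce: "tyeq (\<Delta> @ extId \<Gamma> A) (inst e C) (inst e' C')"
      by (rule inst_tel_tyeq[OF C IH(1)])
    have Ce\<rho>: "subst (ups ?m ?\<rho>) (inst e C) =
        inst (map (subst (ups ?m ?\<rho>)) e) (subst (ups (length \<Theta>) (ups ?m ?\<rho>)) C)"
      using elems_eq_length[OF IH(1)] by (simp add: subst_inst)
    \<comment> \<open>The type of \<open>d0\<close> mentions \<open>ds\<close>, while
      \<open>J_post\<close> expects the restriction of \<open>e\<close> there; the two are equal by
      the computation part of the induction hypothesis.\<close>
    have "isty (\<Theta> @ \<Delta> @ extId \<Gamma> A) C" using C tyeqD by blast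
    from inst_tel_tyeq[OF esub_tyeq[OF this esub_ups[OF \<rho>m ctx\<Theta>]] IH(2)]
    have ty: "tyeq (tsubst ?\<rho> \<Delta> @ A # \<Gamma>) (subst (ups ?m ?\<rho>) (inst e C))
       (inst ds (subst (ups (length \<Theta>) (ups ?m ?\<rho>)) C))" unfolding Ce\<rho> .
    from J_post_main[OF A \<Delta>eq Ce TmEq_conv[OF d(4) TyEq_sym[OF this]]]
    show ?case
      using IH Ce\<rho> by (simp add: d Let_def e_def[symmetric] e'_def[symmetric])
  qed simp
qed

end

section \<open>Identity contexts\<close>

lemma id_ctx_length [simp]: "length (id_ctx \<Lambda>) = length \<Lambda>"
  by (induction \<Lambda>) (auto simp: Let_def)

lemma refl_ctx_length [simp]: "length (refl_ctx \<Lambda>) = length \<Lambda>"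
  by (induction \<Lambda>) auto

lemma id_tel_length [simp]: "length (id_tel \<Lambda> a b) = length \<Lambda>"
  by (simp add: id_tel_def)

text \<open>The path object of \<open>\<Lambda>\<close> as a closed context; \<open>rl\<close> is
  its section \<open>(x, x, r(x))\<close> over the diagonal.\<close>

definition idx :: "'s expr list \<Rightarrow> 's expr list" where
  "idx \<Lambda> = id_ctx \<Lambda> @ \<Lambda> @ \<Lambda>"

definition rl :: "'s expr list \<Rightarrow> 's expr list" where
  "rl \<Lambda> = refl_ctx \<Lambda> @ vars 0 (length \<Lambda>) @ vars 0 (length \<Lambda>)"

lemma idx_length [simp]: "length (idx \<Lambda>) = 3 * length \<Lambda>"
  by (simp add: idx_def)

lemma rl_length [simp]: "length (rl \<Lambda>) = 3 * length \<Lambda>"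
  by (simp add: rl_def)

abbreviation rsub :: "'s expr list \<Rightarrow> nat \<Rightarrow> 's expr" where
  "rsub \<Lambda> \<equiv> sb 0 (rl \<Lambda>)"

context type_theory
begin

text \<open>Typing, congruence and computation for \<open>J_ctx\<close> and well-formedness of \<open>Id\<close> depend on each other at the next
  longer context, so they form a single induction hypothesis.\<close>

definition J_ok where
  "J_ok \<Lambda> \<Lambda>' \<longleftrightarrow> cteq (idx \<Lambda>) (idx \<Lambda>') \<and> eleq \<Lambda> (rl \<Lambda>) (rl \<Lambda>') (idx \<Lambda>) \<and>
    (\<forall>\<Delta> \<Delta>' \<Theta> \<Theta>' d d'. length \<Delta>' = length \<Delta> \<longrightarrow> cteq (\<Theta> @ \<Delta> @ idx \<Lambda>) (\<Theta>' @ \<Delta>' @ idx \<Lambda>') \<longrightarrow>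
      eleq (tsubst (rsub \<Lambda>) \<Delta> @ \<Lambda>) d d' (tsubst (ups (length \<Delta>) (rsub \<Lambda>)) \<Theta>) \<longrightarrow>
      eleq (\<Delta> @ idx \<Lambda>) (J_ctx \<Lambda> \<Delta> \<Theta> d) (J_ctx \<Lambda>' \<Delta>' \<Theta>' d') \<Theta> \<and>
      eleq (tsubst (rsub \<Lambda>) \<Delta> @ \<Lambda>) (map (subst (ups (length \<Delta>) (rsub \<Lambda>))) (J_ctx \<Lambda> \<Delta> \<Theta> d)) d
        (tsubst (ups (length \<Delta>) (rsub \<Lambda>)) \<Theta>))"

lemma J_ok_idx: "J_ok \<Lambda> \<Lambda>' \<Longrightarrow> cteq (idx \<Lambda>) (idx \<Lambda>')"
  and J_ok_rl: "J_ok \<Lambda> \<Lambda>' \<Longrightarrow> eleq \<Lambda> (rl \<Lambda>) (rl \<Lambda>') (idx \<Lambda>)"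
  by (auto simp: J_ok_def)

lemma J_ok_J:
  assumes "J_ok \<Lambda> \<Lambda>'" "cteq (\<Theta> @ \<Delta> @ idx \<Lambda>) (\<Theta>' @ \<Delta>' @ idx \<Lambda>')" "length \<Delta>' = length \<Delta>"
    "eleq (tsubst (rsub \<Lambda>) \<Delta> @ \<Lambda>) d d' (tsubst (ups (length \<Delta>) (rsub \<Lambda>)) \<Theta>)"
  shows "eleq (\<Delta> @ idx \<Lambda>) (J_ctx \<Lambda> \<Delta> \<Theta> d) (J_ctx \<Lambda>' \<Delta>' \<Theta>' d') \<Theta>"
    "eleq (tsubst (rsub \<Lambda>) \<Delta> @ \<Lambda>) (map (subst (ups (length \<Delta>) (rsub \<Lambda>))) (J_ctx \<Lambda> \<Delta> \<Theta> d)) d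
        (tsubst (ups (length \<Delta>) (rsub \<Lambda>)) \<Theta>)"
  using assms unfolding J_ok_def by blast+

lemma elems_idx:
  assumes "ctx \<Lambda>" "length p = length \<Lambda>" "length p2 = length \<Lambda>"
    "length x = length \<Lambda>" "length x2 = length \<Lambda>" "length x' = length \<Lambda>" "length x2' = length \<Lambda>"
  shows "eleq \<Omega> (p @ x' @ x) (p2 @ x2' @ x2) (idx \<Lambda>) \<longleftrightarrow>
    eleq \<Omega> x x2 \<Lambda> \<and> eleq \<Omega> x' x2' \<Lambda> \<and> eleq \<Omega> p p2 (id_tel \<Lambda> x x')"
  using assms by (simp add: idx_def elems_eq_append tsubst_closed id_tel_def)

lemma cteq_idx_ctx:
  assumes "cteq (idx \<Lambda>) (idx \<Lambda>')" "length \<Lambda>' = length \<Lambda>"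
  shows "cteq \<Lambda> \<Lambda>'"
  using assms ctx_eq_append[of "id_ctx \<Lambda> @ \<Lambda>" "id_ctx \<Lambda>'@ \<Lambda>'" _ \<Lambda> \<Lambda>'] by (simp add: idx_def)

lemma is_ctx_idxD: "ctx (idx \<Lambda>) \<Longrightarrow> ctx \<Lambda>"
  using is_ctx_appendD[of _ "id_ctx \<Lambda> @ \<Lambda>" \<Lambda>] by (simp add: idx_def)

lemma tscoped_id_ctx: "ctx (idx \<Lambda>) \<Longrightarrow> tscoped (length \<Lambda> + length \<Lambda>) (id_ctx \<Lambda>)"
  using is_ctx_tscoped_append[of "id_ctx \<Lambda>" "\<Lambda> @ \<Lambda>"] by (simp add: idx_def)

lemma esub_rsub:
  "J_ok \<Lambda> \<Lambda>' \<Longrightarrow> esub \<Lambda> (rsub \<Lambda>) (rsub \<Lambda>') (idx \<Lambda>)"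
  using esub_instI J_ok_rl J_ok_idx cteq_ctx is_ctx_idxD by meson

lemma scoped_refl_ctx: "J_ok \<Lambda> \<Lambda>' \<Longrightarrow> \<forall>e\<in>set (refl_ctx \<Lambda>). scoped (length \<Lambda>) e"
    "J_ok \<Lambda> \<Lambda>' \<Longrightarrow> \<forall>e\<in>set (refl_ctx \<Lambda>'). scoped (length \<Lambda>) e"
  using elems_eq_scoped[OF J_ok_rl] by (auto simp: rl_def)

lemma insts_rl:
  assumes "length x = length \<Lambda>"
  shows "insts x (rl \<Lambda>) = insts x (refl_ctx \<Lambda>) @ x @ x"
  using assms by (simp add: rl_def insts_vars)

lemma id_tel_cong:
  assumes "cteq (idx \<Lambda>) (idx \<Lambda>')" "length \<Lambda>' = length \<Lambda>" "ctx \<Omega>" "eleq \<Omega> x y \<Lambda>" "eleq \<Omega> x' y' \<Lambda>"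
  shows "cteq (id_tel \<Lambda> x x' @ \<Omega>) (id_tel \<Lambda>' y y' @ \<Omega>)"
proof -
  have c: "ctx (idx \<Lambda>)" using assms cteq_ctx by blast
  then have L: "ctx \<Lambda>" "ctx (\<Lambda> @ \<Lambda>)" using is_ctx_idxD is_ctx_append_closed by blast+
  have "eleq \<Omega> (x' @ x) (y' @ y) (\<Lambda> @ \<Lambda>)"
    using assms(4,5) elems_eq_length[OF assms(5)] by (simp add: elems_eq_append tsubst_closed L)
  from cteq_tsubst[OF esub_instI[OF assms(3) L(2) this] assms(1)[unfolded idx_def]] assms(2)
  show ?thesis by (simp add: id_tel_def)
qed

lemma refl_inst:
  assumes "J_ok \<Lambda> \<Lambda>'" "ctx \<Omega>" "eleq \<Omega> x x' \<Lambda>"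
  shows "eleq \<Omega> (insts x (refl_ctx \<Lambda>)) (insts x' (refl_ctx \<Lambda>')) (id_tel \<Lambda> x x)"
proof -
  have L: "ctx \<Lambda>" "ctx (idx \<Lambda>)" "length \<Lambda>' = length \<Lambda>"
    using is_ctx_idxD J_ok_idx[OF assms(1)] cteq_ctx ctx_eq_length[OF J_ok_idx[OF assms(1)]] by auto
  have len: "length x = length \<Lambda>" "length x' = length \<Lambda>" using elems_eq_length[OF assms(3)] by auto
  have "eleq \<Omega> (insts x (rl \<Lambda>)) (insts x' (rl \<Lambda>')) (tsubst (sb 0 x) (idx \<Lambda>))"
    by (rule elems_eq_comp[OF J_ok_rl[OF assms(1)] esub_instI[OF assms(2) L(1) assms(3)]])
  then show ?thesis
    using L len by (simp add: tsubst_closed[OF L(2)] insts_rl elems_idx)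
qed

end

section \<open>Identity contexts extended by one type\<close>

context ml2_theory
begin

context
  fixes \<Lambda> \<Lambda>' :: "'s expr list" and D D' :: "'s expr"
  assumes IH: "J_ok \<Lambda> \<Lambda>'" and D: "tyeq \<Lambda> D D'"
begin

private abbreviation (input) n where "n \<equiv> length \<Lambda>"
private abbreviation (input) tr where "tr \<equiv> transport (J_ctx \<Lambda>) (length \<Lambda>) D"
private abbreviation (input) tr' where "tr' \<equiv> transport (J_ctx \<Lambda>') (length \<Lambda>) D'"

lemma length_\<Lambda>': "length \<Lambda>' = n"
  using ctx_eq_length[OF J_ok_idx[OF IH]] by simp

lemma ctxs: "ctx \<Lambda>" "ctx (idx \<Lambda>)" "cteq \<Lambda> \<Lambda>'" "isty \<Lambda> D" "ctx (D # \<Lambda>)" "cteq (D # \<Lambda>) (D' # \<Lambda>')"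
    "ctx (D' # \<Lambda>')"
proof -
  show 1: "ctx (idx \<Lambda>)" using J_ok_idx[OF IH] cteq_ctx by blast
  then show "ctx \<Lambda>" using is_ctx_idxD by blast
  show 2: "cteq \<Lambda> \<Lambda>'" using cteq_idx_ctx J_ok_idx[OF IH] length_\<Lambda>' by blast
  show "isty \<Lambda> D" using D tyeqD by blast
  show "ctx (D # \<Lambda>)" using D tyeqD \<open>ctx \<Lambda>\<close> by (auto simp: ty_iff)
  show "cteq (D # \<Lambda>) (D' # \<Lambda>')" using 2 D by simp
  then show "ctx (D' # \<Lambda>')" using cteq_ctx by blast
qed

lemma D_scoped: "scoped n D" "scoped n D'"
  using scope[OF D] by auto

lemma idx_vars:
  assumes "ctx (T @ idx \<Lambda>)" "k = length T"
  shows "isel (T @ idx \<Lambda>) (vars (k + 2*n) n) \<Lambda>"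
    "isel (T @ idx \<Lambda>) (vars (k + n) n) \<Lambda>"
    "isel (T @ idx \<Lambda>) (vars k n) (id_tel \<Lambda> (vars (k + 2*n) n) (vars (k + n) n))"
proof -
  have "isel (T @ idx \<Lambda>) (vars k (n + (n + n))) (idx \<Lambda>)"
    by (rule elems_eq_vars[OF assms]) simp
  then show "isel (T @ idx \<Lambda>) (vars (k + 2*n) n) \<Lambda>"
    "isel (T @ idx \<Lambda>) (vars (k + n) n) \<Lambda>"
    "isel (T @ idx \<Lambda>) (vars k n) (id_tel \<Lambda> (vars (k + 2*n) n) (vars (k + n) n))"
    unfolding vars_add by (simp_all add: elems_idx ctxs mult_2 add.assoc)
qed

text \<open>Transport is an elimination with post-context \<open>z : D(x')\<close> and target
  \<open>D(x)\<close>. Its typing, congruence and computation are instances of the hypothesis on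
  \<open>\<Lambda>\<close>.\<close>

lemma tr_ctx: "ctx (inst (vars n n) D # idx \<Lambda>)"
  and tr_typed: "tmeq (inst (vars n n) D # idx \<Lambda>) tr tr' (inst (vars (2*n + 1) n) D)"
  and tr_comp: "tmeq (D # \<Lambda>) (subst (ups 1 (rsub \<Lambda>)) tr) (Var 0) (wk 1 D)"
proof -
  have a: "tyeq (idx \<Lambda>) (inst (vars n n) D) (inst (vars n n) D')"
    using inst_tyeq[OF D ctxs(2)] idx_vars(2)[of "[]" 0] ctxs by simp
  then have a': "cteq ([inst (vars n n) D] @ idx \<Lambda>) ([inst (vars n n) D'] @ idx \<Lambda>')"
    using J_ok_idx[OF IH] by simp
  then show ctx: "ctx (inst (vars n n) D # idx \<Lambda>)" using cteq_ctx by fastforce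
  have b: "tyeq (inst (vars n n) D # idx \<Lambda>) (inst (vars (2*n + 1) n) D) (inst (vars (2*n + 1) n) D')"
    using inst_tyeq[OF D ctx] idx_vars(1)[of "[inst (vars n n) D]" 1] ctx by simp
  have b': "cteq ([inst (vars (2*n + 1) n) D] @ [inst (vars n n) D] @ idx \<Lambda>)
      ([inst (vars (2*n + 1) n) D'] @ [inst (vars n n) D'] @ idx \<Lambda>')"
    using a' b by simp
  \<comment> \<open>At \<open>x' = x\<close> and \<open>p = r(x)\<close> both \<open>D(x')\<close>
    and \<open>D(x)\<close> become \<open>D\<close>, so the variable \<open>z\<close> itself is a
    method of the right type.\<close>
  have i1: "subst (rsub \<Lambda>) (inst (vars n n) D) = D"
  proof -
    have "subst (rsub \<Lambda>) (inst (vars n n) D) = inst (insts (rl \<Lambda>) (vars n n)) D"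
      using D_scoped by (simp add: inst_inst)
    also have "insts (rl \<Lambda>) (vars n n) = vars 0 n"
      by (simp add: insts_vars rl_def)
    finally show ?thesis using inst_vars_0[OF D_scoped(1)] by simp
  qed
  have i2: "subst (ups 1 (rsub \<Lambda>)) (inst (vars (2*n + 1) n) D) = wk 1 D"
  proof -
    have "subst (ups 1 (rsub \<Lambda>)) (inst (vars (2*n + 1) n) D) =
        inst (map (subst (ups 1 (rsub \<Lambda>))) (vars (2*n + 1) n)) D"
      using D_scoped by (simp add: subst_inst_scoped)
    also have "map (subst (ups 1 (rsub \<Lambda>))) (vars (2*n + 1) n) = vars 1 n"
      by (rule nth_equalityI) (auto simp: ups_eq rl_def nth_append)
    finally show ?thesis using inst_vars[OF D_scoped(1)] by simp
  qed
  have v: "istm (D # \<Lambda>) (Var 0) (wk 1 D)"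
    using variable[of "D # \<Lambda>" 0] ctxs by (simp add: tm_iff)
  have "isel (tsubst (rsub \<Lambda>) [inst (vars n n) D] @ \<Lambda>) [Var 0]
      (tsubst (ups (length [inst (vars n n) D]) (rsub \<Lambda>)) [inst (vars (2*n + 1) n) D])"
    using i1 i2 v by simp
  note J = J_ok_J[OF IH b' _ this]
  have 1: "eleq (inst (vars n n) D # idx \<Lambda>)
      (J_ctx \<Lambda> [inst (vars n n) D] [inst (vars (2*n + 1) n) D] [Var 0])
      (J_ctx \<Lambda>' [inst (vars n n) D'] [inst (vars (2*n + 1) n) D'] [Var 0])
      [inst (vars (2*n + 1) n) D]"
    using J(1) by simp
  then obtain t t' where t:
      "J_ctx \<Lambda> [inst (vars n n) D] [inst (vars (2*n + 1) n) D] [Var 0] = [t]"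
      "J_ctx \<Lambda>' [inst (vars n n) D'] [inst (vars (2*n + 1) n) D'] [Var 0] = [t']"
    by (auto elim!: elems_eq_ConsE)
  then have tr: "tr = t" "tr' = t'" by (simp_all add: transport_def)
  show "tmeq (inst (vars n n) D # idx \<Lambda>) tr tr' (inst (vars (2*n + 1) n) D)"
    using 1 unfolding t tr by simp
  show "tmeq (D # \<Lambda>) (subst (ups 1 (rsub \<Lambda>)) tr) (Var 0) (wk 1 D)"
    using J(2) i1 i2 unfolding t tr by simp
qed

lemma tr_scoped: "scoped (Suc (3 * n)) tr" "scoped (Suc (3 * n)) tr'"
  using scope[OF tr_typed] by auto

lemma transport_inst:
  assumes "ctx \<Omega>" "eleq \<Omega> x x2 \<Lambda>" "eleq \<Omega> x' x2' \<Lambda>" "eleq \<Omega> p p2 (id_tel \<Lambda> x x')"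
    "tmeq \<Omega> z z2 (inst x' D)"
  shows "tmeq \<Omega> (inst (z # p @ x' @ x) tr) (inst (z2 # p2 @ x2' @ x2) tr') (inst x D)"
proof -
  have len: "length x = n" "length x2 = n" "length x' = n" "length x2' = n" "length p = n" "length p2 = n"
    using assms elems_eq_length by fastforce+
  have "insts (p @ x' @ x) (vars n n) = x'" "insts (z # p @ x' @ x) (vars (2*n + 1) n) = x"
    by (simp_all add: insts_vars len)
  then have e: "inst (p @ x' @ x) (inst (vars n n) D) = inst x' D"
    "inst (z # p @ x' @ x) (inst (vars (2*n + 1) n) D) = inst x D"
    using D_scoped by (simp_all add: inst_inst)
  have "eleq \<Omega> (z # p @ x' @ x) (z2 # p2 @ x2' @ x2) (inst (vars n n) D # idx \<Lambda>)"
    using assms len e by (simp add: elems_idx ctxs)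
  from inst_tmeq[OF tr_typed assms(1) this] e show ?thesis by simp
qed

text \<open>The equation behind every passage between identities over a reflexivity and identities
  within a fibre.\<close>

lemma transport_refl:
  assumes "ctx \<Omega>" "isel \<Omega> x \<Lambda>" "istm \<Omega> z (inst x D)"
  shows "tmeq \<Omega> (inst (z # insts x (refl_ctx \<Lambda>) @ x @ x) tr) z (inst x D)"
proof -
  have len: "length x = n" using elems_eq_length assms by blast
  have "isel \<Omega> (z # x) (D # \<Lambda>)" using assms by simp
  from inst_tmeq[OF tr_comp assms(1) this]
  have 1: "tmeq \<Omega> (inst (z # x) (subst (ups 1 (rsub \<Lambda>)) tr)) (inst (z # x) (Var 0)) (inst (z # x) (wk 1 D))" .
  have "inst (z # x) (subst (ups 1 (rsub \<Lambda>)) tr) = inst (insts (z # x) (lift 1 (rl \<Lambda>))) tr"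
    unfolding subst_subst
  proof (rule subst_scoped_cong[OF tr_scoped(1)])
    fix i assume "i < Suc (3 * n)"
    then show "inst (z # x) (ups 1 (rsub \<Lambda>) i) = sb 0 (insts (z # x) (lift 1 (rl \<Lambda>))) i"
      using sb_lift[of i 1 "rl \<Lambda>"] by simp
  qed
  also have "insts (z # x) (lift 1 (rl \<Lambda>)) = z # insts x (refl_ctx \<Lambda>) @ x @ x"
  proof -
    have "insts (z # x) (map (wk 1) (rl \<Lambda>)) = insts x (rl \<Lambda>)"
      using insts_wk[of 1 "z # x" "rl \<Lambda>"] by simp
    then show ?thesis
      unfolding lift_def map_append insts_rl[OF len] by (simp add: vars_Suc del: map_map)
  qed
  moreover have "inst (z # x) (wk 1 D) = inst x D" using inst_wk[of 1 "z # x" D] by simp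
  ultimately show ?thesis using 1 by simp
qed

text \<open>Typing of all the permutations in \<open>J_ctx\<close> rests on this regrouping: the
  variables of \<open>idx (D # \<Lambda>)\<close> are interleaved as
  \<open>q, p, y', x', y, x\<close>, while the induction hypothesis speaks of
  \<open>p, x', x\<close> alone.\<close>

lemma elems_idx_Cons_1:
  assumes len: "length p = n" "length p2 = n"
    "length x = n" "length x2 = n" "length x' = n" "length x2' = n"
  shows "eleq \<Omega> (q # p @ y' # x' @ y # x) (q2 # p2 @ y2' # x2' @ y2 # x2) (idx (D # \<Lambda>)) \<longleftrightarrow>
    eleq \<Omega> (p @ x' @ x) (p2 @ x2' @ x2) (idx \<Lambda>) \<and>
    tmeq \<Omega> y y2 (inst x D) \<and> tmeq \<Omega> y' y2' (inst x' D) \<and>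
    tmeq \<Omega> q q2 (idT (inst x D) y (inst (y' # p @ x' @ x) tr))"
proof -
  let ?U = "tsubst (sb 0 (vars 1 n @ vars (n + 2) n)) (id_ctx \<Lambda>)"
  let ?l = "(y' # x') @ y # x"
  have "insts ?l (vars 1 n @ vars (n + 2) n) = x' @ x"
    by (simp add: insts_vars len)
  then have U: "tsubst (sb 0 ?l) ?U = id_tel \<Lambda> x x'"
    using tscoped_id_ctx[OF ctxs(2)] by (simp add: id_tel_def tsubst_inst_inst)
  have c: "tsubst (sb 0 (y # x)) (D # \<Lambda>) = D # \<Lambda>" by (rule tsubst_closed[OF ctxs(5)])
  \<comment> \<open>In the list \<open>p, y', x', y, x\<close> the vector \<open>p\<close> starts at
    0, \<open>y'\<close> stands at \<open>n\<close>, \<open>x'\<close> starts at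
    \<open>n + 1\<close>, \<open>y\<close> stands at \<open>2*n + 1\<close>, and \<open>x\<close>
    starts at \<open>2*n + 2\<close>.\<close>
  have i: "inst (p @ ?l) (id_over (J_ctx \<Lambda>) n D (vars (2*n + 2) n) (vars (n + 1) n) (vars 0 n)
          (Var (2*n + 1)) (Var n)) = idT (inst x D) y (inst (y' # p @ x' @ x) tr)"
  proof -
    have *: "insts (p @ ?l) (vars (2*n + 2) n) = x" "insts (p @ ?l) (vars (n + 1) n) = x'"
      "insts (p @ ?l) (vars 0 n) = p" "sb 0 (p @ ?l) (2*n + 1) = y" "sb 0 (p @ ?l) n = y'"
      by (simp_all add: insts_vars len nth_append)
    have three: "3 * n = n + (n + n)" by simp
    have "inst (p @ ?l) (inst (Var n # vars 0 n @ vars (n + 1) n @ vars (2*n + 2) n) tr) =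
       inst (insts (p @ ?l) (Var n # vars 0 n @ vars (n + 1) n @ vars (2*n + 2) n)) tr"
      by (rule inst_inst) (use tr_scoped three in simp)
    also have "\<dots> = inst (y' # p @ x' @ x) tr"
      unfolding list.map map_append subst.simps(1) * ..
    moreover have "inst (p @ ?l) (inst (vars (2*n + 2) n) D) = inst x D"
      using inst_inst[of "vars (2*n + 2) n" D "p @ ?l"] D_scoped unfolding * by simp
    ultimately show ?thesis
      unfolding id_over_def subst.simps list.map * by simp
  qed
  have "eleq \<Omega> (q # p @ ?l) (q2 # p2 @ (y2' # x2') @ y2 # x2) (idx (D # \<Lambda>)) \<longleftrightarrow>
    eleq \<Omega> ?l ((y2' # x2') @ y2 # x2) ((D # \<Lambda>) @ D # \<Lambda>) \<and>
    eleq \<Omega> p p2 (id_tel \<Lambda> x x') \<and> tmeq \<Omega> q q2 (idT (inst x D) y (inst (y' # p @ x' @ x) tr))"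
  proof -
    have idx: "idx (D # \<Lambda>) = id_over (J_ctx \<Lambda>) n D (vars (2*n + 2) n) (vars (n + 1) n) (vars 0 n)
          (Var (2*n + 1)) (Var n) # ?U @ (D # \<Lambda>) @ D # \<Lambda>"
      by (simp add: idx_def Let_def)
    have "eleq \<Omega> (p @ ?l) (p2 @ (y2' # x2') @ y2 # x2) (?U @ (D # \<Lambda>) @ D # \<Lambda>) \<longleftrightarrow>
      eleq \<Omega> ?l ((y2' # x2') @ y2 # x2) ((D # \<Lambda>) @ D # \<Lambda>) \<and> eleq \<Omega> p p2 (id_tel \<Lambda> x x')"
      using elems_eq_append[of p ?U p2 S \<Omega> ?l] len unfolding U by simp
    then show ?thesis unfolding idx elems_eq_Cons i by blast
  qed
  also have "eleq \<Omega> ?l ((y2' # x2') @ y2 # x2) ((D # \<Lambda>) @ D # \<Lambda>) \<longleftrightarrow>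
     eleq \<Omega> x x2 \<Lambda> \<and> tmeq \<Omega> y y2 (inst x D) \<and> eleq \<Omega> x' x2' \<Lambda> \<and> tmeq \<Omega> y' y2' (inst x' D)"
    using elems_eq_append[of "y' # x'" "D # \<Lambda>" "y2' # x2'" S \<Omega> "y # x" "y2 # x2" "D # \<Lambda>"] len
    by (simp add: c del: append_Cons tsubst.simps)
  finally show ?thesis by (auto simp: elems_idx ctxs len)
qed

lemma elems_idx_Cons:
  assumes len: "length p = n" "length p2 = n"
    "length x = n" "length x2 = n" "length x' = n" "length x2' = n"
  shows "eleq \<Omega> (q # p @ y' # x' @ y # x) (q2 # p2 @ y2' # x2' @ y2 # x2) (idx (D # \<Lambda>)) \<longleftrightarrow>
    eleq \<Omega> x x2 \<Lambda> \<and> eleq \<Omega> x' x2' \<Lambda> \<and> eleq \<Omega> p p2 (id_tel \<Lambda> x x') \<and>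
    tmeq \<Omega> y y2 (inst x D) \<and> tmeq \<Omega> y' y2' (inst x' D) \<and>
    tmeq \<Omega> q q2 (idT (inst x D) y (inst (y' # p @ x' @ x) tr))"
  unfolding elems_idx_Cons_1[OF len] elems_idx[OF ctxs(1) len] by blast

text \<open>The new type contains \<open>J_ctx \<Lambda>\<close> through transport, so equality of
  identity contexts rests on congruence of elimination for the shorter context.\<close>

lemma cteq_idx_Cons: "cteq (idx (D # \<Lambda>)) (idx (D' # \<Lambda>'))"
proof -
  let ?\<Omega> = "(D # \<Lambda>) @ (D # \<Lambda>)"
  let ?x = "vars (n + 2) n" and ?x' = "vars 1 n"
  have \<Omega>: "cteq ?\<Omega> ((D' # \<Lambda>') @ (D' # \<Lambda>'))"
    by (rule cteq_append_closed[OF ctxs(6,6)])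
  then have c\<Omega>: "ctx ?\<Omega>" using cteq_ctx by blast
  have v: "isel ?\<Omega> (vars 0 (2*n+2)) ?\<Omega>"
    by (rule elems_eq_vars_0[OF c\<Omega>]) simp
  have "vars 0 (2*n+2) = vars 0 (Suc n + Suc n)" by (simp add: mult_2)
  also have "\<dots> = (Var 0 # ?x') @ (Var (n+1) # ?x)" by (simp only: vars_add vars_Suc) simp
  finally have e: "vars 0 (2*n+2) = (Var 0 # ?x') @ (Var (n+1) # ?x)" .
  have "isel ?\<Omega> (Var (n+1) # ?x) (D # \<Lambda>) \<and> isel ?\<Omega> (Var 0 # ?x') (D # \<Lambda>)"
    using v unfolding e using elems_eq_append[of "Var 0 # ?x'" "D # \<Lambda>" "Var 0 # ?x'"]
    by (simp add: tsubst_closed[OF ctxs(5)] del: tsubst.simps append_Cons elems_eq_Cons)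
  then have x: "isel ?\<Omega> ?x \<Lambda>" "isel ?\<Omega> ?x' \<Lambda>" by auto
  have U: "cteq (id_tel \<Lambda> ?x ?x' @ ?\<Omega>) (id_tel \<Lambda>' ?x ?x' @ ?\<Omega>)"
    using id_tel_cong[OF J_ok_idx[OF IH] length_\<Lambda>' c\<Omega> x] .
  let ?\<Psi> = "id_tel \<Lambda> ?x ?x' @ ?\<Omega>"
  have c\<Psi>: "ctx ?\<Psi>" using U cteq_ctx by blast
  have U': "cteq ?\<Psi> (id_tel \<Lambda>' ?x ?x' @ (D' # \<Lambda>') @ (D' # \<Lambda>'))"
    by (rule ctx_eq_change_right[OF _ U \<Omega>]) (simp add: length_\<Lambda>')
  have v: "isel ?\<Psi> (vars 0 (3*n+2)) ?\<Psi>"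
    by (rule elems_eq_vars_0[OF c\<Psi>]) simp
  have "vars 0 (3*n+2) = vars 0 (n + (Suc n + Suc n))" by (simp add: numeral_3_eq_3)
  also have "\<dots> = vars 0 n @ (Var n # vars (n+1) n) @ (Var (2*n+1) # vars (2*n+2) n)"
    by (simp only: vars_add vars_Suc) (simp add: mult_2)
  finally have e: "vars 0 (3*n+2) = vars 0 n @ (Var n # vars (n+1) n) @ (Var (2*n+1) # vars (2*n+2) n)" .
  have *: "isel ?\<Psi> (Var (2*n+1) # vars (2*n+2) n) (D # \<Lambda>) \<and>
      isel ?\<Psi> (Var n # vars (n+1) n) (D # \<Lambda>) \<and>
      isel ?\<Psi> (vars 0 n) (tsubst (sb 0 ((Var n # vars (n+1) n) @ (Var (2*n+1) # vars (2*n+2) n)))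
          (id_tel \<Lambda> ?x ?x'))"
    using v unfolding e using elems_eq_append[of "Var n # vars (n+1) n" "D # \<Lambda>" "Var n # vars (n+1) n"]
      elems_eq_append[of "vars 0 n" "id_tel \<Lambda> ?x ?x'" "vars 0 n"]
    by (simp add: tsubst_closed[OF ctxs(5)] del: tsubst.simps append_Cons elems_eq_Cons)
  have "insts ((Var n # vars (n+1) n) @ (Var (2*n+1) # vars (2*n+2) n)) (?x' @ ?x) = (vars (n+1) n @ vars
      (2*n+2) n :: 's expr list)"
    by (simp add: insts_vars)
  then have "tsubst (sb 0 ((Var n # vars (n+1) n) @ (Var (2*n+1) # vars (2*n+2) n))) (id_tel \<Lambda> ?x ?x') =
      id_tel \<Lambda> (vars (2*n+2) n) (vars (n+1) n)"
    using tscoped_id_ctx[OF ctxs(2)] unfolding id_tel_def by (simp add: tsubst_inst_inst)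
  with * have y: "isel ?\<Psi> (vars (2*n+2) n) \<Lambda>" "isel ?\<Psi> (vars (n+1) n) \<Lambda>"
    "isel ?\<Psi> (vars 0 n) (id_tel \<Lambda> (vars (2*n+2) n) (vars (n+1) n))"
    "istm ?\<Psi> (Var (2*n+1)) (inst (vars (2*n+2) n) D)"
    "istm ?\<Psi> (Var n) (inst (vars (n+1) n) D)"
    by simp_all
  have "tyeq ?\<Psi> (id_over (J_ctx \<Lambda>) n D (vars (2*n + 2) n) (vars (n + 1) n) (vars 0 n)
          (Var (2*n + 1)) (Var n))
        (id_over (J_ctx \<Lambda>') n D' (vars (2*n + 2) n) (vars (n + 1) n) (vars 0 n)
          (Var (2*n + 1)) (Var n))"
    unfolding id_over_def
    by (rule id_cong[OF inst_tyeq[OF D c\<Psi> y(1)] y(4) transport_inst[OF c\<Psi> y(1,2,3,5)]])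
  then show ?thesis
    using U' by (simp add: idx_def Let_def id_tel_def length_\<Lambda>')
qed

lemma rl_Cons: "rl (D # \<Lambda>) =
    reflT (wk 1 D) (Var 0) # map (wk 1) (refl_ctx \<Lambda>) @ Var 0 # vars 1 n @ Var 0 # vars 1 n"
  by (simp add: rl_def vars_Suc)

text \<open>\<open>r(y)\<close> has type \<open>Id(y, y)\<close>, whereas the identity context asks
  for \<open>Id(y, r(x)^* y)\<close>; transport along \<open>r(x)\<close> computes away, so the
  types are equal.\<close>

lemma elems_rl_Cons: "eleq (D # \<Lambda>) (rl (D # \<Lambda>)) (rl (D' # \<Lambda>')) (idx (D # \<Lambda>))"
proof -
  have x: "isel (D # \<Lambda>) (vars 1 n) \<Lambda>"
    using elems_eq_vars[of "[D]" \<Lambda> 1 n] ctxs(5) by simp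
  have w: "map (wk 1) (refl_ctx \<Lambda>) = insts (vars 1 n) (refl_ctx \<Lambda>)"
    "map (wk 1) (refl_ctx \<Lambda>') = insts (vars 1 n) (refl_ctx \<Lambda>')" "wk 1 D = inst (vars 1 n) D"
    "wk 1 D' = inst (vars 1 n) D'"
    using scoped_refl_ctx[OF IH] D_scoped by (simp_all add: insts_vars_eq inst_vars)
  have y: "istm (D # \<Lambda>) (Var 0) (inst (vars 1 n) D)"
    using variable[of "D # \<Lambda>" 0] ctxs w by (simp add: tm_iff)
  have DD: "isty (D # \<Lambda>) (inst (vars 1 n) D)"
    by (rule inst_tyeq[OF ctxs(4,5) x])
  have "tmeq (D # \<Lambda>) (reflT (inst (vars 1 n) D) (Var 0)) (reflT (inst (vars 1 n) D') (Var 0))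
      (idT (inst (vars 1 n) D) (Var 0)
        (inst (Var 0 # insts (vars 1 n) (refl_ctx \<Lambda>) @ vars 1 n @ vars 1 n) tr))"
    using TmEq_conv[OF refl_cong[OF inst_tyeq[OF D ctxs(5) x] y]
       id_cong[OF DD y TmEq_sym[OF transport_refl[OF ctxs(5) x y]]]] .
  moreover note refl_inst[OF IH ctxs(5) x]
  moreover have "rl (D' # \<Lambda>') = reflT (inst (vars 1 n) D') (Var 0) # insts (vars 1 n)
      (refl_ctx \<Lambda>') @ Var 0 # vars 1 n @ Var 0 # vars 1 n"
    unfolding w[symmetric] by (simp add: rl_def vars_Suc length_\<Lambda>')
  ultimately show ?thesis
    unfolding rl_Cons w using x y
    by (simp add: elems_idx_Cons length_\<Lambda>')
qed

private abbreviation (input) tail2 :: "'s expr list" where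
  "tail2 \<equiv> [id_over (J_ctx \<Lambda>) n D (vars (2*n + 2) n) (vars (n + 2) n) (vars 2 n) (Var 1) (Var 0),
    inst (vars (n + 1) n) D, inst (vars (2*n) n) D]"

private abbreviation (input) tail2' :: "'s expr list" where
  "tail2' \<equiv> [id_over (J_ctx \<Lambda>') n D' (vars (2*n + 2) n) (vars (n + 2) n) (vars 2 n) (Var 1) (Var 0),
    inst (vars (n + 1) n) D', inst (vars (2*n) n) D']"

text \<open>The substitutions \<open>\<rho>1\<close>, \<open>\<rho>2\<close> and \<open>\<rho>3\<close> of \<open>J_ctx\<close>; \<open>tail2\<close> is the part \<open>y, y', q\<close> of its second post-context.\<close>

private abbreviation (input) list1 :: "'s expr list" where
  "list1 \<equiv> Var 0 # insts (vars 3 n) (refl_ctx \<Lambda>) @ Var 1 # vars 3 n @ Var 2 # vars 3 n"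

private abbreviation (input) list1' :: "'s expr list" where
  "list1' \<equiv> Var 0 # insts (vars 3 n) (refl_ctx \<Lambda>') @ Var 1 # vars 3 n @ Var 2 # vars 3 n"

private abbreviation (input) list2 :: "'s expr list" where
  "list2 \<equiv> Var 0 # vars 3 n @ Var 1 # vars (n + 3) n @ Var 2 # vars (2*n + 3) n"

private abbreviation (input) list3 :: "'s expr list" where
  "list3 \<equiv> Var 0 # Var (n + 1) # Var (2*n + 2) # vars 1 n @ vars (n + 2) n @ vars (2*n + 3) n"

lemma wk_D: "wk k D = inst (vars k n) D"
  using D_scoped by (simp add: inst_vars)

lemma wk_wk: "wk k (wk l e) = wk (k + l) e"
  unfolding subst_subst by (rule subst_cong) (simp add: add.assoc add.commute)

text \<open>By the same conversion as for reflexivity, an identity \<open>q : Id(y, y')\<close>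
  within a fibre counts as an identity over \<open>r(x)\<close>. This types the first elimination
  step.\<close>

lemma elems_list1: "eleq (extId \<Lambda> D) list1 list1' (idx (D # \<Lambda>))"
proof -
  let ?\<Omega> = "extId \<Lambda> D"
  have c: "ctx ?\<Omega>" by (rule is_ctx_extId[OF ctxs(4)])
  have x: "isel ?\<Omega> (vars 3 n) \<Lambda>"
    using elems_eq_vars[of "[idT (wk 2 D) (Var 1) (Var 0), wk 1 D, D]" \<Lambda> 3 n] c by (simp add: extId_def)
  have y: "istm ?\<Omega> (Var 2) (inst (vars 3 n) D)" "istm ?\<Omega> (Var 1) (inst (vars 3 n) D)"
      "istm ?\<Omega> (Var 0) (idT (inst (vars 3 n) D) (Var 2) (Var 1))"
    using variable[OF c, of 2] variable[OF c, of 1] variable[OF c, of 0] wk_wk[of 2 1 D] wk_wk[of 1 2 D]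
      wk_D[of 3]
    unfolding extId_def by (simp_all add: tm_iff numeral_2_eq_2 numeral_3_eq_3)
  have "istm ?\<Omega> (Var 0) (idT (inst (vars 3 n) D) (Var 2)
      (inst (Var 1 # insts (vars 3 n) (refl_ctx \<Lambda>) @ vars 3 n @ vars 3 n) tr))"
    using TmEq_conv[OF y(3) id_cong[OF inst_tyeq[OF ctxs(4) c x] y(1) TmEq_sym[OF transport_refl[OF c x y(2)]]]] .
  with x y refl_inst[OF IH c x] show ?thesis
    by (simp add: elems_idx_Cons length_\<Lambda>')
qed

lemma cteq_tail2: "cteq (tail2 @ idx \<Lambda>) (tail2' @ idx \<Lambda>')"
proof -
  let ?A = "inst (vars (2*n) n) D" and ?B = "inst (vars (n + 1) n) D"
  have 1: "tyeq (idx \<Lambda>) ?A (inst (vars (2*n) n) D')"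
    using inst_tyeq[OF D ctxs(2)] idx_vars(1)[of "[]" 0] ctxs by simp
  then have c1: "ctx ([?A] @ idx \<Lambda>)" using ctxs tyeqD ty_iff by simp
  have 2: "tyeq ([?A] @ idx \<Lambda>) ?B (inst (vars (n + 1) n) D')"
    using inst_tyeq[OF D c1] idx_vars(2)[OF c1, of 1] by simp
  then have c2: "ctx ([?B, ?A] @ idx \<Lambda>)" using c1 tyeqD ty_iff by simp
  have w: "wk 2 ?A = inst (vars (2*n + 2) n) D" "wk 1 ?B = inst (vars (n + 2) n) D"
  proof -
    have "map (wk 2) (vars (2*n) n) = (vars (2*n + 2) n :: 's expr list)"
      "map (wk 1) (vars (n + 1) n) = (vars (n + 2) n :: 's expr list)"
      by (auto intro!: nth_equalityI)
    then show "wk 2 ?A = inst (vars (2*n + 2) n) D" "wk 1 ?B = inst (vars (n + 2) n) D"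
      using D_scoped by (simp_all add: subst_inst_scoped)
  qed
  have y: "istm ([?B, ?A] @ idx \<Lambda>) (Var 1) (inst (vars (2*n + 2) n) D)"
      "istm ([?B, ?A] @ idx \<Lambda>) (Var 0) (inst (vars (n + 2) n) D)"
    using variable[OF c2, of 1] variable[OF c2, of 0] w by (simp_all add: tm_iff numeral_2_eq_2)
  have x: "isel ([?B, ?A] @ idx \<Lambda>) (vars (2*n + 2) n) \<Lambda>"
    "isel ([?B, ?A] @ idx \<Lambda>) (vars (n + 2) n) \<Lambda>"
    "isel ([?B, ?A] @ idx \<Lambda>) (vars 2 n) (id_tel \<Lambda> (vars (2*n + 2) n) (vars (n + 2) n))"
    using idx_vars[OF c2, of 2] by simp_all
  have "tyeq ([?B, ?A] @ idx \<Lambda>)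
      (id_over (J_ctx \<Lambda>) n D (vars (2*n + 2) n) (vars (n + 2) n) (vars 2 n) (Var 1) (Var 0))
      (id_over (J_ctx \<Lambda>') n D' (vars (2*n + 2) n) (vars (n + 2) n) (vars 2 n) (Var 1) (Var 0))"
    unfolding id_over_def
    by (rule id_cong[OF inst_tyeq[OF D c2 x(1)] y(1) transport_inst[OF c2 x y(2)]])
  then show ?thesis using 1 2 J_ok_idx[OF IH] by simp
qed

text \<open>The second elimination step needs \<open>x, x', p\<close> in front and
  \<open>y, y', q\<close> in the post-context. Since this is a mere change of order,
  \<open>\<rho>2\<close> and \<open>\<rho>3\<close> are typed by applying the equivalence to lists
  of variables.\<close>

lemma elems_tail2:
  assumes len: "length p = n" "length x = n" "length x' = n"
  shows "isel \<Omega> (q # y' # y # p @ x' @ x) (tail2 @ idx \<Lambda>) \<longleftrightarrow>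
    isel \<Omega> (q # p @ y' # x' @ y # x) (idx (D # \<Lambda>))"
proof -
  let ?l = "p @ x' @ x"
  have *: "insts ?l (vars (2*n) n) = x" "insts (y # ?l) (vars (n + 1) n) = x'"
      "insts (y' # y # ?l) (vars (2*n + 2) n) = x" "insts (y' # y # ?l) (vars (n + 2) n) = x'"
      "insts (y' # y # ?l) (vars 2 n) = p" "sb 0 (y' # y # ?l) 1 = y" "sb 0 (y' # y # ?l) 0 = y'"
    by (simp_all add: insts_vars len)
  have three: "3 * n = n + (n + n)" by simp
  have "inst (y' # y # ?l) (inst (Var 0 # vars 2 n @ vars (n + 2) n @ vars (2*n + 2) n) tr) =
       inst (insts (y' # y # ?l) (Var 0 # vars 2 n @ vars (n + 2) n @ vars (2*n + 2) n)) tr"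
    by (rule inst_inst) (use tr_scoped three in simp)
  also have "\<dots> = inst (y' # p @ x' @ x) tr"
    unfolding list.map map_append subst.simps(1) * ..
  finally have q: "inst (y' # y # ?l) (id_over (J_ctx \<Lambda>) n D (vars (2*n + 2) n) (vars (n + 2) n) (vars 2 n) (Var 1)
      (Var 0)) =
      idT (inst x D) y (inst (y' # p @ x' @ x) tr)"
    using inst_inst[of "vars (2*n + 2) n" D "y' # y # ?l"] D_scoped(1)
    unfolding id_over_def subst.simps list.map * by simp
  have "inst ?l (inst (vars (2*n) n) D) = inst x D"
    "inst (y # ?l) (inst (vars (n + 1) n) D) = inst x' D"
    using inst_inst[of "vars (2*n) n" D ?l] inst_inst[of "vars (n + 1) n" D "y # ?l"] D_scoped(1)
    unfolding * by simp_all
  then show ?thesis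
    unfolding elems_idx_Cons_1[OF len(1,1,2,2,3,3)] append_Cons append_Nil elems_eq_Cons q by auto
qed

lemma elems_list2: "isel (tail2 @ idx \<Lambda>) list2 (idx (D # \<Lambda>))"
proof -
  have "isel (tail2 @ idx \<Lambda>) (vars 0 (Suc (Suc (Suc (n + (n + n))))))
      (tail2 @ idx \<Lambda>)"
    by (rule elems_eq_vars_0) (use cteq_tail2 cteq_ctx in \<open>blast, simp\<close>)
  moreover have "vars 0 (Suc (Suc (Suc (n + (n + n))))) =
      (Var 0 # Var 1 # Var 2 # vars 3 n @ vars (n + 3) n @ vars (2*n + 3) n :: 's expr list)"
    unfolding vars_Suc vars_add by (simp add: numeral_2_eq_2 numeral_3_eq_3)
  ultimately show ?thesis by (simp only: elems_tail2 vars_length)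
qed

lemma elems_list3: "isel (idx (D # \<Lambda>)) list3 (tail2 @ idx \<Lambda>)"
proof -
  have "isel (idx (D # \<Lambda>)) (vars 0 (Suc (n + Suc (n + Suc n)))) (idx (D # \<Lambda>))"
    by (rule elems_eq_vars_0) (use cteq_idx_Cons cteq_ctx in \<open>blast, simp\<close>)
  moreover have "vars 0 (Suc (n + Suc (n + Suc n))) =
      (Var 0 # vars 1 n @ Var (n + 1) # vars (n + 2) n @ Var (2*n + 2) # vars (2*n + 3) n :: 's expr list)"
    unfolding vars_Suc vars_add by (simp add: numeral_2_eq_2 numeral_3_eq_3)
  ultimately show ?thesis by (simp only: elems_tail2 vars_length)
qed

lemma refl_sub_wk3: "subst (refl_sub B) (wk 3 e) = wk 1 e"
  unfolding subst_subst by (rule subst_cong) (simp add: refl_sub_def sb_def)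

text \<open>Together with \<open>map_list2\<close> this says that the reflexivity of the longer
  context factors through the two elimination steps: setting \<open>p = r(x)\<close> turns
  \<open>list2\<close> into \<open>list1\<close>, and then setting \<open>q = r(y)\<close> turns
  \<open>list1\<close> into \<open>rl (D # \<Lambda>)\<close>.\<close>

lemma map_list1: "map (subst (refl_sub D)) list1 = rl (D # \<Lambda>)"
proof -
  have "map (subst (refl_sub D)) (insts (vars 3 n) (refl_ctx \<Lambda>)) = map (wk 1) (refl_ctx \<Lambda>)"
    using scoped_refl_ctx(1)[OF IH] by (simp add: insts_vars_eq refl_sub_wk3)
  moreover have "map (subst (refl_sub D)) (vars 3 n) = vars 1 n"
    by (rule nth_equalityI) (auto simp: refl_sub_def)
  ultimately show ?thesis
    unfolding rl_Cons list.map map_append by (simp add: refl_sub_def)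
qed

lemma map_list2: "map (subst (ups 3 (rsub \<Lambda>))) list2 = list1"
proof -
  have "map (subst (ups 3 (rsub \<Lambda>))) (vars 3 n) = insts (vars 3 n) (refl_ctx \<Lambda>)"
    using scoped_refl_ctx(1)[OF IH] by (auto intro!: nth_equalityI simp: insts_vars_eq ups_eq rl_def nth_append)
  moreover have "map (subst (ups 3 (rsub \<Lambda>))) (vars (n + 3) n) = vars 3 n"
      "map (subst (ups 3 (rsub \<Lambda>))) (vars (2*n + 3) n) = vars 3 n"
    by (auto intro!: nth_equalityI simp: ups_eq rl_def nth_append)
  ultimately show ?thesis
    unfolding list.map map_append by (simp add: ups_eq)
qed

text \<open>\<open>\<rho>3\<close> undoes \<open>\<rho>2\<close>, so the result of the second step
  lands again in the given \<open>\<Theta>\<close> over the given \<open>\<Delta>\<close>.\<close>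

lemma insts_list3_list2: "insts list3 list2 = vars 0 (3 * Suc n)"
proof -
  have "insts list3 list2 = Var 0 # vars 1 n @ Var (n + 1) # vars (n + 2) n @ Var (2*n + 2) # vars (2*n + 3) n"
    by (simp add: insts_vars numeral_3_eq_3)
  also have "\<dots> = vars 0 (Suc (n + Suc (n + Suc n)))"
    unfolding vars_Suc vars_add by (simp add: numeral_2_eq_2 numeral_3_eq_3)
  also have "Suc (n + Suc (n + Suc n)) = 3 * Suc n" by simp
  finally show ?thesis .
qed

lemma insts_rl_list3: "insts (rl (D # \<Lambda>)) list3 = map (subst (refl_sub D)) (lift 3 (rl \<Lambda>))"
proof -
  have "insts (rl (D # \<Lambda>)) list3 = [reflT (wk 1 D) (Var 0), Var 0, Var 0] @ map (wk 1)
      (refl_ctx \<Lambda>) @ vars 1 n @ vars 1 n"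
    unfolding rl_Cons by (simp add: insts_vars nth_append numeral_3_eq_3)
  moreover have "map (subst (refl_sub D)) (map (wk 3) (vars 0 n)) = vars 1 n"
    by (rule nth_equalityI) (auto simp: refl_sub_def)
  then have "map (subst (refl_sub D)) (lift 3 (rl \<Lambda>)) = map (subst (refl_sub D)) (vars 0 3) @ map (wk 1)
      (refl_ctx \<Lambda>) @ vars 1 n @ vars 1 n"
    unfolding lift_def rl_def map_append by (simp add: refl_sub_wk3)
  moreover have "map (subst (refl_sub D)) (vars 0 3) = [reflT (wk 1 D) (Var 0), Var 0, Var 0]"
    by (simp add: vars_Suc refl_sub_def numeral_3_eq_3)
  ultimately show ?thesis by simp
qed

lemma lift_list3: "vars 0 m @ Var m # Var (m + n + 1) # Var (m + 2*n + 2) #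
      vars (m + 1) n @ vars (m + n + 2) n @ vars (m + 2*n + 3) n = lift m list3"
proof -
  have "map (wk m) (vars k n) = (vars (m + k) n :: 's expr list)" for k
    by (rule nth_equalityI) auto
  from this[of 1] this[of "n + 2"] this[of "2*n + 3"] show ?thesis
    by (simp add: lift_def add.assoc add.commute add.left_commute)
qed

text \<open>The element \<open>e1\<close> eliminates \<open>q\<close> by \<open>J_tel_main\<close>
  and \<open>e\<close> eliminates \<open>p\<close> by the hypothesis on \<open>\<Lambda>\<close>,
  after which the variables are permuted back. The two steps meet over contexts that are equal but
  not identical, which is where computation of transport enters.\<close>

lemma J_ok_Cons: "J_ok (D # \<Lambda>) (D' # \<Lambda>')"
  unfolding J_ok_def
proof (intro conjI allI impI cteq_idx_Cons elems_rl_Cons)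
  fix \<Delta> \<Delta>' \<Theta> \<Theta>' d d' :: "'s expr list"
  let ?m = "length \<Delta>" and ?r = "rsub (D # \<Lambda>)"
  assume len: "length \<Delta>' = length \<Delta>"
    and \<Theta>: "cteq (\<Theta> @ \<Delta> @ idx (D # \<Lambda>)) (\<Theta>' @ \<Delta>' @ idx (D' # \<Lambda>'))"
    and d: "eleq (tsubst ?r \<Delta> @ D # \<Lambda>) d d' (tsubst (ups ?m ?r) \<Theta>)"
  have len\<Theta>: "length \<Theta>' = length \<Theta>"
    using ctx_eq_length[OF \<Theta>] len length_\<Lambda>' by simp
  have \<Delta>: "cteq (\<Delta> @ idx (D # \<Lambda>)) (\<Delta>' @ idx (D' # \<Lambda>'))"
    using ctx_eq_append[OF _ \<Theta>] len\<Theta> by simp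
  have c\<Delta>: "ctx (\<Delta> @ idx (D # \<Lambda>))" and c\<Theta>: "ctx (\<Theta> @ \<Delta> @ idx (D # \<Lambda>))"
    using \<Delta> \<Theta> cteq_ctx by blast+
  have cI: "ctx (idx (D # \<Lambda>))" using cteq_idx_Cons cteq_ctx by blast
  have sc\<Delta>: "tscoped (3 * Suc n) \<Delta>" using is_ctx_tscoped_append[OF c\<Delta>] by simp
  have sc\<Theta>: "tscoped (?m + 3 * Suc n) \<Theta>" using is_ctx_tscoped_append[OF c\<Theta>] by simp
  have l1: "length list1 = 3 * Suc n" and l2: "length list2 = 3 * Suc n" and l3: "length list3 = 3 * Suc n"
    by simp_all
  define \<Delta>1 \<Theta>1 \<Delta>1' \<Theta>1' where "\<Delta>1 = tsubst (sb 0 list1) \<Delta>" "\<Theta>1 = tsubst (ups ?m (sb 0 list1)) \<Theta>"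
    "\<Delta>1' = tsubst (sb 0 list1') \<Delta>'" "\<Theta>1' = tsubst (ups ?m (sb 0 list1')) \<Theta>'"
  note def1 = this
  define \<Delta>2 \<Theta>2 \<Delta>2' \<Theta>2' where "\<Delta>2 = tsubst (sb 0 list2) \<Delta>" "\<Theta>2 = tsubst (ups ?m (sb 0 list2)) \<Theta>"
    "\<Delta>2' = tsubst (sb 0 list2) \<Delta>'" "\<Theta>2' = tsubst (ups ?m (sb 0 list2)) \<Theta>'"
  note def2 = this
  define e1 where "e1 = J_tel D \<Delta>1 \<Theta>1 d"
  define e1' where "e1' = J_tel D' \<Delta>1' \<Theta>1' d'"
  define e where "e = J_ctx \<Lambda> (\<Delta>2 @ tail2) \<Theta>2 e1"
  define e' where "e' = J_ctx \<Lambda>' (\<Delta>2' @ tail2') \<Theta>2' e1'"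
  have J: "J_ctx (D # \<Lambda>) \<Delta> \<Theta> d = insts (lift ?m list3) e"
    "J_ctx (D' # \<Lambda>') \<Delta>' \<Theta>' d' = insts (lift ?m list3) e'"
    unfolding J_ctx.simps Let_def lift_list3[symmetric] e_def e'_def e1_def e1'_def def1 def2 len length_\<Lambda>'
    by (rule refl)+
  have c1: "ctx (extId \<Lambda> D)" by (rule is_ctx_extId[OF ctxs(4)])
  note s1 = esub_instI[OF c1 cI elems_list1]
  have c\<Phi>: "ctx (tail2 @ idx \<Lambda>)" using cteq_tail2 cteq_ctx by blast
  note s2 = esub_instI[OF c\<Phi> cI elems_list2]
  note s3 = esub_instI[OF cI c\<Phi> elems_list3]
  note sr = esub_refl_sub[OF ctxs(4)]
  have ct1: "cteq (\<Theta>1 @ \<Delta>1 @ extId \<Lambda> D) (\<Theta>1' @ \<Delta>1' @ extId \<Lambda> D)"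
    using cteq_tsubst[OF s1, of "\<Theta> @ \<Delta>" "\<Theta>' @ \<Delta>'"] \<Theta> len len\<Theta> by (simp add: tsubst_append def1)
  have r1: "tsubst (refl_sub D) \<Delta>1 = tsubst ?r \<Delta>" "tsubst (ups ?m (refl_sub D)) \<Theta>1 = tsubst (ups ?m ?r) \<Theta>"
    unfolding def1 using tsubst_ups_comp[OF map_list1, of 0 \<Delta>, unfolded l1] tsubst_ups_comp[OF map_list1, of ?m \<Theta>,
        unfolded l1] sc\<Delta> sc\<Theta>
    by simp_all
  have lm: "length \<Delta>1 = ?m" "length \<Delta>1' = ?m" "length \<Delta>2 = ?m" "length \<Delta>2' = ?m" by (simp_all add: def1 def2 len)
  have E1: "eleq (\<Delta>1 @ extId \<Lambda> D) e1 e1' \<Theta>1"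
    "eleq (tsubst ?r \<Delta> @ D # \<Lambda>) (map (subst (ups ?m (refl_sub D))) e1) d (tsubst (ups ?m ?r) \<Theta>)"
    using J_tel_main[OF D ct1, of d d'] d unfolding lm r1 e1_def e1'_def by auto
  have ct2: "cteq (\<Theta>2 @ (\<Delta>2 @ tail2) @ idx \<Lambda>) (\<Theta>2' @ (\<Delta>2' @ tail2') @ idx \<Lambda>')"
  proof -
    have "cteq ((\<Theta>2 @ \<Delta>2) @ tail2 @ idx \<Lambda>) ((\<Theta>2' @ \<Delta>2') @ tail2 @ idx \<Lambda>)"
      using cteq_tsubst[OF s2, of "\<Theta> @ \<Delta>" "\<Theta>' @ \<Delta>'"] \<Theta> len len\<Theta> by (simp add: tsubst_append def2)
    from ctx_eq_change_right[OF _ this cteq_tail2] show ?thesis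
      using len len\<Theta> by (simp add: def2)
  qed
  let ?t = "tsubst (rsub \<Lambda>) tail2"
  have r2: "tsubst (rsub \<Lambda>) (\<Delta>2 @ tail2) = \<Delta>1 @ ?t" "tsubst (ups (length (\<Delta>2 @ tail2)) (rsub \<Lambda>)) \<Theta>2 = \<Theta>1"
  proof -
    have "tsubst (ups 3 (rsub \<Lambda>)) \<Delta>2 = \<Delta>1" "tsubst (ups ?m (ups 3 (rsub \<Lambda>))) \<Theta>2 = \<Theta>1"
      unfolding def1 def2 using tsubst_ups_comp[OF map_list2, of 0 \<Delta>, unfolded l2] tsubst_ups_comp[OF map_list2, of
          ?m \<Theta>, unfolded l2] sc\<Delta> sc\<Theta>
      by simp_all
    moreover have "length (\<Delta>2 @ tail2) = ?m + 3" "length tail2 = 3" by (simp_all add: lm)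
    ultimately show "tsubst (rsub \<Lambda>) (\<Delta>2 @ tail2) = \<Delta>1 @ ?t" "tsubst (ups (length (\<Delta>2 @ tail2)) (rsub \<Lambda>)) \<Theta>2 = \<Theta>1"
      by (simp_all only: tsubst_append ups_add)
  qed
  \<comment> \<open>The second step expects its method over the restricted post-context, in which
    \<open>q\<close> has type \<open>Id(y, r(x)^* y')\<close>, but \<open>e1\<close> lives where
    \<open>q : Id(y, y')\<close>.\<close>
  have \<Psi>: "cteq (extId \<Lambda> D) (?t @ \<Lambda>)"
  proof -
    let ?x = "vars 2 n"
    have D1: "subst (rsub \<Lambda>) (inst (vars (2*n) n) D) = D"
      using subst_inst_scoped[of "vars (2*n) n" D "rsub \<Lambda>"] D_scoped inst_vars_0[OF D_scoped(1)]
      by (simp add: insts_vars rl_def)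
    have D2: "subst (ups 1 (rsub \<Lambda>)) (inst (vars (n + 1) n) D) = wk 1 D"
    proof -
      have "map (subst (ups 1 (rsub \<Lambda>))) (vars (n + 1) n) = vars 1 n"
        by (rule nth_equalityI) (auto simp: ups_eq rl_def nth_append)
      then show ?thesis using subst_inst_scoped[of "vars (n + 1) n" D "ups 1 (rsub \<Lambda>)"] D_scoped wk_D[of 1] by simp
    qed
    have D3: "subst (ups 2 (rsub \<Lambda>)) (id_over (J_ctx \<Lambda>) n D (vars (2*n + 2) n) (vars (n + 2) n) (vars 2 n) (Var 1)
        (Var 0))
      = idT (inst ?x D) (Var 1) (inst (Var 0 # insts ?x (refl_ctx \<Lambda>) @ ?x @ ?x) tr)"
    proof -
      have "map (subst (ups 2 (rsub \<Lambda>))) (vars (2*n + 2) n) = ?x"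
        "map (subst (ups 2 (rsub \<Lambda>))) (vars (n + 2) n) = ?x"
        "map (subst (ups 2 (rsub \<Lambda>))) (vars 2 n) = insts ?x (refl_ctx \<Lambda>)"
        using scoped_refl_ctx(1)[OF IH]
        by (auto intro!: nth_equalityI simp: ups_eq rl_def nth_append insts_vars_eq)
      note m = this
      have 1: "ups 2 (rsub \<Lambda>) 0 = Var 0" "ups 2 (rsub \<Lambda>) 1 = Var 1" by (simp_all add: ups_eq)
      have three: "3 * n = n + (n + n)" by simp
      have "subst (ups 2 (rsub \<Lambda>)) (inst (Var 0 # vars 2 n @ vars (n + 2) n @ vars (2*n + 2) n) tr) =
         inst (map (subst (ups 2 (rsub \<Lambda>))) (Var 0 # vars 2 n @ vars (n + 2) n @ vars (2*n + 2) n)) tr"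
        by (rule subst_inst_scoped) (use tr_scoped three in simp)
      also have "\<dots> = inst (Var 0 # insts ?x (refl_ctx \<Lambda>) @ ?x @ ?x) tr"
        unfolding list.map map_append m subst.simps(1) 1 ..
      finally show ?thesis
        using subst_inst_scoped[of "vars (2*n + 2) n" D "ups 2 (rsub \<Lambda>)"] D_scoped
        unfolding id_over_def subst.simps list.map m 1 by simp
    qed
    have t: "?t = [idT (inst ?x D) (Var 1) (inst (Var 0 # insts ?x (refl_ctx \<Lambda>) @ ?x @ ?x) tr), wk 1 D, D]"
      using D1 D2 D3 by (simp add: numeral_2_eq_2)
    have c: "ctx (wk 1 D # D # \<Lambda>)" using c1 by (simp add: extId_def)
    have x: "isel (wk 1 D # D # \<Lambda>) ?x \<Lambda>"
      using elems_eq_vars[of "[wk 1 D, D]" \<Lambda> 2 n] c by simp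
    have y: "istm (wk 1 D # D # \<Lambda>) (Var 1) (inst ?x D)" "istm (wk 1 D # D # \<Lambda>) (Var 0) (inst ?x D)"
      using variable[OF c, of 1] variable[OF c, of 0] wk_wk[of 1 1 D] wk_D[of 2]
      by (simp_all add: tm_iff numeral_2_eq_2)
    have "tyeq (wk 1 D # D # \<Lambda>) (idT (wk 2 D) (Var 1) (Var 0))
        (idT (inst ?x D) (Var 1) (inst (Var 0 # insts ?x (refl_ctx \<Lambda>) @ ?x @ ?x) tr))"
      unfolding wk_D[of 2]
      by (rule id_cong[OF inst_tyeq[OF ctxs(4) c x] y(1) TmEq_sym[OF transport_refl[OF c x y(2)]]])
    moreover have "cteq (wk 1 D # D # \<Lambda>) (wk 1 D # D # \<Lambda>)" using is_ctx_cteq_refl[OF c] .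
    ultimately show ?thesis unfolding t extId_def by simp
  qed
  have "cteq (\<Delta>1 @ extId \<Lambda> D) (\<Delta>1 @ extId \<Lambda> D)"
    by (rule is_ctx_cteq_refl, rule is_ctx_appendD[of S \<Theta>1]) (use ct1 cteq_ctx in blast)
  from ctx_eq_change_right[OF refl this \<Psi>]
  have \<Delta>\<Psi>: "cteq (\<Delta>1 @ extId \<Lambda> D) (\<Delta>1 @ ?t @ \<Lambda>)" .
  have "eleq (tsubst (rsub \<Lambda>) (\<Delta>2 @ tail2) @ \<Lambda>) e1 e1' (tsubst (ups (length (\<Delta>2 @ tail2)) (rsub \<Lambda>)) \<Theta>2)"
    unfolding r2 using elems_eq_cteq[OF E1(1) \<Delta>\<Psi>] by simp
  note JJ = J_ok_J[OF IH ct2 _ this]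
  have E: "eleq (\<Delta>2 @ tail2 @ idx \<Lambda>) e e' \<Theta>2"
    using JJ(1) unfolding e_def e'_def by (simp add: lm)
  have E': "eleq (\<Delta>1 @ ?t @ \<Lambda>) (map (subst (ups (length (\<Delta>2 @ tail2)) (rsub \<Lambda>))) e) e1 \<Theta>1"
    using JJ(2) lm unfolding r2 e_def by simp
  have sce: "\<forall>t\<in>set e. scoped (?m + 3 * Suc n) t" "\<forall>t\<in>set e'. scoped (?m + 3 * Suc n) t"
  proof -
    have "length (\<Delta>2 @ tail2 @ idx \<Lambda>) = ?m + 3 * Suc n" by (simp add: lm)
    then show "\<forall>t\<in>set e. scoped (?m + 3 * Suc n) t" "\<forall>t\<in>set e'. scoped (?m + 3 * Suc n) t"
      using elems_eq_scoped[OF E] by metis+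
  qed
  have lift: "insts (lift ?m list3) t = map (subst (ups ?m (sb 0 list3))) t"
      if "\<forall>e\<in>set t. scoped (?m + 3 * Suc n) e" for t
  proof (rule map_cong[OF refl])
    fix e assume "e \<in> set t"
    then have "scoped (?m + 3 * Suc n) e" using that by blast
    then show "inst (lift ?m list3) e = subst (ups ?m (sb 0 list3)) e"
      by (rule subst_scoped_cong) (rule sb_lift, use l3 in simp)
  qed
  have i3: "tsubst (sb 0 list3) \<Delta>2 = \<Delta>" "tsubst (ups ?m (sb 0 list3)) \<Theta>2 = \<Theta>"
  proof -
    have "tsubst (sb 0 (vars 0 (3 * Suc n))) \<Delta> = tsubst Var \<Delta>"
      by (rule tsubst_scoped_cong[OF sc\<Delta>]) simp
    moreover have "tsubst (ups ?m (sb 0 (vars 0 (3 * Suc n)))) \<Theta> = tsubst (ups ?m Var) \<Theta>"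
      by (rule tsubst_scoped_cong[OF sc\<Theta>], rule ups_cong[of "3 * Suc n"]) simp_all
    ultimately show "tsubst (sb 0 list3) \<Delta>2 = \<Delta>" "tsubst (ups ?m (sb 0 list3)) \<Theta>2 = \<Theta>"
      unfolding def2 using tsubst_ups_comp[OF insts_list3_list2, of 0 \<Delta>, unfolded l2] tsubst_ups_comp[OF
          insts_list3_list2, of ?m \<Theta>, unfolded l2]
        sc\<Delta> sc\<Theta> by simp_all
  qed
  have c\<Delta>2: "ctx (\<Delta>2 @ tail2 @ idx \<Lambda>)"
    using ct2 is_ctx_appendD[of S \<Theta>2] cteq_ctx by simp
  show "eleq (\<Delta> @ idx (D # \<Lambda>)) (J_ctx (D # \<Lambda>) \<Delta> \<Theta> d) (J_ctx (D' # \<Lambda>') \<Delta>' \<Theta>' d') \<Theta>"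
    unfolding J lift[OF sce(1)] lift[OF sce(2)]
    using elems_eq_comp[OF E esub_ups[OF s3 c\<Delta>2]] unfolding i3 lm .
  have c\<Delta>1: "ctx (\<Delta>1 @ extId \<Lambda> D)" using \<Delta>\<Psi> cteq_ctx by blast
  \<comment> \<open>At \<open>p = r(x)\<close> the element \<open>e\<close> computes to
    \<open>e1\<close>, which at \<open>q = r(y)\<close> computes to \<open>d\<close>.\<close>
  have "eleq (\<Delta>1 @ extId \<Lambda> D) (map (subst (ups (length (\<Delta>2 @ tail2)) (rsub \<Lambda>))) e) e1 \<Theta>1"
    by (rule elems_eq_cteq[OF E' cteq_sym[OF \<Delta>\<Psi>]])
  from elems_eq_comp[OF this esub_ups[OF sr c\<Delta>1]]
  have F: "eleq (tsubst ?r \<Delta> @ D # \<Lambda>)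
      (map (subst (ups ?m (refl_sub D))) (map (subst (ups (length (\<Delta>2 @ tail2)) (rsub \<Lambda>))) e))
      (map (subst (ups ?m (refl_sub D))) e1) (tsubst (ups ?m ?r) \<Theta>)"
    unfolding lm r1 .
  \<comment> \<open>Restricting along the two reflexivities in turn amounts to permuting by
    \<open>list3\<close> and restricting along the reflexivity of the longer context.\<close>
  have G: "map (subst (ups ?m (refl_sub D))) (map (subst (ups (length (\<Delta>2 @ tail2)) (rsub \<Lambda>))) e) =
      map (subst (ups ?m ?r)) (J_ctx (D # \<Lambda>) \<Delta> \<Theta> d)"
    unfolding J lift[OF sce(1)] map_map comp_def
  proof (rule map_cong[OF refl])
    fix t assume "t \<in> set e"
    then have t: "scoped (?m + 3 * Suc n) t" using sce by blast
    have "subst (ups ?m (refl_sub D)) (subst (ups (length (\<Delta>2 @ tail2)) (rsub \<Lambda>)) t) =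
      subst (ups ?m (refl_sub D)) (subst (ups ?m (sb 0 (lift 3 (rl \<Lambda>)))) t)"
    proof -
      have "subst (ups ?m (ups 3 (rsub \<Lambda>))) t = subst (ups ?m (sb 0 (lift 3 (rl \<Lambda>)))) t"
        by (rule subst_scoped_cong[OF t], rule ups_cong[of "3 * Suc n"], rule sb_lift[symmetric])
          simp_all
      moreover have "ups (length (\<Delta>2 @ tail2)) (rsub \<Lambda>) = ups ?m (ups 3 (rsub \<Lambda>))"
        unfolding ups_add[symmetric] by (rule arg_cong[of _ _ "\<lambda>k. ups k (rsub \<Lambda>)"]) (simp add: lm)
      ultimately show ?thesis by simp
    qed
    also have "\<dots> = subst (ups ?m (sb 0 (insts (rl (D # \<Lambda>)) list3))) t"
      by (rule subst_ups_comp[OF insts_rl_list3[symmetric]]) (use t in simp)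
    also have "\<dots> = subst (ups ?m ?r) (subst (ups ?m (sb 0 list3)) t)"
      by (rule subst_ups_comp[OF refl, symmetric]) (simp only: l3 t)
    finally show "subst (ups ?m (refl_sub D)) (subst (ups (length (\<Delta>2 @ tail2)) (rsub \<Lambda>)) t) =
      subst (ups ?m ?r) (subst (ups ?m (sb 0 list3)) t)" .
  qed
  have c: "ctx (tsubst (ups ?m ?r) \<Theta> @ tsubst ?r \<Delta> @ D # \<Lambda>)"
    using is_ctx_tsubst[OF esub_instI[OF ctxs(5) cI elems_rl_Cons], of "\<Theta> @ \<Delta>"] c\<Theta> by (simp add: tsubst_append)
  show "eleq (tsubst ?r \<Delta> @ D # \<Lambda>) (map (subst (ups ?m ?r)) (J_ctx (D # \<Lambda>) \<Delta> \<Theta> d)) d (tsubst (ups ?m ?r) \<Theta>)"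
    using elems_eq_trans[OF F E1(2) c] unfolding G .
qed

end

theorem J_ok: "cteq \<Lambda> \<Lambda>' \<Longrightarrow> J_ok \<Lambda> \<Lambda>'"
proof (induction rule: ctx_eq.induct)
  case 1
  \<comment> \<open>Over the empty context nothing is eliminated: \<open>J_ctx\<close> returns
    \<open>d\<close>, and restriction along reflexivity is the identity.\<close>
  have "map (subst Var) d = d" for d :: "'s expr list" by (simp add: map_idI)
  then show ?case
    unfolding J_ok_def by (auto simp: idx_def rl_def dest: elems_eq_left)
next
  case (2 \<Gamma> \<Delta> A B)
  then show ?case by (intro J_ok_Cons)
qed

end

section \<open>Composition and functoriality of identities\<close>

lemma insts_ups:
  assumes "length \<delta> = m" "scoped (m + length l) e"
  shows "inst (\<delta> @ x) (subst (ups m (sb 0 l)) e) = inst (\<delta> @ insts x l) e"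
  unfolding subst_subst
proof (rule subst_scoped_cong[OF assms(2)])
  fix i assume i: "i < m + length l"
  have "inst (\<delta> @ x) (wk m t) = inst x t" for t
    using inst_wk[of m "\<delta> @ x" t] assms(1) by simp
  then show "inst (\<delta> @ x) (ups m (sb 0 l) i) = sb 0 (\<delta> @ insts x l) i"
    using assms(1) i by (auto simp: ups_eq nth_append)
qed

lemma tsubst_inst_scoped:
  assumes "tscoped (length l) T"
  shows "tsubst \<sigma> (tsubst (sb 0 l) T) = tsubst (sb 0 (map (subst \<sigma>) l)) T"
  unfolding tsubst_tsubst by (rule tsubst_scoped_cong[OF assms]) simp

lemma map_subst_insts:
  assumes "\<forall>e\<in>set es. scoped (length as) e"
  shows "map (subst \<sigma>) (insts as es) = insts (map (subst \<sigma>) as) es"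
  using assms by (simp add: subst_inst_scoped)

text \<open>Discreteness speaks about elements of identity types. In a telescope of this form it can
  be used at every entry.\<close>

definition is_idtel :: "'s expr list \<Rightarrow> bool" where
  "is_idtel T \<longleftrightarrow> (\<forall>A\<in>set T. \<exists>B a b. A = idT B a b)"

lemma is_idtel_tsubst: "is_idtel T \<Longrightarrow> is_idtel (tsubst \<sigma> T)"
  by (induction T) (auto simp: is_idtel_def)

lemma is_idtel_id_ctx: "is_idtel (id_ctx \<Lambda>)"
proof (induction \<Lambda>)
  case (Cons A \<Lambda>)
  then show ?case using is_idtel_tsubst[OF Cons] by (auto simp: Let_def id_over_def is_idtel_def)
qed (simp add: is_idtel_def)

lemma is_idtel_id_tel: "is_idtel (id_tel \<Lambda> a b)"
  by (simp add: id_tel_def is_idtel_tsubst is_idtel_id_ctx)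

section \<open>Elimination as a lifting property\<close>

context type_theory
begin

text \<open>The substitution \<open>\<rho> : B \<rightarrow> \<Psi>\<close> has the left lifting property against context projections, up to
  definitional equality.\<close>

definition elim where
  "elim \<Psi> \<rho> B \<longleftrightarrow> esub B \<rho> \<rho> \<Psi> \<and>
    (\<forall>\<Theta> d. ctx (\<Theta> @ \<Psi>) \<longrightarrow> isel B d (tsubst \<rho> \<Theta>) \<longrightarrow>
      (\<exists>e. isel \<Psi> e \<Theta> \<and> eleq B (map (subst \<rho>) e) d (tsubst \<rho> \<Theta>)))"

lemma elim_esub: "elim \<Psi> \<rho> B \<Longrightarrow> esub B \<rho> \<rho> \<Psi>"
  by (simp add: elim_def)

text \<open>As for any lifting property: extend first along \<open>\<tau>\<close> into the telescope
  restricted along \<open>\<rho>\<close>, then along \<open>\<rho>\<close>.\<close>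

lemma elim_comp:
  assumes "elim \<Psi> \<rho> \<Phi>" "elim \<Phi> \<tau> B"
  shows "elim \<Psi> (\<lambda>i. subst \<tau> (\<rho> i)) B"
  unfolding elim_def
proof (intro conjI allI impI)
  show s: "esub B (\<lambda>i. subst \<tau> (\<rho> i)) (\<lambda>i. subst \<tau> (\<rho> i)) \<Psi>"
    using assms esub_comp elim_esub by blast
  fix \<Theta> d assume c: "ctx (\<Theta> @ \<Psi>)" and d: "isel B d (tsubst (\<lambda>i. subst \<tau> (\<rho> i)) \<Theta>)"
  have c\<rho>: "ctx (tsubst \<rho> \<Theta> @ \<Phi>)" using is_ctx_tsubst[OF elim_esub[OF assms(1)] c] .
  from d have "isel B d (tsubst \<tau> (tsubst \<rho> \<Theta>))" by (simp add: tsubst_tsubst)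
  then obtain e1 where e1: "isel \<Phi> e1 (tsubst \<rho> \<Theta>)"
    "eleq B (map (subst \<tau>) e1) d (tsubst \<tau> (tsubst \<rho> \<Theta>))"
    using assms(2) c\<rho> unfolding elim_def by blast
  then obtain e where e: "isel \<Psi> e \<Theta>" "eleq \<Phi> (map (subst \<rho>) e) e1 (tsubst \<rho> \<Theta>)"
    using assms(1) c unfolding elim_def by blast
  have "eleq B (map (subst \<tau>) (map (subst \<rho>) e)) d (tsubst \<tau> (tsubst \<rho> \<Theta>))"
    using elems_eq_trans[OF elems_eq_comp[OF e(2) elim_esub[OF assms(2)]] e1(2)]
      is_ctx_tsubst[OF elim_esub[OF assms(2)] c\<rho>] by blast
  then show "\<exists>e. isel \<Psi> e \<Theta> \<and>
      eleq B (map (subst (\<lambda>i. subst \<tau> (\<rho> i))) e) d (tsubst (\<lambda>i. subst \<tau> (\<rho> i)) \<Theta>)"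
    using e(1) by (auto simp: tsubst_tsubst subst_subst comp_def)
qed

lemma elim_cteq:
  assumes "elim \<Psi> \<rho> B" "cteq B B'"
  shows "elim \<Psi> \<rho> B'"
  unfolding elim_def
proof (intro conjI allI impI)
  show "esub B' \<rho> \<rho> \<Psi>" using esub_cteq assms elim_esub by blast
  fix \<Theta> d assume "ctx (\<Theta> @ \<Psi>)" "isel B' d (tsubst \<rho> \<Theta>)"
  with elems_eq_cteq[OF _ cteq_sym[OF assms(2)]] assms(1)
  obtain e where "isel \<Psi> e \<Theta>" "eleq B (map (subst \<rho>) e) d (tsubst \<rho> \<Theta>)"
    unfolding elim_def by blast
  then show "\<exists>e. isel \<Psi> e \<Theta> \<and> eleq B' (map (subst \<rho>) e) d (tsubst \<rho> \<Theta>)"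
    using elems_eq_cteq assms(2) by blast
qed

end

context ml2_theory
begin

lemma elim_J_ctx:
  assumes "ctx (\<Delta> @ idx \<Lambda>)"
  shows "elim (\<Delta> @ idx \<Lambda>) (ups (length \<Delta>) (rsub \<Lambda>)) (tsubst (rsub \<Lambda>) \<Delta> @ \<Lambda>)"
proof -
  have ok: "J_ok \<Lambda> \<Lambda>"
    using J_ok is_ctx_cteq_refl is_ctx_idxD is_ctx_appendD assms by blast
  show ?thesis
    unfolding elim_def
  proof (intro conjI allI impI)
    show "esub (tsubst (rsub \<Lambda>) \<Delta> @ \<Lambda>) (ups (length \<Delta>) (rsub \<Lambda>)) (ups (length \<Delta>) (rsub \<Lambda>)) (\<Delta> @ idx \<Lambda>)"
      by (rule esub_ups[OF esub_rsub[OF ok] assms])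
    fix \<Theta> d assume *: "ctx (\<Theta> @ \<Delta> @ idx \<Lambda>)"
      "isel (tsubst (rsub \<Lambda>) \<Delta> @ \<Lambda>) d (tsubst (ups (length \<Delta>) (rsub \<Lambda>)) \<Theta>)"
    from J_ok_J[OF ok is_ctx_cteq_refl[OF *(1)] refl *(2)]
    show "\<exists>e. isel (\<Delta> @ idx \<Lambda>) e \<Theta> \<and>
      eleq (tsubst (rsub \<Lambda>) \<Delta> @ \<Lambda>) (map (subst (ups (length \<Delta>) (rsub \<Lambda>))) e) d (tsubst (ups (length \<Delta>) (rsub \<Lambda>)) \<Theta>)"
      by blast
  qed
qed

lemma elim_J_tel:
  assumes "ctx (\<Delta> @ extId \<Gamma> A)"
  shows "elim (\<Delta> @ extId \<Gamma> A) (ups (length \<Delta>) (refl_sub A)) (tsubst (refl_sub A) \<Delta> @ A # \<Gamma>)"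
proof -
  have A: "isty \<Gamma> A"
    using is_ctx_appendD[OF assms] by (simp add: extId_def ty_iff)
  show ?thesis
    unfolding elim_def
  proof (intro conjI allI impI)
    show "esub (tsubst (refl_sub A) \<Delta> @ A # \<Gamma>) (ups (length \<Delta>) (refl_sub A)) (ups (length \<Delta>) (refl_sub A))
        (\<Delta> @ extId \<Gamma> A)"
      by (rule esub_ups[OF esub_refl_sub[OF A] assms])
    fix \<Theta> d assume *: "ctx (\<Theta> @ \<Delta> @ extId \<Gamma> A)"
      "isel (tsubst (refl_sub A) \<Delta> @ A # \<Gamma>) d (tsubst (ups (length \<Delta>) (refl_sub A)) \<Theta>)"
    from J_tel_main[OF A is_ctx_cteq_refl[OF *(1)] refl *(2)]
    show "\<exists>e. isel (\<Delta> @ extId \<Gamma> A) e \<Theta> \<and>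
      eleq (tsubst (refl_sub A) \<Delta> @ A # \<Gamma>) (map (subst (ups (length \<Delta>) (refl_sub A))) e) d
        (tsubst (ups (length \<Delta>) (refl_sub A)) \<Theta>)"
      by blast
  qed
qed

text \<open>By discreteness of identity types, an identity between two elements of an identity type, which
  \<open>elim\<close> provides from reflexivity, makes them definitionally equal.\<close>

lemma elim_unique:
  assumes "elim \<Psi> \<rho> B"
  shows "ctx (\<Theta> @ \<Psi>) \<Longrightarrow> is_idtel \<Theta> \<Longrightarrow> isel \<Psi> t \<Theta> \<Longrightarrow> isel \<Psi> t' \<Theta> \<Longrightarrow>
    eleq B (map (subst \<rho>) t) (map (subst \<rho>) t') (tsubst \<rho> \<Theta>) \<Longrightarrow> eleq \<Psi> t t' \<Theta>"
proof (induction \<Theta> arbitrary: t t')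
  case (Cons C \<Theta>)
  note s = elim_esub[OF assms]
  obtain a ts where t: "t = a # ts" "isel \<Psi> ts \<Theta>" "istm \<Psi> a (inst ts C)"
    using Cons.prems(3) by (auto elim: elems_eq_ConsE)
  obtain a' ts' where t': "t' = a' # ts'" "isel \<Psi> ts' \<Theta>" "istm \<Psi> a' (inst ts' C)"
    using Cons.prems(4) by (auto elim: elems_eq_ConsE)
  have ctx: "ctx (\<Theta> @ \<Psi>)" "isty (\<Theta> @ \<Psi>) C" and C: "is_idtel \<Theta>" "\<exists>K x y. C = idT K x y"
    using Cons.prems(1,2) by (auto simp: is_idtel_def ty_iff)
  \<comment> \<open>The tails come first: only when they are equal do the two heads have a common
    type, in which an identity between them can be formed.\<close>
  have ts: "eleq \<Psi> ts ts' \<Theta>"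
    using Cons.IH[OF ctx(1) C(1) t(2) t'(2)] Cons.prems(5) by (simp add: t t')
  let ?C = "inst ts C"
  have "tyeq \<Psi> ?C (inst ts' C)" by (rule inst_tel_tyeq[OF ctx(2) ts])
  from TmEq_conv[OF t'(3) TyEq_sym[OF this]] have a': "istm \<Psi> a' ?C" .
  have cC: "isty \<Psi> ?C" using t(3) tmeq_ty by blast
  have "isty \<Psi> (idT ?C a a')" by (rule id_cong[OF cC t(3) a'])
  then have cI: "ctx ([idT ?C a a'] @ \<Psi>)" using s by (simp add: ty_iff esub_def)
  have "tmeq B (subst \<rho> a) (subst \<rho> a') (subst \<rho> ?C)"
    using Cons.prems(5) elems_eq_length[OF t(2)] by (simp add: t t' subst_inst)
  note aa = this tmeqD(1)[OF this]
  have cB: "isty B (subst \<rho> ?C)" by (rule esub_tyeq[OF cC s])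
  \<comment> \<open>Over \<open>B\<close> the heads are equal, so reflexivity inhabits the
    restricted type of identities between them.\<close>
  have "isel B [reflT (subst \<rho> ?C) (subst \<rho> a)] (tsubst \<rho> [idT ?C a a'])"
    using TmEq_conv[OF refl_cong[OF cB aa(2)] id_cong[OF cB aa(2,1)]] by simp
  then obtain e where "isel \<Psi> e [idT ?C a a']"
    using assms cI unfolding elim_def by blast
  then obtain e0 where e0: "istm \<Psi> e0 (idT ?C a a')"
    by (auto elim!: elems_eq_ConsE)
  \<comment> \<open>The type of the heads is itself an identity type, so the lifted identity
    \<open>e0\<close> falls under discreteness.\<close>
  obtain K x y where "?C = idT K x y" using C by auto
  with discrete_eq[of \<Psi> a K x y a' e0] t(3) a' e0 have "tmeq \<Psi> a a' ?C" by (simp add: tm_iff)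
  then show ?case using ts by (simp add: t t')
qed simp

lemma idx_cong: "cteq \<Lambda> \<Lambda>' \<Longrightarrow> cteq (idx \<Lambda>) (idx \<Lambda>')"
  using J_ok J_ok_idx by blast

lemma is_ctx_idx: "ctx \<Lambda> \<Longrightarrow> ctx (idx \<Lambda>)"
  using idx_cong is_ctx_cteq_refl cteq_ctx by blast

lemma id_tel_cteq:
  "cteq \<Lambda> \<Lambda>' \<Longrightarrow> ctx \<Omega> \<Longrightarrow> eleq \<Omega> x y \<Lambda> \<Longrightarrow> eleq \<Omega> x' y' \<Lambda> \<Longrightarrow>
    cteq (id_tel \<Lambda> x x' @ \<Omega>) (id_tel \<Lambda>' y y' @ \<Omega>)"
  using id_tel_cong idx_cong ctx_eq_length by blast

lemma is_ctx_id_tel: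
  "ctx \<Lambda> \<Longrightarrow> ctx \<Omega> \<Longrightarrow> isel \<Omega> x \<Lambda> \<Longrightarrow> isel \<Omega> y \<Lambda> \<Longrightarrow> ctx (id_tel \<Lambda> x y @ \<Omega>)"
  using id_tel_cteq is_ctx_cteq_refl cteq_ctx by blast

lemma id_tel_conv:
  "eleq \<Omega> p q (id_tel \<Lambda> x x') \<Longrightarrow> cteq \<Lambda> \<Lambda>' \<Longrightarrow> ctx \<Omega> \<Longrightarrow> eleq \<Omega> x y \<Lambda> \<Longrightarrow> eleq \<Omega> x' y' \<Lambda> \<Longrightarrow>
    eleq \<Omega> p q (id_tel \<Lambda>' y y')"
  using elems_eq_conv' id_tel_cteq by blast

lemma refl_at_cong:
  "cteq \<Lambda> \<Lambda>' \<Longrightarrow> ctx \<Omega> \<Longrightarrow> eleq \<Omega> x y \<Lambda> \<Longrightarrow>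
     eleq \<Omega> (refl_at \<Lambda> x) (refl_at \<Lambda>' y) (id_tel \<Lambda> x x)"
  unfolding refl_at_def using refl_inst J_ok by blast

lemma refl_at_typed: "ctx \<Lambda> \<Longrightarrow> ctx \<Omega> \<Longrightarrow> isel \<Omega> x \<Lambda> \<Longrightarrow>
     isel \<Omega> (refl_at \<Lambda> x) (id_tel \<Lambda> x x)"
  using refl_at_cong is_ctx_cteq_refl by blast

lemma refl_at_length [simp]: "length (refl_at \<Lambda> x) = length \<Lambda>"
  by (simp add: refl_at_def)

lemma map_subst_refl_at:
  "ctx \<Lambda> \<Longrightarrow> length x = length \<Lambda> \<Longrightarrow> map (subst \<sigma>) (refl_at \<Lambda> x) = refl_at \<Lambda> (map (subst \<sigma>) x)"
  unfolding refl_at_def using scoped_refl_ctx[of \<Lambda> \<Lambda>] J_ok is_ctx_cteq_refl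
  by (intro map_subst_insts) auto

lemma tsubst_id_tel:
  assumes "ctx \<Lambda>" "length a = length \<Lambda>" "length b = length \<Lambda>"
  shows "tsubst \<sigma> (id_tel \<Lambda> a b) = id_tel \<Lambda> (map (subst \<sigma>) a) (map (subst \<sigma>) b)"
  unfolding id_tel_def using tscoped_id_ctx[OF is_ctx_idx[OF assms(1)]] assms
  by (subst tsubst_inst_scoped) auto

lemma elems_eq_idx_append:
  assumes "ctx \<Lambda>" "length x = length \<Lambda>" "length y = length \<Lambda>" "length p = length \<Lambda>" "length \<delta> = length \<Delta>"
    "length x' = length \<Lambda>" "length y' = length \<Lambda>" "length p' = length \<Lambda>" "length \<delta>' = length \<Delta>"
  shows "eleq \<Omega> (\<delta> @ p @ y @ x) (\<delta>' @ p' @ y' @ x') (\<Delta> @ idx \<Lambda>) \<longleftrightarrow>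
    eleq \<Omega> x x' \<Lambda> \<and> eleq \<Omega> y y' \<Lambda> \<and> eleq \<Omega> p p' (id_tel \<Lambda> x y) \<and>
    eleq \<Omega> \<delta> \<delta>' (tsubst (sb 0 (p @ y @ x)) \<Delta>)"
  using assms by (auto simp: elems_eq_append elems_idx)

lemma lift_rl:
  assumes "ctx \<Lambda>"
  shows "lift m (rl \<Lambda>) = vars 0 m @ refl_at \<Lambda> (vars m (length \<Lambda>)) @ vars m (length \<Lambda>) @ vars m (length \<Lambda>)"
proof -
  have "map (wk m) (vars 0 n) = (vars m n :: 's expr list)" for n
    by (rule nth_equalityI) auto
  moreover have "refl_at \<Lambda> (vars m (length \<Lambda>)) = map (wk m) (refl_ctx \<Lambda>)"
    unfolding refl_at_def using scoped_refl_ctx[of \<Lambda> \<Lambda>] J_ok is_ctx_cteq_refl assms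
    by (intro insts_vars_eq) auto
  ultimately show ?thesis by (simp add: lift_def rl_def)
qed

text \<open>Equality of two families of identities, \<open>L\<close> and \<open>R\<close> from \<open>F\<close> to \<open>G\<close>, natural in the context, may be
  checked at reflexivity.\<close>

lemma J_eq:
  fixes L R F G :: "'s expr list \<Rightarrow> 's expr list \<Rightarrow> 's expr list \<Rightarrow> 's expr list \<Rightarrow> 's expr list"
  assumes ctx: "ctx (\<Delta> @ idx \<Lambda>)" "ctx \<Phi>"
    and nat: "\<And>\<sigma> \<delta> p y x T. length \<delta> = length \<Delta> \<Longrightarrow> length p = length \<Lambda> \<Longrightarrow> length y = length \<Lambda> \<Longrightarrow>
        length x = length \<Lambda> \<Longrightarrow> T = L \<or> T = R \<or> T = F \<or> T = G \<Longrightarrow>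
        map (subst \<sigma>) (T \<delta> p y x) = T (map (subst \<sigma>) \<delta>) (map (subst \<sigma>) p) (map (subst \<sigma>) y) (map (subst \<sigma>) x)"
    and typed: "\<And>\<Omega> \<delta> p y x. ctx \<Omega> \<Longrightarrow> isel \<Omega> x \<Lambda> \<Longrightarrow> isel \<Omega> y \<Lambda> \<Longrightarrow> isel \<Omega> p (id_tel \<Lambda> x y) \<Longrightarrow>
        isel \<Omega> \<delta> (tsubst (sb 0 (p @ y @ x)) \<Delta>) \<Longrightarrow>
        length \<delta> = length \<Delta> \<Longrightarrow> length p = length \<Lambda> \<Longrightarrow> length y = length \<Lambda> \<Longrightarrow> length x = length \<Lambda> \<Longrightarrow>
        isel \<Omega> (F \<delta> p y x) \<Phi> \<and> isel \<Omega> (G \<delta> p y x) \<Phi> \<and>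
        isel \<Omega> (L \<delta> p y x) (id_tel \<Phi> (F \<delta> p y x) (G \<delta> p y x)) \<and>
        isel \<Omega> (R \<delta> p y x) (id_tel \<Phi> (F \<delta> p y x) (G \<delta> p y x))"
    and base: "\<And>\<Omega> \<delta> x. ctx \<Omega> \<Longrightarrow> isel \<Omega> x \<Lambda> \<Longrightarrow> isel \<Omega> \<delta> (tsubst (sb 0 (refl_at \<Lambda> x @ x @ x)) \<Delta>) \<Longrightarrow>
        length \<delta> = length \<Delta> \<Longrightarrow> length x = length \<Lambda> \<Longrightarrow>
        eleq \<Omega> (L \<delta> (refl_at \<Lambda> x) x x) (R \<delta> (refl_at \<Lambda> x) x x)
          (id_tel \<Phi> (F \<delta> (refl_at \<Lambda> x) x x) (G \<delta> (refl_at \<Lambda> x) x x))"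
    and inst: "ctx \<Omega>" "isel \<Omega> x \<Lambda>" "isel \<Omega> y \<Lambda>" "isel \<Omega> p (id_tel \<Lambda> x y)"
      "isel \<Omega> \<delta> (tsubst (sb 0 (p @ y @ x)) \<Delta>)"
  shows "eleq \<Omega> (L \<delta> p y x) (R \<delta> p y x) (id_tel \<Phi> (F \<delta> p y x) (G \<delta> p y x))"
proof -
  let ?\<Psi> = "\<Delta> @ idx \<Lambda>" and ?m = "length \<Delta>" and ?n = "length \<Lambda>"
  have c\<Lambda>: "ctx \<Lambda>" using ctx is_ctx_appendD is_ctx_idxD by blast
  \<comment> \<open>The generic identity: the variables of \<open>\<Delta> @ idx \<Lambda>\<close>,
    cut into source, target, identity and post-context.\<close>
  define vx :: "'s expr list" where "vx = vars (?m + 2 * ?n) ?n"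
  define vy :: "'s expr list" where "vy = vars (?m + ?n) ?n"
  define vp :: "'s expr list" where "vp = vars ?m ?n"
  define v\<delta> :: "'s expr list" where "v\<delta> = vars 0 ?m"
  have vl: "length vx = ?n" "length vy = ?n" "length vp = ?n" "length v\<delta> = ?m"
    by (simp_all add: vx_def vy_def vp_def v\<delta>_def)
  have v: "v\<delta> @ vp @ vy @ vx = vars 0 (?m + (?n + (?n + ?n)))"
    unfolding vars_add by (simp add: vx_def vy_def vp_def v\<delta>_def mult_2 add.assoc)
  have "isel ?\<Psi> (v\<delta> @ vp @ vy @ vx) ?\<Psi>"
    unfolding v by (rule elems_eq_vars_0[OF ctx(1)]) simp
  note t = this[unfolded elems_eq_idx_append[OF c\<Lambda> vl(1,2,3,4,1,2,3,4)]]
  define T where "T = id_tel \<Phi> (F v\<delta> vp vy vx) (G v\<delta> vp vy vx)"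
  note ty = typed[OF ctx(1), of vx vy vp v\<delta>]
  have ty: "isel ?\<Psi> (F v\<delta> vp vy vx) \<Phi>" "isel ?\<Psi> (G v\<delta> vp vy vx) \<Phi>"
    "isel ?\<Psi> (L v\<delta> vp vy vx) T" "isel ?\<Psi> (R v\<delta> vp vy vx) T"
    unfolding T_def using ty t vl by blast+
  have cT: "ctx (T @ ?\<Psi>)" unfolding T_def by (rule is_ctx_id_tel[OF ctx(2,1) ty(1,2)])
  have lF: "length (F v\<delta> vp vy vx) = length \<Phi>" "length (G v\<delta> vp vy vx) = length \<Phi>"
    using ty elems_eq_length by blast+
  have nat': "map (subst \<sigma>) (H v\<delta> vp vy vx) = H (map (subst \<sigma>) v\<delta>) (map (subst \<sigma>) vp) (map (subst \<sigma>) vy) (map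
      (subst \<sigma>) vx)"
    if "H = L \<or> H = R \<or> H = F \<or> H = G" for H \<sigma>
    by (rule nat) (use that vl in auto)
  have natT: "tsubst \<sigma> T = id_tel \<Phi> (map (subst \<sigma>) (F v\<delta> vp vy vx)) (map (subst \<sigma>) (G v\<delta> vp vy vx))" for \<sigma>
    unfolding T_def by (rule tsubst_id_tel[OF ctx(2) lF])
  note el = elim_J_ctx[OF ctx(1)]
  let ?\<rho> = "ups ?m (rsub \<Lambda>)" and ?B = "tsubst (rsub \<Lambda>) \<Delta> @ \<Lambda>"
  let ?x = "vars ?m ?n :: 's expr list"
  \<comment> \<open>Restricted along reflexivity, the generic endpoints coincide and the generic
    identity becomes \<open>refl_at\<close>: this is the situation of \<open>base\<close>.\<close>
  have "map (subst ?\<rho>) (v\<delta> @ vp @ vy @ vx) = lift ?m (rl \<Lambda>)"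
    unfolding v by (rule nth_equalityI) (auto simp: sb_lift[symmetric])
  then have "map (subst ?\<rho>) v\<delta> @ map (subst ?\<rho>) vp @ map (subst ?\<rho>) vy @ map
      (subst ?\<rho>) vx = v\<delta> @ refl_at \<Lambda> ?x @ ?x @ ?x"
    unfolding lift_rl[OF c\<Lambda>] by (simp add: v\<delta>_def)
  then have r: "map (subst ?\<rho>) v\<delta> = v\<delta>" "map (subst ?\<rho>) vp = refl_at \<Lambda> ?x" "map (subst ?\<rho>) vy = ?x" "map
      (subst ?\<rho>) vx = ?x"
    by (simp_all add: vl)
  have cB: "ctx ?B" using elim_esub[OF el] esub_ctx by blast
  have x: "isel ?B ?x \<Lambda>" by (rule elems_eq_vars[OF cB]) simp_all
  have "isel ?B (map (subst ?\<rho>) (v\<delta> @ vp @ vy @ vx)) (tsubst ?\<rho> ?\<Psi>)"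
    by (rule elems_eq_comp[OF _ elim_esub[OF el]]) (unfold v, rule elems_eq_vars_0[OF ctx(1)], simp)
  then have "isel ?B (v\<delta> @ refl_at \<Lambda> ?x @ ?x @ ?x) ?\<Psi>"
    unfolding map_append r tsubst_closed[OF ctx(1)] .
  then have "isel ?B v\<delta> (tsubst (sb 0 (refl_at \<Lambda> ?x @ ?x @ ?x)) \<Delta>)"
    using elems_eq_idx_append[OF c\<Lambda>, of ?x ?x "refl_at \<Lambda> ?x" v\<delta> \<Delta> ?x ?x "refl_at \<Lambda> ?x" v\<delta>] vl by simp
  from base[OF cB x this] have "eleq ?B (map (subst ?\<rho>) (L v\<delta> vp vy vx)) (map (subst ?\<rho>) (R v\<delta> vp vy vx))
      (tsubst ?\<rho> T)"
    unfolding natT using vl by (simp add: nat' r)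
  from elim_unique[OF el cT _ ty(3,4) this]
  have eq: "eleq ?\<Psi> (L v\<delta> vp vy vx) (R v\<delta> vp vy vx) T" by (simp add: T_def is_idtel_id_tel)
  have l: "length x = ?n" "length y = ?n" "length p = ?n" "length \<delta> = ?m"
    using inst elems_eq_length by fastforce+
  \<comment> \<open>The equation for the generic identity is specialised by substitution, with which
    all four families commute literally.\<close>
  have "isel \<Omega> (\<delta> @ p @ y @ x) ?\<Psi>"
    using inst l by (simp add: elems_eq_idx_append[OF c\<Lambda>])
  from elems_eq_comp[OF eq esub_instI[OF inst(1) ctx(1) this]]
  have *: "eleq \<Omega> (insts (\<delta> @ p @ y @ x) (L v\<delta> vp vy vx)) (insts (\<delta> @ p @ y @ x) (R v\<delta> vp vy vx)) (tsubst (sb 0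
      (\<delta> @ p @ y @ x)) T)" .
  have "insts (\<delta> @ p @ y @ x) v\<delta> = \<delta>" "insts (\<delta> @ p @ y @ x) vp = p" "insts (\<delta> @ p @ y @ x) vy = y" "insts
      (\<delta> @ p @ y @ x) vx = x"
    using l by (simp_all add: vx_def vy_def vp_def v\<delta>_def insts_vars)
  with * show ?thesis unfolding natT by (simp add: nat')
qed

end

section \<open>Action of morphisms on identities, and composition of identities\<close>

context ml2_theory
begin

text \<open>\<open>id_map\<close> and \<open>id_comp\<close> are defined as instances of
  \<open>J_ctx\<close> at lists of terms. These are congruence, computation and scoping of
  elimination in that form.\<close>

lemma J_inst:
  assumes \<Lambda>: "cteq \<Lambda> \<Lambda>'" and \<Theta>: "cteq (\<Theta> @ \<Delta> @ idx \<Lambda>) (\<Theta>' @ \<Delta>' @ idx \<Lambda>')" "length \<Delta>' = length \<Delta>"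
    and d: "eleq (tsubst (rsub \<Lambda>) \<Delta> @ \<Lambda>) d d' (tsubst (ups (length \<Delta>) (rsub \<Lambda>)) \<Theta>)"
    and \<Omega>: "ctx \<Omega>"
  shows J_inst_cong: "eleq \<Omega> l l' (\<Delta> @ idx \<Lambda>) \<Longrightarrow>
      eleq \<Omega> (insts l (J_ctx \<Lambda> \<Delta> \<Theta> d)) (insts l' (J_ctx \<Lambda>' \<Delta>' \<Theta>' d')) (tsubst (sb 0 l) \<Theta>)"
    and J_inst_refl: "isel \<Omega> x \<Lambda> \<Longrightarrow> isel \<Omega> \<delta> (tsubst (sb 0 (refl_at \<Lambda> x @ x @ x)) \<Delta>) \<Longrightarrow>
      eleq \<Omega> (insts (\<delta> @ refl_at \<Lambda> x @ x @ x) (J_ctx \<Lambda> \<Delta> \<Theta> d)) (insts (\<delta> @ x) d)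
        (tsubst (sb 0 (\<delta> @ refl_at \<Lambda> x @ x @ x)) \<Theta>)"
    and J_scoped: "\<forall>e\<in>set (J_ctx \<Lambda> \<Delta> \<Theta> d). scoped (length \<Delta> + 3 * length \<Lambda>) e"
proof -
  note J = J_ok_J[OF J_ok[OF \<Lambda>] \<Theta> d]
  have len: "length \<Theta>' = length \<Theta>"
    using ctx_eq_length[OF \<Theta>(1)] ctx_eq_length[OF \<Lambda>] \<Theta>(2) by simp
  have c: "ctx (\<Theta> @ \<Delta> @ idx \<Lambda>)" using \<Theta>(1) cteq_ctx by blast
  then have c': "ctx (\<Delta> @ idx \<Lambda>)" "ctx (idx \<Lambda>)" "ctx \<Lambda>" using is_ctx_appendD is_ctx_idxD by blast+
  show "eleq \<Omega> (insts l (J_ctx \<Lambda> \<Delta> \<Theta> d)) (insts l' (J_ctx \<Lambda>' \<Delta>' \<Theta>' d')) (tsubst (sb 0 l) \<Theta>)"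
    if "eleq \<Omega> l l' (\<Delta> @ idx \<Lambda>)"
    by (rule elems_eq_comp[OF J(1) esub_instI[OF \<Omega> c'(1) that]])
  show sc: "\<forall>e\<in>set (J_ctx \<Lambda> \<Delta> \<Theta> d). scoped (length \<Delta> + 3 * length \<Lambda>) e"
    using elems_eq_scoped[OF J(1)] by simp
  assume x: "isel \<Omega> x \<Lambda>" and \<delta>: "isel \<Omega> \<delta> (tsubst (sb 0 (refl_at \<Lambda> x @ x @ x)) \<Delta>)"
  have lx: "length x = length \<Lambda>" and l\<delta>: "length \<delta> = length \<Delta>"
    using elems_eq_length[OF x] elems_eq_length[OF \<delta>] by simp_all
  have rl: "insts x (rl \<Lambda>) = refl_at \<Lambda> x @ x @ x" using insts_rl[OF lx] by (simp add: refl_at_def)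
  have sc\<Delta>: "tscoped (3 * length \<Lambda>) \<Delta>" using is_ctx_tscoped_append[OF c'(1)] by simp
  have sc\<Theta>: "tscoped (length \<Delta> + 3 * length \<Lambda>) \<Theta>" using is_ctx_tscoped_append[OF c] by simp
  have "tsubst (sb 0 x) (tsubst (rsub \<Lambda>) \<Delta>) = tsubst (sb 0 (refl_at \<Lambda> x @ x @ x)) \<Delta>"
    using sc\<Delta> by (simp add: tsubst_inst_inst rl del: map_append)
  then have "isel \<Omega> (\<delta> @ x) (tsubst (rsub \<Lambda>) \<Delta> @ \<Lambda>)"
    using x \<delta> l\<delta> by (simp add: elems_eq_append)
  from elems_eq_comp[OF J(2) esub_instI[OF \<Omega> _ this]] is_ctx_tsubst[OF esub_rsub[OF J_ok[OF is_ctx_cteq_refl[OF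
      c'(3)]]] c'(1)]
  have *: "eleq \<Omega> (insts (\<delta> @ x) (map (subst (ups (length \<Delta>) (rsub \<Lambda>))) (J_ctx \<Lambda> \<Delta> \<Theta> d)))
      (insts (\<delta> @ x) d) (tsubst (sb 0 (\<delta> @ x)) (tsubst (ups (length \<Delta>) (rsub \<Lambda>)) \<Theta>))"
    by blast
  have 1: "insts (\<delta> @ x) (map (subst (ups (length \<Delta>) (rsub \<Lambda>))) (J_ctx \<Lambda> \<Delta> \<Theta> d)) =
      insts (\<delta> @ refl_at \<Lambda> x @ x @ x) (J_ctx \<Lambda> \<Delta> \<Theta> d)"
    unfolding map_map comp_def rl[symmetric]
    by (rule map_cong[OF refl], rule insts_ups[OF l\<delta>]) (use sc in simp)
  have "map (subst (sb 0 (\<delta> @ x))) (lift (length \<Delta>) (rl \<Lambda>)) = \<delta> @ refl_at \<Lambda> x @ x @ x"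
    unfolding lift_def map_append rl[symmetric] using l\<delta>
    by (simp add: insts_vars insts_wk[of "length \<Delta>" "\<delta> @ x"] del: map_map)
  then have 2: "tsubst (sb 0 (\<delta> @ x)) (tsubst (ups (length \<Delta>) (rsub \<Lambda>)) \<Theta>) =
      tsubst (sb 0 (\<delta> @ refl_at \<Lambda> x @ x @ x)) \<Theta>"
    using tsubst_scoped_cong[OF sc\<Theta>, of "ups (length \<Delta>) (rsub \<Lambda>)" "sb 0 (lift (length \<Delta>) (rl \<Lambda>))"] sc\<Theta>
      sb_lift[of _ "length \<Delta>" "rl \<Lambda>"]
    by (simp add: tsubst_inst_inst)
  show "eleq \<Omega> (insts (\<delta> @ refl_at \<Lambda> x @ x @ x) (J_ctx \<Lambda> \<Delta> \<Theta> d)) (insts (\<delta> @ x) d)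
        (tsubst (sb 0 (\<delta> @ refl_at \<Lambda> x @ x @ x)) \<Theta>)"
    using * unfolding 1 2 .
qed

context
  fixes \<Lambda> \<Lambda>' \<Delta> \<Delta>' h h' :: "'s expr list"
  assumes \<Lambda>: "cteq \<Lambda> \<Lambda>'" and \<Delta>: "cteq \<Delta> \<Delta>'" and h: "eleq \<Lambda> h h' \<Delta>"
begin

private abbreviation (input) "map_tel \<equiv> id_tel \<Delta> (insts (vars (2*(length \<Lambda>)) (length \<Lambda>)) h) (insts (vars (length \<Lambda>)
    (length \<Lambda>)) h)"
private abbreviation (input) "map_tel' \<equiv> id_tel \<Delta>' (insts (vars (2*(length \<Lambda>)) (length \<Lambda>)) h') (insts (vars
    (length \<Lambda>) (length \<Lambda>)) h')"

text \<open>The hypotheses of \<open>J_inst\<close> for the motive \<open>Id(h x, h y)\<close> with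
  method \<open>r(h x)\<close>.\<close>

lemma id_map_aux:
  shows "ctx \<Lambda>" "ctx \<Delta>" "length \<Lambda>' = length \<Lambda>" "\<forall>e\<in>set h. scoped (length \<Lambda>) e"
    and "cteq (map_tel @ [] @ idx \<Lambda>) (map_tel' @ [] @ idx \<Lambda>')"
    and "eleq (tsubst (rsub \<Lambda>) [] @ \<Lambda>) (refl_at \<Delta> h) (refl_at \<Delta>' h') (tsubst (ups (length []) (rsub \<Lambda>)) map_tel)"
proof -
  let ?n = "length \<Lambda>"
  show c: "ctx \<Lambda>" "ctx \<Delta>" using \<Lambda> \<Delta> cteq_ctx by blast+
  show "length \<Lambda>' = length \<Lambda>" using ctx_eq_length[OF \<Lambda>] .
  have lh: "length h = length \<Delta>" using elems_eq_length[OF h] by simp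
  show sc: "\<forall>e\<in>set h. scoped ?n e" using elems_eq_scoped[OF h] by simp
  have ci: "ctx (idx \<Lambda>)" using is_ctx_idx[OF c(1)] .
  have "isel (idx \<Lambda>) (vars 0 (?n + (?n + ?n))) (idx \<Lambda>)"
    by (rule elems_eq_vars_0[OF ci]) simp
  then have v: "isel (idx \<Lambda>) (vars (2*?n) ?n) \<Lambda>" "isel (idx \<Lambda>) (vars ?n ?n) \<Lambda>"
    unfolding vars_add by (simp_all add: elems_idx c mult_2)
  have hv: "eleq (idx \<Lambda>) (insts v h) (insts v h') \<Delta>" if "isel (idx \<Lambda>) v \<Lambda>" for v
    using elems_eq_comp[OF h esub_instI[OF ci c(1) that]] unfolding tsubst_closed[OF c(2)] .
  have \<Theta>1: "cteq (map_tel @ idx \<Lambda>) (map_tel' @ idx \<Lambda>)"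
    by (rule id_tel_cteq[OF \<Delta> ci hv[OF v(1)] hv[OF v(2)]])
  from ctx_eq_change_right[OF _ this idx_cong[OF \<Lambda>]] ctx_eq_length[OF \<Delta>]
  show "cteq (map_tel @ [] @ idx \<Lambda>) (map_tel' @ [] @ idx \<Lambda>')" by simp
  have "map (subst (rsub \<Lambda>)) (vars (2*?n) ?n) = vars 0 ?n" "map (subst (rsub \<Lambda>)) (vars ?n ?n) = vars 0 ?n"
    by (simp_all add: insts_vars rl_def)
  then have "tsubst (rsub \<Lambda>) map_tel = id_tel \<Delta> (insts (vars 0 ?n) h) (insts (vars 0 ?n) h)"
    using sc by (simp add: tsubst_id_tel c lh map_subst_insts del: map_map)
  also have "insts (vars 0 ?n) h = h" using sc by (simp add: insts_vars_eq map_idI)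
  finally show "eleq (tsubst (rsub \<Lambda>) [] @ \<Lambda>) (refl_at \<Delta> h) (refl_at \<Delta>' h') (tsubst (ups (length [])
      (rsub \<Lambda>)) map_tel)"
    using refl_at_cong[OF \<Delta> c(1) h] by simp
qed

lemma id_map_cong:
  assumes \<Omega>: "ctx \<Omega>" and x: "eleq \<Omega> x x' \<Lambda>" and y: "eleq \<Omega> y y' \<Lambda>" and p: "eleq \<Omega> p p' (id_tel \<Lambda> x y)"
  shows "eleq \<Omega> (id_map \<Lambda> \<Delta> h x y p) (id_map \<Lambda>' \<Delta>' h' x' y' p') (id_tel \<Delta> (insts x h) (insts y h))"
proof -
  let ?n = "length \<Lambda>"
  note a = id_map_aux
  have l: "length x = ?n" "length x' = ?n" "length y = ?n" "length y' = ?n" "length p = ?n" "length p' = ?n"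
    using elems_eq_length[OF x] elems_eq_length[OF y] elems_eq_length[OF p] by simp_all
  have "eleq \<Omega> (p @ y @ x) (p' @ y' @ x') ([] @ idx \<Lambda>)"
    using x y p l by (simp add: elems_idx a)
  from J_inst_cong[OF \<Lambda> a(5) refl a(6) \<Omega> this]
  have *: "eleq \<Omega> (id_map \<Lambda> \<Delta> h x y p) (id_map \<Lambda>' \<Delta>' h' x' y' p') (tsubst (sb 0 (p @ y @ x)) map_tel)"
    unfolding id_map_def Let_def a(3) .
  have "insts (p @ y @ x) (vars (2*?n) ?n) = x" "insts (p @ y @ x) (vars ?n ?n) = y"
    using l by (simp_all add: insts_vars)
  then have "tsubst (sb 0 (p @ y @ x)) map_tel = id_tel \<Delta> (insts x h) (insts y h)"
    using a(4) elems_eq_length[OF h] by (simp add: tsubst_id_tel a map_subst_insts del: map_map)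
  then show ?thesis using * by simp
qed

lemma id_map_refl:
  assumes \<Omega>: "ctx \<Omega>" and x: "isel \<Omega> x \<Lambda>"
  shows "eleq \<Omega> (id_map \<Lambda> \<Delta> h x x (refl_at \<Lambda> x)) (refl_at \<Delta> (insts x h)) (id_tel \<Delta> (insts x h) (insts x h))"
proof -
  let ?n = "length \<Lambda>"
  note a = id_map_aux
  have l: "length x = ?n" using elems_eq_length[OF x] by simp
  from J_inst_refl[OF \<Lambda> a(5) refl a(6) \<Omega> x, of "[]"]
  have *: "eleq \<Omega> (id_map \<Lambda> \<Delta> h x x (refl_at \<Lambda> x)) (insts x (refl_at \<Delta> h)) (tsubst (sb 0
      (refl_at \<Lambda> x @ x @ x)) map_tel)"
    unfolding id_map_def Let_def by simp
  have "insts (refl_at \<Lambda> x @ x @ x) (vars (2*?n) ?n) = x" "insts (refl_at \<Lambda> x @ x @ x) (vars ?n ?n) = x"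
    using l by (simp_all add: insts_vars)
  then have "tsubst (sb 0 (refl_at \<Lambda> x @ x @ x)) map_tel = id_tel \<Delta> (insts x h) (insts x h)"
    using a(4) elems_eq_length[OF h] by (simp add: tsubst_id_tel a map_subst_insts del: map_map)
  moreover have "insts x (refl_at \<Delta> h) = refl_at \<Delta> (insts x h)"
    using elems_eq_length[OF h] by (simp add: map_subst_refl_at a)
  ultimately show ?thesis using * by simp
qed

lemma map_subst_id_map:
  assumes "length x = length \<Lambda>" "length y = length \<Lambda>" "length p = length \<Lambda>"
  shows "map (subst \<sigma>) (id_map \<Lambda> \<Delta> h x y p) =
    id_map \<Lambda> \<Delta> h (map (subst \<sigma>) x) (map (subst \<sigma>) y) (map (subst \<sigma>) p)"
proof -
  let ?n = "length \<Lambda>"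
  note a = id_map_aux
  from J_scoped[OF \<Lambda> a(5) refl a(6) a(1)] show ?thesis
    unfolding id_map_def Let_def by (subst map_subst_insts) (simp_all add: assms mult_2 numeral_3_eq_3 add.assoc)
qed

end

text \<open>The post-context \<open>x\<^sub>0 : \<Lambda>, p : Id(x\<^sub>0, x)\<close> of \<open>id_comp\<close>, over \<open>x : \<Lambda>, y : \<Lambda>, q : Id(x, y)\<close>.\<close>

definition pre_ctx :: "'s expr list \<Rightarrow> 's expr list" where
  "pre_ctx \<Lambda> = id_tel \<Lambda> (vars 0 (length \<Lambda>)) (vars (3 * length \<Lambda>) (length \<Lambda>)) @ \<Lambda>"

lemma pre_ctx_length [simp]: "length (pre_ctx \<Lambda>) = length \<Lambda> + length \<Lambda>"
  by (simp add: pre_ctx_def)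

lemma tsubst_pre_ctx:
  assumes "ctx \<Lambda>" "length y = length \<Lambda>" "length z = length \<Lambda>" "length q = length \<Lambda>"
  shows "tsubst (sb 0 (q @ z @ y)) (pre_ctx \<Lambda>) =
    id_tel \<Lambda> (vars 0 (length \<Lambda>)) (map (wk (length \<Lambda>)) y) @ \<Lambda>"
proof -
  have "map (subst (ups (length \<Lambda>) (sb 0 (q @ z @ y)))) (vars (3 * length \<Lambda>) (length \<Lambda>)) = map (wk (length \<Lambda>)) y"
    by (rule nth_equalityI) (use assms in \<open>auto simp: ups_eq nth_append\<close>)
  moreover have "map (subst (ups (length \<Lambda>) (sb 0 (q @ z @ y)))) (vars 0 (length \<Lambda>)) = vars 0 (length \<Lambda>)"
    by (rule nth_equalityI) (auto simp: ups_eq)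
  ultimately show ?thesis
    using assms by (simp add: pre_ctx_def tsubst_append tsubst_closed tsubst_id_tel)
qed

lemma elems_pre_ctx:
  assumes "ctx \<Lambda>" "length y = length \<Lambda>" "length z = length \<Lambda>" "length q = length \<Lambda>"
    "length x = length \<Lambda>" "length x' = length \<Lambda>" "length p = length \<Lambda>" "length p' = length \<Lambda>"
  shows "eleq \<Omega> (p @ x) (p' @ x') (tsubst (sb 0 (q @ z @ y)) (pre_ctx \<Lambda>)) \<longleftrightarrow>
    eleq \<Omega> x x' \<Lambda> \<and> eleq \<Omega> p p' (id_tel \<Lambda> x y)"
proof -
  have "insts x (vars 0 (length \<Lambda>)) = x" using assms(5) by (metis insts_vars_all)
  moreover have "insts x (map (wk (length \<Lambda>)) y) = y"
    using insts_wk[of "length \<Lambda>" x y] assms(5) by (simp add: map_idI)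
  ultimately show ?thesis
    using assms by (simp add: tsubst_pre_ctx elems_eq_append tsubst_id_tel del: map_map)
qed

lemma elems_pre_ctxE:
  assumes "ctx \<Lambda>" "length y = length \<Lambda>" "length z = length \<Lambda>" "length q = length \<Lambda>"
    and "eleq \<Omega> \<delta> \<delta>' (tsubst (sb 0 (q @ z @ y)) (pre_ctx \<Lambda>))"
  obtains p x p' x' where "\<delta> = p @ x" "\<delta>' = p' @ x'"
    "length x = length \<Lambda>" "length x' = length \<Lambda>" "length p = length \<Lambda>" "length p' = length \<Lambda>"
    "eleq \<Omega> x x' \<Lambda>" "eleq \<Omega> p p' (id_tel \<Lambda> x y)"
proof -
  have "length \<delta> = length \<Lambda> + length \<Lambda>" "length \<delta>' = length \<Lambda> + length \<Lambda>"
    using elems_eq_length[OF assms(5)] by simp_all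
  then have l: "length (take (length \<Lambda>) \<delta>) = length \<Lambda>" "length (take (length \<Lambda>) \<delta>') = length \<Lambda>"
    "length (drop (length \<Lambda>) \<delta>) = length \<Lambda>" "length (drop (length \<Lambda>) \<delta>') = length \<Lambda>"
    by simp_all
  have "eleq \<Omega> (take (length \<Lambda>) \<delta> @ drop (length \<Lambda>) \<delta>) (take (length \<Lambda>) \<delta>' @ drop (length \<Lambda>) \<delta>')
     (tsubst (sb 0 (q @ z @ y)) (pre_ctx \<Lambda>))" using assms(5) by simp
  with elems_pre_ctx[OF assms(1-4) l(3,4,1,2)] that[OF _ _ l(3,4,1,2)] show ?thesis by simp
qed

lemma pre_ctx_cong:
  assumes "cteq \<Lambda> \<Lambda>'"
  shows "cteq (pre_ctx \<Lambda> @ idx \<Lambda>) (pre_ctx \<Lambda>' @ idx \<Lambda>')"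
proof -
  let ?n = "length \<Lambda>"
  have c: "ctx \<Lambda>" using assms cteq_ctx by blast
  have ci: "ctx (idx \<Lambda>)" using is_ctx_idx[OF c(1)] .
  have \<Lambda>i: "cteq (\<Lambda> @ idx \<Lambda>) (\<Lambda>' @ idx \<Lambda>')"
    using cteq_append_closed[OF assms idx_cong[OF assms]] .
  then have c1: "ctx (\<Lambda> @ idx \<Lambda>)" using cteq_ctx by blast
  have l: "length \<Lambda>' = ?n" using ctx_eq_length[OF assms] .
  have "isel (\<Lambda> @ idx \<Lambda>) (vars 0 (?n + (?n + (?n + ?n)))) (\<Lambda> @ idx \<Lambda>)"
    by (rule elems_eq_vars_0[OF c1]) simp
  then have v: "isel (\<Lambda> @ idx \<Lambda>) (vars 0 ?n) \<Lambda>" "isel (\<Lambda> @ idx \<Lambda>) (vars (3 * ?n) ?n) \<Lambda>"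
    unfolding vars_add by (simp_all add: elems_eq_idx_append c tsubst_closed[OF c] numeral_3_eq_3 add.assoc)
  have "cteq (id_tel \<Lambda> (vars 0 ?n) (vars (3 * ?n) ?n) @ \<Lambda> @ idx \<Lambda>) (id_tel \<Lambda>' (vars 0 ?n) (vars
      (3 * ?n) ?n) @ \<Lambda> @ idx \<Lambda>)"
    by (rule id_tel_cteq[OF assms c1 v])
  from ctx_eq_change_right[OF _ this \<Lambda>i] show ?thesis by (simp add: pre_ctx_def l)
qed

context
  fixes \<Lambda> \<Lambda>' :: "'s expr list"
  assumes \<Lambda>: "cteq \<Lambda> \<Lambda>'"
begin

private abbreviation (input) "comp_tel \<equiv> id_tel \<Lambda> (vars (length \<Lambda>) (length \<Lambda>)) (vars (3*(length \<Lambda>)) (length \<Lambda>))"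
private abbreviation (input) "comp_tel' \<equiv> id_tel \<Lambda>' (vars (length \<Lambda>) (length \<Lambda>)) (vars (3*(length \<Lambda>)) (length \<Lambda>))"

text \<open>The hypotheses of \<open>J_inst\<close> for elimination on \<open>q\<close>. The
  variables are \<open>p, x, q, z, y\<close> from the newest on; the motive \<open>Id(x, z)\<close>
  becomes \<open>Id(x, y)\<close> at \<open>q = r(y)\<close>, and the method is the variable
  \<open>p\<close>.\<close>

lemma id_comp_aux:
  shows "ctx \<Lambda>" "length \<Lambda>' = length \<Lambda>"
    and "cteq (comp_tel @ pre_ctx \<Lambda> @ idx \<Lambda>) (comp_tel' @ pre_ctx \<Lambda>' @ idx \<Lambda>')"
    and "isel (tsubst (rsub \<Lambda>) (pre_ctx \<Lambda>) @ \<Lambda>) (vars 0 (length \<Lambda>)) (tsubst (ups (length (pre_ctx \<Lambda>))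
        (rsub \<Lambda>)) comp_tel)"
proof -
  let ?n = "length \<Lambda>"
  show c: "ctx \<Lambda>" using \<Lambda> cteq_ctx by blast
  show l: "length \<Lambda>' = length \<Lambda>" using ctx_eq_length[OF \<Lambda>] .
  let ?\<Psi> = "pre_ctx \<Lambda> @ idx \<Lambda>"
  have ci: "ctx ?\<Psi>" using pre_ctx_cong[OF \<Lambda>] cteq_ctx by blast
  have "isel ?\<Psi> (vars 0 ((?n + ?n) + (?n + (?n + ?n)))) ?\<Psi>"
    by (rule elems_eq_vars_0[OF ci]) simp
  then have "isel ?\<Psi> (vars (4*?n) ?n) \<Lambda> \<and> isel ?\<Psi> (vars (3*?n) ?n) \<Lambda> \<and>
     isel ?\<Psi> (vars 0 ?n @ vars ?n ?n) (tsubst (sb 0 (vars (2*?n) ?n @ vars (3*?n) ?n @ vars (4*?n) ?n))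
         (pre_ctx \<Lambda>))"
    using elems_eq_idx_append[OF c, of "vars (4*?n) ?n" "vars (3*?n) ?n" "vars
        (2*?n) ?n" "vars 0 ?n @ vars ?n ?n" "pre_ctx \<Lambda>"
       "vars (4*?n) ?n" "vars (3*?n) ?n" "vars (2*?n) ?n" "vars 0 ?n @ vars ?n ?n"]
    unfolding vars_add by (simp add: numeral_eq_Suc add.assoc)
  then have v: "isel ?\<Psi> (vars (3*?n) ?n) \<Lambda>" "isel ?\<Psi> (vars ?n ?n) \<Lambda>"
    using elems_pre_ctx[OF c] by simp_all
  from id_tel_cteq[OF \<Lambda> ci v(2,1)] have "cteq (comp_tel @ ?\<Psi>) (comp_tel' @ ?\<Psi>)" .
  from ctx_eq_change_right[OF _ this pre_ctx_cong[OF \<Lambda>]]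
  show "cteq (comp_tel @ pre_ctx \<Lambda> @ idx \<Lambda>) (comp_tel' @ pre_ctx \<Lambda>' @ idx \<Lambda>')" by (simp add: l)
  have "map (subst (ups ?n (rsub \<Lambda>))) (vars 0 ?n) = vars 0 ?n" "map (subst (ups ?n (rsub \<Lambda>))) (vars
      (3*?n) ?n) = vars ?n ?n"
    by (auto intro!: nth_equalityI simp: ups_eq rl_def nth_append)
  then have t1: "tsubst (rsub \<Lambda>) (pre_ctx \<Lambda>) = id_tel \<Lambda> (vars 0 ?n) (vars ?n ?n) @ \<Lambda>"
    by (simp add: pre_ctx_def tsubst_append tsubst_closed tsubst_id_tel c)
  have "map (subst (ups (?n + ?n) (rsub \<Lambda>))) (vars ?n ?n) = vars ?n ?n" "map (subst (ups (?n + ?n) (rsub \<Lambda>))) (vars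
      (3*?n) ?n) = vars (2*?n) ?n"
    by (auto intro!: nth_equalityI simp: ups_eq rl_def nth_append)
  then have t2: "tsubst (ups (length (pre_ctx \<Lambda>)) (rsub \<Lambda>)) comp_tel = id_tel \<Lambda> (vars ?n ?n) (vars (2*?n) ?n)"
    by (simp add: tsubst_id_tel c)
  have "esub \<Lambda> (rsub \<Lambda>) (rsub \<Lambda>) (idx \<Lambda>)" using esub_rsub J_ok is_ctx_cteq_refl c by blast
  from is_ctx_tsubst[OF this ci] have c3: "ctx (id_tel \<Lambda> (vars 0 ?n) (vars ?n ?n) @ \<Lambda> @ \<Lambda>)" unfolding t1 by simp
  let ?\<Omega> = "id_tel \<Lambda> (vars 0 ?n) (vars ?n ?n) @ \<Lambda> @ \<Lambda>"
  have "isel ?\<Omega> (vars 0 (?n + (?n + ?n))) ?\<Omega>"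
    by (rule elems_eq_vars_0[OF c3]) simp
  then have "isel ?\<Omega> (vars 0 ?n) (tsubst (sb 0 (vars ?n ?n @ vars (2*?n) ?n)) (id_tel \<Lambda> (vars 0 ?n) (vars ?n ?n)))"
    unfolding vars_add by (simp add: elems_eq_append mult_2)
  moreover have "insts (vars ?n ?n @ vars (2*?n) ?n) (vars 0 ?n) = (vars ?n ?n :: 's expr list)"
    "insts (vars ?n ?n @ vars (2*?n) ?n) (vars ?n ?n) = (vars (2*?n) ?n :: 's expr list)"
    by (simp_all add: insts_vars)
  ultimately show "isel (tsubst (rsub \<Lambda>) (pre_ctx \<Lambda>) @ \<Lambda>) (vars 0 ?n) (tsubst (ups (length (pre_ctx \<Lambda>))
      (rsub \<Lambda>)) comp_tel)"
    unfolding t1 t2 by (simp add: tsubst_id_tel c)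
qed

lemma id_comp_cong:
  assumes \<Omega>: "ctx \<Omega>" and x: "eleq \<Omega> x x' \<Lambda>" and y: "eleq \<Omega> y y' \<Lambda>" and z: "eleq \<Omega> z z' \<Lambda>"
    and q: "eleq \<Omega> q q' (id_tel \<Lambda> y z)" and p: "eleq \<Omega> p p' (id_tel \<Lambda> x y)"
  shows "eleq \<Omega> (id_comp \<Lambda> x y z q p) (id_comp \<Lambda>' x' y' z' q' p') (id_tel \<Lambda> x z)"
proof -
  let ?n = "length \<Lambda>"
  note a = id_comp_aux
  have l: "length x = ?n" "length x' = ?n" "length y = ?n" "length y' = ?n" "length p = ?n" "length p' = ?n"
      "length z = ?n" "length z' = ?n" "length q = ?n" "length q' = ?n"
    using elems_eq_length[OF x] elems_eq_length[OF y] elems_eq_length[OF p]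
      elems_eq_length[OF z] elems_eq_length[OF q] by simp_all
  have "eleq \<Omega> ((p @ x) @ q @ z @ y) ((p' @ x') @ q' @ z' @ y') (pre_ctx \<Lambda> @ idx \<Lambda>)"
    using elems_eq_idx_append[OF a(1) l(3,7,9) _ l(4,8,10), of "p @ x" "pre_ctx \<Lambda>" "p' @ x'"]
      elems_pre_ctx[OF a(1) l(3,7,9,1,2,5,6)] x y z p q l by simp
  from J_inst_cong[OF \<Lambda> a(3) _ a(4) \<Omega> this]
  have *: "eleq \<Omega> (id_comp \<Lambda> x y z q p) (id_comp \<Lambda>' x' y' z' q' p') (tsubst (sb 0 ((p @ x) @ q @ z @ y)) comp_tel)"
    unfolding id_comp_def Let_def a(2) by (simp add: a(2) pre_ctx_def)
  have "insts ((p @ x) @ q @ z @ y) (vars (3*?n) ?n) = z" "insts ((p @ x) @ q @ z @ y) (vars ?n ?n) = x"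
    using l by (simp_all add: insts_vars)
  then have "tsubst (sb 0 ((p @ x) @ q @ z @ y)) comp_tel = id_tel \<Lambda> x z"
    by (simp add: tsubst_id_tel a)
  then show ?thesis using * by simp
qed

lemma id_comp_refl_left:
  assumes \<Omega>: "ctx \<Omega>" and x: "isel \<Omega> x \<Lambda>" and y: "isel \<Omega> y \<Lambda>" and p: "isel \<Omega> p (id_tel \<Lambda> x y)"
  shows "eleq \<Omega> (id_comp \<Lambda> x y y (refl_at \<Lambda> y) p) p (id_tel \<Lambda> x y)"
proof -
  let ?n = "length \<Lambda>"
  note a = id_comp_aux
  have l: "length x = ?n" "length y = ?n" "length p = ?n"
    using elems_eq_length[OF x] elems_eq_length[OF y] elems_eq_length[OF p] by simp_all
  have "isel \<Omega> (p @ x) (tsubst (sb 0 (refl_at \<Lambda> y @ y @ y)) (pre_ctx \<Lambda>))"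
    using elems_pre_ctx[OF a(1) l(2,2) _ l(1,1,3,3), of "refl_at \<Lambda> y"] x p by simp
  from J_inst_refl[OF \<Lambda> a(3) _ a(4) \<Omega> y this]
  have *: "eleq \<Omega> (id_comp \<Lambda> x y y (refl_at \<Lambda> y) p) (insts ((p @ x) @ y) (vars 0 ?n)) (tsubst (sb 0
      ((p @ x) @ refl_at \<Lambda> y @ y @ y)) comp_tel)"
    unfolding id_comp_def Let_def by (simp add: a(2) pre_ctx_def)
  have "insts ((p @ x) @ refl_at \<Lambda> y @ y @ y) (vars (3*?n) ?n) = y" "insts ((p @ x) @ refl_at \<Lambda> y @ y @ y)
      (vars ?n ?n) = x"
    "insts ((p @ x) @ y) (vars 0 ?n) = p"
    using l by (simp_all add: insts_vars)
  then show ?thesis using * by (simp add: tsubst_id_tel a)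
qed

lemma map_subst_id_comp:
  assumes "length x = length \<Lambda>" "length y = length \<Lambda>" "length z = length \<Lambda>" "length q = length \<Lambda>" "length p =
      length \<Lambda>"
  shows "map (subst \<sigma>) (id_comp \<Lambda> x y z q p) =
    id_comp \<Lambda> (map (subst \<sigma>) x) (map (subst \<sigma>) y) (map (subst \<sigma>) z) (map (subst \<sigma>) q) (map (subst \<sigma>) p)"
proof -
  let ?n = "length \<Lambda>"
  note a = id_comp_aux
  from J_scoped[OF \<Lambda> a(3) _ a(4) a(1)] show ?thesis
    unfolding id_comp_def Let_def
    by (subst map_subst_insts) (simp_all add: assms a(2) pre_ctx_def numeral_3_eq_3 add.assoc)
qed

end

end

lemma J_tel_length [simp]: "length (J_tel A \<Delta> \<Theta> d) = length \<Theta>"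
  by (induction \<Theta> arbitrary: d) (auto simp: Let_def)

lemma J_ctx_length: "length d = length \<Theta> \<Longrightarrow> length (J_ctx \<Lambda> \<Delta> \<Theta> d) = length \<Theta>"
  by (induction \<Lambda> arbitrary: \<Delta> \<Theta> d) (simp_all add: Let_def)

lemma id_map_length [simp]: "length (id_map \<Lambda> \<Delta> h x y p) = length \<Delta>"
  by (simp add: id_map_def Let_def J_ctx_length refl_at_def)

lemma id_comp_length [simp]: "length (id_comp \<Lambda> x y z q p) = length \<Lambda>"
  by (simp add: id_comp_def Let_def J_ctx_length)

section \<open>Unit laws, functoriality and naturality\<close>

context ml2_theory
begin

lemma hom_inst:
  assumes "ctx \<Delta>" "eleq \<Lambda> h h' \<Delta>" "ctx \<Omega>" "ctx \<Lambda>" "eleq \<Omega> x x' \<Lambda>"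
  shows "eleq \<Omega> (insts x h) (insts x' h') \<Delta>"
  using elems_eq_comp[OF assms(2) esub_instI[OF assms(3,4,5)]] tsubst_closed[OF assms(1)] by simp

lemma cell_inst:
  assumes "ctx \<Delta>" "eleq \<Lambda> \<alpha> \<alpha>' (id_tel \<Delta> f g)" "ctx \<Omega>" "ctx \<Lambda>" "eleq \<Omega> x x' \<Lambda>"
    "length f = length \<Delta>" "length g = length \<Delta>"
  shows "eleq \<Omega> (insts x \<alpha>) (insts x' \<alpha>') (id_tel \<Delta> (insts x f) (insts x g))"
  using elems_eq_comp[OF assms(2) esub_instI[OF assms(3,4,5)]] tsubst_id_tel[OF assms(1,6,7)] by simp

lemma id_tel_trans:
  assumes "ctx \<Lambda>" "ctx \<Omega>" "isel \<Omega> x \<Lambda>" "isel \<Omega> y \<Lambda>"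
    "eleq \<Omega> p q (id_tel \<Lambda> x y)" "eleq \<Omega> q r (id_tel \<Lambda> x y)"
  shows "eleq \<Omega> p r (id_tel \<Lambda> x y)"
  using elems_eq_trans[OF assms(5,6) is_ctx_id_tel[OF assms(1-4)]] .

lemma id_tel_sym:
  assumes "ctx \<Lambda>" "ctx \<Omega>" "isel \<Omega> x \<Lambda>" "isel \<Omega> y \<Lambda>"
    "eleq \<Omega> p q (id_tel \<Lambda> x y)"
  shows "eleq \<Omega> q p (id_tel \<Lambda> x y)"
  using elems_eq_sym[OF assms(5) is_ctx_id_tel[OF assms(1-4)]] .

lemma scoped_hom: "eleq \<Lambda> h h' \<Delta> \<Longrightarrow> length x = length \<Lambda> \<Longrightarrow> \<forall>e\<in>set h. scoped (length x) e"
  using elems_eq_scoped by simp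

lemma insts_insts_hom: "eleq \<Lambda> h h' \<Delta> \<Longrightarrow> length y = length \<Lambda> \<Longrightarrow> insts x (insts y h) = insts (insts x y) h"
  using insts_insts[OF scoped_hom] .

lemma map_subst_insts_hom:
  "eleq \<Lambda> h h' \<Delta> \<Longrightarrow> length y = length \<Lambda> \<Longrightarrow> map (subst \<sigma>) (insts y h) = insts (map (subst \<sigma>) y) h"
  using map_subst_insts[OF scoped_hom] .

lemma insts_vars_0: "length x = n \<Longrightarrow> insts x (vars 0 n) = x"
  by (simp add: insts_vars)

text \<open>Composition computes only at a reflexivity on the left. The right unit law therefore
  goes through \<open>J_eq\<close>, and at \<open>p = r(x)\<close> it becomes the left one.\<close>

lemma id_comp_refl_right:
  assumes c: "ctx \<Lambda>" and "ctx \<Omega>" "isel \<Omega> x \<Lambda>" "isel \<Omega> y \<Lambda>" "isel \<Omega> p (id_tel \<Lambda> x y)"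
  shows "eleq \<Omega> (id_comp \<Lambda> x x y p (refl_at \<Lambda> x)) p (id_tel \<Lambda> x y)"
proof -
  note cc = is_ctx_cteq_refl[OF c]
  show ?thesis
  proof (rule J_eq[of "[]" \<Lambda> \<Lambda> "\<lambda>_ p y x. id_comp \<Lambda> x x y p
      (refl_at \<Lambda> x)" "\<lambda>_ p y x. p" "\<lambda>_ p y x. x" "\<lambda>_ p y x. y", of _ x y p "[]"])
    show "ctx ([] @ idx \<Lambda>)" using is_ctx_idx[OF c] by simp
  next
    fix \<Omega> \<delta> x assume "ctx \<Omega>" "isel \<Omega> x \<Lambda>"
    then show "eleq \<Omega> (id_comp \<Lambda> x x x (refl_at \<Lambda> x) (refl_at \<Lambda> x)) (refl_at \<Lambda> x) (id_tel \<Lambda> x x)"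
      using id_comp_refl_left[OF cc] refl_at_typed[OF c] by blast
  qed (use assms in \<open>auto simp: map_subst_id_comp[OF cc] map_subst_refl_at intro!: id_comp_cong[OF cc]
      refl_at_typed\<close>)
qed

text \<open>Elimination on \<open>q\<close>, keeping \<open>x\<close> and \<open>p\<close> in the
  post-context: at \<open>q = r(y)\<close> both sides reduce to the image of
  \<open>p\<close>.\<close>

lemma id_map_comp:
  assumes c: "ctx \<Lambda>" "ctx \<Delta>" and h: "isel \<Lambda> h \<Delta>" and \<Omega>: "ctx \<Omega>" and x: "isel \<Omega> x \<Lambda>"
    and y: "isel \<Omega> y \<Lambda>" and z: "isel \<Omega> z \<Lambda>"
    and p: "isel \<Omega> p (id_tel \<Lambda> x y)" and q: "isel \<Omega> q (id_tel \<Lambda> y z)"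
  shows "eleq \<Omega> (id_map \<Lambda> \<Delta> h x z (id_comp \<Lambda> x y z q p))
    (id_comp \<Delta> (insts x h) (insts y h) (insts z h) (id_map \<Lambda> \<Delta> h y z q) (id_map \<Lambda> \<Delta> h x y p))
    (id_tel \<Delta> (insts x h) (insts z h))"
proof -
  note cc = is_ctx_cteq_refl[OF c(1)] is_ctx_cteq_refl[OF c(2)]
  note h_inst = hom_inst[OF c(2) h _ c(1)]
  note comp\<Lambda> = id_comp_cong[OF cc(1)] and comp\<Delta> = id_comp_cong[OF cc(2)] and map = id_map_cong[OF cc h]
  let ?n = "length \<Lambda>"
  have l: "length x = ?n" "length y = ?n" "length z = ?n" "length p = ?n" "length q = ?n"
    using elems_eq_length[OF x] elems_eq_length[OF y] elems_eq_length[OF z] elems_eq_length[OF p]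
      elems_eq_length[OF q] by simp_all
  have lh: "length h = length \<Delta>" using elems_eq_length[OF h] by simp
  \<comment> \<open>\<open>J_eq\<close> passes the post-context as a single list \<delta>, which is
    \<open>p @ x\<close>; \<open>take\<close> and \<open>drop\<close> recover the two parts.\<close>
  let ?L = "\<lambda>\<delta> q z y. id_map \<Lambda> \<Delta> h (drop ?n \<delta>) z (id_comp \<Lambda> (drop ?n \<delta>) y z q (take ?n \<delta>))"
  let ?R = "\<lambda>\<delta> q z y. id_comp \<Delta> (insts (drop ?n \<delta>) h) (insts y h) (insts z h)
    (id_map \<Lambda> \<Delta> h y z q) (id_map \<Lambda> \<Delta> h (drop ?n \<delta>) y (take ?n \<delta>))"
  let ?F = "\<lambda>\<delta> q z y. insts (drop ?n \<delta>) h" and ?G = "\<lambda>\<delta> q z y. insts z h"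
  have "eleq \<Omega> (?L (p @ x) q z y) (?R (p @ x) q z y) (id_tel \<Delta> (?F (p @ x) q z y) (?G (p @ x) q z y))"
  proof (rule J_eq[of "pre_ctx \<Lambda>" \<Lambda> \<Delta> ?L ?R ?F ?G \<Omega> y z q "p @ x"])
    show "ctx (pre_ctx \<Lambda> @ idx \<Lambda>)" using pre_ctx_cong[OF cc(1)] cteq_ctx by blast
    show "isel \<Omega> (p @ x) (tsubst (sb 0 (q @ z @ y)) (pre_ctx \<Lambda>))"
      using elems_pre_ctx[OF c(1) l(2,3,5,1,1,4,4)] x p by simp
  next
    fix \<Omega> \<delta> q z y
    assume a: "ctx \<Omega>" "isel \<Omega> y \<Lambda>" "isel \<Omega> z \<Lambda>" "isel \<Omega> q (id_tel \<Lambda> y z)"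
      "isel \<Omega> \<delta> (tsubst (sb 0 (q @ z @ y)) (pre_ctx \<Lambda>))"
      and l: "length q = ?n" "length z = ?n" "length y = ?n"
    from elems_pre_ctxE[OF c(1) l(3,2,1) a(5)] obtain p x where
      b: "\<delta> = p @ x" "length x = ?n" "length p = ?n" "isel \<Omega> x \<Lambda>" "isel \<Omega> p (id_tel \<Lambda> x y)"
      by (metis append_eq_append_conv)
    show "isel \<Omega> (insts (drop ?n \<delta>) h) \<Delta> \<and>
       isel \<Omega> (insts z h) \<Delta> \<and>
       isel \<Omega> (id_map \<Lambda> \<Delta> h (drop ?n \<delta>) z (id_comp \<Lambda> (drop ?n \<delta>) y z q (take ?n \<delta>)))
        (id_tel \<Delta> (insts (drop ?n \<delta>) h) (insts z h)) \<and>
       isel \<Omega> (id_comp \<Delta> (insts (drop ?n \<delta>) h) (insts y h) (insts z h) (id_map \<Lambda> \<Delta> h y z q) (id_map \<Lambda> \<Delta> h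
           (drop ?n \<delta>) y (take ?n \<delta>)))
        (id_tel \<Delta> (insts (drop ?n \<delta>) h) (insts z h))"
      using a b by (auto intro!: h_inst map comp\<Lambda> comp\<Delta>)
  next
    fix \<Omega> \<delta> y
    assume a: "ctx \<Omega>" "isel \<Omega> y \<Lambda>"
      "isel \<Omega> \<delta> (tsubst (sb 0 (refl_at \<Lambda> y @ y @ y)) (pre_ctx \<Lambda>))"
      and l: "length y = ?n"
    from elems_pre_ctxE[OF c(1) l l refl_at_length a(3)] obtain p x where
      b: "\<delta> = p @ x" "length x = ?n" "length p = ?n" "isel \<Omega> x \<Lambda>" "isel \<Omega> p (id_tel \<Lambda> x y)"
      by (metis append_eq_append_conv)
    note hx = h_inst[OF a(1) b(4)] and hy = h_inst[OF a(1,2)]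
    note r = refl_at_typed[OF c(1) a(1,2)]
    have mp: "isel \<Omega> (id_map \<Lambda> \<Delta> h x y p) (id_tel \<Delta> (insts x h) (insts y h))"
      by (rule map[OF a(1) b(4) a(2) b(5)])
    have 1: "eleq \<Omega> (id_map \<Lambda> \<Delta> h x y (id_comp \<Lambda> x y y (refl_at \<Lambda> y) p)) (id_map \<Lambda> \<Delta> h x y p)
      (id_tel \<Delta> (insts x h) (insts y h))"
      by (rule map[OF a(1) b(4) a(2) id_comp_refl_left[OF cc(1) a(1) b(4) a(2) b(5)]])
    have 2: "eleq \<Omega> (id_comp \<Delta> (insts x h) (insts y h) (insts y h) (id_map \<Lambda> \<Delta> h y y (refl_at \<Lambda> y))
        (id_map \<Lambda> \<Delta> h x y p))
      (id_comp \<Delta> (insts x h) (insts y h) (insts y h) (refl_at \<Delta> (insts y h)) (id_map \<Lambda> \<Delta> h x y p))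
      (id_tel \<Delta> (insts x h) (insts y h))"
      by (rule comp\<Delta>[OF a(1) hx hy hy id_map_refl[OF cc h a(1,2)] mp])
    note t = id_tel_trans[OF c(2) a(1) hx hy] and s = id_tel_sym[OF c(2) a(1) hx hy]
    show "eleq \<Omega> (id_map \<Lambda> \<Delta> h (drop ?n \<delta>) y (id_comp \<Lambda> (drop ?n \<delta>) y y (refl_at \<Lambda> y) (take ?n \<delta>)))
        (id_comp \<Delta> (insts (drop ?n \<delta>) h) (insts y h) (insts y h) (id_map \<Lambda> \<Delta> h y y (refl_at \<Lambda> y)) (id_map \<Lambda> \<Delta> h
            (drop ?n \<delta>) y (take ?n \<delta>)))
        (id_tel \<Delta> (insts (drop ?n \<delta>) h) (insts y h))"
      using t[OF 1 s[OF t[OF 2 id_comp_refl_left[OF cc(2) a(1) hx hy mp]]]] b(1-3) by simp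
  qed (rule c \<Omega> y z q |
      (elim disjE; simp add: map_subst_id_comp[OF cc(1)] map_subst_id_comp[OF cc(2)] map_subst_id_map[OF cc h]
         map_subst_insts_hom[OF h] lh drop_map take_map del: map_map))+
  then show ?thesis using l by simp
qed

text \<open>Both sides send the reflexivity at \<open>x\<close> to the reflexivity at the image of
  \<open>x\<close>, and \<open>J_eq\<close> extends this to all identities.\<close>

lemma id_map_id_map:
  assumes c: "ctx \<Lambda>" "ctx \<Delta>" "ctx \<Phi>" and h: "isel \<Lambda> h \<Delta>" and g: "isel \<Delta> g \<Phi>"
    and "ctx \<Omega>" "isel \<Omega> x \<Lambda>" "isel \<Omega> y \<Lambda>" "isel \<Omega> p (id_tel \<Lambda> x y)"
  shows "eleq \<Omega> (id_map \<Lambda> \<Phi> (insts h g) x y p)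
    (id_map \<Delta> \<Phi> g (insts x h) (insts y h) (id_map \<Lambda> \<Delta> h x y p))
    (id_tel \<Phi> (insts x (insts h g)) (insts y (insts h g)))"
proof -
  note cc = is_ctx_cteq_refl[OF c(1)] is_ctx_cteq_refl[OF c(2)] is_ctx_cteq_refl[OF c(3)]
  have gh: "isel \<Lambda> (insts h g) \<Phi>" by (rule hom_inst[OF c(3) g c(1,2) h])
  note h_inst = hom_inst[OF c(2) h _ c(1)] and gh_inst = hom_inst[OF c(3) gh _ c(1)]
  note maph = id_map_cong[OF cc(1,2) h] and mapg = id_map_cong[OF cc(2,3) g] and mapgh = id_map_cong[OF cc(1,3) gh]
  have lh: "length h = length \<Delta>" using elems_eq_length[OF h] by simp
  have e: "insts x (insts h g) = insts (insts x h) g" for x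
    by (rule insts_insts_hom[OF g lh])
  show ?thesis
  proof (rule J_eq[of "[]" \<Lambda> \<Phi> "\<lambda>_ p y x. id_map \<Lambda> \<Phi> (insts h g) x y p"
      "\<lambda>_ p y x. id_map \<Delta> \<Phi> g (insts x h) (insts y h) (id_map \<Lambda> \<Delta> h x y p)" "\<lambda>_ p y x. insts x
          (insts h g)" "\<lambda>_ p y x. insts y (insts h g)", of _ x y p "[]"])
    show "ctx ([] @ idx \<Lambda>)" using is_ctx_idx[OF c(1)] by simp
  next
    fix \<Omega> \<delta> x assume a: "ctx \<Omega>" "isel \<Omega> x \<Lambda>"
    note hx = h_inst[OF a] and ghx = gh_inst[OF a]
    have "eleq \<Omega> (id_map \<Lambda> \<Phi> (insts h g) x x (refl_at \<Lambda> x)) (refl_at \<Phi> (insts x (insts h g)))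
        (id_tel \<Phi> (insts x (insts h g)) (insts x (insts h g)))"
      by (rule id_map_refl[OF cc(1,3) gh a])
    moreover have "eleq \<Omega> (id_map \<Delta> \<Phi> g (insts x h) (insts x h) (id_map \<Lambda> \<Delta> h x x (refl_at \<Lambda> x)))
        (id_map \<Delta> \<Phi> g (insts x h) (insts x h) (refl_at \<Delta> (insts x h)))
        (id_tel \<Phi> (insts x (insts h g)) (insts x (insts h g)))"
      unfolding e by (rule mapg[OF a(1) hx hx id_map_refl[OF cc(1,2) h a]])
    moreover have "eleq \<Omega> (id_map \<Delta> \<Phi> g (insts x h) (insts x h) (refl_at \<Delta> (insts x h))) (refl_at \<Phi> (insts x
        (insts h g)))
        (id_tel \<Phi> (insts x (insts h g)) (insts x (insts h g)))"
      unfolding e by (rule id_map_refl[OF cc(2,3) g a(1) hx])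
    ultimately show "eleq \<Omega> (id_map \<Lambda> \<Phi> (insts h g) x x (refl_at \<Lambda> x))
        (id_map \<Delta> \<Phi> g (insts x h) (insts x h) (id_map \<Lambda> \<Delta> h x x (refl_at \<Lambda> x)))
        (id_tel \<Phi> (insts x (insts h g)) (insts x (insts h g)))"
      using id_tel_trans[OF c(3) a(1) ghx ghx] id_tel_sym[OF c(3) a(1) ghx ghx] by blast
  next
    fix \<Omega> \<delta> p y x
    assume a: "ctx \<Omega>" "isel \<Omega> x \<Lambda>" "isel \<Omega> y \<Lambda>" "isel \<Omega> p (id_tel \<Lambda> x y)"
    have "isel \<Omega> (id_map \<Delta> \<Phi> g (insts x h) (insts y h) (id_map \<Lambda> \<Delta> h x y p))
        (id_tel \<Phi> (insts x (insts h g)) (insts y (insts h g)))"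
      unfolding e by (rule mapg[OF a(1) h_inst[OF a(1,2)] h_inst[OF a(1,3)] maph[OF a]])
    then show "isel \<Omega> (insts x (insts h g)) \<Phi> \<and>
       isel \<Omega> (insts y (insts h g)) \<Phi> \<and>
       isel \<Omega> (id_map \<Lambda> \<Phi> (insts h g) x y p)
        (id_tel \<Phi> (insts x (insts h g)) (insts y (insts h g))) \<and>
       isel \<Omega> (id_map \<Delta> \<Phi> g (insts x h) (insts y h) (id_map \<Lambda> \<Delta> h x y p))
        (id_tel \<Phi> (insts x (insts h g)) (insts y (insts h g)))"
      using gh_inst[OF a(1,2)] gh_inst[OF a(1,3)] mapgh[OF a] by blast
  qed (use assms in \<open>auto simp: map_subst_id_map[OF cc(1,2) h] map_subst_id_map[OF cc(2,3) g] map_subst_id_map[OF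
      cc(1,3) gh]
       map_subst_insts_hom[OF h] map_subst_insts_hom[OF gh] lh simp del: map_map\<close>)
qed

text \<open>At \<open>p = r(x)\<close> the two sides are the two unit laws for the component of
  \<kappa> at \<open>x\<close>. This is why whiskering the two ends of a 2-cell gives a commutative
  square.\<close>

lemma id_comp_natural:
  assumes c: "ctx \<Lambda>" "ctx \<Delta>" and f: "isel \<Lambda> f \<Delta>" and g: "isel \<Lambda> g \<Delta>" and k: "isel \<Lambda> \<kappa> (id_tel \<Delta> f g)"
    and "ctx \<Omega>" "isel \<Omega> x \<Lambda>" "isel \<Omega> y \<Lambda>" "isel \<Omega> p (id_tel \<Lambda> x y)"
  shows "eleq \<Omega> (id_comp \<Delta> (insts x f) (insts y f) (insts y g) (insts y \<kappa>) (id_map \<Lambda> \<Delta> f x y p))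
    (id_comp \<Delta> (insts x f) (insts x g) (insts y g) (id_map \<Lambda> \<Delta> g x y p) (insts x \<kappa>))
    (id_tel \<Delta> (insts x f) (insts y g))"
proof -
  note cc = is_ctx_cteq_refl[OF c(1)] is_ctx_cteq_refl[OF c(2)]
  note f_inst = hom_inst[OF c(2) f _ c(1)] and g_inst = hom_inst[OF c(2) g _ c(1)]
  note mapf = id_map_cong[OF cc f] and mapg = id_map_cong[OF cc g] and comp = id_comp_cong[OF cc(2)]
  have lf: "length f = length \<Delta>" "length g = length \<Delta>" "length \<kappa> = length \<Delta>"
    using elems_eq_length[OF f] elems_eq_length[OF g] elems_eq_length[OF k] by simp_all
  note k_inst = cell_inst[OF c(2) k _ c(1) _ lf(1,2)]
  show ?thesis
  proof (rule J_eq[of "[]" \<Lambda> \<Delta> "\<lambda>_ p y x. id_comp \<Delta> (insts x f) (insts y f) (insts y g) (insts y \<kappa>)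
      (id_map \<Lambda> \<Delta> f x y p)"
      "\<lambda>_ p y x. id_comp \<Delta> (insts x f) (insts x g) (insts y g) (id_map \<Lambda> \<Delta> g x y p)
          (insts x \<kappa>)" "\<lambda>_ p y x. insts x f" "\<lambda>_ p y x. insts y g", of _ x y p "[]"])
    show "ctx ([] @ idx \<Lambda>)" using is_ctx_idx[OF c(1)] by simp
  next
    fix \<Omega> \<delta> x assume a: "ctx \<Omega>" "isel \<Omega> x \<Lambda>"
    note fx = f_inst[OF a] and gx = g_inst[OF a] and kx = k_inst[OF a]
    have "eleq \<Omega> (id_comp \<Delta> (insts x f) (insts x f) (insts x g) (insts x \<kappa>) (id_map \<Lambda> \<Delta> f x x (refl_at \<Lambda> x)))
        (id_comp \<Delta> (insts x f) (insts x f) (insts x g) (insts x \<kappa>) (refl_at \<Delta> (insts x f)))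
        (id_tel \<Delta> (insts x f) (insts x g))"
      by (rule comp[OF a(1) fx fx gx kx id_map_refl[OF cc f a]])
    moreover have "eleq \<Omega> (id_comp \<Delta> (insts x f) (insts x g) (insts x g) (id_map \<Lambda> \<Delta> g x x (refl_at \<Lambda> x))
        (insts x \<kappa>))
        (id_comp \<Delta> (insts x f) (insts x g) (insts x g) (refl_at \<Delta> (insts x g)) (insts x \<kappa>))
        (id_tel \<Delta> (insts x f) (insts x g))"
      by (rule comp[OF a(1) fx gx gx id_map_refl[OF cc g a] kx])
    moreover note id_comp_refl_left[OF cc(2) a(1) fx gx kx] id_comp_refl_right[OF c(2) a(1) fx gx kx]
    ultimately show "eleq \<Omega> (id_comp \<Delta> (insts x f) (insts x f) (insts x g) (insts x \<kappa>) (id_map \<Lambda> \<Delta> f x x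
        (refl_at \<Lambda> x)))
        (id_comp \<Delta> (insts x f) (insts x g) (insts x g) (id_map \<Lambda> \<Delta> g x x (refl_at \<Lambda> x)) (insts x \<kappa>))
        (id_tel \<Delta> (insts x f) (insts x g))"
      using id_tel_trans[OF c(2) a(1) fx gx] id_tel_sym[OF c(2) a(1) fx gx] by blast
  qed (use assms in \<open>auto simp: map_subst_id_map[OF cc f] map_subst_id_map[OF cc g] map_subst_id_comp[OF cc(2)]
       map_subst_insts_hom[OF f] map_subst_insts_hom[OF g] map_subst_insts_hom[OF k] lf
       simp del: map_map intro!: f_inst g_inst k_inst mapf mapg comp\<close>)
qed

lemma elems_idx_Cons_closed:
  assumes c: "ctx (D # \<Lambda>)"
    and len: "length p = length \<Lambda>" "length p2 = length \<Lambda>"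
    "length x = length \<Lambda>" "length x2 = length \<Lambda>" "length x' = length \<Lambda>" "length x2' = length \<Lambda>"
  shows "eleq \<Omega> (q # p @ y' # x' @ y # x) (q2 # p2 @ y2' # x2' @ y2 # x2) (idx (D # \<Lambda>)) \<longleftrightarrow>
    eleq \<Omega> x x2 \<Lambda> \<and> eleq \<Omega> x' x2' \<Lambda> \<and> eleq \<Omega> p p2 (id_tel \<Lambda> x x') \<and>
    tmeq \<Omega> y y2 (inst x D) \<and> tmeq \<Omega> y' y2' (inst x' D) \<and>
    tmeq \<Omega> q q2 (idT (inst x D) y (inst (y' # p @ x' @ x) (transport (J_ctx \<Lambda>) (length \<Lambda>) D)))"
proof -
  from c have \<Lambda>: "ctx \<Lambda>" and D: "isty \<Lambda> D" by (auto simp: ty_iff)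
  show ?thesis by (rule elems_idx_Cons[OF J_ok[OF is_ctx_cteq_refl[OF \<Lambda>]] D len])
qed

lemma elems_id_tel_Cons:
  assumes c: "ctx (D # \<Lambda>)" and x: "isel \<Omega> x \<Lambda>" "isel \<Omega> x' \<Lambda>" "istm \<Omega> y (inst x D)" "istm \<Omega> y' (inst x' D)"
    and len: "length p = length \<Lambda>" "length p2 = length \<Lambda>"
  shows "eleq \<Omega> (q # p) (q2 # p2) (id_tel (D # \<Lambda>) (y # x) (y' # x')) \<longleftrightarrow>
    eleq \<Omega> p p2 (id_tel \<Lambda> x x') \<and>
    tmeq \<Omega> q q2 (idT (inst x D) y (inst (y' # p @ x' @ x) (transport (J_ctx \<Lambda>) (length \<Lambda>) D)))"
proof -
  note l = elems_eq_length[OF x(1)] elems_eq_length[OF x(2)]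
  have "eleq \<Omega> ((q # p) @ (y' # x') @ y # x) ((q2 # p2) @ (y' # x') @ y # x) (idx (D # \<Lambda>)) \<longleftrightarrow>
     isel \<Omega> (y # x) (D # \<Lambda>) \<and> isel \<Omega> (y' # x') (D # \<Lambda>) \<and> eleq \<Omega> (q # p) (q2 # p2) (id_tel (D # \<Lambda>) (y # x)
         (y' # x'))"
    by (rule elems_idx[OF c]) (simp_all add: len l)
  with elems_idx_Cons_closed[OF c len l(1,1) l(3,3), of \<Omega> q y' y q2 y' y] x show ?thesis by simp
qed

lemma refl_at_Cons: "refl_at (D # \<Lambda>) (y # x) = inst (y # x) (reflT (wk 1 D) (Var 0)) # refl_at \<Lambda> x"
proof -
  have "insts (y # x) (map (wk 1) (refl_ctx \<Lambda>)) = insts x (refl_ctx \<Lambda>)"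
    using insts_wk[of 1 "y # x" "refl_ctx \<Lambda>"] by simp
  then show ?thesis by (simp add: refl_at_def del: map_map)
qed

lemma id_tel_ConsE:
  assumes c: "ctx (D # \<Lambda>)" and X: "isel \<Omega> X (D # \<Lambda>)" "isel \<Omega> Y (D # \<Lambda>)"
    and P: "eleq \<Omega> P P' (id_tel (D # \<Lambda>) X Y)"
  shows "eleq \<Omega> (tl P) (tl P') (id_tel \<Lambda> (tl X) (tl Y))"
proof -
  obtain y x where X': "X = y # x" "isel \<Omega> x \<Lambda>" "istm \<Omega> y (inst x D)" using X(1) by (auto elim: elems_eq_ConsE)
  obtain y' x' where Y': "Y = y' # x'" "isel \<Omega> x' \<Lambda>" "istm \<Omega> y' (inst x' D)" using X(2)
      by (auto elim: elems_eq_ConsE)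
  obtain q p q2 p2 where P': "P = q # p" "P' = q2 # p2" "length p = length \<Lambda>" "length p2 = length \<Lambda>"
    using elems_eq_length[OF P] by (auto simp: length_Suc_conv)
  show ?thesis
    using elems_id_tel_Cons[OF c X'(2) Y'(2) X'(3) Y'(3) P'(3,4)] P unfolding X'(1) Y'(1) P'(1,2) by simp
qed

text \<open>The action of the projection is defined by elimination and not by forgetting an entry;
  the two agree since both send reflexivities to reflexivities. It makes lying over an identity of
  the base a condition on \<open>tl\<close>.\<close>

lemma id_map_proj:
  assumes c: "ctx (D # \<Lambda>)" and "ctx \<Omega>" "isel \<Omega> X (D # \<Lambda>)" "isel \<Omega> Y (D # \<Lambda>)" "isel \<Omega> P (id_tel (D # \<Lambda>) X Y)"
  shows "eleq \<Omega> (id_map (D # \<Lambda>) \<Lambda> (vars 1 (length \<Lambda>)) X Y P) (tl P) (id_tel \<Lambda> (tl X) (tl Y))"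
proof -
  let ?h = "vars 1 (length \<Lambda>) :: 's expr list"
  have c\<Lambda>: "ctx \<Lambda>" using c by simp
  note cc = is_ctx_cteq_refl[OF c] is_ctx_cteq_refl[OF c\<Lambda>]
  have h: "isel (D # \<Lambda>) ?h \<Lambda>" using elems_eq_vars[of "[D]" \<Lambda> 1] c by simp
  have tl: "insts X ?h = tl X" if "length X = Suc (length \<Lambda>)" for X
    using that by (cases X) (simp_all add: insts_vars)
  note map = id_map_cong[OF cc h]
  show ?thesis
  proof (rule J_eq[of "[]" "D # \<Lambda>" \<Lambda> "\<lambda>_ p y x. id_map
      (D # \<Lambda>) \<Lambda> ?h x y p" "\<lambda>_ p y x. tl p" "\<lambda>_ p y x. tl x" "\<lambda>_ p y x. tl y", of _ X Y P "[]"])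
    show "ctx ([] @ idx (D # \<Lambda>))" using is_ctx_idx[OF c] by simp
  next
    fix \<Omega> \<delta> x assume a: "ctx \<Omega>" "isel \<Omega> x (D # \<Lambda>)" "length x = length (D # \<Lambda>)"
    then have "tl (refl_at (D # \<Lambda>) x) = refl_at \<Lambda> (tl x)" by (cases x) (auto simp: refl_at_Cons)
    then show "eleq \<Omega> (id_map (D # \<Lambda>) \<Lambda> ?h x x (refl_at (D # \<Lambda>) x)) (tl (refl_at (D # \<Lambda>) x)) (id_tel \<Lambda> (tl x)
        (tl x))"
      using id_map_refl[OF cc h a(1,2)] tl[of x] a by simp
  next
    fix \<Omega> \<delta> p y x
    assume a: "ctx \<Omega>" "isel \<Omega> x (D # \<Lambda>)" "isel \<Omega> y (D # \<Lambda>)" "isel \<Omega> p (id_tel (D # \<Lambda>) x y)"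
      and l: "length y = length (D # \<Lambda>)" "length x = length (D # \<Lambda>)"
    have "isel \<Omega> (tl x) \<Lambda>" "isel \<Omega> (tl y) \<Lambda>" using a by (auto elim: elems_eq_ConsE)
    then show "isel \<Omega> (tl x) \<Lambda> \<and> isel \<Omega> (tl y) \<Lambda> \<and>
       isel \<Omega> (id_map (D # \<Lambda>) \<Lambda> ?h x y p) (id_tel \<Lambda> (tl x) (tl y)) \<and>
       isel \<Omega> (tl p) (id_tel \<Lambda> (tl x) (tl y))"
      using map[OF a] tl l id_tel_ConsE[OF c a(2,3,4)] by simp
  qed (use assms in \<open>auto simp: map_subst_id_map[OF cc h] map_tl simp del: elems_eq_Cons One_nat_def\<close>)
qed

end

section \<open>Inverses and cancellation\<close>

context ml2_theory
begin

lemma elim_obtain: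
  assumes "elim \<Psi> \<rho> B" "ctx (\<Theta> @ \<Psi>)" "isel B d (tsubst \<rho> \<Theta>)"
  obtains e where "isel \<Psi> e \<Theta>" "eleq B (map (subst \<rho>) e) d (tsubst \<rho> \<Theta>)"
  using assms unfolding elim_def by blast

text \<open>The argument of \<open>J_eq\<close> for an arbitrary lifting property, with the families
  given by their values at the generic element.\<close>

lemma elim_eq_generic:
  assumes el: "elim \<Psi> \<rho> B" and c: "ctx \<Phi>"
    and FG: "isel \<Psi> F \<Phi>" "isel \<Psi> G \<Phi>"
    and LR: "isel \<Psi> L (id_tel \<Phi> F G)" "isel \<Psi> R (id_tel \<Phi> F G)"
    and base: "eleq B (map (subst \<rho>) L) (map (subst \<rho>) R) (id_tel \<Phi> (map (subst \<rho>) F) (map (subst \<rho>) G))"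
    and l: "ctx \<Omega>" "isel \<Omega> l \<Psi>"
  shows "eleq \<Omega> (insts l L) (insts l R) (id_tel \<Phi> (insts l F) (insts l G))"
proof -
  have c\<Psi>: "ctx \<Psi>" using elim_esub[OF el] esub_ctx by blast
  have len: "length F = length \<Phi>" "length G = length \<Phi>"
    using elems_eq_length[OF FG(1)] elems_eq_length[OF FG(2)] by simp_all
  have "eleq \<Psi> L R (id_tel \<Phi> F G)"
    by (rule elim_unique[OF el is_ctx_id_tel[OF c c\<Psi> FG] is_idtel_id_tel LR])
      (use base in \<open>simp add: tsubst_id_tel[OF c len]\<close>)
  from cell_inst[OF c this l(1) c\<Psi> l(2) len] show ?thesis .
qed

text \<open>Symmetry, by elimination from reflexivity. The inverse is kept as a list
  \<open>I\<close> over the variables of \<open>idx \<Lambda>\<close>, together with its congruence,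
  computation and scoping.\<close>

lemma id_inverse:
  assumes c: "ctx \<Lambda>"
  obtains I where "\<And>\<Omega> x x' y y' p p'. ctx \<Omega> \<Longrightarrow> eleq \<Omega> x x' \<Lambda> \<Longrightarrow> eleq \<Omega> y y' \<Lambda> \<Longrightarrow> eleq \<Omega> p p' (id_tel \<Lambda> x y) \<Longrightarrow>
      eleq \<Omega> (insts (p @ y @ x) I) (insts (p' @ y' @ x') I) (id_tel \<Lambda> y x)"
    "\<And>\<Omega> x. ctx \<Omega> \<Longrightarrow> isel \<Omega> x \<Lambda> \<Longrightarrow> eleq \<Omega> (insts (refl_at \<Lambda> x @ x @ x) I) (refl_at \<Lambda> x) (id_tel \<Lambda> x x)"
    "\<forall>e\<in>set I. scoped (3 * length \<Lambda>) e" "length I = length \<Lambda>"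
proof -
  let ?n = "length \<Lambda>"
  have ci: "ctx (idx \<Lambda>)" by (rule is_ctx_idx[OF c])
  have "isel (idx \<Lambda>) (vars 0 (?n + (?n + ?n))) (idx \<Lambda>)"
    by (rule elems_eq_vars_0[OF ci]) simp
  then have v: "isel (idx \<Lambda>) (vars (2*?n) ?n) \<Lambda>" "isel (idx \<Lambda>) (vars ?n ?n) \<Lambda>"
    unfolding vars_add by (simp_all add: elems_idx c mult_2)
  let ?\<Theta> = "id_tel \<Lambda> (vars ?n ?n) (vars (2*?n) ?n)"
  have "map (subst (rsub \<Lambda>)) (vars (2*?n) ?n) = vars 0 ?n" "map (subst (rsub \<Lambda>)) (vars ?n ?n) = vars 0 ?n"
    by (simp_all add: insts_vars rl_def)
  then have t: "tsubst (rsub \<Lambda>) ?\<Theta> = id_tel \<Lambda> (vars 0 ?n) (vars 0 ?n)"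
    by (simp add: tsubst_id_tel c)
  have x0: "isel \<Lambda> (vars 0 ?n) \<Lambda>" by (rule elems_eq_vars_0[OF c refl])
  have el: "elim (idx \<Lambda>) (rsub \<Lambda>) \<Lambda>" using elim_J_ctx[of "[]" \<Lambda>] ci by simp
  have "isel \<Lambda> (refl_at \<Lambda> (vars 0 ?n)) (tsubst (rsub \<Lambda>) ?\<Theta>)"
    unfolding t by (rule refl_at_typed[OF c c x0])
  from elim_obtain[OF el is_ctx_id_tel[OF c ci v(2,1)] this]
  obtain I where I: "isel (idx \<Lambda>) I ?\<Theta>"
      "eleq \<Lambda> (map (subst (rsub \<Lambda>)) I) (refl_at \<Lambda> (vars 0 ?n)) (id_tel \<Lambda> (vars 0 ?n) (vars 0 ?n))"
    unfolding t .
  show ?thesis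
  proof
    fix \<Omega> x x' y y' p p' assume a: "ctx \<Omega>" "eleq \<Omega> x x' \<Lambda>" "eleq \<Omega> y y' \<Lambda>" "eleq \<Omega> p p' (id_tel \<Lambda> x y)"
    have l: "length x = ?n" "length x' = ?n" "length y = ?n" "length y' = ?n" "length p = ?n" "length p' = ?n"
      using elems_eq_length[OF a(2)] elems_eq_length[OF a(3)] elems_eq_length[OF a(4)] by simp_all
    have "eleq \<Omega> (p @ y @ x) (p' @ y' @ x') (idx \<Lambda>)" using a l by (simp add: elems_idx c)
    from cell_inst[OF c I(1) a(1) ci this]
    show "eleq \<Omega> (insts (p @ y @ x) I) (insts (p' @ y' @ x') I) (id_tel \<Lambda> y x)"
      using l by (simp add: insts_vars)
  next
    fix \<Omega> x assume a: "ctx \<Omega>" "isel \<Omega> x \<Lambda>"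
    have l: "length x = ?n" using elems_eq_length[OF a(2)] by simp
    have "insts x (map (subst (rsub \<Lambda>)) I) = insts (refl_at \<Lambda> x @ x @ x) I"
      using elems_eq_scoped[OF I(1)] insts_insts[of I "rl \<Lambda>" x] insts_rl[OF l]
          by (simp add: refl_at_def del: map_map)
    with cell_inst[OF c I(2) a(1) c a(2)] map_subst_refl_at[OF c, of "vars 0 ?n" "sb 0 x"]
    show "eleq \<Omega> (insts (refl_at \<Lambda> x @ x @ x) I) (refl_at \<Lambda> x) (id_tel \<Lambda> x x)"
      by (simp add: insts_vars_0[OF l] del: map_map)
  qed (use elems_eq_scoped[OF I(1)] elems_eq_length[OF I(1)] in simp_all)
qed

text \<open>Compose both sides with the inverse of \<open>q\<close>. That the inverse after
  \<open>q \<circ> p\<close> gives back \<open>p\<close> is shown in exactly this bracketing: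
  elimination on \<open>q\<close> leaves two uses of the left unit law.\<close>

lemma id_comp_cancel:
  assumes c: "ctx \<Lambda>" and \<Omega>: "ctx \<Omega>" and x: "isel \<Omega> x \<Lambda>" and y: "isel \<Omega> y \<Lambda>" and z: "isel \<Omega> z \<Lambda>"
    and q: "isel \<Omega> q (id_tel \<Lambda> y z)" and p: "isel \<Omega> p (id_tel \<Lambda> x y)" and p': "isel \<Omega> p' (id_tel \<Lambda> x y)"
    and eq: "eleq \<Omega> (id_comp \<Lambda> x y z q p) (id_comp \<Lambda> x y z q p') (id_tel \<Lambda> x z)"
  shows "eleq \<Omega> p p' (id_tel \<Lambda> x y)"
proof -
  note cc = is_ctx_cteq_refl[OF c]
  note comp = id_comp_cong[OF cc]
  let ?n = "length \<Lambda>"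
  obtain I where I: "\<And>\<Omega> x x' y y' p p'. ctx \<Omega> \<Longrightarrow> eleq \<Omega> x x' \<Lambda> \<Longrightarrow> eleq \<Omega> y y' \<Lambda> \<Longrightarrow> eleq \<Omega> p p' (id_tel \<Lambda> x y) \<Longrightarrow>
      eleq \<Omega> (insts (p @ y @ x) I) (insts (p' @ y' @ x') I) (id_tel \<Lambda> y x)"
    "\<And>\<Omega> x. ctx \<Omega> \<Longrightarrow> isel \<Omega> x \<Lambda> \<Longrightarrow> eleq \<Omega> (insts (refl_at \<Lambda> x @ x @ x) I) (refl_at \<Lambda> x) (id_tel \<Lambda> x x)"
    and Isc: "\<forall>e\<in>set I. scoped (3 * length \<Lambda>) e" and lI: "length I = length \<Lambda>"
    by (rule id_inverse[OF c]) (rule that)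
  let ?L = "\<lambda>\<delta> q z y. id_comp \<Lambda> (drop ?n \<delta>) z y (insts (q @ z @ y) I) (id_comp \<Lambda> (drop ?n \<delta>) y z q (take ?n \<delta>))"
  let ?R = "\<lambda>\<delta> q z y. take ?n \<delta>"
  let ?F = "\<lambda>\<delta> q z y. drop ?n \<delta>" and ?G = "\<lambda>\<delta> q z y. y"
  have l: "length x = ?n" "length y = ?n" "length z = ?n" "length q = ?n"
    using elems_eq_length[OF x] elems_eq_length[OF y] elems_eq_length[OF z] elems_eq_length[OF q] by simp_all
  have *: "eleq \<Omega> (id_comp \<Lambda> x z y (insts (q @ z @ y) I) (id_comp \<Lambda> x y z q p)) p (id_tel \<Lambda> x y)"
    if p: "isel \<Omega> p (id_tel \<Lambda> x y)" for p
  proof -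
    have lp: "length p = ?n" using elems_eq_length[OF p] by simp
    have "eleq \<Omega> (?L (p @ x) q z y) (?R (p @ x) q z y) (id_tel \<Lambda> (?F (p @ x) q z y) (?G (p @ x) q z y))"
    proof (rule J_eq[of "pre_ctx \<Lambda>" \<Lambda> \<Lambda> ?L ?R ?F ?G \<Omega> y z q "p @ x"])
      show "ctx (pre_ctx \<Lambda> @ idx \<Lambda>)" using pre_ctx_cong[OF cc] cteq_ctx by blast
      show "isel \<Omega> (p @ x) (tsubst (sb 0 (q @ z @ y)) (pre_ctx \<Lambda>))"
        using elems_pre_ctx[OF c l(2,3,4,1,1) lp lp] x p by simp
    next
      fix \<sigma> :: "nat \<Rightarrow> 's expr" and \<delta> q z y :: "'s expr list" and T
      assume l: "length \<delta> = length (pre_ctx \<Lambda>)" "length q = ?n" "length z = ?n" "length y = ?n"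
        and T: "T = ?L \<or> T = ?R \<or> T = ?F \<or> T = ?G"
      have "map (subst \<sigma>) (insts (q @ z @ y) I) = insts (map (subst \<sigma>) q @ map (subst \<sigma>) z @ map (subst \<sigma>) y) I"
        using map_subst_insts[of I "q @ z @ y" \<sigma>] Isc l by (simp add: numeral_3_eq_3 add.assoc)
      then show "map (subst \<sigma>) (T \<delta> q z y) = T (map (subst \<sigma>) \<delta>) (map (subst \<sigma>) q) (map (subst \<sigma>) z) (map
          (subst \<sigma>) y)"
        using T l by (elim disjE) (simp_all add: map_subst_id_comp[OF cc] lI drop_map take_map del: map_map)
    next
      fix \<Omega> \<delta> q z y
      assume a: "ctx \<Omega>" "isel \<Omega> y \<Lambda>" "isel \<Omega> z \<Lambda>" "isel \<Omega> q (id_tel \<Lambda> y z)"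
        "isel \<Omega> \<delta> (tsubst (sb 0 (q @ z @ y)) (pre_ctx \<Lambda>))"
        and l: "length q = ?n" "length z = ?n" "length y = ?n"
      from elems_pre_ctxE[OF c l(3,2,1) a(5)] obtain p x where
        b: "\<delta> = p @ x" "length x = ?n" "length p = ?n" "isel \<Omega> x \<Lambda>" "isel \<Omega> p (id_tel \<Lambda> x y)"
        by (metis append_eq_append_conv)
      show "isel \<Omega> (drop ?n \<delta>) \<Lambda> \<and> isel \<Omega> y \<Lambda> \<and>
         isel \<Omega> (?L \<delta> q z y) (id_tel \<Lambda> (drop ?n \<delta>) y) \<and>
         isel \<Omega> (take ?n \<delta>) (id_tel \<Lambda> (drop ?n \<delta>) y)"
        using a b by (auto intro!: comp I)
    next
      fix \<Omega> \<delta> y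
      assume a: "ctx \<Omega>" "isel \<Omega> y \<Lambda>"
        "isel \<Omega> \<delta> (tsubst (sb 0 (refl_at \<Lambda> y @ y @ y)) (pre_ctx \<Lambda>))"
        and l: "length y = ?n"
      from elems_pre_ctxE[OF c l l refl_at_length a(3)] obtain p x where
        b: "\<delta> = p @ x" "length x = ?n" "length p = ?n" "isel \<Omega> x \<Lambda>" "isel \<Omega> p (id_tel \<Lambda> x y)"
        by (metis append_eq_append_conv)
      note t = id_tel_trans[OF c a(1) b(4) a(2)]
      note r = id_comp_refl_left[OF cc a(1) b(4) a(2) b(5)]
      note i = I(2)[OF a(1,2)]
      note 1 = comp[OF a(1) b(4) a(2,2) i r]
      from t[OF 1 r]
      show "eleq \<Omega> (?L \<delta> (refl_at \<Lambda> y) y y) (take ?n \<delta>) (id_tel \<Lambda> (drop ?n \<delta>) y)"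
        using b(1-3) by simp
    qed (rule c \<Omega> y z q)+
    then show ?thesis using l lp by simp
  qed
  note 1 = *[OF p] and 2 = *[OF p']
  note t = id_tel_trans[OF c \<Omega> x y] and s = id_tel_sym[OF c \<Omega> x y]
  have i: "isel \<Omega> (insts (q @ z @ y) I) (id_tel \<Lambda> z y)" by (rule I(1)[OF \<Omega> y z q])
  show ?thesis using t[OF s[OF 1] t[OF comp[OF \<Omega> x z y i eq] 2]] .
qed

end

section \<open>The 2-category of contexts on representatives\<close>

text \<open>Operations on classes are unions over all representatives. Once congruence shows every
  member of the union to be the same class, the union is that class.\<close>

lemma UN_const_eq: "A \<noteq> {} \<Longrightarrow> (\<And>x. x \<in> A \<Longrightarrow> B x = C) \<Longrightarrow> (\<Union>x\<in>A. B x) = C"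
  by auto

context ml2_theory
begin

abbreviation cls where "cls \<equiv> ctx_class S"
abbreviation el where "el \<equiv> elems_class S"
abbreviation KS where "KS \<equiv> ctx_two_cat S"

lemma in_cls [simp]: "\<Delta> \<in> cls \<Gamma> \<longleftrightarrow> cteq \<Gamma> \<Delta>"
  by (simp add: ctx_class_def)

lemma in_el [simp]: "b \<in> el \<Gamma> T a \<longleftrightarrow> eleq \<Gamma> a b T"
  by (simp add: elems_class_def)

lemma cls_nonempty: "ctx \<Gamma> \<Longrightarrow> cls \<Gamma> \<noteq> {}"
  using is_ctx_cteq_refl by fastforce

lemma el_nonempty: "isel \<Gamma> a T \<Longrightarrow> el \<Gamma> T a \<noteq> {}"
  by fastforce

lemma el_rep:
  assumes "cteq \<Gamma> \<Gamma>'" "cteq (T @ \<Gamma>) (T' @ \<Gamma>)" "eleq \<Gamma> a b T"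
  shows "el \<Gamma>' T' b = el \<Gamma> T a"
proof -
  have l: "length T' = length T" using ctx_eq_length[OF assms(2)] by simp
  have c: "ctx (T @ \<Gamma>)" using assms(2) cteq_ctx by blast
  have s: "cteq (T' @ \<Gamma>) (T @ \<Gamma>)" by (rule cteq_sym[OF assms(2)])
  have "eleq \<Gamma>' b d T' \<longleftrightarrow> eleq \<Gamma> a d T" for d
  proof
    assume "eleq \<Gamma>' b d T'"
    from elems_eq_conv'[OF elems_eq_cteq[OF this cteq_sym[OF assms(1)]] s] show "eleq \<Gamma> a d T"
      using elems_eq_trans[OF assms(3) _ c] by blast
  next
    assume "eleq \<Gamma> a d T"
    from elems_eq_trans[OF elems_eq_sym[OF assms(3) c] this c] show "eleq \<Gamma>' b d T'"
      using elems_eq_conv'[OF _ assms(2)] elems_eq_cteq[OF _ assms(1)] by blast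
  qed
  then show ?thesis by (auto simp: elems_class_def)
qed

lemma cteq_closed_append: "cteq \<Delta> \<Delta>' \<Longrightarrow> ctx \<Omega> \<Longrightarrow> cteq (\<Delta> @ \<Omega>) (\<Delta>' @ \<Omega>)"
  using cteq_append_closed is_ctx_cteq_refl by blast

lemma el_rep_closed: "cteq \<Gamma> \<Gamma>' \<Longrightarrow> cteq \<Delta> \<Delta>' \<Longrightarrow> eleq \<Gamma> a b \<Delta> \<Longrightarrow> el \<Gamma>' \<Delta>' b = el \<Gamma> \<Delta> a"
  using el_rep cteq_closed_append cteq_ctx by blast

lemma el_rep_id:
  "cteq \<Gamma> \<Gamma>' \<Longrightarrow> cteq \<Delta> \<Delta>' \<Longrightarrow> eleq \<Gamma> f f' \<Delta> \<Longrightarrow> eleq \<Gamma> g g' \<Delta> \<Longrightarrow> eleq \<Gamma> a b (id_tel \<Delta> f g) \<Longrightarrow>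
    el \<Gamma>' (id_tel \<Delta>' f' g') b = el \<Gamma> (id_tel \<Delta> f g) a"
  by (rule el_rep) (auto intro: id_tel_cteq dest: cteq_ctx)

lemma el_eq_iff: "isel \<Gamma> b T \<Longrightarrow> ctx (T @ \<Gamma>) \<Longrightarrow> el \<Gamma> T a = el \<Gamma> T b \<longleftrightarrow> eleq \<Gamma> a b T"
proof
  assume "isel \<Gamma> b T" "el \<Gamma> T a = el \<Gamma> T b"
  then show "eleq \<Gamma> a b T" unfolding in_el[symmetric] by simp
next
  assume *: "isel \<Gamma> b T" "ctx (T @ \<Gamma>)" "eleq \<Gamma> a b T"
  from el_rep[OF is_ctx_cteq_refl[OF is_ctx_appendD[OF *(2)]] is_ctx_cteq_refl[OF *(2)] *(3)]
  show "el \<Gamma> T a = el \<Gamma> T b" by simp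
qed

lemma ob_KS: "ob KS = {cls \<Gamma> |\<Gamma>. ctx \<Gamma>}"
  by (simp add: ctx_two_cat_def)

text \<open>A 1-cell may come with any representatives of its source and target; context conversion
  moves it to the chosen ones. The same argument gives \<open>cell_KS\<close>.\<close>

lemma hom_KS:
  assumes "ctx \<Gamma>" "ctx \<Delta>"
  shows "hom KS (cls \<Gamma>) (cls \<Delta>) = {el \<Gamma> \<Delta> f |f. isel \<Gamma> f \<Delta>}"
proof (intro set_eqI iffI)
  fix F assume "F \<in> hom KS (cls \<Gamma>) (cls \<Delta>)"
  then obtain \<Gamma>' \<Delta>' f where *: "F = el \<Gamma>' \<Delta>' f" "cteq \<Gamma> \<Gamma>'" "cteq \<Delta> \<Delta>'" "isel \<Gamma>' f \<Delta>'"
    by (auto simp: ctx_two_cat_def elems_iff)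
  have "isel \<Gamma> f \<Delta>"
    using elems_eq_conv'[OF elems_eq_cteq[OF *(4) cteq_sym[OF *(2)]] cteq_closed_append[OF cteq_sym[OF *(3)]
        assms(1)]] .
  with el_rep_closed[OF *(2,3) this] * show "F \<in> {el \<Gamma> \<Delta> f |f. isel \<Gamma> f \<Delta>}" by auto
next
  fix F assume "F \<in> {el \<Gamma> \<Delta> f |f. isel \<Gamma> f \<Delta>}"
  then show "F \<in> hom KS (cls \<Gamma>) (cls \<Delta>)"
    using assms is_ctx_cteq_refl by (fastforce simp: ctx_two_cat_def elems_iff)
qed

lemma cell_KS:
  assumes "ctx \<Gamma>" "ctx \<Delta>" "isel \<Gamma> f \<Delta>" "isel \<Gamma> g \<Delta>"
  shows "cell KS (cls \<Gamma>) (cls \<Delta>) (el \<Gamma> \<Delta> f) (el \<Gamma> \<Delta> g) =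
    {el \<Gamma> (id_tel \<Delta> f g) a |a. isel \<Gamma> a (id_tel \<Delta> f g)}"
proof (intro set_eqI iffI)
  fix F assume "F \<in> cell KS (cls \<Gamma>) (cls \<Delta>) (el \<Gamma> \<Delta> f) (el \<Gamma> \<Delta> g)"
  then obtain \<Gamma>' \<Delta>' f' g' a where *: "F = el \<Gamma>' (id_tel \<Delta>' f' g') a" "cteq \<Gamma> \<Gamma>'" "cteq \<Delta> \<Delta>'"
      "eleq \<Gamma> f f' \<Delta>" "eleq \<Gamma> g g' \<Delta>" "isel \<Gamma>' a (id_tel \<Delta>' f' g')"
    by (auto simp: ctx_two_cat_def elems_iff)
  have "isel \<Gamma> a (id_tel \<Delta> f g)"
    using elems_eq_conv'[OF elems_eq_cteq[OF *(6) cteq_sym[OF *(2)]] cteq_sym[OF id_tel_cteq[OF *(3) assms(1)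
        *(4,5)]]] .
  with el_rep_id[OF *(2-5) this] * show "F \<in> {el \<Gamma> (id_tel \<Delta> f g) a |a. isel \<Gamma> a (id_tel \<Delta> f g)}" by auto
next
  fix F assume "F \<in> {el \<Gamma> (id_tel \<Delta> f g) a |a. isel \<Gamma> a (id_tel \<Delta> f g)}"
  then show "F \<in> cell KS (cls \<Gamma>) (cls \<Delta>) (el \<Gamma> \<Delta> f) (el \<Gamma> \<Delta> g)"
    using assms is_ctx_cteq_refl by (fastforce simp: ctx_two_cat_def elems_iff)
qed

lemma comp1_KS:
  assumes "ctx \<Gamma>" "ctx \<Delta>" "ctx \<Theta>" "isel \<Gamma> f \<Delta>" "isel \<Delta> h \<Theta>"
  shows "comp1 KS (cls \<Gamma>) D (cls \<Theta>) (el \<Delta> \<Theta> h) (el \<Gamma> \<Delta> f) = el \<Gamma> \<Theta> (insts f h)"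
  unfolding ctx_two_cat_def two_cat.simps
proof (intro UN_const_eq cls_nonempty el_nonempty assms)
  fix \<Gamma>' \<Theta>' f' h' assume *: "\<Gamma>' \<in> cls \<Gamma>" "\<Theta>' \<in> cls \<Theta>" "f' \<in> el \<Gamma> \<Delta> f" "h' \<in> el \<Delta> \<Theta> h"
  then show "el \<Gamma>' \<Theta>' (insts f' h') = el \<Gamma> \<Theta> (insts f h)"
    by (intro el_rep_closed hom_inst[of _ \<Delta>]) (use assms in simp_all)
qed

lemma id2_KS:
  assumes "ctx \<Gamma>" "ctx \<Delta>" "isel \<Gamma> f \<Delta>"
  shows "id2 KS (cls \<Gamma>) (cls \<Delta>) (el \<Gamma> \<Delta> f) = el \<Gamma> (id_tel \<Delta> f f) (refl_at \<Delta> f)"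
  unfolding ctx_two_cat_def two_cat.simps
proof (intro UN_const_eq cls_nonempty el_nonempty assms)
  fix \<Gamma>' \<Delta>' f' assume *: "\<Gamma>' \<in> cls \<Gamma>" "\<Delta>' \<in> cls \<Delta>" "f' \<in> el \<Gamma> \<Delta> f"
  then show "el \<Gamma>' (id_tel \<Delta>' f' f') (refl_at \<Delta>' f') = el \<Gamma> (id_tel \<Delta> f f) (refl_at \<Delta> f)"
    by (intro el_rep_id refl_at_cong) (use assms in simp_all)
qed

lemma vcomp_KS:
  assumes "ctx \<Gamma>" "ctx \<Delta>" "isel \<Gamma> f1 \<Delta>" "isel \<Gamma> f2 \<Delta>" "isel \<Gamma> f3 \<Delta>"
    "isel \<Gamma> \<beta> (id_tel \<Delta> f2 f3)" "isel \<Gamma> \<alpha> (id_tel \<Delta> f1 f2)"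
  shows "vcomp KS (cls \<Gamma>) (cls \<Delta>) (el \<Gamma> \<Delta> f1) (el \<Gamma> \<Delta> f2) (el \<Gamma> \<Delta> f3) (el \<Gamma> (id_tel \<Delta> f2 f3) \<beta>) (el \<Gamma>
      (id_tel \<Delta> f1 f2) \<alpha>) =
    el \<Gamma> (id_tel \<Delta> f1 f3) (id_comp \<Delta> f1 f2 f3 \<beta> \<alpha>)"
  unfolding ctx_two_cat_def two_cat.simps
proof (intro UN_const_eq cls_nonempty el_nonempty assms)
  fix \<Gamma>' \<Delta>' f1' f2' f3' b a assume *: "\<Gamma>' \<in> cls \<Gamma>" "\<Delta>' \<in> cls \<Delta>" "f1' \<in> el \<Gamma> \<Delta> f1" "f2' \<in> el \<Gamma> \<Delta> f2" "f3' \<in> el \<Gamma> \<Delta>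
      f3"
    "b \<in> el \<Gamma> (id_tel \<Delta> f2 f3) \<beta>" "a \<in> el \<Gamma> (id_tel \<Delta> f1 f2) \<alpha>"
  then show "el \<Gamma>' (id_tel \<Delta>' f1' f3') (id_comp \<Delta>' f1' f2' f3' b a) = el \<Gamma> (id_tel \<Delta> f1 f3)
      (id_comp \<Delta> f1 f2 f3 \<beta> \<alpha>)"
    by (intro el_rep_id id_comp_cong) (use assms in simp_all)
qed

lemma whisk_r_KS:
  assumes "ctx \<Gamma>" "ctx \<Delta>" "ctx \<Theta>" "isel \<Delta> f \<Theta>" "isel \<Delta> g \<Theta>" "isel \<Delta> \<alpha> (id_tel \<Theta> f g)" "isel \<Gamma> k \<Delta>"
  shows "whisk_r KS (cls \<Gamma>) D (cls \<Theta>) (el \<Delta> \<Theta> f) (el \<Delta> \<Theta> g) (el \<Delta> (id_tel \<Theta> f g) \<alpha>) (el \<Gamma> \<Delta> k) =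
    el \<Gamma> (id_tel \<Theta> (insts k f) (insts k g)) (insts k \<alpha>)"
  unfolding ctx_two_cat_def two_cat.simps
proof (intro UN_const_eq cls_nonempty el_nonempty assms)
  fix \<Gamma>' \<Theta>' f' g' a k' assume *: "\<Gamma>' \<in> cls \<Gamma>" "\<Theta>' \<in> cls \<Theta>" "f' \<in> el \<Delta> \<Theta> f" "g' \<in> el \<Delta> \<Theta> g"
    "a \<in> el \<Delta> (id_tel \<Theta> f g) \<alpha>" "k' \<in> el \<Gamma> \<Delta> k"
  then show "el \<Gamma>' (id_tel \<Theta>' (insts k' f') (insts k' g')) (insts k' a) = el \<Gamma> (id_tel \<Theta> (insts k f) (insts k g))
      (insts k \<alpha>)"
    by (intro el_rep_id hom_inst[of _ \<Delta>] cell_inst[of _ \<Delta>]) (use assms elems_eq_length in \<open>simp_all, blast+\<close>)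
qed

lemma whisk_l_KS:
  assumes "ctx \<Gamma>" "ctx \<Delta>" "ctx \<Theta>" "isel \<Gamma> f \<Delta>" "isel \<Gamma> g \<Delta>" "isel \<Delta> h \<Theta>" "isel \<Gamma> \<alpha> (id_tel \<Delta> f g)"
  shows "whisk_l KS (cls \<Gamma>) (cls \<Delta>) (cls \<Theta>) (el \<Gamma> \<Delta> f) (el \<Gamma> \<Delta> g) (el \<Delta> \<Theta> h) (el \<Gamma> (id_tel \<Delta> f g) \<alpha>) =
    el \<Gamma> (id_tel \<Theta> (insts f h) (insts g h)) (id_map \<Delta> \<Theta> h f g \<alpha>)"
  unfolding ctx_two_cat_def two_cat.simps
proof (intro UN_const_eq cls_nonempty el_nonempty assms)
  fix \<Gamma>' \<Delta>' \<Theta>' f' g' h' a assume *: "\<Gamma>' \<in> cls \<Gamma>" "\<Delta>' \<in> cls \<Delta>" "\<Theta>' \<in> cls \<Theta>" "f' \<in> el \<Gamma> \<Delta> f" "g' \<in> el \<Gamma> \<Delta> g"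
    "h' \<in> el \<Delta> \<Theta> h" "a \<in> el \<Gamma> (id_tel \<Delta> f g) \<alpha>"
  then show "el \<Gamma>' (id_tel \<Theta>' (insts f' h') (insts g' h')) (id_map \<Delta>' \<Theta>' h' f' g' a) =
     el \<Gamma> (id_tel \<Theta> (insts f h) (insts g h)) (id_map \<Delta> \<Theta> h f g \<alpha>)"
    by (intro el_rep_id hom_inst[of _ \<Delta>] id_map_cong) (use assms in simp_all)
qed

end

text \<open>The inverse is taken pointwise, and its functoriality follows by applying
  \<open>F'\<close> and using injectivity on hom-sets. As \<open>cat\<close> carries no axioms, this
  requires that identities and composites of \<open>C\<close> are morphisms of
  \<open>C\<close>.\<close>

lemma is_cat_isoI:
  assumes F: "is_functor C D F F'"
    and obj: "bij_betw F (obj C) (obj D)"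
    and mor: "\<And>a b. a \<in> obj C \<Longrightarrow> b \<in> obj C \<Longrightarrow> bij_betw (F' a b) (mor C a b) (mor D (F a) (F b))"
    and idn: "\<And>a. a \<in> obj C \<Longrightarrow> idn C a \<in> mor C a a"
    and cmp: "\<And>a b c f g. a \<in> obj C \<Longrightarrow> b \<in> obj C \<Longrightarrow> c \<in> obj C \<Longrightarrow> f \<in> mor C a b \<Longrightarrow> g \<in> mor C b c \<Longrightarrow>
      cmp C a b c g f \<in> mor C a c"
  shows "is_cat_iso C D F F'"
proof -
  define G where "G = inv_into (obj C) F"
  define G' where "G' = (\<lambda>a b. inv_into (mor C (G a) (G b)) (F' (G a) (G b)))"
  have GF: "G (F a) = a" if "a \<in> obj C" for a
    using that bij_betw_inv_into_left[OF obj] by (simp add: G_def)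
  have FG: "F (G a) = a" if "a \<in> obj D" for a
    using that bij_betw_inv_into_right[OF obj] by (simp add: G_def)
  have G: "G a \<in> obj C" if "a \<in> obj D" for a
    using that obj unfolding G_def by (metis bij_betw_imp_surj_on inv_into_into)
  have G'F: "inv_into (mor C a b) (F' a b) (F' a b f) = f" if "a \<in> obj C" "b \<in> obj C" "f \<in> mor C a b" for a b f
    by (rule bij_betw_inv_into_left[OF mor]) (use that in auto)
  have FG': "F' (G a) (G b) (G' a b f) = f" if "a \<in> obj D" "b \<in> obj D" "f \<in> mor D a b" for a b f
    unfolding G'_def by (rule bij_betw_inv_into_right[OF mor]) (use that G FG in auto)
  have G': "G' a b f \<in> mor C (G a) (G b)" if "a \<in> obj D" "b \<in> obj D" "f \<in> mor D a b" for a b f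
    using bij_betw_imp_surj_on[OF mor[OF G[OF that(1)] G[OF that(2)]]] that(3) FG[OF that(1)] FG[OF that(2)]
    unfolding G'_def by (metis inv_into_into)
  have "is_functor D C G G'"
    unfolding is_functor_def
  proof (intro conjI ballI)
    fix a assume a: "a \<in> obj D"
    show "G a \<in> obj C" by (rule G[OF a])
    have "F' (G a) (G a) (idn C (G a)) = idn D a"
      using F G[OF a] FG[OF a] unfolding is_functor_def by metis
    with G'F[OF G[OF a] G[OF a] idn[OF G[OF a]]] show "G' a a (idn D a) = idn C (G a)"
      unfolding G'_def by simp
    fix b assume b: "b \<in> obj D"
    {
      fix f assume "f \<in> mor D a b"
      then show "G' a b f \<in> mor C (G a) (G b)" using G' a b by blast
    }
    fix c f g assume c: "c \<in> obj D" "f \<in> mor D a b" "g \<in> mor D b c"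
    let ?h = "cmp C (G a) (G b) (G c) (G' b c g) (G' a b f)"
    have "F' (G a) (G c) ?h = cmp D (F (G a)) (F (G b)) (F (G c)) (F' (G b) (G c) (G' b c g)) (F' (G a) (G b)
        (G' a b f))"
      using F G G' a b c unfolding is_functor_def by blast
    also have "\<dots> = cmp D a b c g f" using FG FG' a b c by simp
    finally show "G' a c (cmp D a b c g f) = ?h"
      using G'F[OF G[OF a] G[OF c(1)], of ?h] cmp[OF G[OF a] G[OF b] G[OF c(1)] G'[OF a b c(2)] G'[OF b c(1) c(3)]]
      unfolding G'_def by simp
  qed
  then show ?thesis
    unfolding is_cat_iso_def
    by (intro conjI F exI[of _ G] exI[of _ G']) (use GF FG G'F FG' in \<open>auto simp: G'_def\<close>)
qed

section \<open>Identities in \<open>\<Gamma>.A.A.Id\<^sub>A\<close>\<close>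

context ml2_theory
begin

context
  fixes \<Gamma> A
  assumes cX: "ctx (A # \<Gamma>)"
begin

private abbreviation (input) "X \<equiv> A # \<Gamma>"
private abbreviation (input) "Y \<equiv> extId \<Gamma> A"
private abbreviation (input) "N \<equiv> length \<Gamma>"
text \<open>With \<open>Y\<close> read as \<open>x, y, z, w\<close> and \<open>w : Id(y, z)\<close>
  newest, \<open>y\<close> is \<open>Var 2\<close> and \<open>z\<close> is
  \<open>Var 1\<close>.\<close>

private abbreviation (input) "src \<equiv> Var 2 # vars 3 N"
private abbreviation (input) "tgt \<equiv> Var 1 # vars 3 N"
private abbreviation (input) "trA \<equiv> transport (J_ctx \<Gamma>) N A"

lemma ctx_\<Gamma>: "ctx \<Gamma>" and A_type: "isty \<Gamma> A" and ctx_Y: "ctx Y"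
    and cteq_\<Gamma>: "cteq \<Gamma> \<Gamma>" and cteq_X: "cteq X X" and cteq_Y: "cteq Y Y"
    and A_scoped: "scoped N A"
proof -
  show 1: "ctx \<Gamma>" "isty \<Gamma> A" using cX by (auto simp: ty_iff)
  then show 2: "ctx Y" using is_ctx_extId by blast
  show "cteq \<Gamma> \<Gamma>" "cteq X X" "cteq Y Y"
    using is_ctx_cteq_refl cX 1 2 by blast+
  show "scoped N A" using scope[OF 1(2)] by simp
qed

lemma Y_length: "length Y = Suc (Suc (Suc N))"
  by (simp add: extId_def)

lemma elems_Y:
  "eleq \<Omega> (w # z # y # x) (w' # z' # y' # x') Y \<longleftrightarrow>
    eleq \<Omega> x x' \<Gamma> \<and> tmeq \<Omega> y y' (inst x A) \<and> tmeq \<Omega> z z' (inst x A) \<and> tmeq \<Omega> w w' (idT (inst x A) y z)"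
  using inst_wk[of 1 "y # x" A] inst_wk[of 2 "z # y # x" A] by (auto simp: extId_def numeral_2_eq_2)

lemma elems_YE:
  assumes "eleq \<Omega> h h' Y"
  obtains w z y x w' z' y' x' where "h = w # z # y # x" "h' = w' # z' # y' # x'"
    "length x = N" "length x' = N"
    "eleq \<Omega> x x' \<Gamma>" "tmeq \<Omega> y y' (inst x A)" "tmeq \<Omega> z z' (inst x A)" "tmeq \<Omega> w w' (idT (inst x A) y z)"
proof -
  have "length h = Suc (Suc (Suc N))" "length h' = Suc (Suc (Suc N))"
    using elems_eq_length[OF assms] by (simp_all add: Y_length)
  then obtain w z y x w' z' y' x' where h: "h = w # z # y # x" "h' = w' # z' # y' # x'" "length x = N" "length x' =
      N"
    by (auto simp: length_Suc_conv)
  show ?thesis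
    by (rule that[OF h]) (use assms h elems_Y in blast)+
qed

lemma transport_A_refl:
  "ctx \<Omega> \<Longrightarrow> isel \<Omega> x \<Gamma> \<Longrightarrow> istm \<Omega> z (inst x A) \<Longrightarrow>
    tmeq \<Omega> (inst (z # refl_at \<Gamma> x @ x @ x) trA) z (inst x A)"
  unfolding refl_at_def by (rule transport_refl[OF J_ok[OF cteq_\<Gamma>] A_type])

lemma transport_A:
  "ctx \<Omega> \<Longrightarrow> eleq \<Omega> x x2 \<Gamma> \<Longrightarrow> eleq \<Omega> x' x2' \<Gamma> \<Longrightarrow> eleq \<Omega> p p2 (id_tel \<Gamma> x x') \<Longrightarrow>
    tmeq \<Omega> z z2 (inst x' A) \<Longrightarrow>
    tmeq \<Omega> (inst (z # p @ x' @ x) trA) (inst (z2 # p2 @ x2' @ x2) trA) (inst x A)"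
  by (rule transport_inst[OF J_ok[OF cteq_\<Gamma>] A_type])

lemma A_inst: "ctx \<Omega> \<Longrightarrow> eleq \<Omega> x x' \<Gamma> \<Longrightarrow> tyeq \<Omega> (inst x A) (inst x' A)"
  by (rule inst_tyeq[OF A_type])

text \<open>Transport along a reflexivity does nothing, so identities in \<open>\<Gamma>.A\<close> over one are identities in a fibre.\<close>

lemma elems_vertical:
  assumes "ctx \<Omega>" "isel \<Omega> x \<Gamma>" "istm \<Omega> y (inst x A)" "istm \<Omega> z (inst x A)"
  shows "eleq \<Omega> (w # refl_at \<Gamma> x) (w' # refl_at \<Gamma> x) (id_tel X (y # x) (z # x)) \<longleftrightarrow>
    tmeq \<Omega> w w' (idT (inst x A) y z)"
proof -
  have "tyeq \<Omega> (idT (inst x A) y (inst (z # refl_at \<Gamma> x @ x @ x) trA)) (idT (inst x A) y z)"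
    by (rule id_cong[OF A_inst[OF assms(1,2)] assms(3) transport_A_refl[OF assms(1,2,4)]])
  then have "tmeq \<Omega> w w' (idT (inst x A) y (inst (z # refl_at \<Gamma> x @ x @ x) trA)) \<longleftrightarrow> tmeq \<Omega> w w' (idT (inst x A) y z)"
    using TmEq_conv TyEq_sym by blast
  then show ?thesis
    using elems_id_tel_Cons[OF cX assms(2,2,3,4)] refl_at_typed[OF ctx_\<Gamma> assms(1,2)] by simp
qed

text \<open>The context of \<open>(x, y), (x', y') : \<Gamma>.A\<close> with an identity \<open>(p, u)\<close> between them, extended by \<open>z : A(x)\<close>,
  \<open>z' : A(x')\<close>, \<open>v : Id(z, p\<^sup>* z')\<close> and \<open>w' : Id(y', z')\<close>. Eliminating \<open>(p, u)\<close> and then \<open>v\<close> leaves \<open>\<Gamma>.A.A.Id\<^sub>A\<close>.\<close>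

private abbreviation (input) \<Delta>\<Psi> :: "'s expr list" where
  "\<Delta>\<Psi> \<equiv> [idT (inst (vars (N + 5) N) A) (Var (N + 4)) (Var 1),
    id_over (J_ctx \<Gamma>) N A (vars (2*N + 5) N) (vars (N + 4) N) (vars 3 N) (Var 1) (Var 0),
    inst (vars (N + 3) N) A, inst (vars (2*N + 3) N) A]"

definition fill_ctx :: "'s expr list" where
  "fill_ctx = \<Delta>\<Psi> @ idx X"

lemma elems_fill_ctx:
  assumes len: "length x = N" "length x2 = N" "length x' = N" "length x2' = N" "length p = N" "length p2 = N"
  shows "eleq \<Omega> (w' # v # z' # z # u # p @ y' # x' @ y # x)
      (w2' # v2 # z2' # z2 # u2 # p2 @ y2' # x2' @ y2 # x2) fill_ctx \<longleftrightarrow>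
    eleq \<Omega> x x2 \<Gamma> \<and> eleq \<Omega> x' x2' \<Gamma> \<and> eleq \<Omega> p p2 (id_tel \<Gamma> x x') \<and>
    tmeq \<Omega> y y2 (inst x A) \<and> tmeq \<Omega> y' y2' (inst x' A) \<and>
    tmeq \<Omega> u u2 (idT (inst x A) y (inst (y' # p @ x' @ x) trA)) \<and>
    tmeq \<Omega> z z2 (inst x A) \<and> tmeq \<Omega> z' z2' (inst x' A) \<and>
    tmeq \<Omega> v v2 (idT (inst x A) z (inst (z' # p @ x' @ x) trA)) \<and>
    tmeq \<Omega> w' w2' (idT (inst x' A) y' z')"
proof -
  let ?l = "u # p @ y' # x' @ y # x"
  \<comment> \<open>In \<open>idx X\<close> the entries \<open>u, p, y', x', y, x\<close> start at
    0, 1, \<open>N + 1\<close>, \<open>N + 2\<close>, \<open>2*N + 2\<close> and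
    \<open>2*N + 3\<close>; each further variable shifts them by one.\<close>
  have "insts ?l (vars (2*N + 3) N) = x" "insts (z # ?l) (vars (N + 3) N) = x'"
    "insts (z' # z # ?l) (vars (2*N + 5) N) = x" "insts (z' # z # ?l) (vars (N + 4) N) = x'"
    "insts (z' # z # ?l) (vars 3 N) = p" "insts (v # z' # z # ?l) (vars (N + 5) N) = x'"
    by (simp_all add: insts_vars len numeral_eq_Suc)
  note b = this
  have N: "sb 0 (z' # z # ?l) 1 = z" "sb 0 (z' # z # ?l) 0 = z'" "sb 0 (v # z' # z # ?l) 1 = z'"
    "sb 0 (v # z' # z # ?l) (N + 4) = y'"
    by (simp_all add: numeral_eq_Suc nth_append len)
  have A1: "inst ?l (inst (vars (2*N + 3) N) A) = inst x A" "inst (z # ?l) (inst (vars (N + 3) N) A) = inst x' A"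
    "inst (v # z' # z # ?l) (inst (vars (N + 5) N) A) = inst x' A"
    using inst_inst[of "vars (2*N + 3) N" A ?l] inst_inst[of "vars (N + 3) N" A "z # ?l"]
      inst_inst[of "vars (N + 5) N" A "v # z' # z # ?l"] A_scoped unfolding b by simp_all
  have three: "3 * N = N + (N + N)" by simp
  have "inst (z' # z # ?l) (inst (Var 0 # vars 3 N @ vars (N + 4) N @ vars (2*N + 5) N) trA) =
       inst (insts (z' # z # ?l) (Var 0 # vars 3 N @ vars (N + 4) N @ vars (2*N + 5) N)) trA"
    by (rule inst_inst) (use tr_scoped[OF J_ok[OF cteq_\<Gamma>] A_type] three in simp)
  also have "\<dots> = inst (z' # p @ x' @ x) trA"
    unfolding list.map map_append subst.simps(1) b N ..
  finally have A2: "inst (z' # z # ?l) (id_over (J_ctx \<Gamma>) N A (vars (2*N + 5) N) (vars (N + 4) N) (vars 3 N)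
      (Var 1) (Var 0)) =
      idT (inst x A) z (inst (z' # p @ x' @ x) trA)"
    using inst_inst[of "vars (2*N + 5) N" A "z' # z # ?l"] A_scoped
    unfolding id_over_def subst.simps list.map b N by simp
  show ?thesis
    unfolding fill_ctx_def append_Cons append_Nil elems_eq_Cons A2
      elems_idx_Cons_closed[OF cX len(5,6,1,2,3,4)]
    unfolding subst.simps list.map A1 N by auto
qed

lemma is_ctx_fill_ctx: "ctx fill_ctx"
proof -
  let ?I = "idx X"
  let ?z = "inst (vars (2*N + 3) N) A" and ?z' = "inst (vars (N + 3) N) A"
  let ?v = "id_over (J_ctx \<Gamma>) N A (vars (2*N + 5) N) (vars (N + 4) N) (vars 3 N) (Var 1) (Var 0)"
  let ?w = "idT (inst (vars (N + 5) N) A) (Var (N + 4)) (Var 1)"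
  have c0: "ctx ?I" by (rule is_ctx_idx[OF cX])
  have v: "isel \<Omega> (vars (k + 2*N + 3) N) \<Gamma> \<and> isel \<Omega> (vars (k + N + 2) N) \<Gamma> \<and>
    isel \<Omega> (vars (k + 1) N) (id_tel \<Gamma> (vars (k + 2*N + 3) N) (vars (k + N + 2) N)) \<and>
    istm \<Omega> (Var (k + N + 1)) (inst (vars (k + N + 2) N) A)"
    if c: "ctx \<Omega>" and \<Omega>: "\<Omega> = T @ ?I" "k = length T" for \<Omega> T k
  proof -
    have "isel \<Omega> (vars k (Suc (N + Suc (N + Suc N)))) ?I"
      using elems_eq_vars[OF c[unfolded \<Omega>(1)] \<Omega>(2), of "Suc (N + Suc (N + Suc N))"] \<Omega> by simp
    moreover have "vars k (Suc (N + Suc (N + Suc N))) =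
      (Var k # vars (k + 1) N @ Var (k + N + 1) # vars (k + N + 2) N @ Var (k + 2*N + 2) # vars
          (k + 2*N + 3) N :: 's expr list)"
      unfolding vars_Suc vars_add by (simp add: numeral_2_eq_2 numeral_3_eq_3 add.assoc)
    ultimately show ?thesis by (simp add: elems_idx_Cons_closed[OF cX])
  qed
  have v0: "istm (T @ \<Omega>) (Var k) (inst (vars (k + 1 + m) N) A)"
    if "ctx (T @ \<Omega>)" "T = U @ [inst (vars m N) A]" "k = length U" for T \<Omega> U k m
  proof -
    have "wk (Suc k) (inst (vars m N) A) = inst (vars (k + 1 + m) N) A"
    proof -
      have "map (wk (Suc k)) (vars m N) = (vars (k + 1 + m) N :: 's expr list)"
        by (rule nth_equalityI) auto
      then show ?thesis using A_scoped by (simp add: subst_inst_scoped)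
    qed
    then show ?thesis
      using variable[OF that(1), of k] that by (simp add: tm_iff nth_append)
  qed
  have 1: "ctx ([?z] @ ?I)"
    using A_inst[OF c0, of "vars (2*N + 3) N"] v[of ?I "[]" 0] c0 by (simp add: ty_iff)
  have 2: "ctx ([?z', ?z] @ ?I)"
    using A_inst[OF 1, of "vars (N + 3) N"] v[OF 1 refl] 1 by (simp add: ty_iff numeral_eq_Suc)
  have "isty ([?z', ?z] @ ?I) ?v"
    unfolding id_over_def
  proof (intro id_cong A_inst transport_A)
    show "isel ([?z', ?z] @ ?I) (vars (2*N + 5) N) \<Gamma>"
      "isel ([?z', ?z] @ ?I) (vars (2*N + 5) N) \<Gamma>"
      "isel ([?z', ?z] @ ?I) (vars (N + 4) N) \<Gamma>"
      "isel ([?z', ?z] @ ?I) (vars 3 N) (id_tel \<Gamma> (vars (2*N + 5) N) (vars (N + 4) N))"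
      using v[OF 2 refl] by (simp_all add: numeral_eq_Suc)
    show "istm ([?z', ?z] @ ?I) (Var 1) (inst (vars (2*N + 5) N) A)"
      using v0[OF 2, of "[?z']" "2*N+3" 1] by (simp add: numeral_eq_Suc)
    show "istm ([?z', ?z] @ ?I) (Var 0) (inst (vars (N + 4) N) A)"
      using v0[of "[?z']" "[?z] @ ?I" "[]" "N+3" 0] 2 by (simp add: numeral_eq_Suc)
  qed (use 2 in simp_all)
  then have 3: "ctx ([?v, ?z', ?z] @ ?I)" using 2 by (simp add: ty_iff)
  have "isty ([?v, ?z', ?z] @ ?I) ?w"
  proof (intro id_cong A_inst)
    show "isel ([?v, ?z', ?z] @ ?I) (vars (N + 5) N) \<Gamma>"
      "istm ([?v, ?z', ?z] @ ?I) (Var (N + 4)) (inst (vars (N + 5) N) A)"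
      using v[OF 3 refl] by (simp_all add: numeral_eq_Suc)
    show "istm ([?v, ?z', ?z] @ ?I) (Var 1) (inst (vars (N + 5) N) A)"
      using v0[of "[?v, ?z']" "[?z] @ ?I" "[?v]" "N+3" 1] 3 by (simp add: numeral_eq_Suc)
  qed (use 3 in simp_all)
  then show ?thesis using 3 by (simp add: fill_ctx_def ty_iff)
qed

section \<open>Elimination over squares of identities\<close>

text \<open>The two reflexivity substitutions composed: the first, for \<open>(p, u)\<close>, is
  lifted over the four variables \<open>z, z', v, w'\<close>, the second, for \<open>v\<close>, over
  \<open>w'\<close>.\<close>

definition fill_sub :: "nat \<Rightarrow> 's expr" where
  "fill_sub i = subst (ups 1 (refl_sub (wk 1 A))) (ups 4 (rsub X) i)"

lemma fill_ctx_length: "length fill_ctx = 3 * N + 7"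
  by (simp add: fill_ctx_def)

lemma wk_A: "inst (vars k N) A = wk k A"
  using A_scoped by (rule inst_vars)

text \<open>Lifting properties compose, but the context left by eliminating \<open>(p, u)\<close>
  only becomes an identity context for \<open>v\<close> after conversion: until then
  \<open>v\<close> is an identity over a reflexivity.\<close>

lemma elim_fill_ctx: "elim fill_ctx fill_sub Y"
proof -
  let ?r = "rsub X"
  \<comment> \<open>The context between the two eliminations:
    \<open>x, y, z, z', v : Id(z, z'), w' : Id(y, z')\<close>.\<close>
  let ?B = "[idT (wk 4 A) (Var 3) (Var 1)] @ extId X (wk 1 A)"
  have e1: "elim fill_ctx (ups 4 ?r) (tsubst ?r \<Delta>\<Psi> @ A # \<Gamma>)"
    using elim_J_ctx[of \<Delta>\<Psi> "A # \<Gamma>"] is_ctx_fill_ctx by (simp add: fill_ctx_def numeral_eq_Suc)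
  have m: "map (subst (ups k ?r)) (vars (k + 2*N + 3) N) = vars (k + 1) N"
    "map (subst (ups k ?r)) (vars (k + N + 2) N) = vars (k + 1) N"
    "map (subst (ups k ?r)) (vars (k + 1) N) = refl_at \<Gamma> (vars (k + 1) N)"
    "ups k ?r (k + N + 1) = Var k" for k
  proof -
    show "map (subst (ups k ?r)) (vars (k + 2*N + 3) N) = vars (k + 1) N"
      "map (subst (ups k ?r)) (vars (k + N + 2) N) = vars (k + 1) N" "ups k ?r (k + N + 1) = Var k"
      by (auto intro!: nth_equalityI simp: ups_eq rl_def nth_append)
    have "refl_at \<Gamma> (vars (k + 1) N) = map (wk (k + 1)) (refl_ctx \<Gamma>)"
      unfolding refl_at_def using scoped_refl_ctx[OF J_ok[OF cteq_\<Gamma>]] by (intro insts_vars_eq) auto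
    then show "map (subst (ups k ?r)) (vars (k + 1) N) = refl_at \<Gamma> (vars (k + 1) N)"
      by (auto intro!: nth_equalityI simp: ups_eq rl_def nth_append wk_wk[OF J_ok[OF cteq_\<Gamma>] A_type, of _ 1,
          simplified])
  qed
  have tz: "subst ?r (inst (vars (2*N + 3) N) A) = wk 1 A"
    using m(1)[of 0] subst_inst_scoped[of "vars (2*N + 3) N" A ?r] A_scoped by (simp add: wk_A)
  have tz': "subst (ups 1 ?r) (inst (vars (N + 3) N) A) = wk 2 A"
    using m(2)[of 1] subst_inst_scoped[of "vars (N + 3) N" A "ups 1 ?r"] A_scoped by (simp add: wk_A numeral_eq_Suc)
  let ?x = "vars 3 N :: 's expr list"
  have tv: "subst (ups 2 ?r) (id_over (J_ctx \<Gamma>) N A (vars (2*N + 5) N) (vars (N + 4) N) (vars 3 N) (Var 1)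
      (Var 0)) =
    idT (inst ?x A) (Var 1) (inst (Var 0 # refl_at \<Gamma> ?x @ ?x @ ?x) trA)"
  proof -
    have b: "map (subst (ups 2 ?r)) (vars (2*N + 5) N) = ?x" "map (subst (ups 2 ?r)) (vars (N + 4) N) = ?x"
      "map (subst (ups 2 ?r)) (vars 3 N) = refl_at \<Gamma> ?x" "ups 2 ?r 0 = Var 0" "ups 2 ?r 1 = Var 1"
      using m[of 2] by (simp_all add: numeral_eq_Suc ups_eq)
    have three: "3 * N = N + (N + N)" by simp
    have "subst (ups 2 ?r) (inst (Var 0 # vars 3 N @ vars (N + 4) N @ vars (2*N + 5) N) trA) =
       inst (map (subst (ups 2 ?r)) (Var 0 # vars 3 N @ vars (N + 4) N @ vars (2*N + 5) N)) trA"
      by (rule subst_inst_scoped) (use tr_scoped[OF J_ok[OF cteq_\<Gamma>] A_type] three in simp)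
    also have "\<dots> = inst (Var 0 # refl_at \<Gamma> ?x @ ?x @ ?x) trA"
      unfolding list.map map_append subst.simps(1) b ..
    finally show ?thesis
      using subst_inst_scoped[of "vars (2*N + 5) N" A "ups 2 ?r"] A_scoped
      unfolding id_over_def subst.simps list.map b by simp
  qed
  have tw: "subst (ups 3 ?r) (idT (inst (vars (N + 5) N) A) (Var (N + 4)) (Var 1)) = idT (wk 4 A) (Var 3) (Var 1)"
    using m(2,4)[of 3] subst_inst_scoped[of "vars (N + 5) N" A "ups 3 ?r"] A_scoped
    by (simp add: wk_A[symmetric] numeral_eq_Suc up_def)
  have t: "tsubst ?r \<Delta>\<Psi> = [idT (wk 4 A) (Var 3) (Var 1),
      idT (inst ?x A) (Var 1) (inst (Var 0 # refl_at \<Gamma> ?x @ ?x @ ?x) trA), wk 2 A, wk 1 A]"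
    using tz tz' tv tw by (simp add: numeral_eq_Suc)
  have c: "ctx (tsubst ?r \<Delta>\<Psi> @ A # \<Gamma>)" using elim_esub[OF e1] esub_ctx by blast
  then have c2: "ctx ([wk 2 A, wk 1 A] @ A # \<Gamma>)" and cw: "isty (tl (tsubst ?r \<Delta>\<Psi>) @ A # \<Gamma>) (idT (wk 4 A) (Var 3)
      (Var 1))"
    unfolding t by (simp_all add: ty_iff)
  have x: "isel ([wk 2 A, wk 1 A] @ A # \<Gamma>) ?x \<Gamma>"
    using elems_eq_vars[of "[wk 2 A, wk 1 A, A]" \<Gamma> 3 N] c2 by simp
  note ww = wk_wk[OF J_ok[OF cteq_\<Gamma>] A_type]
  have y: "istm ([wk 2 A, wk 1 A] @ A # \<Gamma>) (Var 1) (inst ?x A)" "istm ([wk 2 A, wk 1 A] @ A # \<Gamma>) (Var 0)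
      (inst ?x A)"
    using variable[OF c2, of 1] variable[OF c2, of 0] ww[of 2 1 A] ww[of 1 2 A]
    by (simp_all add: tm_iff wk_A numeral_eq_Suc)
  \<comment> \<open>Transport along the reflexivity left by the first step computes away, which
    makes \<open>v\<close> an identity within a fibre.\<close>
  have "tyeq ([wk 2 A, wk 1 A] @ A # \<Gamma>) (idT (inst ?x A) (Var 1) (inst (Var 0 # refl_at \<Gamma> ?x @ ?x @ ?x) trA)) (idT
      (inst ?x A) (Var 1) (Var 0))"
    by (rule id_cong[OF A_inst[OF c2 x] y(1) transport_A_refl[OF c2 x y(2)]])
  then have "cteq (tsubst ?r \<Delta>\<Psi> @ A # \<Gamma>) ?B"
    using cw is_ctx_cteq_refl[OF c2] ww[of 2 1 A] ww[of 1 1 A] unfolding t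
        by (simp add: extId_def wk_A numeral_eq_Suc)
  note e1 = elim_cteq[OF e1 this]
  have cB: "ctx ?B" using elim_esub[OF e1] esub_ctx by blast
  have "subst (refl_sub (wk 1 A)) (idT (wk 4 A) (Var 3) (Var 1)) = idT (wk 2 A) (Var 1) (Var 0)"
    by (auto simp: refl_sub_def subst_subst sb_def intro!: subst_cong)
  then have "elim ?B (ups 1 (refl_sub (wk 1 A))) Y"
    using elim_J_tel[OF cB] by (simp add: extId_def)
  from elim_comp[OF e1 this] show ?thesis unfolding fill_sub_def[abs_def] .
qed

text \<open>The degenerate square on an element of \<open>Y\<close>: \<open>x'\<close>,
  \<open>y'\<close>, \<open>z'\<close> coincide with \<open>x\<close>, \<open>y\<close>,
  \<open>z\<close>, and the two identities in \<open>\<Gamma>.A\<close> are reflexivities. The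
  hypothesis \<open>base\<close> of \<open>fill_eq\<close> and the last clause of
  \<open>filler\<close> are stated for squares of this form.\<close>

lemma map_fill_sub:
  "map (subst fill_sub) (vars 0 (3 * N + 7)) =
    [Var 0, reflT (wk 3 A) (Var 1), Var 1, Var 1] @
    refl_at X (Var 2 # vars 3 N) @ (Var 2 # vars 3 N) @ (Var 2 # vars 3 N)"
proof -
  have "3 * N + 7 = 4 + 3 * length X" by simp
  then have v: "vars 0 (3 * N + 7) = vars 0 4 @ (vars 4 (3 * length X) :: 's expr list)"
    by (simp only: vars_add) simp
  have "rename Suc t = wk (Suc 0) t" for t :: "'s expr"
    unfolding rename_conv_subst by (rule subst_cong) simp
  then have 1: "map (subst fill_sub) (vars 0 4) = [Var 0, reflT (wk 3 A) (Var 1), Var 1, Var 1]"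
    using wk_wk[OF J_ok[OF cteq_\<Gamma>] A_type, of 1 1 A] wk_wk[OF J_ok[OF cteq_\<Gamma>] A_type, of 1 2 A]
    by (simp add: vars_Suc fill_sub_def ups_eq refl_sub_def numeral_eq_Suc)
  have w: "subst (ups 1 (refl_sub B)) (wk 4 e) = wk 2 e" for B e
    unfolding subst_subst by (rule subst_cong) (simp add: refl_sub_def numeral_eq_Suc)
  have "map (subst fill_sub) (vars 4 (3 * length X)) = map (wk 2) (rl X)"
    by (rule nth_equalityI) (auto simp: fill_sub_def ups_eq w[simplified])
  also have "\<dots> = refl_at X (vars 2 (Suc N)) @ vars 2 (Suc N) @ vars 2 (Suc N)"
    using lift_rl[OF cX, of 2] unfolding lift_def by simp
  finally show ?thesis using 1 unfolding v by (simp add: vars_Suc numeral_eq_Suc)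
qed

text \<open>The counterpart of \<open>J_eq\<close> for squares: by \<open>elim_fill_ctx\<close>,
  families of identities over \<open>fill_ctx\<close> may be compared on degenerate squares.\<close>

lemma fill_eq:
  fixes L R F G :: "'s expr \<Rightarrow> 's expr \<Rightarrow> 's expr \<Rightarrow> 's expr \<Rightarrow> 's expr \<Rightarrow> 's expr list \<Rightarrow>
    's expr \<Rightarrow> 's expr list \<Rightarrow> 's expr \<Rightarrow> 's expr list \<Rightarrow> 's expr list"
  assumes c: "ctx \<Phi>"
    and nat: "\<And>\<sigma> w' v z' z u p y' x' y x H. length p = N \<Longrightarrow> length x' = N \<Longrightarrow> length x = N \<Longrightarrow>
        H = L \<or> H = R \<or> H = F \<or> H = G \<Longrightarrow>
        map (subst \<sigma>) (H w' v z' z u p y' x' y x) =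
          H (subst \<sigma> w') (subst \<sigma> v) (subst \<sigma> z') (subst \<sigma> z) (subst \<sigma> u) (map (subst \<sigma>) p)
            (subst \<sigma> y') (map (subst \<sigma>) x') (subst \<sigma> y) (map (subst \<sigma>) x)"
    and typed: "\<And>\<Omega> w' v z' z u p y' x' y x. ctx \<Omega> \<Longrightarrow>
        isel \<Omega> (w' # v # z' # z # u # p @ y' # x' @ y # x) fill_ctx \<Longrightarrow>
        length p = N \<Longrightarrow> length x' = N \<Longrightarrow> length x = N \<Longrightarrow>
        isel \<Omega> (F w' v z' z u p y' x' y x) \<Phi> \<and>
        isel \<Omega> (G w' v z' z u p y' x' y x) \<Phi> \<and>
        isel \<Omega> (L w' v z' z u p y' x' y x)
          (id_tel \<Phi> (F w' v z' z u p y' x' y x) (G w' v z' z u p y' x' y x)) \<and>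
        isel \<Omega> (R w' v z' z u p y' x' y x)
          (id_tel \<Phi> (F w' v z' z u p y' x' y x) (G w' v z' z u p y' x' y x))"
    and base: "\<And>\<Omega> w z y x u. ctx \<Omega> \<Longrightarrow> isel \<Omega> (w # z # y # x) Y \<Longrightarrow> length x = N \<Longrightarrow>
        refl_at X (y # x) = u # refl_at \<Gamma> x \<Longrightarrow>
        eleq \<Omega> (L w (reflT (inst x A) z) z z u (refl_at \<Gamma> x) y x y x)
          (R w (reflT (inst x A) z) z z u (refl_at \<Gamma> x) y x y x)
          (id_tel \<Phi> (F w (reflT (inst x A) z) z z u (refl_at \<Gamma> x) y x y x)
            (G w (reflT (inst x A) z) z z u (refl_at \<Gamma> x) y x y x))"
    and l: "ctx \<Omega>" "isel \<Omega> (w' # v # z' # z # u # p @ y' # x' @ y # x) fill_ctx"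
      "length p = N" "length x' = N" "length x = N"
  shows "eleq \<Omega> (L w' v z' z u p y' x' y x) (R w' v z' z u p y' x' y x)
          (id_tel \<Phi> (F w' v z' z u p y' x' y x) (G w' v z' z u p y' x' y x))"
proof -
  let ?vp = "vars 5 N :: 's expr list" and ?vx' = "vars (N + 6) N :: 's expr list" and ?vx = "vars
      (2*N + 7) N :: 's expr list"
  let ?at = "\<lambda>H :: 's expr \<Rightarrow> 's expr \<Rightarrow> 's expr \<Rightarrow> 's expr \<Rightarrow> 's expr \<Rightarrow> 's expr list \<Rightarrow>
    's expr \<Rightarrow> 's expr list \<Rightarrow> 's expr \<Rightarrow> 's expr list \<Rightarrow> 's expr list.
    H (Var 0) (Var 1) (Var 2) (Var 3) (Var 4) ?vp (Var (N + 5)) ?vx' (Var (2*N + 6)) ?vx"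
  let ?vs = "Var 0 # Var 1 # Var 2 # Var 3 # Var 4 # ?vp @ Var (N + 5) # ?vx' @ Var (2*N + 6) # ?vx"
  have vs: "vars 0 (3 * N + 7) = ?vs"
  proof -
    have "3 * N + 7 = Suc (Suc (Suc (Suc (Suc (N + Suc (N + Suc N))))))" by simp
    then have "vars 0 (3 * N + 7) = vars 0 (Suc (Suc (Suc (Suc (Suc (N + Suc (N + Suc N)))))))" by (rule arg_cong)
    also have "\<dots> = ?vs"
      unfolding vars_Suc vars_add by (simp add: numeral_eq_Suc)
    finally show ?thesis .
  qed
  have "isel fill_ctx (vars 0 (3 * N + 7)) fill_ctx"
    by (rule elems_eq_vars_0[OF is_ctx_fill_ctx]) (simp add: fill_ctx_length)
  from typed[OF is_ctx_fill_ctx this[unfolded vs]]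
  have ty: "isel fill_ctx (?at F) \<Phi>" "isel fill_ctx (?at G) \<Phi>"
      "isel fill_ctx (?at L) (id_tel \<Phi> (?at F) (?at G))" "isel fill_ctx (?at R) (id_tel \<Phi> (?at F) (?at G))"
    by auto
  have at: "map (subst \<sigma>) (?at H) = H (\<sigma> 0) (\<sigma> 1) (\<sigma> 2) (\<sigma> 3) (\<sigma> 4) (map (subst \<sigma>) ?vp) (\<sigma> (N + 5))
      (map (subst \<sigma>) ?vx') (\<sigma> (2*N + 6)) (map (subst \<sigma>) ?vx)" if "H = L \<or> H = R \<or> H = F \<or> H = G" for H \<sigma>
    using nat[of ?vp ?vx' ?vx H \<sigma>] that by simp
  have cY': "ctx Y" by (rule ctx_Y)
  obtain u0 where u0: "refl_at X (Var 2 # vars 3 N) = u0 # refl_at \<Gamma> (vars 3 N)" by (simp add: refl_at_Cons)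
  have "map (subst fill_sub) ?vs = [Var 0, reflT (wk 3 A) (Var 1), Var 1, Var 1] @
    refl_at X (Var 2 # vars 3 N) @ (Var 2 # vars 3 N) @ (Var 2 # vars 3 N)"
    using map_fill_sub unfolding vs .
  then have f: "fill_sub 0 = Var 0" "fill_sub 1 = reflT (wk 3 A) (Var 1)" "fill_sub 2 = Var 1" "fill_sub 3 = Var 1"
    "fill_sub 4 = u0" "map (subst fill_sub) ?vp = refl_at \<Gamma> (vars 3 N)" "fill_sub (N + 5) = Var 2"
    "map (subst fill_sub) ?vx' = vars 3 N" "fill_sub (2*N + 6) = Var 2" "map (subst fill_sub) ?vx = vars 3 N"
    unfolding u0 by simp_all
  have "isel Y (vars 0 (Suc (Suc (Suc N)))) Y"
    by (rule elems_eq_vars_0[OF ctx_Y]) (simp add: Y_length)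
  then have "isel Y (Var 0 # Var 1 # Var 2 # vars 3 N) Y"
    by (simp add: vars_Suc numeral_eq_Suc)
  from base[OF ctx_Y this _ u0]
  have "eleq Y (map (subst fill_sub) (?at L)) (map (subst fill_sub) (?at R))
    (id_tel \<Phi> (map (subst fill_sub) (?at F)) (map (subst fill_sub) (?at G)))"
    by (simp add: at f wk_A del: One_nat_def)
  note * = elim_eq_generic[OF elim_fill_ctx c ty this l(1,2)]
  let ?l = "w' # v # z' # z # u # p @ y' # x' @ y # x"
  have "insts ?l (vars 0 (3 * N + 7)) = ?l"
    by (rule insts_vars_0) (simp add: l)
  then have "insts ?l ?vs = ?l" unfolding vs .
  then have "sb 0 ?l 0 = w'" "sb 0 ?l 1 = v" "sb 0 ?l 2 = z'" "sb 0 ?l 3 = z" "sb 0 ?l 4 = u"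
     "insts ?l ?vp = p" "sb 0 ?l (N + 5) = y'" "insts ?l ?vx' = x'" "sb 0 ?l (2 * N + 6) = y" "insts ?l ?vx = x"
    unfolding list.map map_append subst.simps using l by simp_all
  with * show ?thesis by (simp add: at del: One_nat_def)
qed

text \<open>\<open>T\<close> completes \<open>(u, p)\<close>, \<open>(v, p)\<close> and \<open>w' : Id(y', z')\<close> to a commutative square, and \<open>\<theta>\<close> is an identity
  between the elements \<open>T\<close> and \<open>w'\<close> of \<open>\<Gamma>.A.A.Id\<^sub>A\<close> lying over it.\<close>

definition filler :: "'s expr \<Rightarrow> 's expr list \<Rightarrow> bool" where
  "filler T \<theta> \<longleftrightarrow> scoped (3 * N + 7) T \<and> (\<forall>e\<in>set \<theta>. scoped (3 * N + 7) e) \<and> length \<theta> = length Y \<and>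
    (\<forall>\<Omega> w' v z' z u p y' x' y x l2. ctx \<Omega> \<longrightarrow> eleq \<Omega> (w' # v # z' # z # u # p @ y' # x' @ y # x) l2 fill_ctx \<longrightarrow>
      length p = N \<longrightarrow> length x' = N \<longrightarrow> length x = N \<longrightarrow>
      tmeq \<Omega> (inst (w' # v # z' # z # u # p @ y' # x' @ y # x) T) (inst l2 T) (idT (inst x A) y z) \<and>
      eleq \<Omega> (insts (w' # v # z' # z # u # p @ y' # x' @ y # x) \<theta>) (insts l2 \<theta>)
        (id_tel Y (inst (w' # v # z' # z # u # p @ y' # x' @ y # x) T # z # y # x) (w' # z' # y' # x'))) \<and>
    (\<forall>\<Omega> w z y x u. ctx \<Omega> \<longrightarrow> isel \<Omega> (w # z # y # x) Y \<longrightarrow> length x = N \<longrightarrow>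
      refl_at X (y # x) = u # refl_at \<Gamma> x \<longrightarrow>
      tmeq \<Omega> (inst (w # reflT (inst x A) z # z # z # u # refl_at \<Gamma> x @ y # x @ y # x) T) w (idT (inst x A) y z) \<and>
      eleq \<Omega> (insts (w # reflT (inst x A) z # z # z # u # refl_at \<Gamma> x @ y # x @ y # x) \<theta>) (refl_at Y
          (w # z # y # x))
        (id_tel Y (w # z # y # x) (w # z # y # x)))"

text \<open>Two eliminations in succession, since the type of \<theta> mentions \<open>T\<close>.
  Both are solved once over the variables of \<open>fill_ctx\<close>; the clauses of
  \<open>filler\<close> are then obtained by substitution.\<close>

lemma filler_exists: "\<exists>T \<theta>. filler T \<theta>"
proof -
  let ?vx' = "vars (N + 6) N :: 's expr list" and ?vx = "vars (2*N + 7) N :: 's expr list"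
  let ?vs = "Var 0 # Var 1 # Var 2 # Var 3 # Var 4 # vars 5 N @ Var (N + 5) # ?vx' @ Var (2*N + 6) # ?vx"
  have vs: "vars 0 (3 * N + 7) = ?vs"
  proof -
    have "3 * N + 7 = Suc (Suc (Suc (Suc (Suc (N + Suc (N + Suc N))))))" by simp
    then have "vars 0 (3 * N + 7) = vars 0 (Suc (Suc (Suc (Suc (Suc (N + Suc (N + Suc N)))))))" by (rule arg_cong)
    also have "\<dots> = ?vs"
      unfolding vars_Suc vars_add by (simp add: numeral_eq_Suc)
    finally show ?thesis .
  qed
  note el = elim_fill_ctx
  have "isel fill_ctx (vars 0 (3 * N + 7)) fill_ctx"
    by (rule elems_eq_vars_0[OF is_ctx_fill_ctx]) (simp add: fill_ctx_length)
  note tv = this[unfolded vs elems_fill_ctx[OF vars_length vars_length vars_length vars_length vars_length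
      vars_length]]
  then have tx: "isel fill_ctx ?vx \<Gamma>" "istm fill_ctx (Var (2*N + 6)) (inst ?vx A)"
    "istm fill_ctx (Var 3) (inst ?vx A)" by simp_all
  have tY': "isel fill_ctx (Var 0 # Var 2 # Var (N + 5) # ?vx') Y"
    using tv by (simp add: elems_Y)
  \<comment> \<open>\<open>T : Id(y, z)\<close> is the missing side of the square. On degenerate
    squares \<open>y' = y\<close> and \<open>z' = z\<close>, so \<open>w'\<close> itself can be
    prescribed as its value.\<close>
  let ?C = "idT (inst ?vx A) (Var (2*N + 6)) (Var 3)"
  have "isty fill_ctx ?C" by (rule id_cong[OF A_inst[OF is_ctx_fill_ctx tx(1)] tx(2,3)])
  then have cC: "ctx ([?C] @ fill_ctx)" using is_ctx_fill_ctx by (simp add: ty_iff)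
  obtain u0 where u0: "refl_at X (Var 2 # vars 3 N) = u0 # refl_at \<Gamma> (vars 3 N)" by (simp add: refl_at_Cons)
  have fvs: "map (subst fill_sub) ?vs = Var 0 # reflT (wk 3 A) (Var 1) # Var 1 # Var 1 #
    u0 # refl_at \<Gamma> (vars 3 N) @ (Var 2 # vars 3 N) @ (Var 2 # vars 3 N)"
    using map_fill_sub unfolding vs u0 by simp
  then have f: "fill_sub 0 = Var 0" "fill_sub 2 = Var 1" "fill_sub 3 = Var 1"
    "fill_sub (N + 5) = Var 2" "map (subst fill_sub) ?vx' = vars 3 N" "fill_sub (2*N + 6) = Var 2" "map
        (subst fill_sub) ?vx = vars 3 N"
    by simp_all
  have "isel Y (vars 0 (Suc (Suc (Suc N)))) Y"
    by (rule elems_eq_vars_0[OF ctx_Y]) (simp add: Y_length)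
  then have vY: "isel Y (Var 0 # Var 1 # Var 2 # vars 3 N) Y"
    by (simp add: vars_Suc numeral_eq_Suc)
  have fC: "subst fill_sub ?C = idT (inst (vars 3 N) A) (Var 2) (Var 1)"
    using subst_inst_scoped[of ?vx A fill_sub] A_scoped f by simp
  have "isel Y [Var 0] (tsubst fill_sub [?C])"
    using vY fC unfolding elems_Y by simp
  from elim_obtain[OF el cC this] obtain ts where ts: "isel fill_ctx ts [?C]"
    "eleq Y (map (subst fill_sub) ts) [Var 0] (tsubst fill_sub [?C])" .
  then obtain T where T: "istm fill_ctx T ?C" "tmeq Y (subst fill_sub T) (Var 0) (idT (inst (vars 3 N) A) (Var 2)
      (Var 1))"
    using fC by (auto elim!: elems_eq_ConsE)
  have tY: "isel fill_ctx (T # Var 3 # Var (2*N + 6) # ?vx) Y"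
    using tx T by (simp add: elems_Y)
  \<comment> \<open>\<theta> is to join \<open>(T, z, y, x)\<close> and
    \<open>(w', z', y', x')\<close>, which on degenerate squares are equal elements of
    \<open>Y\<close>.\<close>
  let ?\<Theta> = "id_tel Y (T # Var 3 # Var (2*N + 6) # ?vx) (Var 0 # Var 2 # Var (N + 5) # ?vx')"
  have c\<Theta>: "ctx (?\<Theta> @ fill_ctx)" by (rule is_ctx_id_tel[OF ctx_Y is_ctx_fill_ctx tY tY'])
  have f\<Theta>: "tsubst fill_sub ?\<Theta> = id_tel Y (subst fill_sub T # Var 1 # Var 2 # vars 3 N)
      (Var 0 # Var 1 # Var 2 # vars 3 N)"
    by (simp add: tsubst_id_tel[OF ctx_Y] Y_length f)
  let ?vY = "Var 0 # Var 1 # Var 2 # vars 3 N :: 's expr list"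
  have TY: "eleq Y (subst fill_sub T # Var 1 # Var 2 # vars 3 N) ?vY Y"
    using vY T(2) unfolding elems_Y by simp
  \<comment> \<open>The value of \<open>T\<close> on degenerate squares is \<open>w\<close> only up
    to definitional equality, so the reflexivity is first converted to the required type.\<close>
  have "isel Y (refl_at Y ?vY) (tsubst fill_sub ?\<Theta>)"
    unfolding f\<Theta>
    by (rule id_tel_conv[OF refl_at_typed[OF ctx_Y ctx_Y vY] cteq_Y ctx_Y elems_eq_sym_closed[OF TY ctx_Y ctx_Y]
        vY])
  from elim_obtain[OF el c\<Theta> this] obtain \<theta> where \<theta>: "isel fill_ctx \<theta> ?\<Theta>"
    "eleq Y (map (subst fill_sub) \<theta>) (refl_at Y ?vY) (tsubst fill_sub ?\<Theta>)" .
  have T_scoped: "scoped (3 * N + 7) T" using scope[OF T(1)] by (simp add: fill_ctx_length)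
  have \<theta>_scoped: "\<forall>e\<in>set \<theta>. scoped (3 * N + 7) e" using elems_eq_scoped[OF \<theta>(1)] by (simp add: fill_ctx_length)
  have \<theta>_length: "length \<theta> = length Y" using elems_eq_length[OF \<theta>(1)] by simp
  {
    fix \<Omega> w' v z' z u y' y and p x' x l2 :: "'s expr list"
    let ?l = "w' # v # z' # z # u # p @ y' # x' @ y # x"
    assume a: "ctx \<Omega>" "eleq \<Omega> ?l l2 fill_ctx" "length p = N" "length x' = N" "length x = N"
    have "insts ?l (vars 0 (3 * N + 7)) = ?l" by (rule insts_vars_0) (simp add: a)
    then have "insts ?l ?vs = ?l" unfolding vs .
    then have b: "sb 0 ?l 0 = w'" "sb 0 ?l 2 = z'" "sb 0 ?l 3 = z" "sb 0 ?l (N + 5) = y'"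
      "insts ?l ?vx' = x'" "sb 0 ?l (2 * N + 6) = y" "insts ?l ?vx = x"
      unfolding list.map map_append subst.simps using a by simp_all
    have "inst ?l ?C = idT (inst x A) y z" using subst_inst_scoped[of ?vx A "sb 0 ?l"] A_scoped b by simp
    moreover have "tsubst (sb 0 ?l) ?\<Theta> = id_tel Y (inst ?l T # z # y # x) (w' # z' # y' # x')"
      by (simp add: tsubst_id_tel[OF ctx_Y] Y_length b)
    ultimately have "tmeq \<Omega> (inst ?l T) (inst l2 T) (idT (inst x A) y z) \<and>
      eleq \<Omega> (insts ?l \<theta>) (insts l2 \<theta>) (id_tel Y (inst ?l T # z # y # x) (w' # z' # y' # x'))"
      using inst_tmeq[OF T(1) a(1,2)] elems_eq_comp[OF \<theta>(1) esub_instI[OF a(1) is_ctx_fill_ctx a(2)]] by simp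
  }
  note A = this
  {
    fix \<Omega> w z y u and x :: "'s expr list"
    let ?y = "w # z # y # x" and ?l = "w # reflT (inst x A) z # z # z # u # refl_at \<Gamma> x @ y # x @ y # x"
    assume a: "ctx \<Omega>" "isel \<Omega> ?y Y" "length x = N" and u: "refl_at X (y # x) = u # refl_at \<Gamma> x"
    have b: "insts ?y (vars 3 N) = x" "insts ?y (Var 2 # vars 3 N) = y # x"
      using a(3) by (simp_all add: insts_vars numeral_eq_Suc)
    have "insts ?y (refl_at X (Var 2 # vars 3 N)) = refl_at X (insts ?y (Var 2 # vars 3 N))"
      by (rule map_subst_refl_at[OF cX]) simp
    then have r: "inst ?y u0 # insts ?y (refl_at \<Gamma> (vars 3 N)) = u # refl_at \<Gamma> x"
      unfolding b u u0 by simp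
    have "inst ?y (wk 3 A) = inst x A" using inst_wk[of 3 ?y A] by (simp add: numeral_eq_Suc)
    then have l: "insts ?y (map (subst fill_sub) ?vs) = ?l"
      unfolding fvs using r b by simp
    have sv: "map fill_sub [0..<3 * N + 7] = map (subst fill_sub) ?vs"
      unfolding vs[symmetric] by (simp add: map_subst_vars)
    \<comment> \<open>Instantiating a term restricted along \<open>fill_sub\<close> at an element of
      \<open>Y\<close> is instantiating the term at the degenerate square on that element.\<close>
    have i: "inst ?y (subst fill_sub e) = inst ?l e" if "scoped (3 * N + 7) e" for e
      unfolding subst_subst
    proof (rule subst_scoped_cong[OF that])
      fix i assume i: "i < 3 * N + 7"
      have "?l ! i = inst ?y (map fill_sub [0..<3 * N + 7] ! i)" unfolding l[symmetric] sv[symmetric] using i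
          by simp
      then show "inst ?y (fill_sub i) = sb 0 ?l i" using i a(3) by (simp del: nth_Cons')
    qed
    have 1: "tmeq \<Omega> (inst ?l T) w (idT (inst x A) y z)"
      using inst_tmeq[OF T(2) a(1,2)] i[OF T_scoped] subst_inst_scoped[of "vars 3 N" A "sb 0 ?y"] A_scoped b a(3)
      by (simp add: numeral_eq_Suc)
    have i\<theta>: "insts ?y (map (subst fill_sub) \<theta>) = insts ?l \<theta>"
      using \<theta>_scoped i by simp
    have "insts ?y (refl_at Y ?vY) = refl_at Y ?y"
      using b(1) by (subst map_subst_refl_at[OF ctx_Y]) (simp_all add: Y_length numeral_eq_Suc)
    moreover have "tsubst (sb 0 ?y) (tsubst fill_sub ?\<Theta>) = id_tel Y (inst ?l T # z # y # x) ?y"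
      unfolding f\<Theta> using b(1) i[OF T_scoped] by (simp add: tsubst_id_tel[OF ctx_Y] Y_length numeral_eq_Suc)
    ultimately have "eleq \<Omega> (insts ?l \<theta>) (refl_at Y ?y) (id_tel Y (inst ?l T # z # y # x) ?y)"
      using elems_eq_comp[OF \<theta>(2) esub_instI[OF a(1) ctx_Y a(2)]] i\<theta> by (simp del: map_map)
    moreover have "eleq \<Omega> (inst ?l T # z # y # x) ?y Y"
      using 1 a(2) by (simp add: elems_Y)
    ultimately have "eleq \<Omega> (insts ?l \<theta>) (refl_at Y ?y) (id_tel Y ?y ?y)"
      using id_tel_conv[OF _ cteq_Y a(1) _ a(2)] by blast
    with 1 have "tmeq \<Omega> (inst ?l T) w (idT (inst x A) y z) \<and>
      eleq \<Omega> (insts ?l \<theta>) (refl_at Y ?y) (id_tel Y ?y ?y)" by blast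
  }
  note B = this
  show ?thesis
    unfolding filler_def
    by (rule exI[of _ T], rule exI[of _ \<theta>]) (intro conjI[OF T_scoped] conjI[OF \<theta>_scoped] conjI[OF \<theta>_length], use A
        B in blast)
qed

text \<open>\<open>Sq\<close> and \<open>Q\<close> are identities in \<open>\<Gamma>.A\<close> whose
  base parts agree only up to definitional equality, whereas \<open>fill_ctx\<close> has a single
  \<open>p\<close>. It is taken from \<open>Sq\<close>.\<close>

private abbreviation (input) "args w' Q z' z Sq y' x' y x \<equiv>
  w' # hd Q # z' # z # hd Sq # tl Sq @ y' # x' @ y # x"

lemmas XY_ctxs = ctx_\<Gamma> ctx_Y cteq_\<Gamma> cteq_X cteq_Y

lemma refl_at_X: "refl_at X (z # x) = reflT (inst x A) z # refl_at \<Gamma> x"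
  using inst_wk[of 1 "z # x" A] by (simp add: refl_at_Cons)

lemma src_inst: "length x = N \<Longrightarrow> insts (w # z # y # x) src = y # x"
  and tgt_inst: "length x = N \<Longrightarrow> insts (w # z # y # x) tgt = z # x"
  by (simp_all add: insts_vars numeral_eq_Suc)

lemma elems_src: "isel Y src X"
  and elems_tgt: "isel Y tgt X"
proof -
  have "isel Y (vars 0 (Suc (Suc (Suc N)))) Y"
    by (rule elems_eq_vars_0[OF XY_ctxs(2)]) (simp add: Y_length)
  then have "isel Y (Var 0 # Var 1 # Var 2 # vars 3 N) Y"
    by (simp add: vars_Suc numeral_eq_Suc)
  then show "isel Y src X" "isel Y tgt X"
    unfolding elems_Y by simp_all
qed

lemma elems_XE:
  assumes "eleq \<Omega> Sq S2 (id_tel X (y # x) (y' # x'))"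
  obtains u p u2 p2 where "Sq = u # p" "S2 = u2 # p2" "length p = N" "length p2 = N"
  using elems_eq_length[OF assms] by (auto simp: length_Suc_conv)

text \<open>\<open>hd Q\<close> lies over \<open>tl Q\<close>; placing it over \<open>tl Sq\<close>
  changes its type by an equality of transports.\<close>

lemma fill_args:
  assumes \<Omega>: "ctx \<Omega>" and h: "isel \<Omega> (w # z # y # x) Y"
    and h': "isel \<Omega> (w' # z' # y' # x') Y"
    and l: "length x = N" "length x' = N"
    and Sq: "eleq \<Omega> Sq S2 (id_tel X (y # x) (y' # x'))" and Q: "eleq \<Omega> Q Q2 (id_tel X (z # x) (z' # x'))"
    and SQ: "eleq \<Omega> (tl Sq) (tl Q) (id_tel \<Gamma> x x')"
  shows "eleq \<Omega> (args w' Q z' z Sq y' x' y x) (args w' Q2 z' z S2 y' x' y x) fill_ctx"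
    "eleq \<Omega> Q (hd Q # tl Sq) (id_tel X (z # x) (z' # x'))"
proof -
  obtain u p u2 p2 where S: "Sq = u # p" "S2 = u2 # p2" "length p = N" "length p2 = N" by (rule elems_XE[OF Sq])
  obtain v r v2 r2 where Q': "Q = v # r" "Q2 = v2 # r2" "length r = N" "length r2 = N" by (rule elems_XE[OF Q])
  have x: "isel \<Omega> x \<Gamma>" "istm \<Omega> y (inst x A)" "istm \<Omega> z (inst x A)"
    and x': "isel \<Omega> x' \<Gamma>" "istm \<Omega> y' (inst x' A)" "istm \<Omega> z' (inst x' A)" "istm \<Omega> w' (idT (inst x' A) y' z')"
    using h h' by (simp_all add: elems_Y)
  note s = elems_id_tel_Cons[OF cX x(1) x'(1) x(2) x'(2)] and q = elems_id_tel_Cons[OF cX x(1) x'(1) x(3) x'(3)]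
  from Sq have S1: "eleq \<Omega> p p2 (id_tel \<Gamma> x x')" "tmeq \<Omega> u u2 (idT (inst x A) y (inst (y' # p @ x' @ x) (transport
      (J_ctx \<Gamma>) N A)))"
    unfolding S using s[OF S(3,4)] by simp_all
  have pr: "eleq \<Omega> p r (id_tel \<Gamma> x x')" using SQ by (simp add: S Q')
  from Q have Q1: "tmeq \<Omega> v v2 (idT (inst x A) z (inst (z' # r @ x' @ x) (transport (J_ctx \<Gamma>) N A)))"
    "eleq \<Omega> r r2 (id_tel \<Gamma> x x')"
    unfolding Q' using q[OF Q'(3,4)] by simp_all
  have "tyeq \<Omega> (idT (inst x A) z (inst (z' # r @ x' @ x) (transport (J_ctx \<Gamma>) N A)))
     (idT (inst x A) z (inst (z' # p @ x' @ x) (transport (J_ctx \<Gamma>) N A)))"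
    by (rule id_cong[OF A_inst[OF \<Omega> x(1)] x(3) transport_A[OF \<Omega> x(1) x'(1) id_tel_sym[OF XY_ctxs(1) \<Omega> x(1) x'(1)
        pr] x'(3)]])
  with Q1 have "tmeq \<Omega> v v2 (idT (inst x A) z (inst (z' # p @ x' @ x) (transport (J_ctx \<Gamma>) N A)))"
    using TmEq_conv by blast
  then show "eleq \<Omega> (args w' Q z' z Sq y' x' y x) (args w' Q2 z' z S2 y' x' y x) fill_ctx"
    unfolding S Q' list.sel elems_fill_ctx[OF l(1,1) l(2,2) S(3,4)] using x x' S1 by blast
  show "eleq \<Omega> Q (hd Q # tl Sq) (id_tel X (z # x) (z' # x'))"
    unfolding S Q' list.sel using q[OF Q'(3) S(3)] id_tel_sym[OF XY_ctxs(1) \<Omega> x(1) x'(1) pr] tmeqD(1)[OF Q1(1)]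
        by blast
qed

text \<open>\<open>src\<close> and \<open>tgt\<close> followed by the projection to
  \<open>\<Gamma>\<close> are the same morphism, so by functoriality their actions on an identity
  have equal base parts.\<close>

lemma tl_id_map:
  assumes \<Omega>: "ctx \<Omega>" and h: "isel \<Omega> h Y" and h': "isel \<Omega> h' Y"
    and k: "isel \<Omega> k (id_tel Y h h')"
    and s: "isel Y s X" "s = Var i # vars 3 N"
  shows "eleq \<Omega> (tl (id_map Y X s h h' k)) (id_map Y \<Gamma> (vars 3 N) h h' k)
    (id_tel \<Gamma> (drop 3 h) (drop 3 h'))"
proof -
  have v: "isel X (vars 1 N) \<Gamma>" using elems_eq_vars[of "[A]" \<Gamma> 1 N] cX by simp
  have e: "insts s (vars 1 N) = vars 3 N" using s(2) by (simp add: insts_vars)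
  note hs = hom_inst[OF cX s(1) \<Omega> XY_ctxs(2) h] hom_inst[OF cX s(1) \<Omega> XY_ctxs(2) h']
  note m = id_map_cong[OF XY_ctxs(5,4) s(1) \<Omega> h h' k]
  have i: "tl (insts h s) = drop 3 h" if "length h = Suc (Suc (Suc N))" for h
    using that by (simp add: s(2) insts_vars)
  have i2: "insts h (vars 3 N) = drop 3 h" if "length h = Suc (Suc (Suc N))" for h
    using that by (simp add: insts_vars)
  have l: "length h = Suc (Suc (Suc N))" "length h' = Suc (Suc (Suc N))"
    using elems_eq_length[OF h] elems_eq_length[OF h'] by (simp_all add: Y_length)
  note 1 = id_map_proj[OF cX \<Omega> hs m, unfolded i[OF l(1)] i[OF l(2)]]
  note 2 = id_map_id_map[OF XY_ctxs(2) cX XY_ctxs(1) s(1) v \<Omega> h h' k, unfolded e i2[OF l(1)] i2[OF l(2)]]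
  have d: "isel \<Omega> (drop 3 h) \<Gamma>" "isel \<Omega> (drop 3 h') \<Gamma>"
    using h h' by (auto elim!: elems_YE)
  show ?thesis
    using id_tel_sym[OF XY_ctxs(1) \<Omega> d id_tel_trans[OF XY_ctxs(1) \<Omega> d 2 1]] .
qed

lemma tl_src_tgt:
  assumes \<Omega>: "ctx \<Omega>" and h: "isel \<Omega> h Y" and h': "isel \<Omega> h' Y"
    and k: "isel \<Omega> k (id_tel Y h h')"
  shows "eleq \<Omega> (tl (id_map Y X src h h' k)) (tl (id_map Y X tgt h h' k))
    (id_tel \<Gamma> (drop 3 h) (drop 3 h'))"
proof -
  have d: "isel \<Omega> (drop 3 h) \<Gamma>" "isel \<Omega> (drop 3 h') \<Gamma>"
    using h h' by (auto elim!: elems_YE)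
  show ?thesis
    using id_tel_trans[OF XY_ctxs(1) \<Omega> d tl_id_map[OF \<Omega> h h' k elems_src refl] id_tel_sym[OF XY_ctxs(1) \<Omega> d
        tl_id_map[OF \<Omega> h h' k elems_tgt refl]]] .
qed

section \<open>Boundary of the filler, and recovery of an identity from its square\<close>

context
  fixes T \<theta>
  assumes fill: "filler T \<theta>"
begin

lemma T_scoped: "scoped (3 * N + 7) T" and \<theta>_scoped: "\<forall>e\<in>set \<theta>. scoped (3 * N + 7) e"
    and \<theta>_length: "length \<theta> = length Y"
  using fill unfolding filler_def by blast+

lemma filler_cong:
  "ctx \<Omega> \<Longrightarrow> eleq \<Omega> (w' # v # z' # z # u # p @ y' # x' @ y # x) l2 fill_ctx \<Longrightarrow>
      length p = N \<Longrightarrow> length x' = N \<Longrightarrow> length x = N \<Longrightarrow>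
      tmeq \<Omega> (inst (w' # v # z' # z # u # p @ y' # x' @ y # x) T) (inst l2 T) (idT (inst x A) y z) \<and>
      eleq \<Omega> (insts (w' # v # z' # z # u # p @ y' # x' @ y # x) \<theta>) (insts l2 \<theta>)
        (id_tel Y (inst (w' # v # z' # z # u # p @ y' # x' @ y # x) T # z # y # x) (w' # z' # y' # x'))"
  using fill unfolding filler_def by blast

lemma filler_refl:
  "ctx \<Omega> \<Longrightarrow> isel \<Omega> (w # z # y # x) Y \<Longrightarrow> length x = N \<Longrightarrow>
      refl_at X (y # x) = u # refl_at \<Gamma> x \<Longrightarrow>
      tmeq \<Omega> (inst (w # reflT (inst x A) z # z # z # u # refl_at \<Gamma> x @ y # x @ y # x) T) w (idT (inst x A) y z) \<and>
      eleq \<Omega> (insts (w # reflT (inst x A) z # z # z # u # refl_at \<Gamma> x @ y # x @ y # x) \<theta>) (refl_at Y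
          (w # z # y # x))
        (id_tel Y (w # z # y # x) (w # z # y # x))"
  using fill unfolding filler_def by blast

lemma T_nat: "length p = N \<Longrightarrow> length x' = N \<Longrightarrow> length x = N \<Longrightarrow>
   subst \<sigma> (inst (w' # v # z' # z # u # p @ y' # x' @ y # x) T) =
   inst (subst \<sigma> w' # subst \<sigma> v # subst \<sigma> z' # subst \<sigma> z # subst \<sigma> u # map (subst \<sigma>) p @ subst \<sigma> y' # map
       (subst \<sigma>) x' @ subst \<sigma> y # map (subst \<sigma>) x) T"
  using subst_inst_scoped[of "w' # v # z' # z # u # p @ y' # x' @ y # x" T \<sigma>] T_scoped
      by (simp add: numeral_eq_Suc add.assoc)

lemma \<theta>_nat: "length p = N \<Longrightarrow> length x' = N \<Longrightarrow> length x = N \<Longrightarrow>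
   map (subst \<sigma>) (insts (w' # v # z' # z # u # p @ y' # x' @ y # x) \<theta>) =
   insts (subst \<sigma> w' # subst \<sigma> v # subst \<sigma> z' # subst \<sigma> z # subst \<sigma> u # map (subst \<sigma>) p @ subst \<sigma> y' # map
       (subst \<sigma>) x' @ subst \<sigma> y # map (subst \<sigma>) x) \<theta>"
  using map_subst_insts[of \<theta> "w' # v # z' # z # u # p @ y' # x' @ y # x" \<sigma>] \<theta>_scoped
      by (simp add: numeral_eq_Suc add.assoc)

lemma fill_endpoints:
  assumes l: "ctx \<Omega>" "isel \<Omega> (w' # v # z' # z # u # p @ y' # x' @ y # x) fill_ctx"
      "length p = N" "length x' = N" "length x = N"
    and "l = w' # v # z' # z # u # p @ y' # x' @ y # x"
  shows "isel \<Omega> x \<Gamma>" "isel \<Omega> x' \<Gamma>" "isel \<Omega> (y # x) X" "isel \<Omega> (z # x) X"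
    "isel \<Omega> (y' # x') X" "isel \<Omega> (z' # x') X"
    "isel \<Omega> (u # p) (id_tel X (y # x) (y' # x'))" "isel \<Omega> (v # p) (id_tel X (z # x) (z' # x'))"
    "isel \<Omega> (w' # z' # y' # x') Y"
    "isel \<Omega> (inst l T # z # y # x) Y"
    "isel \<Omega> (insts l \<theta>) (id_tel Y (inst l T # z # y # x) (w' # z' # y' # x'))"
    "isel \<Omega> (w' # refl_at \<Gamma> x') (id_tel X (y' # x') (z' # x'))"
    "isel \<Omega> (inst l T # refl_at \<Gamma> x) (id_tel X (y # x) (z # x))"
proof -
  note a = l(2)[unfolded elems_fill_ctx[OF l(5,5,4,4,3,3)]]
  note b = filler_cong[OF l(1,2,3,4,5), folded assms(6)]
  show 1: "isel \<Omega> x \<Gamma>" "isel \<Omega> x' \<Gamma>" "isel \<Omega> (y # x) X" "isel \<Omega> (z # x) X"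
    "isel \<Omega> (y' # x') X" "isel \<Omega> (z' # x') X"
    "isel \<Omega> (w' # z' # y' # x') Y"
    "isel \<Omega> (inst l T # z # y # x) Y"
    "isel \<Omega> (insts l \<theta>) (id_tel Y (inst l T # z # y # x) (w' # z' # y' # x'))"
    using a b by (simp_all add: elems_Y)
  show "isel \<Omega> (u # p) (id_tel X (y # x) (y' # x'))" "isel \<Omega> (v # p) (id_tel X (z # x) (z' # x'))"
    using a elems_id_tel_Cons[OF cX 1(1,2) _ _ l(3,3)] by simp_all
  show "isel \<Omega> (w' # refl_at \<Gamma> x') (id_tel X (y' # x') (z' # x'))"
    "isel \<Omega> (inst l T # refl_at \<Gamma> x) (id_tel X (y # x) (z # x))"
    using a b elems_vertical[OF l(1) 1(1)] elems_vertical[OF l(1) 1(2)] by simp_all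
qed

lemma fill_base:
  assumes a: "ctx \<Omega>" "isel \<Omega> (w # z # y # x) Y" "length x = N"
    "refl_at X (y # x) = u # refl_at \<Gamma> x"
    and l: "l = w # reflT (inst x A) z # z # z # u # refl_at \<Gamma> x @ y # x @ y # x"
  shows "eleq \<Omega> (inst l T # z # y # x) (w # z # y # x) Y"
    "eleq \<Omega> (w # z # y # x) (inst l T # z # y # x) Y"
    "eleq \<Omega> (insts l \<theta>) (refl_at Y (w # z # y # x)) (id_tel Y (inst l T # z # y # x) (w # z # y # x))"
    "eleq \<Omega> (inst l T # refl_at \<Gamma> x) (w # refl_at \<Gamma> x) (id_tel X (y # x) (z # x))"
    "isel \<Omega> x \<Gamma>" "isel \<Omega> (y # x) X" "isel \<Omega> (z # x) X"
proof -
  note b = filler_refl[OF a, folded l] and c = a(2)[unfolded elems_Y]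
  show 1: "eleq \<Omega> (inst l T # z # y # x) (w # z # y # x) Y" using b c by (simp add: elems_Y)
  show 2: "eleq \<Omega> (w # z # y # x) (inst l T # z # y # x) Y"
    by (rule elems_eq_sym_closed[OF 1 a(1) XY_ctxs(2)])
  show "eleq \<Omega> (insts l \<theta>) (refl_at Y (w # z # y # x)) (id_tel Y (inst l T # z # y # x) (w # z # y # x))"
    by (rule id_tel_conv[OF conjunct2[OF b] XY_ctxs(5) a(1) 2 a(2)])
  show "isel \<Omega> x \<Gamma>" "isel \<Omega> (y # x) X" "isel \<Omega> (z # x) X" using c by simp_all
  show "eleq \<Omega> (inst l T # refl_at \<Gamma> x) (w # refl_at \<Gamma> x) (id_tel X (y # x) (z # x))"
    using b c elems_vertical[OF a(1)] by simp
qed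

text \<open>On a degenerate square \<theta> is a reflexivity; its image under \<open>src\<close> is
  the reflexivity of \<open>(y, x)\<close>, which there is also \<open>(u, p)\<close>. The argument
  for \<open>tgt\<close> in \<open>fill_tgt\<close> is the same.\<close>

lemma fill_src:
  assumes l: "ctx \<Omega>" "isel \<Omega> (w' # v # z' # z # u # p @ y' # x' @ y # x) fill_ctx"
      "length p = N" "length x' = N" "length x = N"
  shows "eleq \<Omega> (id_map Y X src (inst (w' # v # z' # z # u # p @ y' # x' @ y # x) T # z # y # x) (w' # z' # y' # x')
      (insts (w' # v # z' # z # u # p @ y' # x' @ y # x) \<theta>)) (u # p) (id_tel X (y # x) (y' # x'))"
proof -
  note map = id_map_cong[OF XY_ctxs(5,4) elems_src]
  show ?thesis
  proof (rule fill_eq[OF cX, of "\<lambda>w' v z' z u p y' x' y x. id_map Y X src (inst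
      (w' # v # z' # z # u # p @ y' # x' @ y # x) T # z # y # x) (w' # z' # y' # x')
      (insts (w' # v # z' # z # u # p @ y' # x' @ y # x) \<theta>)" "\<lambda>w' v z' z u p y' x' y x. u # p"
      "\<lambda>w' v z' z u p y' x' y x. y # x" "\<lambda>w' v z' z u p y' x' y x. y' # x'" \<Omega> w' v z' z u p y' x' y x, OF _ _ _ l])
    fix \<Omega> w' v z' z u p y' x' y x
    assume l: "ctx \<Omega>" "isel \<Omega> (w' # v # z' # z # u # p @ y' # x' @ y # x) fill_ctx"
      "length p = N" "length x' = N" "length x = N"
    note e = fill_endpoints[OF l refl]
    show "isel \<Omega> (y # x) X \<and> isel \<Omega> (y' # x') X \<and>
      isel \<Omega> (id_map Y X src (inst (w' # v # z' # z # u # p @ y' # x' @ y # x) T # z # y # x) (w' # z' # y' # x')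
          (insts (w' # v # z' # z # u # p @ y' # x' @ y # x) \<theta>)) (id_tel X (y # x) (y' # x')) \<and>
      isel \<Omega> (u # p) (id_tel X (y # x) (y' # x'))"
      using map[OF l(1) e(10,9,11)] e unfolding src_inst[OF l(5)] src_inst[OF l(4)] by blast
  next
    fix \<Omega> w z y x u
    let ?l = "w # reflT (inst x A) z # z # z # u # refl_at \<Gamma> x @ y # x @ y # x"
    assume a: "ctx \<Omega>" "isel \<Omega> (w # z # y # x) Y" "length x = N"
      and u: "refl_at X (y # x) = u # refl_at \<Gamma> x"
    note b = fill_base[OF a u refl]
    note 1 = map[OF a(1) b(1) a(2) b(3)]
    note 2 = id_map_refl[OF XY_ctxs(5,4) elems_src a(1,2)]
    show "eleq \<Omega> (id_map Y X src (inst ?l T # z # y # x) (w # z # y # x) (insts ?l \<theta>)) (u # refl_at \<Gamma> x)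
        (id_tel X (y # x) (y # x))"
      using id_tel_trans[OF cX a(1) b(6,6)] 1 2 unfolding src_inst[OF a(3)] u by blast
  qed (elim disjE; simp add: map_subst_id_map[OF XY_ctxs(5,4) elems_src] Y_length \<theta>_length T_nat \<theta>_nat del: map_map)
qed

lemma fill_tgt:
  assumes l: "ctx \<Omega>" "isel \<Omega> (w' # v # z' # z # u # p @ y' # x' @ y # x) fill_ctx"
      "length p = N" "length x' = N" "length x = N"
  shows "eleq \<Omega> (id_map Y X tgt (inst (w' # v # z' # z # u # p @ y' # x' @ y # x) T # z # y # x) (w' # z' # y' # x')
      (insts (w' # v # z' # z # u # p @ y' # x' @ y # x) \<theta>)) (v # p) (id_tel X (z # x) (z' # x'))"
proof -
  note map = id_map_cong[OF XY_ctxs(5,4) elems_tgt]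
  show ?thesis
  proof (rule fill_eq[OF cX, of "\<lambda>w' v z' z u p y' x' y x. id_map Y X tgt (inst
      (w' # v # z' # z # u # p @ y' # x' @ y # x) T # z # y # x) (w' # z' # y' # x')
      (insts (w' # v # z' # z # u # p @ y' # x' @ y # x) \<theta>)" "\<lambda>w' v z' z u p y' x' y x. v # p"
      "\<lambda>w' v z' z u p y' x' y x. z # x" "\<lambda>w' v z' z u p y' x' y x. z' # x'" \<Omega> w' v z' z u p y' x' y x, OF _ _ _ l])
    fix \<Omega> w' v z' z u p y' x' y x
    assume l: "ctx \<Omega>" "isel \<Omega> (w' # v # z' # z # u # p @ y' # x' @ y # x) fill_ctx"
      "length p = N" "length x' = N" "length x = N"
    note e = fill_endpoints[OF l refl]
    show "isel \<Omega> (z # x) X \<and> isel \<Omega> (z' # x') X \<and>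
      isel \<Omega> (id_map Y X tgt (inst (w' # v # z' # z # u # p @ y' # x' @ y # x) T # z # y # x) (w' # z' # y' # x')
          (insts (w' # v # z' # z # u # p @ y' # x' @ y # x) \<theta>)) (id_tel X (z # x) (z' # x')) \<and>
      isel \<Omega> (v # p) (id_tel X (z # x) (z' # x'))"
      using map[OF l(1) e(10,9,11)] e unfolding tgt_inst[OF l(5)] tgt_inst[OF l(4)] by blast
  next
    fix \<Omega> w z y x u
    let ?l = "w # reflT (inst x A) z # z # z # u # refl_at \<Gamma> x @ y # x @ y # x"
    assume a: "ctx \<Omega>" "isel \<Omega> (w # z # y # x) Y" "length x = N"
      and u: "refl_at X (y # x) = u # refl_at \<Gamma> x"
    note b = fill_base[OF a u refl]
    note 1 = map[OF a(1) b(1) a(2) b(3)]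
    note 2 = id_map_refl[OF XY_ctxs(5,4) elems_tgt a(1,2)]
    show "eleq \<Omega> (id_map Y X tgt (inst ?l T # z # y # x) (w # z # y # x) (insts ?l \<theta>)) (reflT
        (inst x A) z # refl_at \<Gamma> x)
        (id_tel X (z # x) (z # x))"
      using id_tel_trans[OF cX a(1) b(7,7)] 1 2 unfolding tgt_inst[OF a(3)] refl_at_X by blast
  qed (elim disjE; simp add: map_subst_id_map[OF XY_ctxs(5,4) elems_tgt] Y_length \<theta>_length T_nat \<theta>_nat del: map_map
      One_nat_def)
qed

text \<open>On a degenerate square the sides \<open>(u, p)\<close> and \<open>(v, p)\<close> are
  reflexivities and \<open>T\<close> is \<open>w\<close>, so the two composites reduce to
  \<open>w\<close> by the right and the left unit law.\<close>

lemma fill_square: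
  assumes l: "ctx \<Omega>" "isel \<Omega> (w' # v # z' # z # u # p @ y' # x' @ y # x) fill_ctx"
      "length p = N" "length x' = N" "length x = N"
  shows "eleq \<Omega> (id_comp X (y # x) (y' # x') (z' # x') (w' # refl_at \<Gamma> x') (u # p))
    (id_comp X (y # x) (z # x) (z' # x') (v # p) (inst (w' # v # z' # z # u # p @ y' # x' @ y # x) T # refl_at \<Gamma> x))
    (id_tel X (y # x) (z' # x'))"
proof -
  note comp = id_comp_cong[OF XY_ctxs(4)]
  show ?thesis
  proof (rule fill_eq[OF cX, of "\<lambda>w' v z' z u p y' x' y x. id_comp X (y # x) (y' # x') (z' # x')
      (w' # refl_at \<Gamma> x') (u # p)"
      "\<lambda>w' v z' z u p y' x' y x. id_comp X (y # x) (z # x) (z' # x') (v # p) (inst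
          (w' # v # z' # z # u # p @ y' # x' @ y # x) T # refl_at \<Gamma> x)"
      "\<lambda>w' v z' z u p y' x' y x. y # x" "\<lambda>w' v z' z u p y' x' y x. z' # x'" \<Omega> w' v z' z u p y' x' y x, OF _ _ _ l])
    fix \<Omega> w' v z' z u p y' x' y x
    assume l: "ctx \<Omega>" "isel \<Omega> (w' # v # z' # z # u # p @ y' # x' @ y # x) fill_ctx"
      "length p = N" "length x' = N" "length x = N"
    note e = fill_endpoints[OF l refl]
    show "isel \<Omega> (y # x) X \<and> isel \<Omega> (z' # x') X \<and>
      isel \<Omega> (id_comp X (y # x) (y' # x') (z' # x') (w' # refl_at \<Gamma> x') (u # p)) (id_tel X (y # x) (z' # x')) \<and>
      isel \<Omega> (id_comp X (y # x) (z # x) (z' # x') (v # p) (inst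
          (w' # v # z' # z # u # p @ y' # x' @ y # x) T # refl_at \<Gamma> x))
       (id_tel X (y # x) (z' # x'))"
      using comp[OF l(1) e(3,5,6,12,7)] comp[OF l(1) e(3,4,6,8,13)] e by blast
  next
    fix \<Omega> w z y x u
    let ?l = "w # reflT (inst x A) z # z # z # u # refl_at \<Gamma> x @ y # x @ y # x"
    assume a: "ctx \<Omega>" "isel \<Omega> (w # z # y # x) Y" "length x = N"
      and u: "refl_at X (y # x) = u # refl_at \<Gamma> x"
    note b = fill_base[OF a u refl]
    have w: "isel \<Omega> (w # refl_at \<Gamma> x) (id_tel X (y # x) (z # x))"
      using a(2) elems_vertical[OF a(1)] by (simp add: elems_Y)
    note 1 = id_comp_refl_right[OF cX a(1) b(6,7) w]
    note 2 = comp[OF a(1) b(6,7,7) refl_at_typed[OF cX a(1) b(7)] b(4)]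
    note 3 = id_comp_refl_left[OF XY_ctxs(4) a(1) b(6,7) w]
    note t = id_tel_trans[OF cX a(1) b(6,7)] and s = id_tel_sym[OF cX a(1) b(6,7)]
    show "eleq \<Omega> (id_comp X (y # x) (y # x) (z # x) (w # refl_at \<Gamma> x) (u # refl_at \<Gamma> x))
       (id_comp X (y # x) (z # x) (z # x) (reflT (inst x A) z # refl_at \<Gamma> x) (inst ?l T # refl_at \<Gamma> x))
       (id_tel X (y # x) (z # x))"
      using t[OF 1 s[OF t[OF 2 3]]] u unfolding refl_at_X by simp
  qed (elim disjE; simp add: map_subst_id_comp[OF XY_ctxs(4)] T_nat map_subst_refl_at[OF XY_ctxs(1)] del: map_map)
qed

text \<open>Elimination on \<open>k\<close> itself: for a reflexivity the projected square is
  degenerate, and there \<open>T\<close> and \<theta> compute. \<open>T\<close> has to be identified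
  with \<open>w\<close> first, since only then do \<theta> and \<open>k\<close> have equal
  sources.\<close>

lemma fill_of_id:
  assumes \<Omega>: "ctx \<Omega>" and h: "isel \<Omega> (w # z # y # x) Y"
    and h': "isel \<Omega> (w' # z' # y' # x') Y"
    and len: "length x = N" "length x' = N"
    and k: "isel \<Omega> k (id_tel Y (w # z # y # x) (w' # z' # y' # x'))"
  defines "Sq \<equiv> \<lambda>h h' k. id_map Y X src h h' k"
    and "Q \<equiv> \<lambda>h h' k. id_map Y X tgt h h' k"
  defines "l \<equiv> \<lambda>w z y x w' z' y' x' k. args w' (Q (w # z # y # x) (w' # z' # y' # x') k) z' z (Sq (w # z # y # x)
      (w' # z' # y' # x') k) y' x' y x"
  shows fill_of_id_T: "eleq \<Omega> (inst (l w z y x w' z' y' x' k) T # refl_at \<Gamma> x) (w # refl_at \<Gamma> x) (id_tel X (y # x)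
      (z # x))"
    and fill_of_id_\<theta>: "eleq \<Omega> (insts (l w z y x w' z' y' x' k) \<theta>) k (id_tel Y (w # z # y # x) (w' # z' # y' # x'))"
proof -
  note maps = id_map_cong[OF XY_ctxs(5,4) elems_src] and mapt = id_map_cong[OF XY_ctxs(5,4) elems_tgt]
  let ?s = "\<lambda>h :: 's expr list. hd (drop 2 h)"
  \<comment> \<open>\<open>J_eq\<close> hands over the endpoints as whole lists; here they are taken
    apart by position.\<close>
  define l' where "l' = (\<lambda>h h' k. l (h ! 0) (h ! 1) (h ! 2) (drop 3 h) (h' ! 0) (h' ! 1) (h' ! 2) (drop 3 h') k)"
  have l': "l' (w # z # y # x) (w' # z' # y' # x') k = l w z y x w' z' y' x' k" for w z y x w' z' y' x' k
    by (simp add: l'_def numeral_eq_Suc)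
  have el: "isel \<Omega> (l w z y x w' z' y' x' k) fill_ctx"
    if \<Omega>: "ctx \<Omega>" and h: "isel \<Omega> (w # z # y # x) Y"
      and h': "isel \<Omega> (w' # z' # y' # x') Y"
      and len: "length x = N" "length x' = N"
      and k: "isel \<Omega> k (id_tel Y (w # z # y # x) (w' # z' # y' # x'))"
    for \<Omega> w z y x w' z' y' x' k
    unfolding l_def Sq_def Q_def
    by (rule fill_args(1)[OF \<Omega> h h' len maps[OF \<Omega> h h' k, unfolded src_inst[OF len(1)] src_inst[OF len(2)]]
        mapt[OF \<Omega> h h' k, unfolded tgt_inst[OF len(1)] tgt_inst[OF len(2)]]])
      (use tl_src_tgt[OF \<Omega> h h' k] in \<open>simp add: numeral_eq_Suc\<close>)
  have form: "\<exists>v u p. l w z y x w' z' y' x' k = w' # v # z' # z # u # p @ y' # x' @ y # x \<and> length p = N"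
    for w z y x w' z' y' x' k
  proof -
    have "length (Sq (w # z # y # x) (w' # z' # y' # x') k) = Suc N" by (simp add: Sq_def)
    then obtain u p where "Sq (w # z # y # x) (w' # z' # y' # x') k = u # p" "length p = N"
        by (auto simp: length_Suc_conv)
    then show ?thesis by (auto simp: l_def)
  qed
  \<comment> \<open>The square of a reflexivity equals the degenerate square only up to definitional
    equality, because the actions of \<open>src\<close> and \<open>tgt\<close> have to be
    computed.\<close>
  have base: "eleq \<Omega> (l w z y x w z y x (refl_at Y (w # z # y # x)))
      (w # reflT (inst x A) z # z # z # reflT (inst x A) y # refl_at \<Gamma> x @ y # x @ y # x) fill_ctx"
    if \<Omega>: "ctx \<Omega>" and h: "isel \<Omega> (w # z # y # x) Y" and len: "length x = N" for \<Omega> w z y x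
  proof -
    note k = refl_at_typed[OF XY_ctxs(2) \<Omega> h]
    note S = id_map_refl[OF XY_ctxs(5,4) elems_src \<Omega> h, unfolded src_inst[OF len]]
    note Q' = id_map_refl[OF XY_ctxs(5,4) elems_tgt \<Omega> h, unfolded tgt_inst[OF len]]
    have t: "eleq \<Omega> (tl (Sq (w # z # y # x) (w # z # y # x) (refl_at Y (w # z # y # x))))
      (tl (Q (w # z # y # x) (w # z # y # x) (refl_at Y (w # z # y # x)))) (id_tel \<Gamma> x x)"
      using tl_src_tgt[OF \<Omega> h h k] by (simp add: Sq_def Q_def numeral_eq_Suc)
    show ?thesis
      using fill_args(1)[OF \<Omega> h h len len S Q' t[unfolded Sq_def Q_def]]
      unfolding l_def Sq_def Q_def refl_at_X list.sel .
  qed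
  have nat: "map (subst \<sigma>) (insts (l' h h' k) R) = insts (l' (map (subst \<sigma>) h) (map (subst \<sigma>) h') (map
      (subst \<sigma>) k)) R"
    if len: "length h = length Y" "length h' = length Y" "length k = length Y"
      and R: "\<forall>e\<in>set R. scoped (3 * N + 7) e" for \<sigma> h h' k R
  proof -
    obtain w z y x where h: "h = w # z # y # x" "length x = N" using len(1) by (auto simp: Y_length length_Suc_conv)
    obtain w' z' y' x' where h': "h' = w' # z' # y' # x'" "length x' = N" using len(2)
        by (auto simp: Y_length length_Suc_conv)
    have ll: "length (l w z y x w' z' y' x' k) = 3 * N + 7"
      using form[of w z y x w' z' y' x' k] h(2) h'(2) by auto
    have hd: "subst \<sigma> (hd (id_map Y X s h h' k)) = hd (map (subst \<sigma>) (id_map Y X s h h' k))" for s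
      using id_map_length[of "Y" "A # \<Gamma>" s h h' k]
      by (cases "id_map Y X s h h' k") simp_all
    have "map (subst \<sigma>) (l w z y x w' z' y' x' k) = l' (map (subst \<sigma>) h) (map (subst \<sigma>) h') (map (subst \<sigma>) k)"
      unfolding l_def Sq_def Q_def l'_def list.map map_append h(1)[symmetric] h'(1)[symmetric] hd map_tl
        map_subst_id_map[OF XY_ctxs(5,4) elems_src len] map_subst_id_map[OF XY_ctxs(5,4) elems_tgt len]
      by (simp add: h h' numeral_eq_Suc)
    then show ?thesis
      using map_subst_insts[of R "l w z y x w' z' y' x' k" \<sigma>] R unfolding h h' l' ll by simp
  qed
  have natT: "subst \<sigma> (inst (l' h h' k) T) = inst (l' (map (subst \<sigma>) h) (map (subst \<sigma>) h') (map (subst \<sigma>) k)) T"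
    if len: "length h = length Y" "length h' = length Y" "length k = length Y" for \<sigma> h h' k
    using nat[OF len, of "[T]"] T_scoped by simp
  have T: "eleq \<Omega> (inst (l w z y x w' z' y' x' k) T # refl_at \<Gamma> x) (w # refl_at \<Gamma> x) (id_tel X (y # x) (z # x))"
    if \<Omega>: "ctx \<Omega>" and h: "isel \<Omega> (w # z # y # x) Y"
      and h': "isel \<Omega> (w' # z' # y' # x') Y"
      and len: "length x = N" "length x' = N"
      and k: "isel \<Omega> k (id_tel Y (w # z # y # x) (w' # z' # y' # x'))"
    for \<Omega> w z y x w' z' y' x' k
  proof -
    \<comment> \<open>\<open>J_eq\<close> compares elements of the identity context of a fixed
      closed context; completed by \<open>refl_at\<close>, the term \<open>T\<close> becomes an
      identity in \<open>\<Gamma>.A\<close>.\<close>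
    let ?L = "\<lambda>(\<delta> :: 's expr list) k h' h. inst (l' h h' k) T # refl_at \<Gamma> (drop 3 h)"
    let ?R = "\<lambda>(\<delta> :: 's expr list) (k :: 's expr list) (h' :: 's expr list) h. h ! 0 # refl_at \<Gamma> (drop 3 h)"
    let ?F = "\<lambda>(\<delta> :: 's expr list) (k :: 's expr list) (h' :: 's expr list) h. h ! 2 # drop 3 h"
    let ?G = "\<lambda>(\<delta> :: 's expr list) (k :: 's expr list) (h' :: 's expr list) h. h ! 1 # drop 3 h"
    let ?h = "w # z # y # x" and ?h' = "w' # z' # y' # x'"
    have "eleq \<Omega> (?L [] k ?h' ?h) (?R [] k ?h' ?h) (id_tel X (?F [] k ?h' ?h) (?G [] k ?h' ?h))"
    proof (rule J_eq[of "[]" "Y" "A # \<Gamma>" ?L ?R ?F ?G \<Omega> ?h ?h' k "[]", OF _ cX _ _ _ \<Omega> h h' k])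
      show "ctx ([] @ idx Y)" using is_ctx_idx[OF XY_ctxs(2)] by simp
      show "isel \<Omega> [] (tsubst (sb 0 (k @ ?h' @ ?h)) [])" by simp
    next
      fix \<sigma> :: "nat \<Rightarrow> 's expr" and \<delta> k h' h :: "'s expr list" and H
      assume len: "length k = length Y" "length h' = length Y" "length h = length Y"
        and H: "H = ?L \<or> H = ?R \<or> H = ?F \<or> H = ?G"
      show "map (subst \<sigma>) (H \<delta> k h' h) = H (map (subst \<sigma>) \<delta>) (map (subst \<sigma>) k) (map (subst \<sigma>) h') (map (subst \<sigma>) h)"
        using H len(3) by (elim disjE) (simp_all add: natT[OF len(3,2,1)] map_subst_refl_at[OF XY_ctxs(1)] Y_length
            drop_map nth_map)
    next
      fix \<Omega> \<delta> k h' h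
      assume a: "ctx \<Omega>" "isel \<Omega> h Y" "isel \<Omega> h' Y" "isel \<Omega> k (id_tel Y h h')"
      obtain w z y x where h: "h = w # z # y # x" "length x = N" using a(2) by (auto elim!: elems_YE)
      obtain w' z' y' x' where h': "h' = w' # z' # y' # x'" "length x' = N" using a(3) by (auto elim!: elems_YE)
      obtain v u p where f: "l w z y x w' z' y' x' k = w' # v # z' # z # u # p @ y' # x' @ y # x" "length p = N"
        using form by blast
      note e = el[OF a(1) a(2)[unfolded h] a(3)[unfolded h'] h(2) h'(2) a(4)[unfolded h h'], unfolded f(1)]
      note e = fill_endpoints[OF a(1) e f(2) h'(2) h(2) refl]
      have w: "isel \<Omega> (w # refl_at \<Gamma> x) (id_tel X (y # x) (z # x))"
        using a(2) elems_vertical[OF a(1)] by (simp add: h elems_Y)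
      have x3: "drop 3 h = x" "h ! 0 = w" "h ! 1 = z" "h ! 2 = y" by (simp_all add: h numeral_eq_Suc)
      show "isel \<Omega> (?F \<delta> k h' h) X \<and> isel \<Omega> (?G \<delta> k h' h) X \<and>
        isel \<Omega> (?L \<delta> k h' h) (id_tel X (?F \<delta> k h' h) (?G \<delta> k h' h)) \<and>
        isel \<Omega> (?R \<delta> k h' h) (id_tel X (?F \<delta> k h' h) (?G \<delta> k h' h))"
        unfolding x3 using e(3,4,13) w unfolding f(1)[symmetric] l'[symmetric] h(1)[symmetric] h'(1)[symmetric]
            by blast
    next
      fix \<Omega> \<delta> h
      assume a: "ctx \<Omega>" "isel \<Omega> h Y"
      obtain w z y x where h: "h = w # z # y # x" "length x = N" using a(2) by (auto elim!: elems_YE)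
      obtain v u p where f: "l w z y x w z y x (refl_at Y h) = w # v # z # z # u # p @ y # x @ y # x" "length p = N"
        using form by blast
      have x3: "drop 3 h = x" "h ! 0 = w" "h ! 1 = z" "h ! 2 = y" by (simp_all add: h numeral_eq_Suc)
      note ha = a(2)[unfolded h]
      note b = base[OF a(1) ha h(2), folded h(1), unfolded f(1)]
      note 1 = conjunct1[OF filler_cong[OF a(1) b f(2) h(2) h(2)], folded f(1)]
      note 2 = conjunct1[OF filler_refl[OF a(1) ha h(2) refl_at_X]]
      from TmEq_trans[OF 1 2]
      have "eleq \<Omega> (inst (l w z y x w z y x (refl_at Y h)) T # refl_at \<Gamma> x) (w # refl_at \<Gamma> x) (id_tel X (y # x)
          (z # x))"
        using ha elems_vertical[OF a(1)] by (simp add: elems_Y)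
      then show "eleq \<Omega> (?L \<delta> (refl_at Y h) h h) (?R \<delta> (refl_at Y h) h h) (id_tel X (?F \<delta> (refl_at Y h) h h) (?G \<delta>
          (refl_at Y h) h h))"
        unfolding x3 unfolding l'[symmetric] h(1)[symmetric] .
    qed
    then show ?thesis by (simp add: l' numeral_eq_Suc)
  qed
  then show "eleq \<Omega> (inst (l w z y x w' z' y' x' k) T # refl_at \<Gamma> x) (w # refl_at \<Gamma> x) (id_tel X (y # x) (z # x))"
    using \<Omega> h h' len k by blast
  \<comment> \<open>Since \<open>T\<close> equals \<open>w\<close>, the type of \<theta> can be
    converted to that of \<open>k\<close>, and \<open>J_eq\<close> applies to the pair.\<close>
  have TY: "eleq \<Omega> (inst (l w z y x w' z' y' x' k) T # z # y # x) (w # z # y # x) Y"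
    if \<Omega>: "ctx \<Omega>" and h: "isel \<Omega> (w # z # y # x) Y"
      and h': "isel \<Omega> (w' # z' # y' # x') Y"
      and len: "length x = N" "length x' = N"
      and k: "isel \<Omega> k (id_tel Y (w # z # y # x) (w' # z' # y' # x'))"
    for \<Omega> w z y x w' z' y' x' k
    using T[OF \<Omega> h h' len k] h elems_vertical[OF \<Omega>] by (simp add: elems_Y)
  let ?L = "\<lambda>(\<delta> :: 's expr list) k h' h. insts (l' h h' k) \<theta>"
  let ?R = "\<lambda>(\<delta> :: 's expr list) (k :: 's expr list) (h' :: 's expr list) (h :: 's expr list). k"
  let ?F = "\<lambda>(\<delta> :: 's expr list) (k :: 's expr list) (h' :: 's expr list) (h :: 's expr list). h"
  let ?G = "\<lambda>(\<delta> :: 's expr list) (k :: 's expr list) (h' :: 's expr list) (h :: 's expr list). h'"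
  let ?h = "w # z # y # x" and ?h' = "w' # z' # y' # x'"
  have "eleq \<Omega> (?L [] k ?h' ?h) (?R [] k ?h' ?h) (id_tel Y (?F [] k ?h' ?h) (?G [] k ?h' ?h))"
  proof (rule J_eq[of "[]" "Y" "Y" ?L ?R ?F ?G \<Omega> ?h ?h' k "[]", OF _ XY_ctxs(2) _ _ _ \<Omega> h h' k])
    show "ctx ([] @ idx Y)" using is_ctx_idx[OF XY_ctxs(2)] by simp
    show "isel \<Omega> [] (tsubst (sb 0 (k @ ?h' @ ?h)) [])" by simp
  next
    fix \<sigma> :: "nat \<Rightarrow> 's expr" and \<delta> k h' h :: "'s expr list" and H
    assume len: "length k = length Y" "length h' = length Y" "length h = length Y"
      and H: "H = ?L \<or> H = ?R \<or> H = ?F \<or> H = ?G"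
    show "map (subst \<sigma>) (H \<delta> k h' h) = H (map (subst \<sigma>) \<delta>) (map (subst \<sigma>) k) (map (subst \<sigma>) h') (map (subst \<sigma>) h)"
      using H nat[OF len(3,2,1) \<theta>_scoped] by (elim disjE) simp_all
  next
    fix \<Omega> \<delta> k h' h
    assume a: "ctx \<Omega>" "isel \<Omega> h Y" "isel \<Omega> h' Y" "isel \<Omega> k (id_tel Y h h')"
    obtain w z y x where h: "h = w # z # y # x" "length x = N" using a(2) by (auto elim!: elems_YE)
    obtain w' z' y' x' where h': "h' = w' # z' # y' # x'" "length x' = N" using a(3) by (auto elim!: elems_YE)
    obtain v u p where f: "l w z y x w' z' y' x' k = w' # v # z' # z # u # p @ y' # x' @ y # x" "length p = N"
      using form by blast
    note e0 = el[OF a(1) a(2)[unfolded h] a(3)[unfolded h'] h(2) h'(2) a(4)[unfolded h h'], unfolded f(1)]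
    note e = fill_endpoints(11)[OF a(1) e0 f(2) h'(2) h(2) refl, folded f(1)]
    note ty = TY[OF a(1) a(2)[unfolded h] a(3)[unfolded h'] h(2) h'(2) a(4)[unfolded h h']]
    have "isel \<Omega> (insts (l w z y x w' z' y' x' k) \<theta>) (id_tel Y h h')"
      unfolding h(1) h'(1) by (rule id_tel_conv[OF e XY_ctxs(5) a(1) ty a(3)[unfolded h']])
    then show "isel \<Omega> (?F \<delta> k h' h) Y \<and> isel \<Omega> (?G \<delta> k h' h) Y \<and>
      isel \<Omega> (?L \<delta> k h' h) (id_tel Y (?F \<delta> k h' h) (?G \<delta> k h' h)) \<and>
      isel \<Omega> (?R \<delta> k h' h) (id_tel Y (?F \<delta> k h' h) (?G \<delta> k h' h))"
      using a unfolding l'[symmetric] h(1)[symmetric] h'(1)[symmetric] by blast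
  next
    fix \<Omega> \<delta> h
    assume a: "ctx \<Omega>" "isel \<Omega> h Y"
    obtain w z y x where h: "h = w # z # y # x" "length x = N" using a(2) by (auto elim!: elems_YE)
    obtain v u p where f: "l w z y x w z y x (refl_at Y h) = w # v # z # z # u # p @ y # x @ y # x" "length p = N"
      using form by blast
    note ha = a(2)[unfolded h]
    note b = base[OF a(1) ha h(2), folded h(1), unfolded f(1)]
    note 1 = conjunct2[OF filler_cong[OF a(1) b f(2) h(2) h(2)], folded f(1)]
    note 2 = conjunct2[OF filler_refl[OF a(1) ha h(2) refl_at_X]]
    note ty = TY[OF a(1) ha ha h(2) h(2) refl_at_typed[OF XY_ctxs(2) a(1) ha], folded h(1)]
    from id_tel_trans[OF XY_ctxs(2) a(1) ha ha id_tel_conv[OF 1[unfolded h(1)] XY_ctxs(5) a(1) ty[unfolded h(1)]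
        ha] 2, folded h(1)]
    have "eleq \<Omega> (insts (l w z y x w z y x (refl_at Y h)) \<theta>) (refl_at Y h) (id_tel Y h h)" .
    then show "eleq \<Omega> (?L \<delta> (refl_at Y h) h h) (?R \<delta> (refl_at Y h) h h) (id_tel Y (?F \<delta> (refl_at Y h) h h) (?G \<delta>
        (refl_at Y h) h h))"
      unfolding l'[symmetric] h(1)[symmetric] .
  qed
  then show "eleq \<Omega> (insts (l w z y x w' z' y' x' k) \<theta>) k (id_tel Y (w # z # y # x) (w' # z' # y' # x'))"
    by (simp add: l')
qed

end

text \<open>The filler of the square obtained by projecting \<open>k\<close> gives \<open>k\<close> back, so that \<open>k\<close> is determined by its
  projections.\<close>

lemma Y_faithful:
  assumes \<Omega>: "ctx \<Omega>" and h: "isel \<Omega> h Y" and h': "isel \<Omega> h' Y"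
    and k: "isel \<Omega> k (id_tel Y h h')" and k': "isel \<Omega> k' (id_tel Y h h')"
    and src: "eleq \<Omega> (id_map Y X src h h' k) (id_map Y X src h h' k')
      (id_tel X (insts h src) (insts h' src))"
    and tgt: "eleq \<Omega> (id_map Y X tgt h h' k) (id_map Y X tgt h h' k')
      (id_tel X (insts h tgt) (insts h' tgt))"
  shows "eleq \<Omega> k k' (id_tel Y h h')"
proof -
  obtain T \<theta> where f: "filler T \<theta>" using filler_exists by blast
  obtain w z y x where e: "h = w # z # y # x" "length x = N" using h by (auto elim!: elems_YE)
  obtain w' z' y' x' where e': "h' = w' # z' # y' # x'" "length x' = N" using h' by (auto elim!: elems_YE)
  note h = h[unfolded e] and h' = h'[unfolded e'] and k = k[unfolded e e'] and k' = k'[unfolded e e']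
  note src = src[unfolded e(1) e'(1) src_inst[OF e(2)] src_inst[OF e'(2)]]
  note tgt = tgt[unfolded e(1) e'(1) tgt_inst[OF e(2)] tgt_inst[OF e'(2)]]
  let ?S = "id_map Y X src (w # z # y # x) (w' # z' # y' # x')"
  let ?Q = "id_map Y X tgt (w # z # y # x) (w' # z' # y' # x')"
  have "eleq \<Omega> (tl (?S k)) (tl (?Q k)) (id_tel \<Gamma> x x')"
    using tl_src_tgt[OF \<Omega> h h' k] by (simp add: numeral_eq_Suc)
  note l = fill_args(1)[OF \<Omega> h h' e(2) e'(2) src tgt this]
  obtain u p where S: "?S k = u # p" "length p = N" by (rule elems_XE[OF src])
  note 1 = conjunct2[OF filler_cong[OF f \<Omega> l[unfolded S list.sel] S(2) e'(2) e(2)]]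
  have S3: "hd (u # p) # tl (u # p) = u # p" by simp
  note T = fill_of_id_T[OF f \<Omega> h h' e(2) e'(2) k, unfolded S list.sel]
    and \<theta> = fill_of_id_\<theta>[OF f \<Omega> h h' e(2) e'(2) k, unfolded S list.sel]
    and \<theta>' = fill_of_id_\<theta>[OF f \<Omega> h h' e(2) e'(2) k']
  note 1 = 1[unfolded list.sel]
  \<comment> \<open>The values of \<theta> on the two squares are compared with source
    \<open>T\<close>; as \<open>T\<close> equals \<open>w\<close>, the equation can be read at the
    given endpoints.\<close>
  have "eleq \<Omega> (inst (w' # hd (?Q k) # z' # z # u # p @ y' # x' @ y # x) T # z # y # x) (w # z # y # x) Y"
    using T h elems_vertical[OF \<Omega>] by (simp add: elems_Y)
  note 2 = id_tel_conv[OF 1 XY_ctxs(5) \<Omega> this h']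
  note t = id_tel_trans[OF XY_ctxs(2) \<Omega> h h'] and s = id_tel_sym[OF XY_ctxs(2) \<Omega> h h']
  show ?thesis
    unfolding e(1) e'(1) by (rule t[OF s[OF \<theta>] t[OF 2 \<theta>']])
qed

text \<open>Cancelling the vertical sides \<open>Q\<close> in the two commutative squares with the same other sides shows that the
  filler starts at \<open>w\<close>.\<close>

lemma Y_full:
  assumes \<Omega>: "ctx \<Omega>" and h: "isel \<Omega> (w # z # y # x) Y"
    and h': "isel \<Omega> (w' # z' # y' # x') Y"
    and len: "length x = N" "length x' = N"
    and Sq: "isel \<Omega> Sq (id_tel X (y # x) (y' # x'))" and Q: "isel \<Omega> Q (id_tel X (z # x) (z' # x'))"
    and tl: "eleq \<Omega> (tl Sq) (tl Q) (id_tel \<Gamma> x x')"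
    and sq: "eleq \<Omega> (id_comp X (y # x) (y' # x') (z' # x') (w' # refl_at \<Gamma> x') Sq)
      (id_comp X (y # x) (z # x) (z' # x') Q (w # refl_at \<Gamma> x)) (id_tel X (y # x) (z' # x'))"
  obtains k where "isel \<Omega> k (id_tel Y (w # z # y # x) (w' # z' # y' # x'))"
    "eleq \<Omega> (id_map Y X src (w # z # y # x) (w' # z' # y' # x') k) Sq (id_tel X (y # x) (y' # x'))"
    "eleq \<Omega> (id_map Y X tgt (w # z # y # x) (w' # z' # y' # x') k) Q (id_tel X (z # x) (z' # x'))"
proof -
  obtain T \<theta> where f: "filler T \<theta>" using filler_exists by blast
  obtain u p where S: "Sq = u # p" "length p = N" by (rule elems_XE[OF Sq])
  let ?l = "w' # hd Q # z' # z # u # p @ y' # x' @ y # x"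
  note l = fill_args(1)[OF \<Omega> h h' len Sq Q tl, unfolded S list.sel]
  note Q' = fill_args(2)[OF \<Omega> h h' len Sq Q tl, unfolded S list.sel]
  note e = fill_endpoints[OF f \<Omega> l S(2) len(2,1) refl]
  note src = fill_src[OF f \<Omega> l S(2) len(2,1)] and tgt = fill_tgt[OF f \<Omega> l S(2) len(2,1)]
    and square = fill_square[OF f \<Omega> l S(2) len(2,1)]
  note cc = id_comp_cong[OF XY_ctxs(4) \<Omega>]
  have w: "isel \<Omega> (w # refl_at \<Gamma> x) (id_tel X (y # x) (z # x))"
    using h elems_vertical[OF \<Omega>] by (simp add: elems_Y)
  note t = id_tel_trans[OF cX \<Omega> e(3,6)] and s = id_tel_sym[OF cX \<Omega> e(3,6)]
  \<comment> \<open>Both \<open>T\<close> and \<open>w\<close>, followed by the side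
    \<open>hd Q # tl Sq\<close>, equal \<open>Sq\<close> followed by \<open>w'\<close>: for
    \<open>T\<close> because the filler makes the square commute, for \<open>w\<close> by
    assumption.\<close>
  note 1 = t[OF s[OF square] t[OF sq[unfolded S] cc[OF e(3,4,6) Q' w]]]
  note 2 = id_comp_cancel[OF cX \<Omega> e(3,4,6,8,13) w 1]
  have T: "eleq \<Omega> (inst ?l T # z # y # x) (w # z # y # x) Y"
    using 2 h elems_vertical[OF \<Omega>] by (simp add: elems_Y)
  have T': "eleq \<Omega> (w # z # y # x) (inst ?l T # z # y # x) Y"
    by (rule elems_eq_sym_closed[OF T \<Omega> XY_ctxs(2)])
  \<comment> \<open>With \<open>T\<close> replaced by its equal \<open>w\<close>, \<theta> has the
    required endpoints; its projections are those of the filler.\<close>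
  note k = id_tel_conv[OF e(11) XY_ctxs(5) \<Omega> T h']
  note ks = id_map_cong[OF XY_ctxs(5,4) elems_src \<Omega> T' h' k, unfolded src_inst[OF len(1)] src_inst[OF len(2)]]
  note kt = id_map_cong[OF XY_ctxs(5,4) elems_tgt \<Omega> T' h' k, unfolded tgt_inst[OF len(1)] tgt_inst[OF len(2)]]
  show thesis
    by (rule that[OF k, unfolded S(1), OF id_tel_trans[OF cX \<Omega> e(3,5) ks src]
        id_tel_trans[OF cX \<Omega> e(4,6) kt id_tel_trans[OF cX \<Omega> e(4,6) tgt id_tel_sym[OF cX \<Omega> e(4,6) Q']]]])
qed

section \<open>The arrow object\<close>

text \<open>The universal 2-cell \<kappa>: the variable of type \<open>Id(y, z)\<close>, placed over
  the reflexivity in \<open>\<Gamma>\<close> so that it is a 2-cell of the slice.\<close>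

private abbreviation (input) "kap \<equiv> Var 0 # refl_at \<Gamma> (vars 3 N)"
private abbreviation (input) "SL \<equiv> slice KS (cls \<Gamma>)"
private abbreviation (input) "Xo \<equiv> over S 1 (ext1 \<Gamma> A)"
private abbreviation (input) "Yo \<equiv> over S 3 (extId \<Gamma> A)"
private abbreviation (input) "at \<Omega> e \<equiv> (cls \<Omega>, el \<Omega> \<Gamma> e)"

lemma Xo: "Xo = at X (vars 1 N)" and Yo: "Yo = at Y (vars 3 N)"
  by (simp_all add: over_def proj_def ext1_def extId_def)

lemma elems_projX: "isel X (vars 1 N) \<Gamma>"
  using elems_eq_vars[of "[A]" \<Gamma> 1 N] cX by simp

lemma elems_generic_Y: "isel Y (Var 0 # Var 1 # Var 2 # vars 3 N) Y"
proof -
  have "isel Y (vars 0 (Suc (Suc (Suc N)))) Y"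
    by (rule elems_eq_vars_0[OF XY_ctxs(2)]) (simp add: Y_length)
  then show ?thesis by (simp add: vars_Suc numeral_eq_Suc)
qed

lemma elems_projY: "isel Y (vars 3 N) \<Gamma>"
  using elems_generic_Y by (simp add: elems_Y)

lemma elems_kap: "isel Y kap (id_tel X src tgt)"
  using elems_generic_Y elems_vertical[OF XY_ctxs(2)] by (simp add: elems_Y)

lemma kap_inst: "length x = N \<Longrightarrow> insts (w # z # y # x) kap = w # refl_at \<Gamma> x"
  using map_subst_refl_at[OF XY_ctxs(1), of "vars 3 N" "sb 0 (w # z # y # x)"]
      by (simp add: insts_vars numeral_eq_Suc)

lemma ob_SL: "ob SL = {at \<Omega> e |\<Omega> e. ctx \<Omega> \<and> isel \<Omega> e \<Gamma>}"
  unfolding slice_def using XY_ctxs(1) by (fastforce simp: ob_KS hom_KS)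

section \<open>1-cells and 2-cells of the slice\<close>

context
  fixes \<Omega> e
  assumes \<Omega>: "ctx \<Omega>" and e: "isel \<Omega> e \<Gamma>"
begin

lemma e_length: "length e = N"
  using elems_eq_length[OF e] by simp

text \<open>A strictly commuting triangle of classes means that the base part of a representative is
  definitionally equal to \<open>e\<close>, so a representative with base part literally
  \<open>e\<close> can be chosen.\<close>

lemma hom_X: "hom SL (at \<Omega> e) Xo = {el \<Omega> X (y # e) |y. istm \<Omega> y (inst e A)}"
proof (intro set_eqI iffI)
  fix F assume "F \<in> hom SL (at \<Omega> e) Xo"
  then have "F \<in> hom KS (cls \<Omega>) (cls X)" "comp1 KS (cls \<Omega>) (cls X) (cls \<Gamma>) (el X \<Gamma> (vars 1 N)) F = el \<Omega> \<Gamma> e"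
    by (simp_all add: slice_def Xo[unfolded One_nat_def])
  then obtain f where f: "F = el \<Omega> X f" "isel \<Omega> f X" "el \<Omega> \<Gamma> (insts f (vars 1 N)) = el \<Omega> \<Gamma> e"
    using hom_KS[OF \<Omega> cX] comp1_KS[OF \<Omega> cX XY_ctxs(1) _ elems_projX] by auto
  then obtain y x where yx: "f = y # x" "isel \<Omega> x \<Gamma>" "istm \<Omega> y (inst x A)" by (auto elim: elems_eq_ConsE)
  have lx: "length x = N" using elems_eq_length[OF yx(2)] by simp
  have "insts f (vars 1 N) = x" using lx by (simp add: yx(1) insts_vars)
  with f(3) have x: "eleq \<Omega> x e \<Gamma>"
    using el_eq_iff[OF e] is_ctx_append_closed[OF XY_ctxs(1) \<Omega>] by simp
  then have "eleq \<Omega> f (y # e) X" using yx by simp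
  with el_rep_closed[OF is_ctx_cteq_refl[OF \<Omega>] XY_ctxs(4) this] f
  have "F = el \<Omega> X (y # e)" by simp
  moreover have "istm \<Omega> y (inst e A)" using yx(3) A_inst[OF \<Omega> x] TmEq_conv by blast
  ultimately show "F \<in> {el \<Omega> X (y # e) |y. istm \<Omega> y (inst e A)}" by blast
next
  fix F assume "F \<in> {el \<Omega> X (y # e) |y. istm \<Omega> y (inst e A)}"
  then obtain y where y: "F = el \<Omega> X (y # e)" "isel \<Omega> (y # e) X" using e by auto
  have "insts (y # e) (vars 1 N) = e" using e_length by (simp add: insts_vars)
  then show "F \<in> hom SL (at \<Omega> e) Xo"
    using y hom_KS[OF \<Omega> cX] comp1_KS[OF \<Omega> cX XY_ctxs(1) y(2) elems_projX]
        by (auto simp: slice_def Xo[unfolded One_nat_def])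
qed

lemma hom_Y: "hom SL (at \<Omega> e) Yo = {el \<Omega> Y (w # z # y # e) |w z y. isel \<Omega> (w # z # y # e) Y}"
proof (intro set_eqI iffI)
  fix F assume "F \<in> hom SL (at \<Omega> e) Yo"
  then have "F \<in> hom KS (cls \<Omega>) (cls Y)" "comp1 KS (cls \<Omega>) (cls Y) (cls \<Gamma>) (el Y \<Gamma> (vars 3 N)) F = el \<Omega> \<Gamma> e"
    by (simp_all add: slice_def Yo)
  then obtain f where f: "F = el \<Omega> Y f" "isel \<Omega> f Y" "el \<Omega> \<Gamma> (insts f (vars 3 N)) = el \<Omega> \<Gamma> e"
    using hom_KS[OF \<Omega> XY_ctxs(2)] comp1_KS[OF \<Omega> XY_ctxs(2) XY_ctxs(1) _ elems_projY] by auto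
  then obtain w z y x where yx: "f = w # z # y # x" "length x = N" by (auto elim!: elems_YE)
  have "insts f (vars 3 N) = x" using yx(2) by (simp add: yx(1) insts_vars numeral_eq_Suc)
  with f(3) have x: "eleq \<Omega> x e \<Gamma>"
    using el_eq_iff[OF e] is_ctx_append_closed[OF XY_ctxs(1) \<Omega>] by simp
  then have fe: "eleq \<Omega> f (w # z # y # e) Y" using yx f(2) by (simp add: elems_Y)
  with el_rep_closed[OF is_ctx_cteq_refl[OF \<Omega>] XY_ctxs(5) this] f
  have "F = el \<Omega> Y (w # z # y # e)" by simp
  moreover have "isel \<Omega> (w # z # y # e) Y"
    using elems_eq_left[OF elems_eq_sym_closed[OF fe \<Omega> XY_ctxs(2)]] .
  ultimately show "F \<in> {el \<Omega> Y (w # z # y # e) |w z y. isel \<Omega> (w # z # y # e) Y}" by blast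
next
  fix F assume "F \<in> {el \<Omega> Y (w # z # y # e) |w z y. isel \<Omega> (w # z # y # e) Y}"
  then obtain w z y where y: "F = el \<Omega> Y (w # z # y # e)" "isel \<Omega> (w # z # y # e) Y" by auto
  have "insts (w # z # y # e) (vars 3 N) = e" using e_length by (simp add: insts_vars numeral_eq_Suc)
  then show "F \<in> hom SL (at \<Omega> e) Yo"
    using y hom_KS[OF \<Omega> XY_ctxs(2)] comp1_KS[OF \<Omega> XY_ctxs(2) XY_ctxs(1) y(2) elems_projY]
        by (auto simp: slice_def Yo)
qed

lemma is_ctx_e: "ctx (id_tel \<Gamma> e e @ \<Omega>)"
  by (rule is_ctx_id_tel[OF XY_ctxs(1) \<Omega> e e])

lemma refl_e: "isel \<Omega> (refl_at \<Gamma> e) (id_tel \<Gamma> e e)"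
  by (rule refl_at_typed[OF XY_ctxs(1) \<Omega> e])

text \<open>By \<open>id_map_proj\<close>, whiskering with the projection drops the newest entry, so
  lying over the identity is a condition on the base part of \<open>a\<close> alone.\<close>

lemma cell_X:
  assumes y: "istm \<Omega> y (inst e A)" and z: "istm \<Omega> z (inst e A)"
  shows "cell SL (at \<Omega> e) Xo (el \<Omega> X (y # e)) (el \<Omega> X (z # e)) =
    {el \<Omega> (id_tel X (y # e) (z # e)) a |a. isel \<Omega> a (id_tel X (y # e) (z # e)) \<and>
      eleq \<Omega> (tl a) (refl_at \<Gamma> e) (id_tel \<Gamma> e e)}"
proof -
  have ye: "isel \<Omega> (y # e) X" and ze: "isel \<Omega> (z # e) X" using y z e by simp_all
  have i: "insts (y # e) (vars 1 N) = e" for y using e_length by (simp add: insts_vars)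
  have id2: "id2 KS (cls \<Omega>) (cls \<Gamma>) (el \<Omega> \<Gamma> e) = el \<Omega> (id_tel \<Gamma> e e) (refl_at \<Gamma> e)"
    by (rule id2_KS[OF \<Omega> XY_ctxs(1) e])
  have tl: "eleq \<Omega> (id_map X \<Gamma> (vars 1 N) (y # e) (z # e) a) (tl a) (id_tel \<Gamma> e e)"
      if "isel \<Omega> a (id_tel X (y # e) (z # e))" for a
    using id_map_proj[OF cX \<Omega> ye ze that] by simp
  have wl: "whisk_l KS (cls \<Omega>) (cls X) (cls \<Gamma>) (el \<Omega> X (y # e)) (el \<Omega> X (z # e)) (el X \<Gamma> (vars 1 N)) (el \<Omega>
      (id_tel X (y # e) (z # e)) a) =
      id2 KS (cls \<Omega>) (cls \<Gamma>) (el \<Omega> \<Gamma> e) \<longleftrightarrow> eleq \<Omega> (tl a) (refl_at \<Gamma> e) (id_tel \<Gamma> e e)"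
    if a: "isel \<Omega> a (id_tel X (y # e) (z # e))" for a
    using whisk_l_KS[OF \<Omega> cX XY_ctxs(1) ye ze elems_projX a] el_eq_iff[OF refl_e is_ctx_e] tl[OF a]
      id_tel_trans[OF XY_ctxs(1) \<Omega> e e] id_tel_sym[OF XY_ctxs(1) \<Omega> e e]
    unfolding i id2 by metis
  show ?thesis
    using cell_KS[OF \<Omega> cX ye ze] wl by (auto simp: slice_def Xo[unfolded One_nat_def])
qed

text \<open>Since the base part equals \<open>refl_at\<close>, it can be replaced by it, and what
  remains is an identity within a fibre. This provides the preimage of an arrow under composition
  with \<kappa>.\<close>

lemma cell_X_normal:
  assumes y: "istm \<Omega> y (inst e A)" and z: "istm \<Omega> z (inst e A)"
    and a: "isel \<Omega> a (id_tel X (y # e) (z # e))" "eleq \<Omega> (tl a) (refl_at \<Gamma> e) (id_tel \<Gamma> e e)"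
  obtains q where "eleq \<Omega> a (q # refl_at \<Gamma> e) (id_tel X (y # e) (z # e))" "istm \<Omega> q (idT (inst e A) y z)"
proof -
  have ye: "isel \<Omega> (y # e) X" and ze: "isel \<Omega> (z # e) X" using y z e by simp_all
  obtain q p where qp: "a = q # p" "length p = N" using elems_eq_length[OF a(1)] by (auto simp: length_Suc_conv)
  have "eleq \<Omega> (q # p) (q # refl_at \<Gamma> e) (id_tel X (y # e) (z # e))"
    using elems_id_tel_Cons[OF cX e e y z qp(2), of "refl_at \<Gamma> e" q q] elems_id_tel_Cons[OF cX e e y z qp(2,2), of
        q q] a qp by simp
  then have 1: "eleq \<Omega> a (q # refl_at \<Gamma> e) (id_tel X (y # e) (z # e))" by (simp add: qp)
  have c: "ctx (id_tel X (y # e) (z # e) @ \<Omega>)" by (rule is_ctx_id_tel[OF cX \<Omega> ye ze])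
  have "istm \<Omega> q (idT (inst e A) y z)"
    using elems_eq_right[OF 1 c] elems_vertical[OF \<Omega> e y z] by simp
  with 1 that show ?thesis by blast
qed

lemma cell_Y:
  assumes h: "isel \<Omega> (w # z # y # e) Y" and h': "isel \<Omega> (w' # z' # y' # e) Y"
  shows "cell SL (at \<Omega> e) Yo (el \<Omega> Y (w # z # y # e)) (el \<Omega> Y (w' # z' # y' # e)) =
    {el \<Omega> (id_tel Y (w # z # y # e) (w' # z' # y' # e)) k |k. isel \<Omega> k (id_tel Y (w # z # y # e)
        (w' # z' # y' # e)) \<and>
      eleq \<Omega> (id_map Y \<Gamma> (vars 3 N) (w # z # y # e) (w' # z' # y' # e) k) (refl_at \<Gamma> e) (id_tel \<Gamma> e e)}"
proof -
  have i: "insts (w # z # y # e) (vars 3 N) = e" for w z y using e_length by (simp add: insts_vars numeral_eq_Suc)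
  have id2: "id2 KS (cls \<Omega>) (cls \<Gamma>) (el \<Omega> \<Gamma> e) = el \<Omega> (id_tel \<Gamma> e e) (refl_at \<Gamma> e)"
    by (rule id2_KS[OF \<Omega> XY_ctxs(1) e])
  have wl: "whisk_l KS (cls \<Omega>) (cls Y) (cls \<Gamma>) (el \<Omega> Y (w # z # y # e)) (el \<Omega> Y (w' # z' # y' # e)) (el Y \<Gamma>
      (vars 3 N)) (el \<Omega> (id_tel Y (w # z # y # e) (w' # z' # y' # e)) a) =
      id2 KS (cls \<Omega>) (cls \<Gamma>) (el \<Omega> \<Gamma> e) \<longleftrightarrow> eleq \<Omega> (id_map Y \<Gamma> (vars 3 N) (w # z # y # e) (w' # z' # y' # e) a)
          (refl_at \<Gamma> e) (id_tel \<Gamma> e e)"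
    if a: "isel \<Omega> a (id_tel Y (w # z # y # e) (w' # z' # y' # e))" for a
    using whisk_l_KS[OF \<Omega> XY_ctxs(2) XY_ctxs(1) h h' elems_projY a] el_eq_iff[OF refl_e is_ctx_e]
    unfolding i id2 by metis
  show ?thesis
    using cell_KS[OF \<Omega> XY_ctxs(2) h h'] wl by (auto simp: slice_def Yo)
qed

end

section \<open>Composition with the universal 2-cell\<close>

private abbreviation (input) "src_cls \<equiv> el Y X src"
private abbreviation (input) "tgt_cls \<equiv> el Y X tgt"
private abbreviation (input) "kap_cls \<equiv> el Y (id_tel X src tgt) kap"

lemma slice_simps:
  "comp1 SL (E, p) (E', p') (E'', p'') = comp1 KS E E' E''"
  "id2 SL (E, p) (E', p') = id2 KS E E'"
  "vcomp SL (E, p) (E', p') = vcomp KS E E'"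
  "whisk_r SL (E, p) (E', p') (E'', p'') = whisk_r KS E E' E''"
  "whisk_l SL (E, p) (E', p') (E'', p'') = whisk_l KS E E' E''"
  by (simp_all add: slice_def)

lemma src_tgt_cls:
  "comp1 SL Yo (over S 2 (ext2 \<Gamma> A)) Xo (proj1 S \<Gamma> A) (proj S 1 (extId \<Gamma> A)) = src_cls"
  "comp1 SL Yo (over S 2 (ext2 \<Gamma> A)) Xo (proj2 S \<Gamma> A) (proj S 1 (extId \<Gamma> A)) = tgt_cls"
proof -
  let ?E = "ext2 \<Gamma> A"
  have Y: "Y = [idT (wk 2 A) (Var 1) (Var 0)] @ ?E" by (simp add: extId_def ext2_def)
  have cE: "ctx ?E" using XY_ctxs(2) is_ctx_appendD unfolding Y by blast
  have v: "isel Y (vars 1 (Suc (Suc N))) ?E"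
    using elems_eq_vars[of "[idT (wk 2 A) (Var 1) (Var 0)]" ?E 1 "Suc (Suc N)"] XY_ctxs(2) Y by (simp add: ext2_def)
  have "isel ?E (vars 0 (Suc (Suc N))) ?E"
    by (rule elems_eq_vars_0[OF cE]) (simp add: ext2_def)
  then have w: "isel ?E (Var 1 # vars 2 N) X" "isel ?E (Var 0 # vars 2 N) X"
    using inst_wk[of 1 "Var 1 # vars 2 N" A] by (simp_all add: ext2_def vars_Suc numeral_2_eq_2)
  have p: "proj S 1 (extId \<Gamma> A) = el Y ?E (vars 1 (Suc (Suc N)))"
    by (simp add: proj_def extId_def ext2_def)
  have i: "insts (vars 1 (Suc (Suc N))) (Var 1 # vars 2 N) = (src :: 's expr list)"
    "insts (vars 1 (Suc (Suc N))) (Var 0 # vars 2 N) = (tgt :: 's expr list)"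
    by (auto simp: insts_vars numeral_eq_Suc)
  show "comp1 SL Yo (over S 2 ?E) Xo (proj1 S \<Gamma> A) (proj S 1 (extId \<Gamma> A)) = src_cls"
    using comp1_KS[OF XY_ctxs(2) cE cX v w(1), of "cls ?E"] unfolding i p
    by (simp add: over_def slice_simps proj1_def ext1_def)
  show "comp1 SL Yo (over S 2 ?E) Xo (proj2 S \<Gamma> A) (proj S 1 (extId \<Gamma> A)) = tgt_cls"
    using comp1_KS[OF XY_ctxs(2) cE cX v w(2), of "cls ?E"] unfolding i p
    by (simp add: over_def slice_simps proj2_def ext1_def)
qed

lemma with_cell_obj_rep:
  assumes "ctx \<Omega>" "isel \<Omega> h Y"
  shows "with_cell_obj SL Xo Yo src_cls tgt_cls kap_cls (cls \<Omega>, p) (el \<Omega> Y h) =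
    (el \<Omega> X (insts h src), el \<Omega> X (insts h tgt), el \<Omega> (id_tel X (insts h src) (insts h tgt)) (insts h kap))"
  unfolding with_cell_obj_def Xo Yo slice_simps
  by (simp only: comp1_KS[OF assms(1) XY_ctxs(2) cX assms(2) elems_src] comp1_KS[OF assms(1) XY_ctxs(2) cX assms(2)
      elems_tgt]
      whisk_r_KS[OF assms(1) XY_ctxs(2) cX elems_src elems_tgt elems_kap assms(2)])

lemma with_cell_mor_rep:
  assumes "ctx \<Omega>" "isel \<Omega> h Y" "isel \<Omega> h' Y" "isel \<Omega> k (id_tel Y h h')"
  shows "with_cell_mor SL Xo Yo src_cls tgt_cls (cls \<Omega>, p) (el \<Omega> Y h) (el \<Omega> Y h') (el \<Omega> (id_tel Y h h') k) =
    (el \<Omega> (id_tel X (insts h src) (insts h' src)) (id_map Y X src h h' k),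
     el \<Omega> (id_tel X (insts h tgt) (insts h' tgt)) (id_map Y X tgt h h' k))"
  unfolding with_cell_mor_def Xo Yo slice_simps
  by (simp only: whisk_l_KS[OF assms(1) XY_ctxs(2) cX assms(2,3) elems_src assms(4)]
      whisk_l_KS[OF assms(1) XY_ctxs(2) cX assms(2,3) elems_tgt assms(4)])

text \<open>On objects, \<open>(w, z, y, e)\<close> corresponds to the arrow \<open>w\<close> from
  \<open>y\<close> to \<open>z\<close> over \<open>refl_at\<close>, and \<open>cell_X_normal\<close>
  gives surjectivity. On morphisms, injectivity is \<open>Y_faithful\<close> and surjectivity is
  \<open>Y_full\<close>, while \<open>id_comp_natural\<close> says that the images are commutative
  squares.\<close>

lemma with_cell_iso:
  assumes \<Omega>: "ctx \<Omega>" and e: "isel \<Omega> e \<Gamma>"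
  shows "is_cat_iso (hom_cat SL (at \<Omega> e) Yo) (arrow_cat (hom_cat SL (at \<Omega> e) Xo))
    (with_cell_obj SL Xo Yo src_cls tgt_cls kap_cls (at \<Omega> e)) (with_cell_mor SL Xo Yo src_cls tgt_cls (at \<Omega> e))"
    (is "is_cat_iso ?C ?D ?F ?F'")
proof -
  note le = e_length[OF \<Omega> e]
  let ?r = "refl_at \<Gamma> e"
  let ?H = "\<lambda>w z y. w # z # y # e"
  note si = src_inst[OF le] tgt_inst[OF le] kap_inst[OF le]
  have YX: "istm \<Omega> y (inst e A)" "istm \<Omega> z (inst e A)" "istm \<Omega> w (idT (inst e A) y z)"
    "isel \<Omega> (y # e) X" "isel \<Omega> (z # e) X" "isel \<Omega> (w # ?r) (id_tel X (y # e) (z # e))"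
    if "isel \<Omega> (?H w z y) Y" for w z y
    using that e elems_vertical[OF \<Omega> e] by (simp_all add: elems_Y)
  have F: "?F (el \<Omega> Y (?H w z y)) = (el \<Omega> X (y # e), el \<Omega> X (z # e), el \<Omega> (id_tel X (y # e) (z # e)) (w # ?r))"
    if "isel \<Omega> (?H w z y) Y" for w z y
    unfolding with_cell_obj_rep[OF \<Omega> that] si ..
  let ?S = "\<lambda>w z y w' z' y' k. id_map Y X src (?H w z y) (?H w' z' y') k"
  let ?Q = "\<lambda>w z y w' z' y' k. id_map Y X tgt (?H w z y) (?H w' z' y') k"
  have F': "?F' (el \<Omega> Y (?H w z y)) (el \<Omega> Y (?H w' z' y')) (el \<Omega> (id_tel Y (?H w z y) (?H w' z' y')) k) =
    (el \<Omega> (id_tel X (y # e) (y' # e)) (?S w z y w' z' y' k), el \<Omega> (id_tel X (z # e) (z' # e))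
        (?Q w z y w' z' y' k))"
    if "isel \<Omega> (?H w z y) Y" "isel \<Omega> (?H w' z' y') Y" "isel \<Omega> k (id_tel Y (?H w z y) (?H w' z' y'))"
    for w z y w' z' y' k
    unfolding with_cell_mor_rep[OF \<Omega> that] si ..
  have objC: "obj ?C = {el \<Omega> Y (?H w z y) |w z y. isel \<Omega> (?H w z y) Y}"
    by (simp add: hom_cat_def hom_Y[OF \<Omega> e])
  have objX: "obj (hom_cat SL (at \<Omega> e) Xo) = {el \<Omega> X (y # e) |y. istm \<Omega> y (inst e A)}"
    by (simp add: hom_cat_def hom_X[OF \<Omega> e, unfolded One_nat_def])
  have morX: "mor (hom_cat SL (at \<Omega> e) Xo) (el \<Omega> X (y # e)) (el \<Omega> X (z # e)) =
    {el \<Omega> (id_tel X (y # e) (z # e)) a |a. isel \<Omega> a (id_tel X (y # e) (z # e)) \<and> eleq \<Omega> (tl a) ?r (id_tel \<Gamma> e e)}"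
    if "istm \<Omega> y (inst e A)" "istm \<Omega> z (inst e A)" for y z
    using cell_X[OF \<Omega> e that, unfolded One_nat_def] by (simp add: hom_cat_def)
  have morC: "mor ?C (el \<Omega> Y (?H w z y)) (el \<Omega> Y (?H w' z' y')) =
    {el \<Omega> (id_tel Y (?H w z y) (?H w' z' y')) k |k. isel \<Omega> k (id_tel Y (?H w z y) (?H w' z' y')) \<and>
      eleq \<Omega> (id_map Y \<Gamma> (vars 3 N) (?H w z y) (?H w' z' y') k) ?r (id_tel \<Gamma> e e)}"
    if "isel \<Omega> (?H w z y) Y" "isel \<Omega> (?H w' z' y') Y" for w z y w' z' y'
    using cell_Y[OF \<Omega> e that] by (simp add: hom_cat_def)
  have idnC: "idn ?C (el \<Omega> Y (?H w z y)) = el \<Omega> (id_tel Y (?H w z y) (?H w z y)) (refl_at Y (?H w z y))"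
    if "isel \<Omega> (?H w z y) Y" for w z y
    using id2_KS[OF \<Omega> XY_ctxs(2) that] by (simp add: hom_cat_def Yo slice_simps)
  have idnX: "idn (hom_cat SL (at \<Omega> e) Xo) (el \<Omega> X (y # e)) = el \<Omega> (id_tel X (y # e) (y # e)) (refl_at X (y # e))"
    if "isel \<Omega> (y # e) X" for y
    using id2_KS[OF \<Omega> cX that] by (simp add: hom_cat_def Xo[unfolded One_nat_def] slice_simps)
  have cmpC: "cmp ?C (el \<Omega> Y f1) (el \<Omega> Y f2) (el \<Omega> Y f3) (el \<Omega> (id_tel Y f2 f3) b) (el \<Omega> (id_tel Y f1 f2) a) =
      el \<Omega> (id_tel Y f1 f3) (id_comp Y f1 f2 f3 b a)"
    if "isel \<Omega> f1 Y" "isel \<Omega> f2 Y" "isel \<Omega> f3 Y" "isel \<Omega> b (id_tel Y f2 f3)" "isel \<Omega> a (id_tel Y f1 f2)"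
    for f1 f2 f3 a b
    using vcomp_KS[OF \<Omega> XY_ctxs(2) that] by (simp add: hom_cat_def Yo slice_simps)
  have cmpX: "cmp (hom_cat SL (at \<Omega> e) Xo) (el \<Omega> X f1) (el \<Omega> X f2) (el \<Omega> X f3) (el \<Omega> (id_tel X f2 f3) b) (el \<Omega>
      (id_tel X f1 f2) a) =
      el \<Omega> (id_tel X f1 f3) (id_comp X f1 f2 f3 b a)"
    if "isel \<Omega> f1 X" "isel \<Omega> f2 X" "isel \<Omega> f3 X" "isel \<Omega> b (id_tel X f2 f3)" "isel \<Omega> a (id_tel X f1 f2)"
    for f1 f2 f3 a b
    using vcomp_KS[OF \<Omega> cX that] by (simp add: hom_cat_def Xo[unfolded One_nat_def] slice_simps)
  note te = id_tel_trans[OF XY_ctxs(1) \<Omega> e e] and se = id_tel_sym[OF XY_ctxs(1) \<Omega> e e] and re = refl_e[OF \<Omega> e]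
  have ve: "insts (?H w z y) (vars 3 N) = e" for w z y using le by (simp add: insts_vars numeral_eq_Suc)
  have tl: "eleq \<Omega> (tl (?S w z y w' z' y' k)) (id_map Y \<Gamma> (vars 3 N) (?H w z y) (?H w' z' y') k) (id_tel \<Gamma> e e)"
    "eleq \<Omega> (tl (?Q w z y w' z' y' k)) (id_map Y \<Gamma> (vars 3 N) (?H w z y) (?H w' z' y') k) (id_tel \<Gamma> e e)"
    if "isel \<Omega> (?H w z y) Y" "isel \<Omega> (?H w' z' y') Y" "isel \<Omega> k (id_tel Y (?H w z y) (?H w' z' y'))"
    for w z y w' z' y' k
    using tl_id_map[OF \<Omega> that elems_src refl] tl_id_map[OF \<Omega> that elems_tgt refl]
    by (simp_all add: numeral_eq_Suc)
  have SQ: "eleq \<Omega> (?S w z y w' z' y' k) (?S w z y w' z' y' k') (id_tel X (y # e) (y' # e))"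
    "eleq \<Omega> (?Q w z y w' z' y' k) (?Q w z y w' z' y' k') (id_tel X (z # e) (z' # e))"
    if "isel \<Omega> (?H w z y) Y" "isel \<Omega> (?H w' z' y') Y" "eleq \<Omega> k k' (id_tel Y (?H w z y) (?H w' z' y'))"
    for w z y w' z' y' k k'
    using id_map_cong[OF XY_ctxs(5,4) elems_src \<Omega> that] id_map_cong[OF XY_ctxs(5,4) elems_tgt \<Omega> that] unfolding si
        by blast+
  have el_iff: "el \<Omega> (id_tel X f g) a = el \<Omega> (id_tel X f g) b \<longleftrightarrow> eleq \<Omega> a b (id_tel X f g)"
    if "isel \<Omega> b (id_tel X f g)" "isel \<Omega> f X" "isel \<Omega> g X" for f g a b
    by (rule el_eq_iff[OF that(1) is_ctx_id_tel[OF cX \<Omega> that(2,3)]])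
  have el_iffY: "el \<Omega> (id_tel Y f g) a = el \<Omega> (id_tel Y f g) b \<longleftrightarrow> eleq \<Omega> a b (id_tel Y f g)"
    if "isel \<Omega> b (id_tel Y f g)" "isel \<Omega> f Y" "isel \<Omega> g Y" for f g a b
    by (rule el_eq_iff[OF that(1) is_ctx_id_tel[OF XY_ctxs(2) \<Omega> that(2,3)]])
  have el_X: "el \<Omega> X a = el \<Omega> X b \<longleftrightarrow> eleq \<Omega> a b X" if "isel \<Omega> b X" for a b
    by (rule el_eq_iff[OF that is_ctx_append_closed[OF cX \<Omega>]])
  have el_Y: "el \<Omega> Y a = el \<Omega> Y b \<longleftrightarrow> eleq \<Omega> a b Y" if "isel \<Omega> b Y" for a b
    by (rule el_eq_iff[OF that is_ctx_append_closed[OF XY_ctxs(2) \<Omega>]])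
  have objD: "obj ?D = {el3. \<exists>y z a. el3 = (el \<Omega> X (y # e), el \<Omega> X (z # e), el \<Omega> (id_tel X (y # e) (z # e)) a) \<and>
      istm \<Omega> y (inst e A) \<and> istm \<Omega> z (inst e A) \<and> isel \<Omega> a (id_tel X (y # e) (z # e)) \<and> eleq \<Omega> (tl a) ?r
          (id_tel \<Gamma> e e)}"
    unfolding arrow_cat_def using objX morX by fastforce
  \<comment> \<open>Commutativity is an equation of classes of composites; on representatives it
    becomes the equation of \<open>id_comp\<close> that \<open>Y_full\<close> assumes.\<close>
  have morD: "(U, V) \<in> mor ?D (?F (el \<Omega> Y (?H w z y))) (?F (el \<Omega> Y (?H w' z' y'))) \<longleftrightarrow>
     (\<exists>a b. U = el \<Omega> (id_tel X (y # e) (y' # e)) a \<and> V = el \<Omega> (id_tel X (z # e) (z' # e)) b \<and>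
        isel \<Omega> a (id_tel X (y # e) (y' # e)) \<and> isel \<Omega> b (id_tel X (z # e) (z' # e)) \<and>
        eleq \<Omega> (tl a) ?r (id_tel \<Gamma> e e) \<and> eleq \<Omega> (tl b) ?r (id_tel \<Gamma> e e) \<and>
        eleq \<Omega> (id_comp X (y # e) (y' # e) (z' # e) (w' # ?r) a) (id_comp X (y # e) (z # e) (z' # e) b (w # ?r))
            (id_tel X (y # e) (z' # e)))"
    if h: "isel \<Omega> (?H w z y) Y" and h': "isel \<Omega> (?H w' z' y') Y" for w z y w' z' y' U V
  proof -
    note x = YX[OF h] and x' = YX[OF h']
    have "cmp (hom_cat SL (at \<Omega> e) Xo) (el \<Omega> X (y # e)) (el \<Omega> X (y' # e)) (el \<Omega> X (z' # e))
        (el \<Omega> (id_tel X (y' # e) (z' # e)) (w' # ?r)) (el \<Omega> (id_tel X (y # e) (y' # e)) a) =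
      cmp (hom_cat SL (at \<Omega> e) Xo) (el \<Omega> X (y # e)) (el \<Omega> X (z # e)) (el \<Omega> X (z' # e))
        (el \<Omega> (id_tel X (z # e) (z' # e)) b) (el \<Omega> (id_tel X (y # e) (z # e)) (w # ?r)) \<longleftrightarrow>
      eleq \<Omega> (id_comp X (y # e) (y' # e) (z' # e) (w' # ?r) a) (id_comp X (y # e) (z # e) (z' # e) b (w # ?r))
          (id_tel X (y # e) (z' # e))"
      if "isel \<Omega> a (id_tel X (y # e) (y' # e))" "isel \<Omega> b (id_tel X (z # e) (z' # e))" for a b
      unfolding cmpX[OF x(4) x'(4,5,6) that(1)] cmpX[OF x(4,5) x'(5) that(2) x(6)]
      by (rule el_iff[OF id_comp_cong[OF XY_ctxs(4) \<Omega> x(4,5) x'(5) that(2) x(6)] x(4) x'(5)])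
    then show ?thesis
      unfolding F[OF h] F[OF h'] arrow_cat_def
      using morX[OF x(1) x'(1)] morX[OF x(2) x'(2)] by fastforce
  qed
  show ?thesis
  proof (rule is_cat_isoI)
    show "idn ?C a \<in> mor ?C a a" if a: "a \<in> obj ?C" for a
    proof -
      obtain w z y where h: "a = el \<Omega> Y (?H w z y)" "isel \<Omega> (?H w z y) Y" using a unfolding objC by blast
      show ?thesis
        using id_map_refl[OF XY_ctxs(5,3) elems_projY \<Omega> h(2)] refl_at_typed[OF XY_ctxs(2) \<Omega> h(2)]
        unfolding h(1) idnC[OF h(2)] morC[OF h(2,2)] ve by blast
    qed
    show "cmp ?C a b c f g \<in> mor ?C a c"
      if a: "a \<in> obj ?C" "b \<in> obj ?C" "c \<in> obj ?C" "g \<in> mor ?C a b" "f \<in> mor ?C b c" for a b c f g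
    proof -
      obtain w1 z1 y1 where h1: "a = el \<Omega> Y (?H w1 z1 y1)" "isel \<Omega> (?H w1 z1 y1) Y" using a(1) unfolding objC
          by blast
      obtain w2 z2 y2 where h2: "b = el \<Omega> Y (?H w2 z2 y2)" "isel \<Omega> (?H w2 z2 y2) Y" using a(2) unfolding objC
          by blast
      obtain w3 z3 y3 where h3: "c = el \<Omega> Y (?H w3 z3 y3)" "isel \<Omega> (?H w3 z3 y3) Y" using a(3) unfolding objC
          by blast
      obtain g0 where g: "g = el \<Omega> (id_tel Y (?H w1 z1 y1) (?H w2 z2 y2)) g0" "isel \<Omega> g0 (id_tel Y (?H w1 z1 y1)
          (?H w2 z2 y2))"
        "eleq \<Omega> (id_map Y \<Gamma> (vars 3 N) (?H w1 z1 y1) (?H w2 z2 y2) g0) ?r (id_tel \<Gamma> e e)"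
        using a(4) unfolding h1(1) h2(1) morC[OF h1(2) h2(2)] by blast
      obtain f0 where f: "f = el \<Omega> (id_tel Y (?H w2 z2 y2) (?H w3 z3 y3)) f0" "isel \<Omega> f0 (id_tel Y (?H w2 z2 y2)
          (?H w3 z3 y3))"
        "eleq \<Omega> (id_map Y \<Gamma> (vars 3 N) (?H w2 z2 y2) (?H w3 z3 y3) f0) ?r (id_tel \<Gamma> e e)"
        using a(5) unfolding h2(1) h3(1) morC[OF h2(2) h3(2)] by blast
      \<comment> \<open>The projection to \<open>\<Gamma>\<close> preserves composition, so a
        composite of cells over an identity lies over the composite of two reflexivities, which is a
        reflexivity.\<close>
      note 1 = id_map_comp[OF XY_ctxs(2,1) elems_projY \<Omega> h1(2) h2(2) h3(2) g(2) f(2), unfolded ve]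
      note 2 = id_comp_cong[OF XY_ctxs(3) \<Omega> e e e f(3) g(3)]
      note 3 = te[OF 1 te[OF 2 id_comp_refl_left[OF XY_ctxs(3) \<Omega> e e re]]]
      show ?thesis
        unfolding h1(1) h2(1) h3(1) f(1) g(1) cmpC[OF h1(2) h2(2) h3(2) f(2) g(2)] morC[OF h1(2) h3(2)]
        using 3 id_comp_cong[OF XY_ctxs(5) \<Omega> h1(2) h2(2) h3(2) f(2) g(2)] by blast
    qed
    show "bij_betw ?F (obj ?C) (obj ?D)"
    proof (rule bij_betw_imageI)
      show "inj_on ?F (obj ?C)"
      proof (rule inj_onI)
        fix a b assume a: "a \<in> obj ?C" "b \<in> obj ?C" "?F a = ?F b"
        obtain w z y where h: "a = el \<Omega> Y (?H w z y)" "isel \<Omega> (?H w z y) Y" using a(1) unfolding objC by blast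
        obtain w' z' y' where h': "b = el \<Omega> Y (?H w' z' y')" "isel \<Omega> (?H w' z' y') Y" using a(2) unfolding objC
            by blast
        note x = YX[OF h(2)] and x' = YX[OF h'(2)]
        from a(3) have eq: "el \<Omega> X (y # e) = el \<Omega> X (y' # e)" "el \<Omega> X (z # e) = el \<Omega> X (z' # e)"
          "el \<Omega> (id_tel X (y # e) (z # e)) (w # ?r) = el \<Omega> (id_tel X (y' # e) (z' # e)) (w' # ?r)"
          unfolding h(1) h'(1) F[OF h(2)] F[OF h'(2)] by simp_all
        have "tmeq \<Omega> y y' (inst e A)" "tmeq \<Omega> z z' (inst e A)" using eq(1,2) el_X[OF x'(4)] el_X[OF x'(5)]
            by simp_all
        \<comment> \<open>The two classes are formed with different, though equal, endpoints.
          Membership of \<open>w'\<close> in the class of \<open>w\<close> gives the equation at the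
          endpoints of the latter.\<close>
        moreover have "w' # ?r \<in> el \<Omega> (id_tel X (y # e) (z # e)) (w # ?r)" unfolding eq(3) using x'(6) by simp
        then have "tmeq \<Omega> w w' (idT (inst e A) y z)" using elems_vertical[OF \<Omega> e x(1,2)] by simp
        ultimately have "eleq \<Omega> (?H w z y) (?H w' z' y') Y" using e by (simp add: elems_Y)
        then show "a = b" unfolding h(1) h'(1) using el_Y[OF h'(2)] by simp
      qed
      show "?F ` obj ?C = obj ?D"
      proof (intro set_eqI iffI)
        fix u assume "u \<in> ?F ` obj ?C"
        then obtain w z y where h: "u = ?F (el \<Omega> Y (?H w z y))" "isel \<Omega> (?H w z y) Y" unfolding objC by blast
        note x = YX[OF h(2)]
        show "u \<in> obj ?D" unfolding h(1) F[OF h(2)] objD using x re by fastforce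
      next
        fix u assume "u \<in> obj ?D"
        then obtain y z a where u: "u = (el \<Omega> X (y # e), el \<Omega> X (z # e), el \<Omega> (id_tel X (y # e) (z # e)) a)"
          "istm \<Omega> y (inst e A)" "istm \<Omega> z (inst e A)" "isel \<Omega> a (id_tel X (y # e) (z # e))" "eleq \<Omega> (tl a) ?r
              (id_tel \<Gamma> e e)"
          unfolding objD by blast
        obtain q where q: "eleq \<Omega> a (q # ?r) (id_tel X (y # e) (z # e))" "istm \<Omega> q (idT (inst e A) y z)"
          by (rule cell_X_normal[OF \<Omega> e u(2-5)])
        have h: "isel \<Omega> (?H q z y) Y" using u(2,3) q(2) e by (simp add: elems_Y)
        have "?F (el \<Omega> Y (?H q z y)) = u"
          unfolding F[OF h] u(1) using el_iff[OF YX(6)[OF h] YX(4,5)[OF h], THEN iffD2, OF q(1)] by simp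
        then show "u \<in> ?F ` obj ?C" unfolding objC using h by blast
      qed
    qed
    show "bij_betw (?F' a b) (mor ?C a b) (mor ?D (?F a) (?F b))" if a: "a \<in> obj ?C" "b \<in> obj ?C" for a b
    proof -
      obtain w z y where h: "a = el \<Omega> Y (?H w z y)" "isel \<Omega> (?H w z y) Y" using a(1) unfolding objC by blast
      obtain w' z' y' where h': "b = el \<Omega> Y (?H w' z' y')" "isel \<Omega> (?H w' z' y') Y" using a(2) unfolding objC
          by blast
      note x = YX[OF h(2)] and x' = YX[OF h'(2)]
      show ?thesis
      proof (rule bij_betw_imageI)
        show "inj_on (?F' a b) (mor ?C a b)"
        proof (rule inj_onI)
          fix f g assume fg: "f \<in> mor ?C a b" "g \<in> mor ?C a b" "?F' a b f = ?F' a b g"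
          obtain f0 where f: "f = el \<Omega> (id_tel Y (?H w z y) (?H w' z' y')) f0" "isel \<Omega> f0 (id_tel Y (?H w z y)
              (?H w' z' y'))"
            using fg(1) unfolding h(1) h'(1) morC[OF h(2) h'(2)] by blast
          obtain g0 where g: "g = el \<Omega> (id_tel Y (?H w z y) (?H w' z' y')) g0" "isel \<Omega> g0 (id_tel Y (?H w z y)
              (?H w' z' y'))"
            using fg(2) unfolding h(1) h'(1) morC[OF h(2) h'(2)] by blast
          note sg = SQ[OF h(2) h'(2) g(2)]
          from fg(3) have "eleq \<Omega> (?S w z y w' z' y' f0) (?S w z y w' z' y' g0) (id_tel X (y # e) (y' # e))"
            "eleq \<Omega> (?Q w z y w' z' y' f0) (?Q w z y w' z' y' g0) (id_tel X (z # e) (z' # e))"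
            unfolding h(1) h'(1) f(1) g(1) F'[OF h(2) h'(2) f(2)] F'[OF h(2) h'(2) g(2)]
            using el_iff[OF sg(1) x(4) x'(4)] el_iff[OF sg(2) x(5) x'(5)] by simp_all
          then have "eleq \<Omega> f0 g0 (id_tel Y (?H w z y) (?H w' z' y'))"
            using Y_faithful[OF \<Omega> h(2) h'(2) f(2) g(2)] unfolding si by blast
          then show "f = g" unfolding f(1) g(1) using el_iffY[OF g(2) h(2) h'(2)] by simp
        qed
        show "?F' a b ` mor ?C a b = mor ?D (?F a) (?F b)"
        proof (intro set_eqI iffI)
          fix u assume "u \<in> ?F' a b ` mor ?C a b"
          then obtain k where k: "u = ?F' a b (el \<Omega> (id_tel Y (?H w z y) (?H w' z' y')) k)" "isel \<Omega> k (id_tel Y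
              (?H w z y) (?H w' z' y'))"
            "eleq \<Omega> (id_map Y \<Gamma> (vars 3 N) (?H w z y) (?H w' z' y') k) ?r (id_tel \<Gamma> e e)"
            unfolding h(1) h'(1) morC[OF h(2) h'(2)] by blast
          note sk = SQ[OF h(2) h'(2) k(2)] and tk = tl[OF h(2) h'(2) k(2)]
          note nat = id_comp_natural[OF XY_ctxs(2) cX elems_src elems_tgt elems_kap \<Omega> h(2) h'(2) k(2), unfolded si]
          show "u \<in> mor ?D (?F a) (?F b)"
            unfolding k(1) h(1) h'(1) F'[OF h(2) h'(2) k(2)] morD[OF h(2) h'(2)]
            using sk te[OF tk(1) k(3)] te[OF tk(2) k(3)] nat by blast
        next
          fix u assume u: "u \<in> mor ?D (?F a) (?F b)"
          obtain U V where UV: "u = (U, V)" by (cases u)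
          obtain f g where fg: "U = el \<Omega> (id_tel X (y # e) (y' # e)) f" "V = el \<Omega> (id_tel X (z # e) (z' # e)) g"
            "isel \<Omega> f (id_tel X (y # e) (y' # e))" "isel \<Omega> g (id_tel X (z # e) (z' # e))"
            "eleq \<Omega> (tl f) ?r (id_tel \<Gamma> e e)" "eleq \<Omega> (tl g) ?r (id_tel \<Gamma> e e)"
            "eleq \<Omega> (id_comp X (y # e) (y' # e) (z' # e) (w' # ?r) f) (id_comp X (y # e) (z # e) (z' # e) g
                (w # ?r)) (id_tel X (y # e) (z' # e))"
            using u unfolding h(1) h'(1) UV morD[OF h(2) h'(2)] by blast
          \<comment> \<open>The base parts of \<open>f\<close> and \<open>g\<close> are both equal
            to the reflexivity, hence to each other, as \<open>Y_full\<close> requires.\<close>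
          obtain k where k: "isel \<Omega> k (id_tel Y (?H w z y) (?H w' z' y'))"
            "eleq \<Omega> (?S w z y w' z' y' k) f (id_tel X (y # e) (y' # e))" "eleq \<Omega> (?Q w z y w' z' y' k) g (id_tel X
                (z # e) (z' # e))"
            by (rule Y_full[OF \<Omega> h(2) h'(2) le le fg(3,4) te[OF fg(5) se[OF fg(6)]] fg(7)])
          \<comment> \<open>The base part of \<open>k\<close> is that of its image under
            \<open>src\<close>, hence that of \<open>f\<close>, a reflexivity; so \<open>k\<close>
            is a 2-cell of the slice.\<close>
          have "eleq \<Omega> (tl (?S w z y w' z' y' k)) (tl f) (id_tel \<Gamma> e e)"
            using id_tel_ConsE[OF cX x(4) x'(4) k(2)] by simp
          from te[OF se[OF tl(1)[OF h(2) h'(2) k(1)]] te[OF this fg(5)]]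
          have m: "el \<Omega> (id_tel Y (?H w z y) (?H w' z' y')) k \<in> mor ?C a b"
            unfolding h(1) h'(1) morC[OF h(2) h'(2)] using k(1) by blast
          have "?F' a b (el \<Omega> (id_tel Y (?H w z y) (?H w' z' y')) k) = u"
            unfolding h(1) h'(1) F'[OF h(2) h'(2) k(1)] UV fg(1,2)
            using el_iff[OF fg(3) x(4) x'(4)] el_iff[OF fg(4) x(5) x'(5)] k(2,3) by simp
          with m show "u \<in> ?F' a b ` mor ?C a b" by blast
        qed
      qed
    qed
    note bij_obj = this
    show "is_functor ?C ?D ?F ?F'"
      unfolding is_functor_def
    proof (intro conjI ballI)
      fix a assume a: "a \<in> obj ?C"
      obtain w z y where h: "a = el \<Omega> Y (?H w z y)" "isel \<Omega> (?H w z y) Y" using a unfolding objC by blast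
      note x = YX[OF h(2)]
      show "?F a \<in> obj ?D" unfolding h(1) F[OF h(2)] objD using x re by fastforce
      have "idn ?D (?F a) = (el \<Omega> (id_tel X (y # e) (y # e)) (refl_at X (y # e)), el \<Omega> (id_tel X (z # e) (z # e))
          (refl_at X (z # e)))"
        unfolding h(1) F[OF h(2)] by (simp add: arrow_cat_def idnX[OF x(4), unfolded One_nat_def] idnX[OF x(5),
            unfolded One_nat_def])
      moreover have "?F' a a (idn ?C a) = \<dots>"
        unfolding h(1) idnC[OF h(2)] F'[OF h(2,2) refl_at_typed[OF XY_ctxs(2) \<Omega> h(2)]]
        using id_map_refl[OF XY_ctxs(5,4) elems_src \<Omega> h(2)] id_map_refl[OF XY_ctxs(5,4) elems_tgt \<Omega> h(2)]
          el_iff[OF refl_at_typed[OF cX \<Omega> x(4)] x(4,4)] el_iff[OF refl_at_typed[OF cX \<Omega> x(5)] x(5,5)]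
        unfolding si by simp
      ultimately show "?F' a a (idn ?C a) = idn ?D (?F a)" by simp
      fix b assume b: "b \<in> obj ?C"
      {
        fix f assume "f \<in> mor ?C a b"
        with bij_obj[OF a b] show "?F' a b f \<in> mor ?D (?F a) (?F b)" by (auto dest: bij_betwE)
      }
      fix c f g assume c: "c \<in> obj ?C" "f \<in> mor ?C a b" "g \<in> mor ?C b c"
      obtain w2 z2 y2 where h2: "b = el \<Omega> Y (?H w2 z2 y2)" "isel \<Omega> (?H w2 z2 y2) Y" using b unfolding objC by blast
      obtain w3 z3 y3 where h3: "c = el \<Omega> Y (?H w3 z3 y3)" "isel \<Omega> (?H w3 z3 y3) Y" using c(1) unfolding objC
          by blast
      obtain f0 where f: "f = el \<Omega> (id_tel Y (?H w z y) (?H w2 z2 y2)) f0" "isel \<Omega> f0 (id_tel Y (?H w z y)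
          (?H w2 z2 y2))"
        using c(2) unfolding h(1) h2(1) morC[OF h(2) h2(2)] by blast
      obtain g0 where g: "g = el \<Omega> (id_tel Y (?H w2 z2 y2) (?H w3 z3 y3)) g0" "isel \<Omega> g0 (id_tel Y (?H w2 z2 y2)
          (?H w3 z3 y3))"
        using c(3) unfolding h2(1) h3(1) morC[OF h2(2) h3(2)] by blast
      note x2 = YX[OF h2(2)] and x3 = YX[OF h3(2)]
      note sf = SQ[OF h(2) h2(2) f(2)] and sg = SQ[OF h2(2) h3(2) g(2)]
      note gf = id_comp_cong[OF XY_ctxs(5) \<Omega> h(2) h2(2) h3(2) g(2) f(2)]
      have "cmp ?D (?F a) (?F b) (?F c) (?F' b c g) (?F' a b f) =
        (el \<Omega> (id_tel X (y # e) (y3 # e)) (id_comp X (y # e) (y2 # e) (y3 # e) (?S w2 z2 y2 w3 z3 y3 g0)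
            (?S w z y w2 z2 y2 f0)),
         el \<Omega> (id_tel X (z # e) (z3 # e)) (id_comp X (z # e) (z2 # e) (z3 # e) (?Q w2 z2 y2 w3 z3 y3 g0)
             (?Q w z y w2 z2 y2 f0)))"
        unfolding h(1) h2(1) h3(1) f(1) g(1) F[OF h(2)] F[OF h2(2)] F[OF h3(2)] F'[OF h(2) h2(2) f(2)] F'[OF h2(2)
            h3(2) g(2)]
        by (simp add: arrow_cat_def cmpX[OF x(4) x2(4) x3(4) sg(1) sf(1), unfolded One_nat_def] cmpX[OF x(5) x2(5)
            x3(5) sg(2) sf(2), unfolded One_nat_def])
      moreover have "?F' a c (cmp ?C a b c g f) = \<dots>"
        unfolding h(1) h2(1) h3(1) f(1) g(1) cmpC[OF h(2) h2(2) h3(2) g(2) f(2)] F'[OF h(2) h3(2) gf]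
        using id_map_comp[OF XY_ctxs(2) cX elems_src \<Omega> h(2) h2(2) h3(2) f(2) g(2)]
          id_map_comp[OF XY_ctxs(2) cX elems_tgt \<Omega> h(2) h2(2) h3(2) f(2) g(2)]
          el_iff[OF id_comp_cong[OF XY_ctxs(4) \<Omega> x(4) x2(4) x3(4) sg(1) sf(1)] x(4) x3(4)]
          el_iff[OF id_comp_cong[OF XY_ctxs(4) \<Omega> x(5) x2(5) x3(5) sg(2) sf(2)] x(5) x3(5)]
        unfolding si by simp
      ultimately show "?F' a c (cmp ?C a b c g f) = cmp ?D (?F a) (?F b) (?F c) (?F' b c g) (?F' a b f)" by simp
    qed
  qed
qed

text \<open>Precomposition is substitution, so the first two clauses hold on representatives because
  substitution commutes with \<open>src\<close>, \<open>tgt\<close>, \<open>kap\<close> and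
  \<open>id_map\<close>. The clause for 2-cells \<open>\<tau>\<close> is functoriality of the action
  on identities, \<open>id_map_id_map\<close>.\<close>

lemma with_cell_2natural: "with_cell_2natural SL Xo Yo src_cls tgt_cls kap_cls"
  unfolding with_cell_2natural_def
proof (intro ballI)
  fix B B' k1 assume "B \<in> ob SL" "B' \<in> ob SL" and k1: "k1 \<in> hom SL B' B"
  then obtain \<Omega> e \<Omega>' e' where B: "B = at \<Omega> e" "ctx \<Omega>" "isel \<Omega> e \<Gamma>" "B' = at \<Omega>' e'" "ctx \<Omega>'" "isel \<Omega>' e' \<Gamma>"
    unfolding ob_SL by blast
  note \<Omega> = B(2,3) and c = B(2) and c' = B(5)
  have homD: "\<exists>k. k1 = el \<Omega>' \<Omega> k \<and> isel \<Omega>' k \<Omega>" if "k1 \<in> hom SL B' B" for k1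
    using that hom_KS[OF c' c] by (auto simp: slice_def B(1,4))
  obtain k where k: "k1 = el \<Omega>' \<Omega> k" "isel \<Omega>' k \<Omega>" using homD[OF k1] by blast
  have homYD: "\<exists>h. h1 = el \<Omega> Y h \<and> isel \<Omega> h Y" if "h1 \<in> hom SL B Yo" for h1
    using that hom_Y[OF \<Omega>] unfolding B(1) by blast
  have lh: "length h = length Y" if "isel \<Omega> h Y" for h
    using elems_eq_length[OF that] by simp
  have st: "insts k (insts h src) = insts (insts k h) src" "insts k (insts h tgt) = insts (insts k h) tgt"
    "insts k (insts h kap) = insts (insts k h) kap"
    if "isel \<Omega> h Y" for h k
    using insts_insts_hom[OF elems_src lh[OF that]] insts_insts_hom[OF elems_tgt lh[OF that]] insts_insts_hom[OF
        elems_kap lh[OF that]]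
    by blast+
  have hk: "isel \<Omega>' (insts k h) Y" if "isel \<Omega> h Y" "isel \<Omega>' k \<Omega>" for h k
    by (rule hom_inst[OF XY_ctxs(2) that(1) c' c that(2)])
  have s: "isel \<Omega> (insts h src) X" "isel \<Omega> (insts h tgt) X" if "isel \<Omega> h Y" for h
    by (rule hom_inst[OF cX elems_src c XY_ctxs(2) that], rule hom_inst[OF cX elems_tgt c XY_ctxs(2) that])
  have kp: "isel \<Omega> (insts h kap) (id_tel X (insts h src) (insts h tgt))" if "isel \<Omega> h Y" for h
    by (rule cell_inst[OF cX elems_kap c XY_ctxs(2) that]) simp_all
  let ?F = "with_cell_obj SL Xo Yo src_cls tgt_cls kap_cls" and ?F' = "with_cell_mor SL Xo Yo src_cls tgt_cls"
  have objF: "?F B' (comp1 SL B' B Yo h1 k1) = (case ?F B h1 of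
      (u, v, \<gamma>) \<Rightarrow> (comp1 SL B' B Xo u k1, comp1 SL B' B Xo v k1, whisk_r SL B' B Xo u v \<gamma> k1))"
    if h1: "h1 \<in> hom SL B Yo" for h1
  proof -
    obtain h where h: "h1 = el \<Omega> Y h" "isel \<Omega> h Y" using homYD[OF h1] by blast
    show ?thesis
      unfolding h(1) k(1) B(1,4) Xo Yo slice_simps comp1_KS[OF c' c XY_ctxs(2) k(2) h(2)]
        with_cell_obj_rep[OF c h(2), unfolded Xo Yo] with_cell_obj_rep[OF c' hk[OF h(2) k(2)], unfolded Xo Yo]
            prod.case
        comp1_KS[OF c' c cX k(2) s(1)[OF h(2)]] comp1_KS[OF c' c cX k(2) s(2)[OF h(2)]]
        whisk_r_KS[OF c' c cX s[OF h(2)] kp[OF h(2)] k(2)] st[OF h(2)] ..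
  qed
  have comps: "comp1 SL B Yo Xo src_cls (el \<Omega> Y h) = el \<Omega> X (insts h src)"
    "comp1 SL B Yo Xo tgt_cls (el \<Omega> Y h) = el \<Omega> X (insts h tgt)" if "isel \<Omega> h Y" for h
    unfolding B(1) Xo Yo slice_simps
    by (rule comp1_KS[OF c XY_ctxs(2) cX that elems_src], rule comp1_KS[OF c XY_ctxs(2) cX that elems_tgt])
  have morF: "?F' B' (comp1 SL B' B Yo h1 k1) (comp1 SL B' B Yo h1' k1) (whisk_r SL B' B Yo h1 h1' \<theta> k1) =
      (case ?F' B h1 h1' \<theta> of (\<phi>, \<psi>) \<Rightarrow>
        (whisk_r SL B' B Xo (comp1 SL B Yo Xo src_cls h1) (comp1 SL B Yo Xo src_cls h1') \<phi> k1,
         whisk_r SL B' B Xo (comp1 SL B Yo Xo tgt_cls h1) (comp1 SL B Yo Xo tgt_cls h1') \<psi> k1))"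
    if h1: "h1 \<in> hom SL B Yo" and h1': "h1' \<in> hom SL B Yo" and \<theta>: "\<theta> \<in> cell SL B Yo h1 h1'" for h1 h1' \<theta>
  proof -
    obtain h where h: "h1 = el \<Omega> Y h" "isel \<Omega> h Y" using homYD[OF h1] by blast
    obtain h' where h': "h1' = el \<Omega> Y h'" "isel \<Omega> h' Y" using homYD[OF h1'] by blast
    obtain t where t: "\<theta> = el \<Omega> (id_tel Y h h') t" "isel \<Omega> t (id_tel Y h h')"
      using \<theta> cell_KS[OF c XY_ctxs(2) h(2) h'(2)] unfolding B(1) h(1) h'(1) by (auto simp: slice_def Yo)
    have tk: "isel \<Omega>' (insts k t) (id_tel Y (insts k h) (insts k h'))"
      by (rule cell_inst[OF XY_ctxs(2) t(2) c' c k(2) lh[OF h(2)] lh[OF h'(2)]])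
    have m: "isel \<Omega> (id_map Y X src h h' t) (id_tel X (insts h src) (insts h' src))"
      "isel \<Omega> (id_map Y X tgt h h' t) (id_tel X (insts h tgt) (insts h' tgt))"
      by (rule id_map_cong[OF XY_ctxs(5,4) elems_src c h(2) h'(2) t(2)],
          rule id_map_cong[OF XY_ctxs(5,4) elems_tgt c h(2) h'(2) t(2)])
    have l: "length h = length Y" "length h' = length Y" "length t = length Y"
      using lh[OF h(2)] lh[OF h'(2)] elems_eq_length[OF t(2)] by simp_all
    have sm: "insts k (id_map Y X src h h' t) = id_map Y X src (insts k h) (insts k h') (insts k t)"
      "insts k (id_map Y X tgt h h' t) = id_map Y X tgt (insts k h) (insts k h') (insts k t)"
      by (rule map_subst_id_map[OF XY_ctxs(5,4) elems_src l], rule map_subst_id_map[OF XY_ctxs(5,4) elems_tgt l])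
    show ?thesis
      unfolding h(1) h'(1) comps[OF h(2)] comps[OF h'(2)]
      unfolding k(1) t(1) B(1,4) Xo Yo slice_simps comp1_KS[OF c' c XY_ctxs(2) k(2) h(2)] comp1_KS[OF c' c
          XY_ctxs(2) k(2) h'(2)]
        whisk_r_KS[OF c' c XY_ctxs(2) h(2) h'(2) t(2) k(2)]
        with_cell_mor_rep[OF c h(2) h'(2) t(2), unfolded Xo Yo]
        with_cell_mor_rep[OF c' hk[OF h(2) k(2)] hk[OF h'(2) k(2)] tk, unfolded Xo Yo] prod.case
        whisk_r_KS[OF c' c cX s(1)[OF h(2)] s(1)[OF h'(2)] m(1) k(2)]
        whisk_r_KS[OF c' c cX s(2)[OF h(2)] s(2)[OF h'(2)] m(2) k(2)] st[OF h(2)] st[OF h'(2)] sm ..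
  qed
  have tauF: "?F' B' (comp1 SL B' B Yo h1 k1) (comp1 SL B' B Yo h1 k1') (whisk_l SL B' B Yo k1 k1' h1 \<tau>) =
      (case ?F B h1 of (u, v, \<gamma>) \<Rightarrow> (whisk_l SL B' B Xo k1 k1' u \<tau>, whisk_l SL B' B Xo k1 k1' v \<tau>))"
    if k1': "k1' \<in> hom SL B' B" and \<tau>: "\<tau> \<in> cell SL B' B k1 k1'" and h1: "h1 \<in> hom SL B Yo" for k1' \<tau> h1
  proof -
    obtain h where h: "h1 = el \<Omega> Y h" "isel \<Omega> h Y" using homYD[OF h1] by blast
    obtain k' where k': "k1' = el \<Omega>' \<Omega> k'" "isel \<Omega>' k' \<Omega>" using homD[OF k1'] by blast
    obtain t where t: "\<tau> = el \<Omega>' (id_tel \<Omega> k k') t" "isel \<Omega>' t (id_tel \<Omega> k k')"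
      using \<tau> cell_KS[OF c' c k(2) k'(2)] unfolding B(1,4) k(1) k'(1) by (auto simp: slice_def)
    have cc: "cteq \<Omega> \<Omega>" by (rule is_ctx_cteq_refl[OF c])
    have m: "isel \<Omega>' (id_map \<Omega> Y h k k' t) (id_tel Y (insts k h) (insts k' h))"
      by (rule id_map_cong[OF cc XY_ctxs(5) h(2) c' k(2) k'(2) t(2)])
    have eq: "el \<Omega>' (id_tel X (insts k (insts h f)) (insts k' (insts h f))) (id_map \<Omega> X (insts h f) k k' t) =
      el \<Omega>' (id_tel X (insts k (insts h f)) (insts k' (insts h f)))
        (id_map Y X f (insts k h) (insts k' h) (id_map \<Omega> Y h k k' t))"
      if f: "isel Y f X" for f
    proof -
      note hf = hom_inst[OF cX f c XY_ctxs(2) h(2)]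
      note kf = hom_inst[OF cX hf c' c k(2)] hom_inst[OF cX hf c' c k'(2)]
      have ctx: "ctx (id_tel X (insts k (insts h f)) (insts k' (insts h f)) @ \<Omega>')"
        by (rule is_ctx_id_tel[OF cX c' kf])
      note e = id_map_id_map[OF c XY_ctxs(2) cX h(2) f c' k(2) k'(2) t(2)]
      show ?thesis using el_eq_iff[OF elems_eq_right[OF e ctx] ctx] e by blast
    qed
    show ?thesis
      unfolding h(1) k(1) k'(1) t(1) B(1,4) Xo Yo slice_simps comp1_KS[OF c' c XY_ctxs(2) k(2) h(2)] comp1_KS[OF c'
          c XY_ctxs(2) k'(2) h(2)]
        whisk_l_KS[OF c' c XY_ctxs(2) k(2) k'(2) h(2) t(2)]
        with_cell_mor_rep[OF c' hk[OF h(2) k(2)] hk[OF h(2) k'(2)] m, unfolded Xo Yo]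
        with_cell_obj_rep[OF c h(2), unfolded Xo Yo] prod.case
        whisk_l_KS[OF c' c cX k(2) k'(2) s(1)[OF h(2)] t(2)] whisk_l_KS[OF c' c cX k(2) k'(2) s(2)[OF h(2)] t(2)]
        eq[OF elems_src, symmetric] eq[OF elems_tgt, symmetric] st[OF h(2), symmetric] ..
  qed
  show "(\<forall>h\<in>hom SL B Yo. ?F B' (comp1 SL B' B Yo h k1) = (case ?F B h of
          (u, v, \<gamma>) \<Rightarrow> (comp1 SL B' B Xo u k1, comp1 SL B' B Xo v k1, whisk_r SL B' B Xo u v \<gamma> k1))) \<and>
      (\<forall>h\<in>hom SL B Yo. \<forall>h'\<in>hom SL B Yo. \<forall>\<theta>\<in>cell SL B Yo h h'.
        ?F' B' (comp1 SL B' B Yo h k1) (comp1 SL B' B Yo h' k1) (whisk_r SL B' B Yo h h' \<theta> k1) =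
        (case ?F' B h h' \<theta> of (\<phi>, \<psi>) \<Rightarrow>
          (whisk_r SL B' B Xo (comp1 SL B Yo Xo src_cls h) (comp1 SL B Yo Xo src_cls h') \<phi> k1,
           whisk_r SL B' B Xo (comp1 SL B Yo Xo tgt_cls h) (comp1 SL B Yo Xo tgt_cls h') \<psi> k1))) \<and>
      (\<forall>k'\<in>hom SL B' B. \<forall>\<tau>\<in>cell SL B' B k1 k'. \<forall>h\<in>hom SL B Yo.
        ?F' B' (comp1 SL B' B Yo h k1) (comp1 SL B' B Yo h k') (whisk_l SL B' B Yo k1 k' h \<tau>) =
        (case ?F B h of (u, v, \<gamma>) \<Rightarrow> (whisk_l SL B' B Xo k1 k' u \<tau>, whisk_l SL B' B Xo k1 k' v \<tau>)))"
    by (intro conjI ballI objF morF tauF)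
qed

lemma Id_arrow_object: "arrow_object SL Xo Yo src_cls tgt_cls kap_cls"
proof -
  have g: "isel Y (Var 1 # vars 3 N) X" "isel Y (Var 2 # vars 3 N) X"
    by (rule elems_tgt, rule elems_src)
  then have y: "istm Y (Var 2) (inst (vars 3 N) A)" "istm Y (Var 1) (inst (vars 3 N) A)" by simp_all
  have "kap_cls \<in> cell SL Yo Xo src_cls tgt_cls"
    unfolding Yo cell_X[OF XY_ctxs(2) elems_projY y] using elems_kap refl_e[OF XY_ctxs(2) elems_projY] by fastforce
  moreover have "src_cls \<in> hom SL Yo Xo" "tgt_cls \<in> hom SL Yo Xo"
    unfolding Yo hom_X[OF XY_ctxs(2) elems_projY] using y by blast+
  moreover have "Xo \<in> ob SL" "Yo \<in> ob SL"
    unfolding Xo Yo ob_SL using cX XY_ctxs(2) elems_projX elems_projY by blast+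
  moreover have "is_cat_iso (hom_cat SL B Yo) (arrow_cat (hom_cat SL B Xo))
      (with_cell_obj SL Xo Yo src_cls tgt_cls kap_cls B) (with_cell_mor SL Xo Yo src_cls tgt_cls B)"
          if "B \<in> ob SL" for B
    using that with_cell_iso unfolding ob_SL by blast
  ultimately show ?thesis
    unfolding arrow_object_def using with_cell_2natural by blast
qed

end

end

theorem proposition4p1p1:
  fixes S :: "'s tt" and \<Gamma> :: "'s expr list" and A :: "'s expr"
  assumes "ml2_theory S"
    and "is_ctx S \<Gamma>"
    and "(\<Gamma>, Ty A) \<in> S"
  shows "\<exists>\<kappa>. arrow_object (slice (ctx_two_cat S) (ctx_class S \<Gamma>))
     (over S 1 (ext1 \<Gamma> A)) (over S 3 (extId \<Gamma> A))
     (comp1 (slice (ctx_two_cat S) (ctx_class S \<Gamma>))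
        (over S 3 (extId \<Gamma> A)) (over S 2 (ext2 \<Gamma> A)) (over S 1 (ext1 \<Gamma> A))
        (proj1 S \<Gamma> A) (proj S 1 (extId \<Gamma> A)))
     (comp1 (slice (ctx_two_cat S) (ctx_class S \<Gamma>))
        (over S 3 (extId \<Gamma> A)) (over S 2 (ext2 \<Gamma> A)) (over S 1 (ext1 \<Gamma> A))
        (proj2 S \<Gamma> A) (proj S 1 (extId \<Gamma> A)))
     \<kappa>"
proof -
  interpret ml2_theory S by (rule assms(1))
  have cX: "is_ctx S (A # \<Gamma>)" by (rule is_ctx.intros(2)[OF assms(2,3)])
  show ?thesis
    unfolding src_tgt_cls[OF cX] using Id_arrow_object[OF cX] by blast
qed

end
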